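(* Let $N\ge 1$, $0<\theta<2$, $0\le \ell\le K$, and $1\le q\le\infty$. Let $\varphi\in L^1_K$ and let $f$ be a measurable function in $\mathbb R^N\times(0,\infty)$ such that $E_{K,q}[f]\in L^1(0,\tau)$ for every $\tau>0$, where $$E_{K,q}[f](t):=(t+1)^{\frac K\theta}\left[t^{\frac N\theta\left(1-\frac1q\right)}\|f(t)\|_q+\|f(t)\|_1\right]+t^{\frac N\theta\left(1-\frac1q\right)}|||f(t)|||_{q,K}+|||f(t)|||_{1,K},\quad t>0.$$ Let $u\in C(\mathbb R^N\times(0,\infty))$ be a solution to $\partial_t u+(-\Delta)^{\theta/2}u=f$ in $\mathbb R^N\times(0,\infty)$, $u(\cdot,0)=\varphi$, that is, $$u(x,t)=\int_{\mathbb R^N}G_\theta(x-y,t)\varphi(y)\,dy+\int_0^t\int_{\mathbb R^N}G_\theta(x-y,t-s)f(y,s)\,dy\,ds,\quad (x,t)\in\mathbb R^N\times(0,\infty).$$ Set $$w(x,t):=\sum_{m=0}^{K_\theta}\sum_{|\alpha|\le K}\left\{M_\alpha(\varphi)+\int_0^t(s+1)^mM_\alpha(f(s))\,ds\right\}g_{\alpha,m}(x,t).$$ Then $$\sup_{0<t<\tau}t^{\frac N\theta\left(1-\frac1q\right)}|||u(t)-w(t)|||_{q,\ell}<\infty\quad\text{for every }\tau>0.$$ Furthermore, there exists $C>0$ such that, for any $\varepsilon>0$ and $T>0$, $$t^{\frac N\theta\left(1-\frac1q\right)-\frac\ell\theta}|||u(t)-w(t)|||_{q,\ell}\le\varepsilon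 t^{-\frac K\theta}+Ct^{-\frac K\theta}\int_T^tE_{K,q}[f](s)\,ds$$ holds for all large enough $t>0$. In particular, if $\int_0^\infty E_{K,q}[f](s)\,ds<\infty$, then $$\lim_{t\to\infty}t^{\frac N\theta\left(1-\frac1q\right)+\frac{K-\ell}\theta}|||u(t)-w(t)|||_{q,\ell}=0.$$
   Context: $\|\cdot\|_q$ is the norm of $L^q=L^q(\mathbb R^N)$. For $K\ge0$ and $1\le q\le\infty$, $|||h|||_{q,K}:=\|\,|x|^Kh\,\|_q$, and $L^q_K:=\{h\in L^q: \|h\|_{L^q_K}:=\|h\|_q+|||h|||_{q,K}<\infty\}$. Write $f(t)=f(\cdot,t)$, $u(t)=u(\cdot,t)$, etc. For a multi-index $\alpha\in\mathbb M:=\mathbb N_0^N$ ($\mathbb N_0=\{0,1,2,\dots\}$) with $|\alpha|\le K$ and $h\in L^1_K$, $M_\alpha(h):=\int_{\mathbb R^N}x^\alpha h(x)\,dx$. For $k\ge0$, $[k]$ is the integer with $k-1<[k]\le k$, and $K_\theta:=[K/\theta]$. $G_\theta(x,t)=(2\pi)^{-N}\int_{\mathbb R^N}e^{ix\cdot\xi}e^{-t|\xi|^\theta}\,d\xi$ is the fundamental solution of $\partial_tv+(-\Delta)^{\theta/2}v=0$ in $\mathbb R^N\times(0,\infty)$. For $\alpha\in\mathbb M$, $m\in\mathbb N_0$, $g_{\alpha,m}(x,t):=\frac{(-1)^{|\alpha|+m}}{\alpha!\,m!}(\partial_t^m\partial_x^\alpha G_\theta)(x,t+1)$. *)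

theory Defs
  imports "HOL-Analysis.Analysis" "HOL-Probability.Essential_Supremum"
begin

section \<open>Weighted Lebesgue spaces\<close>

text \<open>The exponent \<open>q \<in> [1, \<infinity>]\<close> is an extended real. Norms take values in \<open>[0, \<infinity>]\<close>, so that
  finiteness of a norm is always stated explicitly.\<close>

definition Lnorm :: "ennreal \<Rightarrow> (real^'n \<Rightarrow> real) \<Rightarrow> ennreal" where
  "Lnorm q h =
     (if q = \<infinity> then esssup lebesgue (\<lambda>x. ennreal \<bar>h x\<bar>)
      else let I = (\<integral>\<^sup>+ x. ennreal (\<bar>h x\<bar> powr enn2real q) \<partial>lebesgue)
           in if I = \<infinity> then \<infinity> else ennreal (enn2real I powr (1 / enn2real q)))"

text \<open>For \<open>K = 0\<close> the weight \<open>norm x powr K\<close> is \<open>1\<close> except at \<open>x = 0\<close>, where \<open>powr\<close> yields \<open>0\<close>;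
  this concerns a null set only.\<close>

definition wnorm :: "ennreal \<Rightarrow> real \<Rightarrow> (real^'n \<Rightarrow> real) \<Rightarrow> ennreal" where
  "wnorm q K h = Lnorm q (\<lambda>x. norm x powr K * h x)"

definition weighted_L :: "ennreal \<Rightarrow> real \<Rightarrow> (real^'n \<Rightarrow> real) set" where
  "weighted_L q K = {h \<in> borel_measurable lebesgue. Lnorm q h + wnorm q K h < \<infinity>}"


section \<open>Multi-indices, moments and derivatives\<close>

type_synonym 'n multi_index = "'n \<Rightarrow> nat"

definition mi_order :: "('n::finite) multi_index \<Rightarrow> nat" where
  "mi_order \<alpha> = (\<Sum>i\<in>UNIV. \<alpha> i)"

definition mi_fact :: "('n::finite) multi_index \<Rightarrow> real" where
  "mi_fact \<alpha> = (\<Prod>i\<in>UNIV. fact (\<alpha> i))"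

definition mi_power :: "real^'n \<Rightarrow> 'n multi_index \<Rightarrow> real" where
  "mi_power x \<alpha> = (\<Prod>i\<in>UNIV. x $ i ^ \<alpha> i)"

lemma finite_mi_order_le: "finite {\<alpha> :: ('n::finite) multi_index. real (mi_order \<alpha>) \<le> K}"
proof (rule finite_subset)
  have "\<alpha> i \<le> nat \<lceil>K\<rceil>" if "real (mi_order \<alpha>) \<le> K" for \<alpha> :: "'n multi_index" and i
  proof -
    have "\<alpha> i \<le> mi_order \<alpha>"
      unfolding mi_order_def by (rule member_le_sum) auto
    with that have "real (\<alpha> i) \<le> K" by linarith
    then show ?thesis by linarith
  qed
  then show "{\<alpha> :: 'n multi_index. real (mi_order \<alpha>) \<le> K} \<subseteq> UNIV \<rightarrow>\<^sub>E {..nat \<lceil>K\<rceil>}"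
    by (auto simp: PiE_def)
  show "finite (UNIV \<rightarrow>\<^sub>E {..nat \<lceil>K\<rceil>} :: 'n multi_index set)"
    by (rule finite_PiE) auto
qed

definition moment :: "'n multi_index \<Rightarrow> (real^'n \<Rightarrow> real) \<Rightarrow> real" where
  "moment \<alpha> h = (\<integral>x. mi_power x \<alpha> * h x \<partial>lebesgue)"

definition partial_deriv :: "'n \<Rightarrow> (real^'n \<Rightarrow> real) \<Rightarrow> (real^'n \<Rightarrow> real)" where
  "partial_deriv i h x = deriv (\<lambda>r. h (x + r *\<^sub>R axis i 1)) 0"

text \<open>The derivative \<open>\<partial>\<^sup>\<alpha>\<close> is taken along an arbitrary enumeration of the coordinates; for the smooth
  functions it is applied to, the order of differentiation is immaterial.\<close>

definition mi_deriv :: "('n::finite) multi_index \<Rightarrow> (real^'n \<Rightarrow> real) \<Rightarrow> (real^'n \<Rightarrow> real)" where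
  "mi_deriv \<alpha> = foldr (\<lambda>i. partial_deriv i ^^ \<alpha> i) (SOME is. distinct is \<and> set is = UNIV)"


section \<open>The fractional heat kernel\<close>

text \<open>The Fourier integral is real, since its integrand is conjugated by \<open>\<xi> \<mapsto> -\<xi>\<close>; \<open>Re\<close> only adjusts
  the type.\<close>

definition frac_heat_kernel :: "real \<Rightarrow> real^'n \<Rightarrow> real \<Rightarrow> real" where
  "frac_heat_kernel \<theta> x t =
     (2 * pi) powr (- real CARD('n)) *
     Re (\<integral>\<xi>. exp (\<i> * of_real (x \<bullet> \<xi>)) * of_real (exp (- t * norm (\<xi> :: real^'n) powr \<theta>)) \<partial>lebesgue)"

definition kernel_g :: "real \<Rightarrow> 'n multi_index \<Rightarrow> nat \<Rightarrow> real^'n \<Rightarrow> real \<Rightarrow> real" where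
  "kernel_g \<theta> \<alpha> m x t =
     (-1) ^ (mi_order \<alpha> + m) / (mi_fact \<alpha> * fact m) *
     (deriv ^^ m) (\<lambda>s. mi_deriv \<alpha> (\<lambda>z. frac_heat_kernel \<theta> z s) x) (t + 1)"


section \<open>The inhomogeneous fractional heat equation\<close>

text \<open>The second and third conjuncts say that the iterated integral in the Duhamel term exists;
  the convolution of the bounded kernel with an integrable \<open>\<phi>\<close> always does.\<close>

definition frac_heat_solution ::
  "real \<Rightarrow> (real^'n \<Rightarrow> real) \<Rightarrow> (real^'n \<Rightarrow> real \<Rightarrow> real) \<Rightarrow> (real^'n \<Rightarrow> real \<Rightarrow> real) \<Rightarrow> bool" where
  "frac_heat_solution \<theta> \<phi> f u \<longleftrightarrow>
     continuous_on (UNIV \<times> {0<..}) (\<lambda>(x, t). u x t) \<and>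
     (\<forall>x. \<forall>t>0.
        (AE s in lebesgue_on {0<..<t}.
           integrable lebesgue (\<lambda>y. frac_heat_kernel \<theta> (x - y) (t - s) * f y s)) \<and>
        integrable (lebesgue_on {0<..<t})
           (\<lambda>s. \<integral>y. frac_heat_kernel \<theta> (x - y) (t - s) * f y s \<partial>lebesgue) \<and>
        u x t = (\<integral>y. frac_heat_kernel \<theta> (x - y) t * \<phi> y \<partial>lebesgue) +
          (\<integral>s. (\<integral>y. frac_heat_kernel \<theta> (x - y) (t - s) * f y s \<partial>lebesgue)
             \<partial>lebesgue_on {0<..<t}))"

text \<open>The number \<open>N / \<theta> * (1 - 1 / q)\<close>, with \<open>1 / \<infinity> = 0\<close>.\<close>

definition decay_exponent :: "nat \<Rightarrow> real \<Rightarrow> ennreal \<Rightarrow> real" where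
  "decay_exponent N \<theta> q = real N / \<theta> * (1 - enn2real (1 / q))"

definition source_size ::
  "real \<Rightarrow> real \<Rightarrow> ennreal \<Rightarrow> (real^'n \<Rightarrow> real \<Rightarrow> real) \<Rightarrow> real \<Rightarrow> ennreal" where
  "source_size \<theta> K q f t =
     (let a = decay_exponent CARD('n) \<theta> q; ft = (\<lambda>x. f x t) in
        ennreal ((t + 1) powr (K / \<theta>)) * (ennreal (t powr a) * Lnorm q ft + Lnorm 1 ft) +
        ennreal (t powr a) * wnorm q K ft + wnorm 1 K ft)"

definition asymptotic_profile ::
  "real \<Rightarrow> real \<Rightarrow> (real^'n \<Rightarrow> real) \<Rightarrow> (real^'n \<Rightarrow> real \<Rightarrow> real) \<Rightarrow> real^'n \<Rightarrow> real \<Rightarrow> real" where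
  "asymptotic_profile \<theta> K \<phi> f x t =
     (\<Sum>m = 0..nat \<lfloor>K / \<theta>\<rfloor>. \<Sum>\<alpha> | real (mi_order \<alpha>) \<le> K.
        (moment \<alpha> \<phi> + (\<integral>s. (s + 1) ^ m * moment \<alpha> (\<lambda>y. f y s) \<partial>lebesgue_on {0<..<t})) *
        kernel_g \<theta> \<alpha> m x t)"

end

theory Submission
  imports Defs
begin

text \<open>Integrated against \<open>\<phi>\<close> (at \<open>s = 0\<close>) and \<open>f(s)\<close>, the remainder kernel
  \<open>S(x,y,t,s) = G\<^sub>\<theta>(x - y, t - s) - \<Sum> (s + 1)\<^sup>m y\<^sup>\<alpha> g\<^sub>\<alpha>\<^sub>,\<^sub>m(x,t)\<close> gives \<open>u - w\<close>. Put
  \<open>z = |y| + (s + 1) powr (1/\<theta>)\<close> and \<open>\<rho> = (t + 1) powr (1/\<theta>)\<close>. If \<open>z\<close> is small compared with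
  \<open>|x| + \<rho>\<close>, then \<open>S\<close> is the remainder of a Taylor expansion of \<open>G\<^sub>\<theta>\<close>, in space and then in time, around
  \<open>(x, t + 1)\<close>; otherwise every term of \<open>S\<close> is small enough by itself. In both cases \<open>|x| powr l |S|\<close> is at
  most \<open>C \<rho> powr (l - K) z powr K (min 1 (z/\<rho>)) powr d\<close> times a sum of kernels whose \<open>L\<^sup>1\<close> norms do not depend
  on the parameters. The \<open>L\<^sup>q\<close> bound follows by interpolation between \<open>L\<^sup>1\<close> and \<open>L\<^sup>\<infinity>\<close>, and by Young's
  inequality for the times \<open>s > t/2\<close>, where the kernel \<open>G\<^sub>\<theta>(x - y, t - s)\<close> is too singular for interpolation. By
  dominated convergence, the factor \<open>(min 1 (z/\<rho>)) powr d\<close> makes the contributions of \<open>\<phi>\<close> and of \<open>f(s)\<close>,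
  \<open>s \<le> T\<close>, vanish as \<open>t \<rightarrow> \<infinity>\<close>; the times \<open>s > T\<close> contribute the integral of the source size.\<close>

section \<open>Rescaled kernels with algebraic decay\<close>

text \<open>The obstacle is that the heat kernel decays only like |x|^(-N-\<theta>), so its moments
  of order \<theta> and above are infinite. For large l the weight |x|^l therefore cannot be
  absorbed by a single kernel. Where z is at least a fixed fraction of |x| + \<rho> the excess
  weight is paid for by powers of z; elsewhere the cancellation in the Taylor expansion has to
  supply the missing decay. Truncating at |\<alpha>| \<le> K and m \<le> [K/\<theta>] makes the
  first omitted homogeneities, [K] + 1 in space and ([K/\<theta>] + 1) \<theta> in time, both
  strictly larger than K; this strict surplus is what leaves room for an exponent d > 0. The profile
  is centred at time t + 1 so that it stays smooth as t tends to 0, and this is why s + 1, not s,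
  measures the displacement in time. The kernel bounds come from the Fourier side alone: scaling
  yields the size near the origin, and the limited smoothness of the symbol at \<xi> = 0 dictates
  the decay at infinity.\<close>

definition decay_kernel :: "real \<Rightarrow> real \<Rightarrow> real^'n \<Rightarrow> real" where
  "decay_kernel d r x = r powr d * (norm x + r) powr (- real CARD('n) - d)"

lemma decay_kernel_nonneg [simp]: "0 \<le> decay_kernel d r x"
  by (simp add: decay_kernel_def)

lemma decay_kernel_measurable [measurable]: "decay_kernel d r \<in> borel_measurable borel"
  unfolding decay_kernel_def by measurable

lemma decay_kernel_minus [simp]: "decay_kernel d r (- x) = decay_kernel d r x"
  by (simp add: decay_kernel_def)

text \<open>\<open>decay_kernel d r\<close> is the rescaling r^(-N) Q(x/r) of Q(x) = (|x| +
  1)^(-N-d). Raising d multiplies it by a further power of r / (|x| + r), which is at most 1, so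
  estimates with different decay rates can all be weakened to one common d.\<close>

lemma decay_kernel_antimono:
  fixes x :: "real^'n"
  assumes "0 < r" "d \<le> d'"
  shows "decay_kernel d' r x \<le> decay_kernel d r x"
proof -
  let ?N = "real CARD('n)" and ?y = "norm x + r"
  have y: "?y > 0" "r \<le> ?y" using assms norm_ge_zero[of x] by linarith+
  have "decay_kernel d' r x = r powr d * ?y powr (- ?N - d) * (r powr (d' - d) * ?y powr (- (d' - d)))"
    unfolding decay_kernel_def using assms y by (simp add: powr_diff powr_minus field_simps powr_add)
  also have "r powr (d' - d) * ?y powr (- (d' - d)) \<le> 1"
    using assms y powr_mono2[of "d' - d" r ?y] by (subst powr_minus) (simp add: divide_simps)
  then have "r powr d * ?y powr (- ?N - d) * (r powr (d' - d) * ?y powr (- (d' - d)))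
      \<le> r powr d * ?y powr (- ?N - d) * 1"
    by (intro mult_left_mono) auto
  finally show ?thesis by (simp add: decay_kernel_def)
qed

lemma decay_kernel_le:
  fixes x :: "real^'n"
  assumes "0 < r" "0 \<le> d"
  shows "decay_kernel d r x \<le> r powr (- real CARD('n))"
proof -
  have "decay_kernel d r x \<le> decay_kernel 0 r x" using assms by (intro decay_kernel_antimono) auto
  also have "\<dots> \<le> r powr (- real CARD('n))"
    unfolding decay_kernel_def using assms by (auto intro: powr_mono2')
  finally show ?thesis .
qed

lemma dyadic_bracket:
  fixes v :: real
  assumes "1 \<le> v"
  obtains n :: nat where "2 ^ n \<le> v" "v \<le> 2 ^ (n + 1)"
proof -
  define n where "n = nat \<lfloor>log 2 v\<rfloor>"
  have "0 \<le> log 2 v" using assms by simp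
  then have "real n \<le> log 2 v" "log 2 v \<le> real n + 1"
    unfolding n_def by linarith+
  then have "2 powr real n \<le> v" "v \<le> 2 powr (real n + 1)"
    using assms by (auto simp: le_log_iff log_le_iff)
  then have "2 ^ n \<le> v" "v \<le> 2 ^ (n + 1)"
    by (auto simp: powr_realpow powr_add)
  then show thesis by (rule that)
qed

text \<open>On the shell where |x| + r lies between 2^n r and 2^(n+1) r the kernel is at most (2^n
  r)^(-N-d) r^d, and the shell is contained in a ball of volume V (2^(n+1) r)^N. All powers of r
  cancel in the product, which leaves the geometric series of V 2^N (2^(-d))^n.\<close>

lemma nn_integral_decay_kernel_bounded:
  assumes "0 < d"
  obtains C where "0 \<le> C"
    "\<And>r. 0 < r \<Longrightarrow> (\<integral>\<^sup>+x. ennreal (decay_kernel d r (x :: real^'n)) \<partial>lborel) \<le> ennreal C"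
proof -
  let ?N = "real CARD('n)"
  define V where "V = unit_ball_vol ?N"
  define q where "q = (2::real) powr (- d)"
  have q: "0 < q" "q < 1" unfolding q_def using assms powr_less_mono[of "- d" 0 2] by auto
  have V: "0 \<le> V" unfolding V_def by simp
  let ?C = "\<Sum>n. V * 2 powr ?N * q ^ n"
  have summ: "summable (\<lambda>n. V * 2 powr ?N * q ^ n)"
    using q by (intro summable_mult summable_geometric) auto
  show thesis
  proof (rule that[of ?C])
    show "0 \<le> ?C" using q V by (intro suminf_nonneg summ) auto
    fix r :: real assume r: "0 < r"
    define c where "c n = (2 ^ n * r) powr (- ?N - d) * r powr d" for n :: nat
    have c0: "0 \<le> c n" for n by (simp add: c_def)
    have pt: "ennreal (decay_kernel d r x) \<le> (\<Sum>n. ennreal (c n) * indicator (cball 0 (2 ^ (n + 1) * r)) x)" for x :: "real^'n"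
    proof -
      have "1 \<le> (norm x + r) / r" using r by simp
      then obtain n :: nat where n: "2 ^ n \<le> (norm x + r) / r" "(norm x + r) / r \<le> 2 ^ (n + 1)"
        using dyadic_bracket by blast
      have a: "2 ^ n * r \<le> norm x + r" "norm x + r \<le> 2 ^ (n + 1) * r"
        using n r by (simp_all add: field_simps)
      have "(norm x + r) powr (- ?N - d) \<le> (2 ^ n * r) powr (- ?N - d)"
        using a r assms by (intro powr_mono2') auto
      then have "decay_kernel d r x \<le> c n" unfolding decay_kernel_def c_def by (subst mult.commute) (intro mult_right_mono, auto)
      moreover have "x \<in> cball 0 (2 ^ (n + 1) * r)" using a r by simp
      ultimately have "ennreal (decay_kernel d r x) \<le> ennreal (c n) * indicator (cball 0 (2 ^ (n + 1) * r)) x"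
        by (simp add: ennreal_leI)
      also have "\<dots> = (\<Sum>k\<in>{n}. ennreal (c k) * indicator (cball 0 (2 ^ (k + 1) * r)) x)"
          by (simp only: sum.insert finite.emptyI sum.empty add_0_right empty_iff not_False_eq_True)
      also have "\<dots> \<le> (\<Sum>n. ennreal (c n) * indicator (cball 0 (2 ^ (n + 1) * r)) x)"
        by (rule sum_le_suminf) (auto intro: summableI)
      finally show ?thesis .
    qed
    have "(\<integral>\<^sup>+x. ennreal (decay_kernel d r (x :: real^'n)) \<partial>lborel)
        \<le> (\<integral>\<^sup>+(x::real^'n). (\<Sum>n. ennreal (c n) * indicator (cball 0 (2 ^ (n + 1) * r)) x) \<partial>lborel)"
      by (intro nn_integral_mono pt)
    also have "\<dots> = (\<Sum>n. \<integral>\<^sup>+(x::real^'n). ennreal (c n) * indicator (cball 0 (2 ^ (n + 1) * r)) x \<partial>lborel)"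
      by (rule nn_integral_suminf) (intro borel_measurable_times_ennreal borel_measurable_const borel_measurable_indicator, simp)
    also have "\<dots> = (\<Sum>n. ennreal (V * 2 powr ?N * q ^ n))"
    proof (intro suminf_cong)
      fix n :: nat
      have "(\<integral>\<^sup>+(x::real^'n). ennreal (c n) * indicator (cball 0 (2 ^ (n + 1) * r)) x \<partial>lborel)
         = ennreal (c n) * emeasure lborel (cball (0::real^'n) (2 ^ (n + 1) * r))"
        by (subst nn_integral_cmult_indicator) auto
      also have "\<dots> = ennreal (c n * (V * (2 ^ (n + 1) * r) ^ CARD('n)))"
        using r V c0 by (subst emeasure_cball) (auto simp: V_def ennreal_mult)
      also have "c n * (V * (2 ^ (n + 1) * r) ^ CARD('n)) = V * 2 powr ?N * q ^ n"
      proof -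
        have "(2 ^ (n + 1) * r) ^ CARD('n) = (2 * (2 ^ n * r)) powr ?N"
          using r by (subst powr_realpow) (auto simp: power_mult_distrib)
        also have "\<dots> = 2 powr ?N * (2 ^ n * r) powr ?N"
          using r by (simp add: powr_mult)
        finally have "c n * (V * (2 ^ (n + 1) * r) ^ CARD('n))
            = V * 2 powr ?N * (((2 ^ n * r) powr ?N * (2 ^ n * r) powr (- ?N - d)) * r powr d)"
          by (simp add: c_def)
        also have "(2 ^ n * r) powr ?N * (2 ^ n * r) powr (- ?N - d) = (2 ^ n * r) powr (- d)"
          by (simp flip: powr_add)
        also have "(2 ^ n * r) powr (- d) * r powr d = q ^ n"
        proof -
          have "(2 ^ n * r) powr (- d) * r powr d = (2 ^ n) powr (- d) * (r powr (- d) * r powr d)"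
            using r by (simp add: powr_mult)
          also have "r powr (- d) * r powr d = 1" using r by (simp flip: powr_add)
          also have "((2::real) ^ n) powr (- d) = q ^ n"
            unfolding q_def by (subst (1 2) powr_realpow[symmetric]) (auto simp: powr_powr mult.commute)
          finally show ?thesis by simp
        qed
        finally show ?thesis .
      qed
      finally show "(\<integral>\<^sup>+(x::real^'n). ennreal (c n) * indicator (cball 0 (2 ^ (n + 1) * r)) x \<partial>lborel)
         = ennreal (V * 2 powr ?N * q ^ n)" .
    qed
    also have "\<dots> = ennreal ?C"
      using q V by (intro suminf_ennreal2 summ) auto
    finally show "(\<integral>\<^sup>+x. ennreal (decay_kernel d r (x :: real^'n)) \<partial>lborel) \<le> ennreal ?C" by simp
  qed
qed

section \<open>Moments of exp(-t |\<xi>|^\<theta>)\<close>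

text \<open>The maximum is at u = \<kappa>. The inequality ln v \<le> v - 1 at v = u/\<kappa> gives
  the sharp value with an additional factor exp(-\<kappa>), which is dropped.\<close>

lemma powr_exp_le:
  fixes u \<kappa> :: real
  assumes "0 < \<kappa>" "0 \<le> u"
  shows "u powr \<kappa> * exp (- u) \<le> \<kappa> powr \<kappa>"
proof (cases "u = 0")
  case False
  then have u: "u > 0" using assms by simp
  have "ln (u / \<kappa>) \<le> u / \<kappa> - 1" using u assms by (intro ln_le_minus_one) auto
  then have "\<kappa> * (ln u - ln \<kappa>) \<le> \<kappa> * (u / \<kappa> - 1)"
    using u assms by (simp add: ln_div)
  then have "\<kappa> * ln u - u \<le> \<kappa> * ln \<kappa>" using assms by (simp add: algebra_simps)
  then have "exp (\<kappa> * ln u - u) \<le> exp (\<kappa> * ln \<kappa>)" by simp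
  then show ?thesis using u assms by (simp add: powr_def exp_diff exp_minus field_simps)
qed auto

text \<open>Substituting |\<xi>| = t^(-1/\<theta>) v removes t, so that only v^p exp(-v^\<theta>) (v
  + 1)^(N+1) has to be bounded. The exponent \<kappa> is chosen so that (v^\<theta>)^\<kappa> =
  v^(p+N+1), which is the growth to be beaten for v > 1.\<close>

lemma radial_exp_le_decay_kernel:
  assumes "0 < \<theta>" "0 \<le> p"
  obtains C where "0 \<le> C"
    "\<And>t (\<xi> :: real^'n). 0 < t \<Longrightarrow> norm \<xi> powr p * exp (- t * norm \<xi> powr \<theta>)
       \<le> C * t powr (- (p + real CARD('n)) / \<theta>) * decay_kernel 1 (t powr (- 1 / \<theta>)) \<xi>"
proof -
  let ?N = "real CARD('n)"
  define \<kappa> where "\<kappa> = (p + ?N + 1) / \<theta>"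
  have k: "\<kappa> > 0" unfolding \<kappa>_def using assms by (auto intro!: divide_pos_pos add_nonneg_pos)
  define C where "C = 2 powr (?N + 1) * (1 + \<kappa> powr \<kappa>)"
  have key: "v powr p * exp (- (v powr \<theta>)) * (v + 1) powr (?N + 1) \<le> C" if v: "0 \<le> v" for v :: real
  proof (cases "v \<le> 1")
    case True
    have "v powr p \<le> 1 powr p" using True v assms by (intro powr_mono2) auto
    moreover have "exp (- (v powr \<theta>)) \<le> 1" by simp
    ultimately have "v powr p * exp (- (v powr \<theta>)) \<le> 1 * 1" by (intro mult_mono) auto
    moreover have "(v + 1) powr (?N + 1) \<le> 2 powr (?N + 1)" using True v by (intro powr_mono2) auto
    ultimately have "v powr p * exp (- (v powr \<theta>)) * (v + 1) powr (?N + 1) \<le> (1 * 1) * 2 powr (?N + 1)"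
      by (rule mult_mono) auto
    also have "\<dots> \<le> C" unfolding C_def by simp
    finally show ?thesis .
  next
    case False
    have "(v + 1) powr (?N + 1) \<le> (2 * v) powr (?N + 1)" using False by (intro powr_mono2) auto
    also have "\<dots> = 2 powr (?N + 1) * v powr (?N + 1)" using v by (simp add: powr_mult)
    finally have "v powr p * exp (- (v powr \<theta>)) * (v + 1) powr (?N + 1)
       \<le> v powr p * exp (- (v powr \<theta>)) * (2 powr (?N + 1) * v powr (?N + 1))"
      by (intro mult_left_mono) auto
    also have "\<dots> = 2 powr (?N + 1) * ((v powr \<theta>) powr \<kappa> * exp (- (v powr \<theta>)))"
      using assms by (simp add: powr_powr \<kappa>_def powr_add)
    also have "\<dots> \<le> 2 powr (?N + 1) * \<kappa> powr \<kappa>"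
      using k by (intro mult_left_mono powr_exp_le) auto
    also have "\<dots> \<le> C" unfolding C_def by simp
    finally show ?thesis .
  qed
  show thesis
  proof (rule that[of C])
    show "0 \<le> C" by (simp add: C_def)
    fix t :: real and \<xi> :: "real^'n" assume t: "0 < t"
    define R where "R = t powr (- 1 / \<theta>)"
    define v where "v = norm \<xi> / R"
    have R: "R > 0" using t by (simp add: R_def)
    have v: "v \<ge> 0" and nv: "norm \<xi> = R * v" using R by (auto simp: v_def)
    have Rt: "R powr \<theta> = 1 / t" unfolding R_def powr_powr using t assms by (simp add: powr_minus_divide)
    have e: "t * norm \<xi> powr \<theta> = v powr \<theta>"
      unfolding nv using R v t by (simp add: powr_mult Rt)
    have tR: "t powr (- (p + ?N) / \<theta>) = R powr (p + ?N)" unfolding R_def by (simp add: powr_powr diff_divide_distrib add_divide_distrib)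
    have Q: "decay_kernel 1 R \<xi> = R powr (- ?N) * (v + 1) powr (- ?N - 1)"
    proof -
      have "norm \<xi> + R = R * (v + 1)" by (simp add: nv algebra_simps)
      then have "decay_kernel 1 R \<xi> = R powr 1 * (R powr (- ?N - 1) * (v + 1) powr (- ?N - 1))"
        unfolding decay_kernel_def using R v by (simp add: powr_mult)
      also have "\<dots> = R powr (1 + (- ?N - 1)) * (v + 1) powr (- ?N - 1)" by (simp only: powr_add mult.assoc)
      finally show ?thesis by simp
    qed
    have "(v + 1) powr (?N + 1) > 0" using v by simp
    moreover have "(v + 1) powr (- ?N - 1) = inverse ((v + 1) powr (?N + 1))"
      unfolding powr_minus[symmetric] by (rule arg_cong[where f = "\<lambda>z. (v + 1) powr z"]) simp
    ultimately have "v powr p * exp (- (v powr \<theta>)) \<le> C * (v + 1) powr (- ?N - 1)"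
      using key[OF v] by (simp only: pos_le_divide_eq flip: divide_inverse)
    then have "R powr p * (v powr p * exp (- (v powr \<theta>))) \<le> R powr p * (C * (v + 1) powr (- ?N - 1))"
      by (intro mult_left_mono) auto
    moreover have "norm \<xi> powr p * exp (- t * norm \<xi> powr \<theta>) = R powr p * (v powr p * exp (- (v powr \<theta>)))"
      using e R v by (simp add: nv powr_mult)
    moreover have "C * R powr (p + ?N) * decay_kernel 1 R \<xi> = R powr p * (C * (v + 1) powr (- ?N - 1))"
    proof -
      have "R powr (p + ?N) * R powr (- ?N) = R powr p" by (simp flip: powr_add)
      then show ?thesis unfolding Q by (simp add: algebra_simps)
    qed
    ultimately show "norm \<xi> powr p * exp (- t * norm \<xi> powr \<theta>)
       \<le> C * t powr (- (p + ?N) / \<theta>) * decay_kernel 1 (t powr (- 1 / \<theta>)) \<xi>"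
      unfolding tR R_def[symmetric] by (simp only:)
  qed
qed

lemma radial_exp_integrable:
  assumes "0 < \<theta>" "0 \<le> p"
  shows "0 < t \<Longrightarrow> integrable lborel (\<lambda>\<xi> :: real^'n. norm \<xi> powr p * exp (- t * norm \<xi> powr \<theta>))"
    and "\<exists>C\<ge>0. \<forall>t>0. (LINT \<xi>|lborel. norm (\<xi> :: real^'n) powr p * exp (- t * norm \<xi> powr \<theta>))
           \<le> C * t powr (- (p + real CARD('n)) / \<theta>)"
proof -
  obtain C where C: "0 \<le> C" and le: "\<And>t (\<xi> :: real^'n). 0 < t \<Longrightarrow> norm \<xi> powr p * exp (- t * norm \<xi> powr \<theta>)
       \<le> C * t powr (- (p + real CARD('n)) / \<theta>) * decay_kernel 1 (t powr (- 1 / \<theta>)) \<xi>"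
    using radial_exp_le_decay_kernel[OF assms] by blast
  obtain D where D: "0 \<le> D" and leD: "\<And>r. 0 < r \<Longrightarrow> (\<integral>\<^sup>+x. ennreal (decay_kernel 1 r (x :: real^'n)) \<partial>lborel) \<le> ennreal D"
    using nn_integral_decay_kernel_bounded[of 1] by auto
  have nn: "(\<integral>\<^sup>+\<xi>. ennreal (norm (\<xi> :: real^'n) powr p * exp (- t * norm \<xi> powr \<theta>)) \<partial>lborel)
      \<le> ennreal (C * D * t powr (- (p + real CARD('n)) / \<theta>))" if t: "0 < t" for t
  proof -
    have "(\<integral>\<^sup>+\<xi>. ennreal (norm (\<xi> :: real^'n) powr p * exp (- t * norm \<xi> powr \<theta>)) \<partial>lborel)
      \<le> (\<integral>\<^sup>+\<xi>. ennreal (C * t powr (- (p + real CARD('n)) / \<theta>)) * ennreal (decay_kernel 1 (t powr (- 1 / \<theta>)) (\<xi> :: real^'n)) \<partial>lborel)"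
      using C le[OF t] by (intro nn_integral_mono) (simp add: ennreal_leI flip: ennreal_mult)
    also have "\<dots> = ennreal (C * t powr (- (p + real CARD('n)) / \<theta>)) * (\<integral>\<^sup>+\<xi>. ennreal (decay_kernel 1 (t powr (- 1 / \<theta>)) (\<xi> :: real^'n)) \<partial>lborel)"
      by (rule nn_integral_cmult) simp
    also have "\<dots> \<le> ennreal (C * t powr (- (p + real CARD('n)) / \<theta>)) * ennreal D"
      using t by (intro mult_left_mono leD) auto
    also have "\<dots> = ennreal (C * D * t powr (- (p + real CARD('n)) / \<theta>))"
      using C D by (simp flip: ennreal_mult add: mult_ac)
    finally show ?thesis .
  qed
  show "integrable lborel (\<lambda>\<xi> :: real^'n. norm \<xi> powr p * exp (- t * norm \<xi> powr \<theta>))" if t: "0 < t" for t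
    using nn[OF t] by (intro integrableI_nonneg) (auto intro: order.strict_trans1)
  show "\<exists>C\<ge>0. \<forall>t>0. (LINT \<xi>|lborel. norm (\<xi> :: real^'n) powr p * exp (- t * norm \<xi> powr \<theta>))
           \<le> C * t powr (- (p + real CARD('n)) / \<theta>)"
  proof (intro exI[of _ "C * D"] conjI allI impI)
    show "0 \<le> C * D" using C D by simp
    fix t :: real assume "0 < t"
    from nn[OF this] show "(LINT \<xi>|lborel. norm (\<xi> :: real^'n) powr p * exp (- t * norm \<xi> powr \<theta>))
           \<le> C * D * t powr (- (p + real CARD('n)) / \<theta>)"
      using C D by (subst integral_eq_nn_integral) (auto intro!: enn2real_leI)
  qed
qed

section \<open>Symbols and finite differences\<close>

text \<open>\<open>symbol_class n p F\<close>: the first \<open>n\<close> derivatives of \<open>F t e\<close> in the direction \<open>e\<close> are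
  bounded by constants times \<open>|\<xi>| powr (p - j)\<close>, uniformly in \<open>t\<close> and \<open>e\<close>. The symbol takes \<open>e\<close> as an
  argument because its directional derivatives depend on it.\<close>

primrec symbol_class :: "nat \<Rightarrow> real \<Rightarrow> (real \<Rightarrow> real^'n \<Rightarrow> real^'n \<Rightarrow> real) \<Rightarrow> bool" where
  "symbol_class 0 p F = (\<exists>C. \<forall>t>0. \<forall>e \<xi>. norm e = 1 \<longrightarrow> \<xi> \<noteq> 0 \<longrightarrow> \<bar>F t e \<xi>\<bar> \<le> C * norm \<xi> powr p)"
| "symbol_class (Suc n) p F = ((\<exists>C. \<forall>t>0. \<forall>e \<xi>. norm e = 1 \<longrightarrow> \<xi> \<noteq> 0 \<longrightarrow> \<bar>F t e \<xi>\<bar> \<le> C * norm \<xi> powr p) \<and>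
     (\<exists>F'. (\<forall>t>0. \<forall>e \<xi>. norm e = 1 \<longrightarrow> \<xi> \<noteq> 0 \<longrightarrow>
              ((\<lambda>r. F t e (\<xi> + r *\<^sub>R e)) has_real_derivative F' t e \<xi>) (at 0)) \<and> symbol_class n (p - 1) F'))"

section \<open>Closure properties of symbol classes\<close>

lemma symbol_class_0D: "symbol_class n p F \<Longrightarrow> symbol_class 0 p F"
  by (cases n) simp_all

lemma symbol_class_SucI:
  assumes "symbol_class 0 p F" "symbol_class n (p - 1) F'"
    and "\<And>t e \<xi>. 0 < t \<Longrightarrow> norm e = 1 \<Longrightarrow> \<xi> \<noteq> 0 \<Longrightarrow>
          ((\<lambda>r. F t e (\<xi> + r *\<^sub>R e)) has_real_derivative F' t e \<xi>) (at 0)"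
  shows "symbol_class (Suc n) p F"
  using assms by auto

lemma symbol_class_SucE:
  assumes "symbol_class (Suc n) p F"
  obtains F' where "symbol_class 0 p F" "symbol_class n (p - 1) F'"
    "\<And>t e \<xi>. 0 < t \<Longrightarrow> norm e = 1 \<Longrightarrow> \<xi> \<noteq> 0 \<Longrightarrow>
          ((\<lambda>r. F t e (\<xi> + r *\<^sub>R e)) has_real_derivative F' t e \<xi>) (at 0)"
  using assms by auto

lemma symbol_class_0I:
  assumes "\<And>t e \<xi>. 0 < t \<Longrightarrow> norm e = 1 \<Longrightarrow> \<xi> \<noteq> 0 \<Longrightarrow> \<bar>F t e \<xi>\<bar> \<le> C * norm \<xi> powr p"
  shows "symbol_class 0 p F"
  using assms by auto

lemma symbol_class_0E:
  assumes "symbol_class 0 p F"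
  obtains C where "0 \<le> C" "\<And>t e \<xi>. 0 < t \<Longrightarrow> norm e = 1 \<Longrightarrow> \<xi> \<noteq> 0 \<Longrightarrow> \<bar>F t e \<xi>\<bar> \<le> C * norm \<xi> powr p"
proof -
  from assms obtain C where C: "\<forall>t>0. \<forall>e \<xi>. norm e = 1 \<longrightarrow> \<xi> \<noteq> 0 \<longrightarrow> \<bar>F t e \<xi>\<bar> \<le> C * norm \<xi> powr p"
    by auto
  have "\<bar>F t e \<xi>\<bar> \<le> \<bar>C\<bar> * norm \<xi> powr p" if "0 < t" "norm e = 1" "\<xi> \<noteq> 0" for t e \<xi>
    using C that by (meson abs_ge_self mult_right_mono order_trans powr_ge_zero)
  then show thesis by (intro that[of "\<bar>C\<bar>"]) auto
qed

text \<open>Needed in the product rule, where a derivative of one factor, controlled to order n,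
  meets the undifferentiated other factor, controlled to order n + 1.\<close>

lemma symbol_class_mono: "symbol_class (Suc n) p F \<Longrightarrow> symbol_class n p F"
proof (induction n arbitrary: p F)
  case 0 then show ?case by auto
next
  case (Suc n)
  from Suc.prems obtain F' where F': "symbol_class 0 p F" "symbol_class (Suc n) (p - 1) F'"
    "\<And>t e \<xi>. 0 < t \<Longrightarrow> norm e = 1 \<Longrightarrow> \<xi> \<noteq> 0 \<Longrightarrow>
          ((\<lambda>r. F t e (\<xi> + r *\<^sub>R e)) has_real_derivative F' t e \<xi>) (at 0)"
    by (rule symbol_class_SucE) blast
  then show ?case using Suc.IH[OF F'(2)] by (intro symbol_class_SucI) auto
qed

lemma symbol_class_add:
  fixes F G :: "real \<Rightarrow> real^'n \<Rightarrow> real^'n \<Rightarrow> real"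
  assumes "symbol_class n p F" "symbol_class n p G"
  shows "symbol_class n p (\<lambda>t e \<xi>. F t e \<xi> + G t e \<xi>)"
proof -
  have base: "symbol_class 0 p (\<lambda>t e \<xi>. F t e \<xi> + G t e \<xi>)" if F: "symbol_class 0 p F" and G: "symbol_class 0 p G" for p and F G :: "real \<Rightarrow> real^'n \<Rightarrow> real^'n \<Rightarrow> real"
  proof -
    obtain C where C: "\<And>t e \<xi>. 0 < t \<Longrightarrow> norm e = 1 \<Longrightarrow> \<xi> \<noteq> 0 \<Longrightarrow> \<bar>F t e \<xi>\<bar> \<le> C * norm \<xi> powr p"
      using F by (rule symbol_class_0E) blast
    obtain D where D: "\<And>t e \<xi>. 0 < t \<Longrightarrow> norm e = 1 \<Longrightarrow> \<xi> \<noteq> 0 \<Longrightarrow> \<bar>G t e \<xi>\<bar> \<le> D * norm \<xi> powr p"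
      using G by (rule symbol_class_0E) blast
    show ?thesis
    proof (rule symbol_class_0I[of _ "C + D"])
      fix t :: real and e \<xi> :: "real^'n" assume "0 < t" "norm e = 1" "\<xi> \<noteq> 0"
      from C[OF this] D[OF this] show "\<bar>F t e \<xi> + G t e \<xi>\<bar> \<le> (C + D) * norm \<xi> powr p"
        unfolding distrib_right by linarith
    qed
  qed
  show ?thesis using assms
  proof (induction n arbitrary: p F G)
    case 0 then show ?case by (rule base)
  next
    case (Suc n)
    from Suc.prems(1) obtain F' where F': "symbol_class 0 p F" "symbol_class n (p - 1) F'"
      "\<And>t e \<xi>. 0 < t \<Longrightarrow> norm e = 1 \<Longrightarrow> \<xi> \<noteq> 0 \<Longrightarrow>
            ((\<lambda>r. F t e (\<xi> + r *\<^sub>R e)) has_real_derivative F' t e \<xi>) (at 0)"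
      by (rule symbol_class_SucE) blast
    from Suc.prems(2) obtain G' where G': "symbol_class 0 p G" "symbol_class n (p - 1) G'"
      "\<And>t e \<xi>. 0 < t \<Longrightarrow> norm e = 1 \<Longrightarrow> \<xi> \<noteq> 0 \<Longrightarrow>
            ((\<lambda>r. G t e (\<xi> + r *\<^sub>R e)) has_real_derivative G' t e \<xi>) (at 0)"
      by (rule symbol_class_SucE) blast
    show ?case
      by (rule symbol_class_SucI[OF base[OF F'(1) G'(1)] Suc.IH[OF F'(2) G'(2)]])
         (intro derivative_intros F' G')
  qed
qed

lemma symbol_class_mult:
  fixes F G :: "real \<Rightarrow> real^'n \<Rightarrow> real^'n \<Rightarrow> real"
  assumes "symbol_class n p F" "symbol_class n q G"
  shows "symbol_class n (p + q) (\<lambda>t e \<xi>. F t e \<xi> * G t e \<xi>)"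
proof -
  have base: "symbol_class 0 (p + q) (\<lambda>t e \<xi>. F t e \<xi> * G t e \<xi>)" if F: "symbol_class 0 p F" and G: "symbol_class 0 q G" for p q and F G :: "real \<Rightarrow> real^'n \<Rightarrow> real^'n \<Rightarrow> real"
  proof -
    obtain C where C: "0 \<le> C" "\<And>t e \<xi>. 0 < t \<Longrightarrow> norm e = 1 \<Longrightarrow> \<xi> \<noteq> 0 \<Longrightarrow> \<bar>F t e \<xi>\<bar> \<le> C * norm \<xi> powr p"
      using F by (rule symbol_class_0E) blast
    obtain D where D: "0 \<le> D" "\<And>t e \<xi>. 0 < t \<Longrightarrow> norm e = 1 \<Longrightarrow> \<xi> \<noteq> 0 \<Longrightarrow> \<bar>G t e \<xi>\<bar> \<le> D * norm \<xi> powr q"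
      using G by (rule symbol_class_0E) blast
    show ?thesis
    proof (rule symbol_class_0I[of _ "C * D"])
      fix t :: real and e \<xi> :: "real^'n" assume a: "0 < t" "norm e = 1" "\<xi> \<noteq> 0"
      have "\<bar>F t e \<xi> * G t e \<xi>\<bar> \<le> (C * norm \<xi> powr p) * (D * norm \<xi> powr q)"
        unfolding abs_mult using C(1) by (intro mult_mono C(2)[OF a] D(2)[OF a]) auto
      then show "\<bar>F t e \<xi> * G t e \<xi>\<bar> \<le> (C * D) * norm \<xi> powr (p + q)"
        by (simp add: powr_add mult_ac)
    qed
  qed
  show ?thesis using assms
  proof (induction n arbitrary: p q F G)
    case 0 then show ?case by (rule base)
  next
    case (Suc n)
    from Suc.prems(1) obtain F' where F': "symbol_class 0 p F" "symbol_class n (p - 1) F'"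
      "\<And>t e \<xi>. 0 < t \<Longrightarrow> norm e = 1 \<Longrightarrow> \<xi> \<noteq> 0 \<Longrightarrow>
            ((\<lambda>r. F t e (\<xi> + r *\<^sub>R e)) has_real_derivative F' t e \<xi>) (at 0)"
      by (rule symbol_class_SucE) blast
    from Suc.prems(2) obtain G' where G': "symbol_class 0 q G" "symbol_class n (q - 1) G'"
      "\<And>t e \<xi>. 0 < t \<Longrightarrow> norm e = 1 \<Longrightarrow> \<xi> \<noteq> 0 \<Longrightarrow>
            ((\<lambda>r. G t e (\<xi> + r *\<^sub>R e)) has_real_derivative G' t e \<xi>) (at 0)"
      by (rule symbol_class_SucE) blast
    have 1: "symbol_class n (p + q - 1) (\<lambda>t e \<xi>. F' t e \<xi> * G t e \<xi>)"
      using Suc.IH[OF F'(2) symbol_class_mono[OF Suc.prems(2)]] by (simp add: algebra_simps)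
    have 2: "symbol_class n (p + q - 1) (\<lambda>t e \<xi>. G' t e \<xi> * F t e \<xi>)"
      using Suc.IH[OF G'(2) symbol_class_mono[OF Suc.prems(1)]] by (simp add: algebra_simps)
    show ?case
    proof (rule symbol_class_SucI[OF base[OF F'(1) G'(1)] symbol_class_add[OF 1 2]])
      fix t :: real and e \<xi> :: "real^'n" assume a: "0 < t" "norm e = 1" "\<xi> \<noteq> 0"
      show "((\<lambda>r. F t e (\<xi> + r *\<^sub>R e) * G t e (\<xi> + r *\<^sub>R e)) has_real_derivative
          F' t e \<xi> * G t e \<xi> + G' t e \<xi> * F t e \<xi>) (at 0)"
        using DERIV_mult[OF F'(3)[OF a] G'(3)[OF a]] by simp
    qed
  qed
qed

lemma symbol_class_zero: "symbol_class n p (\<lambda>t e \<xi>. 0)"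
proof (induction n arbitrary: p)
  case 0 show ?case by (rule symbol_class_0I[of _ 0]) simp
next
  case (Suc n)
  show ?case by (rule symbol_class_SucI[OF symbol_class_0D[OF Suc.IH] Suc.IH]) simp
qed

text \<open>Derivatives are taken in the direction e with e fixed, so a function of e alone is
  constant along each line that matters. This covers the components of e and the product of e with
  itself, which arise as derivatives of linear symbols.\<close>

lemma symbol_class_of_direction:
  assumes "\<And>e. norm e = 1 \<Longrightarrow> \<bar>g e\<bar> \<le> C"
  shows "symbol_class n 0 (\<lambda>t e \<xi>. g e)"
proof -
  have base: "symbol_class 0 0 (\<lambda>t e \<xi>. g e)" by (rule symbol_class_0I[of _ C]) (use assms in auto)
  show ?thesis
  proof (cases n)
    case (Suc m)
    show ?thesis unfolding Suc by (rule symbol_class_SucI[OF base symbol_class_zero]) simp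
  qed (use base in simp)
qed

lemma symbol_class_const: "symbol_class n 0 (\<lambda>t e \<xi>. c)"
  by (rule symbol_class_of_direction[of _ "\<bar>c\<bar>"]) simp

lemma symbol_class_cmult: "symbol_class n p F \<Longrightarrow> symbol_class n p (\<lambda>t e \<xi>. c * F t e \<xi>)"
  using symbol_class_mult[OF symbol_class_const[of n c], of p F] by simp

lemma symbol_class_coord: "symbol_class n 1 (\<lambda>t e \<xi>. \<xi> $ i)"
proof -
  have base: "symbol_class 0 1 (\<lambda>t e (\<xi>::real^'a). \<xi> $ i)"
    by (rule symbol_class_0I[of _ 1]) (simp add: component_le_norm_cart)
  show ?thesis
  proof (cases n)
    case (Suc m)
    have 1: "symbol_class m (1 - 1) (\<lambda>t e (\<xi>::real^'a). e $ i)"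
      by (simp, rule symbol_class_of_direction[of _ 1]) (metis component_le_norm_cart)
    show ?thesis unfolding Suc
      by (rule symbol_class_SucI[OF base 1]) (auto intro!: derivative_eq_intros)
  qed (use base in simp)
qed

lemma symbol_class_inner: "symbol_class n 1 (\<lambda>t e \<xi>. e \<bullet> \<xi>)"
proof -
  have base: "symbol_class 0 1 (\<lambda>t e (\<xi>::real^'a). e \<bullet> \<xi>)"
    by (rule symbol_class_0I[of _ 1]) (metis Cauchy_Schwarz_ineq2 mult_1 norm_ge_zero powr_one)
  show ?thesis
  proof (cases n)
    case (Suc m)
    have 1: "symbol_class m (1 - 1) (\<lambda>t e (\<xi>::real^'a). e \<bullet> e)"
      by (simp, rule symbol_class_of_direction[of _ 1]) (simp add: dot_square_norm)
    show ?thesis unfolding Suc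
      by (rule symbol_class_SucI[OF base 1]) (auto intro!: derivative_eq_intros simp: inner_add_right)
  qed (use base in simp)
qed

section \<open>The symbols that occur in the heat kernel\<close>

lemma norm_powr_eq_inner: "norm (v :: 'a :: real_inner) powr g = (v \<bullet> v) powr (g / 2)"
  by (cases "v = 0") (simp_all add: dot_square_norm powr_powr flip: powr_numeral)

text \<open>Along the line, the square of the norm is a quadratic polynomial in r that is positive
  at r = 0, so the chain rule for real powers applies.\<close>

lemma DERIV_norm_powr_line:
  fixes \<xi> e :: "'a :: real_inner"
  assumes "\<xi> \<noteq> 0"
  shows "((\<lambda>r. norm (\<xi> + r *\<^sub>R e) powr g) has_real_derivative
           g * (norm \<xi> powr (g - 2) * (e \<bullet> \<xi>))) (at 0)"
proof -
  let ?h = "\<lambda>r::real. \<xi> \<bullet> \<xi> + 2 * r * (e \<bullet> \<xi>) + r\<^sup>2 * (e \<bullet> e)"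
  have h: "(\<xi> + r *\<^sub>R e) \<bullet> (\<xi> + r *\<^sub>R e) = ?h r" for r
    by (simp add: inner_add_left inner_add_right inner_commute power2_eq_square algebra_simps)
  have d: "(?h has_real_derivative 2 * (e \<bullet> \<xi>)) (at 0)"
    by (auto intro!: derivative_eq_intros)
  have pos: "?h 0 > 0" using assms by simp
  have "((\<lambda>r. ?h r powr (g / 2)) has_real_derivative ((g / 2) * ?h 0 powr (g / 2 - 1)) * (2 * (e \<bullet> \<xi>))) (at 0)"
    using DERIV_chain2[OF has_real_derivative_powr[OF pos] d] .
  moreover have "(\<xi> \<bullet> \<xi>) powr (g / 2 - 1) = norm \<xi> powr (g - 2)"
    by (subst norm_powr_eq_inner) (simp add: diff_divide_distrib)
  ultimately show ?thesis
    unfolding norm_powr_eq_inner[of "\<xi> + _ *\<^sub>R e"] h by (simp add: mult_ac)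
qed

text \<open>The derivative is again a power of the norm times a linear symbol. Since the power
  changes from g to g - 2, the induction runs over all exponents at once.\<close>

lemma symbol_class_norm_powr: "symbol_class n g (\<lambda>t e \<xi>. norm \<xi> powr g)"
proof (induction n arbitrary: g)
  case 0 show ?case by (rule symbol_class_0I[of _ 1]) simp
next
  case (Suc n)
  have "symbol_class n (g - 2 + 1) (\<lambda>t e (\<xi>::real^'a). norm \<xi> powr (g - 2) * (e \<bullet> \<xi>))"
    by (intro symbol_class_mult Suc.IH symbol_class_inner)
  then have 1: "symbol_class n (g - 1) (\<lambda>t e (\<xi>::real^'a). g * (norm \<xi> powr (g - 2) * (e \<bullet> \<xi>)))"
    using symbol_class_cmult[where c = g] by fastforce
  show ?case
    by (rule symbol_class_SucI[OF symbol_class_0D[OF Suc.IH] 1]) (rule DERIV_norm_powr_line)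
qed

text \<open>With u = t |\<xi>|^\<theta>, the derivative of u^k exp(-u) is \<theta> |\<xi>|^(-2) (e .
  \<xi>) (k u^k - u^(k+1)) exp(-u). The powers of u are included to make the family closed under
  differentiation; since t enters only through u, the bounds are uniform in t.\<close>

lemma symbol_class_exp_powr:
  assumes "0 < \<theta>"
  shows "symbol_class n 0 (\<lambda>t e \<xi>. (t * norm \<xi> powr \<theta>) ^ k * exp (- t * norm \<xi> powr \<theta>))"
proof (induction n arbitrary: k)
  case 0
  show ?case
  \<comment> \<open>For k = 0 the expression \<open>real k powr real k\<close> is 0, because
    \<open>0 powr 0 = 0\<close>; the maximum with 1 covers this case.\<close>
  proof (rule symbol_class_0I[of _ "max 1 (real k powr real k)"])
    fix t :: real and e \<xi> :: "real^'a" assume "0 < t" "\<xi> \<noteq> 0"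
    then have u: "t * norm \<xi> powr \<theta> > 0" by simp
    show "\<bar>(t * norm \<xi> powr \<theta>) ^ k * exp (- t * norm \<xi> powr \<theta>)\<bar> \<le> max 1 (real k powr real k) * norm \<xi> powr 0"
    proof (cases "k = 0")
      case True
      then show ?thesis using u \<open>\<xi> \<noteq> 0\<close> by simp
    next
      case False
      then show ?thesis using powr_exp_le[of "real k" "t * norm \<xi> powr \<theta>"] u \<open>\<xi> \<noteq> 0\<close>
        by (simp add: powr_realpow abs_mult)
    qed
  qed
next
  case (Suc n)
  let ?E = "\<lambda>k t e (\<xi>::real^'a). (t * norm \<xi> powr \<theta>) ^ k * exp (- t * norm \<xi> powr \<theta>)"
  let ?A = "\<lambda>t e (\<xi>::real^'a). \<theta> * (norm \<xi> powr (- 2) * (e \<bullet> \<xi>))"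
  have A: "symbol_class n (- 2 + 1) ?A"
    by (intro symbol_class_cmult symbol_class_mult symbol_class_norm_powr symbol_class_inner)
  have B: "symbol_class n 0 (\<lambda>t e \<xi>. real k * ?E k t e \<xi> + (- 1) * ?E (Suc k) t e \<xi>)"
    by (intro symbol_class_add symbol_class_cmult Suc.IH)
  have AB: "symbol_class n (0 - 1) (\<lambda>t e \<xi>. ?A t e \<xi> * (real k * ?E k t e \<xi> + (- 1) * ?E (Suc k) t e \<xi>))"
    using symbol_class_mult[OF A B] by simp
  show ?case
  proof (rule symbol_class_SucI[OF symbol_class_0D[OF Suc.IH] AB])
    fix t :: real and e \<xi> :: "real^'a" assume a: "0 < t" "norm e = 1" "\<xi> \<noteq> 0"
    have p2: "norm \<xi> powr (\<theta> - 2) = norm \<xi> powr \<theta> * norm \<xi> powr (- 2)"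
      using powr_add[of "norm \<xi>" \<theta> "- 2"] by simp
    let ?u = "\<lambda>r. t * norm (\<xi> + r *\<^sub>R e) powr \<theta>"
    have u: "(?u has_real_derivative ?A t e \<xi> * ?u 0) (at 0)"
      by (rule derivative_eq_intros DERIV_norm_powr_line[OF a(3)] refl)+ (simp add: p2 mult_ac)
    have "((\<lambda>r. ?u r ^ k * exp (- ?u r)) has_real_derivative
        (real k * ?u 0 ^ (k - 1) * (?A t e \<xi> * ?u 0)) * exp (- ?u 0) + (exp (- ?u 0) * (- (?A t e \<xi> * ?u 0))) * ?u 0 ^ k) (at 0)"
      by (rule derivative_eq_intros u refl)+ simp
    moreover have "real k * ?u 0 ^ (k - 1) * ?u 0 = real k * ?u 0 ^ k"
      by (cases k) auto
    ultimately show "((\<lambda>r. ?E k t e (\<xi> + r *\<^sub>R e)) has_real_derivative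
          ?A t e \<xi> * (real k * ?E k t e \<xi> + (- 1) * ?E (Suc k) t e \<xi>)) (at 0)"
      by (auto simp: algebra_simps elim!: DERIV_cong)
  qed
qed

text \<open>Undifferentiated, the bound is 1 - exp(-u) \<le> u with u = t |\<xi>|^\<theta>. One
  derivative removes the constant 1, and the factor t of the chain rule cancels the division by t,
  which leaves a product of known symbols that is bounded uniformly in t.\<close>

lemma symbol_class_exp_minus_one:
  assumes "0 < \<theta>"
  shows "symbol_class n \<theta> (\<lambda>t e \<xi>. (exp (- t * norm \<xi> powr \<theta>) - 1) / t)"
proof -
  have base: "symbol_class 0 \<theta> (\<lambda>t e (\<xi>::real^'a). (exp (- t * norm \<xi> powr \<theta>) - 1) / t)"
  proof (rule symbol_class_0I[of _ 1])
    fix t :: real and e \<xi> :: "real^'a" assume "0 < t"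
    moreover have "1 - t * norm \<xi> powr \<theta> \<le> exp (- t * norm \<xi> powr \<theta>)"
      using exp_ge_add_one_self[of "- t * norm \<xi> powr \<theta>"] by simp
    moreover have "exp (- t * norm \<xi> powr \<theta>) \<le> 1" using \<open>0 < t\<close> by simp
    ultimately show "\<bar>(exp (- t * norm \<xi> powr \<theta>) - 1) / t\<bar> \<le> 1 * norm \<xi> powr \<theta>"
      by (simp add: abs_le_iff field_simps)
  qed
  show ?thesis
  proof (cases n)
    case (Suc m)
    have E: "symbol_class m 0 (\<lambda>t e (\<xi>::real^'a). exp (- t * norm \<xi> powr \<theta>))"
      using symbol_class_exp_powr[OF assms, of m 0] by simp
    have "symbol_class m ((\<theta> - 2 + 1) + 0) (\<lambda>t e (\<xi>::real^'a). (- \<theta> * (norm \<xi> powr (\<theta> - 2) * (e \<bullet> \<xi>))) * exp (- t * norm \<xi> powr \<theta>))"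
      by (intro symbol_class_cmult symbol_class_mult symbol_class_norm_powr symbol_class_inner E)
    then have 1: "symbol_class m (\<theta> - 1) (\<lambda>t e (\<xi>::real^'a). (- \<theta> * (norm \<xi> powr (\<theta> - 2) * (e \<bullet> \<xi>))) * exp (- t * norm \<xi> powr \<theta>))"
      by simp
    show ?thesis unfolding Suc
      by (rule symbol_class_SucI[OF base 1])
         (rule derivative_eq_intros DERIV_norm_powr_line refl | assumption | simp)+
  qed (use base in simp)
qed

lemma symbol_class_power: "symbol_class n p F \<Longrightarrow> symbol_class n (real k * p) (\<lambda>t e \<xi>. F t e \<xi> ^ k)"
proof (induction k)
  case (Suc k)
  from symbol_class_mult[OF Suc.prems Suc.IH[OF Suc.prems]] show ?case by (simp add: algebra_simps)
qed (use symbol_class_const in simp)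

lemma symbol_class_prod:
  assumes "finite I" "\<And>i. i \<in> I \<Longrightarrow> symbol_class n (p i) (F i)"
  shows "symbol_class n (\<Sum>i\<in>I. p i) (\<lambda>t e \<xi>. \<Prod>i\<in>I. F i t e \<xi>)"
  using assms by (induction I) (auto intro!: symbol_class_mult symbol_class_const)

lemma symbol_class_mi_power: "symbol_class n (real (mi_order \<alpha>)) (\<lambda>t e \<xi>. mi_power \<xi> \<alpha>)"
proof -
  have "symbol_class n (\<Sum>i\<in>UNIV. real (\<alpha> i) * 1) (\<lambda>t e \<xi>. \<Prod>i\<in>UNIV. \<xi> $ i ^ \<alpha> i)"
    by (intro symbol_class_prod symbol_class_power symbol_class_coord) auto
  then show ?thesis by (simp add: mi_order_def mi_power_def)
qed

section \<open>Iterated finite differences of symbols\<close>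

definition fdiff :: "'a::real_vector \<Rightarrow> ('a \<Rightarrow> real) \<Rightarrow> 'a \<Rightarrow> real" where
  "fdiff h F = (\<lambda>\<xi>. F (\<xi> + h) - F \<xi>)"

lemma funpow_fdiff_Suc: "(fdiff h ^^ Suc n) F \<xi> = (fdiff h ^^ n) F (\<xi> + h) - (fdiff h ^^ n) F \<xi>"
  by (simp only: funpow.simps o_apply) (simp only: fdiff_def)

text \<open>The n-th difference combines the values at \<xi> + j h, 0 \<le> j \<le> n, with binomial
  coefficients whose absolute values add up to 2^n.\<close>

lemma funpow_fdiff_bound:
  fixes b :: "'a::real_normed_vector \<Rightarrow> real"
  assumes "\<And>\<eta>. norm (\<eta> - \<xi>) \<le> real n * norm h \<Longrightarrow> \<bar>b \<eta>\<bar> \<le> M"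
  shows "\<bar>(fdiff h ^^ n) b \<xi>\<bar> \<le> 2 ^ n * M"
  using assms
proof (induction n arbitrary: \<xi>)
  case 0 then show ?case by simp
next
  case (Suc n)
  have "\<bar>(fdiff h ^^ n) b (\<xi> + h)\<bar> \<le> 2 ^ n * M"
  proof (rule Suc.IH)
    fix \<eta> assume "norm (\<eta> - (\<xi> + h)) \<le> real n * norm h"
    moreover have "norm (\<eta> - \<xi>) \<le> norm (\<eta> - (\<xi> + h)) + norm h"
      using norm_triangle_ineq[of "\<eta> - (\<xi> + h)" h] by simp
    ultimately show "\<bar>b \<eta>\<bar> \<le> M" by (intro Suc.prems) (simp add: algebra_simps)
  qed
  moreover have "\<bar>(fdiff h ^^ n) b \<xi>\<bar> \<le> 2 ^ n * M"
  proof (rule Suc.IH)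
    fix \<eta> assume "norm (\<eta> - \<xi>) \<le> real n * norm h"
    then show "\<bar>b \<eta>\<bar> \<le> M" by (intro Suc.prems) (smt (verit) mult_right_mono norm_ge_zero of_nat_mono le_SucI order_refl)
  qed
  ultimately show ?case unfolding funpow_fdiff_Suc by simp
qed

text \<open>An n-th difference at r looks ahead as far as r + n a. The right end b is left general
  because each difference step uses the induction hypothesis on an interval that is longer by
  a.\<close>

lemma funpow_fdiff_deriv:
  assumes "\<And>r. 0 \<le> r \<Longrightarrow> r \<le> b + real n * a \<Longrightarrow> ((\<lambda>r. F (\<xi> + r *\<^sub>R e)) has_real_derivative F' (\<xi> + r *\<^sub>R e)) (at r)"
    and "0 \<le> a" "0 \<le> r" "r \<le> b"
  shows "((\<lambda>r. (fdiff (a *\<^sub>R e) ^^ n) F (\<xi> + r *\<^sub>R e)) has_real_derivative (fdiff (a *\<^sub>R e) ^^ n) F' (\<xi> + r *\<^sub>R e)) (at r)"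
  using assms
proof (induction n arbitrary: b r)
  case 0 then show ?case by simp
next
  case (Suc n)
  have IH: "((\<lambda>r. (fdiff (a *\<^sub>R e) ^^ n) F (\<xi> + r *\<^sub>R e)) has_real_derivative (fdiff (a *\<^sub>R e) ^^ n) F' (\<xi> + r *\<^sub>R e)) (at r)"
    if "0 \<le> r" "r \<le> b + a" for r
    using that Suc.prems(2) by (intro Suc.IH[of "b + a"] Suc.prems(1)) (auto simp: algebra_simps)
  have shift: "\<xi> + r *\<^sub>R e + a *\<^sub>R e = \<xi> + (r + a) *\<^sub>R e" for r by (simp add: algebra_simps)
  have "((\<lambda>r. (fdiff (a *\<^sub>R e) ^^ n) F (\<xi> + (r + a) *\<^sub>R e)) has_real_derivative (fdiff (a *\<^sub>R e) ^^ n) F' (\<xi> + (r + a) *\<^sub>R e)) (at r)"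
    using IH[of "r + a"] Suc.prems
    by (intro iffD1[OF DERIV_shift[where f = "\<lambda>r. (fdiff (a *\<^sub>R e) ^^ n) F (\<xi> + r *\<^sub>R e)"]]) auto
  then show ?case
    using Suc.prems unfolding funpow_fdiff_Suc shift by (intro DERIV_diff IH) auto
qed

lemma norm_powr_le_comparable:
  fixes u v :: real
  assumes "0 < v" "v / 2 \<le> u" "u \<le> 2 * v"
  shows "u powr s \<le> 2 powr \<bar>s\<bar> * v powr s"
proof (cases "0 \<le> s")
  case True
  then have "u powr s \<le> (2 * v) powr s" using assms by (intro powr_mono2) auto
  also have "\<dots> = 2 powr \<bar>s\<bar> * v powr s" using True assms by (simp add: powr_mult)
  finally show ?thesis .
next
  case False
  then have "u powr s \<le> (v / 2) powr s" using assms by (intro powr_mono2') auto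
  also have "\<dots> = 2 powr \<bar>s\<bar> * v powr s" using False assms by (simp add: powr_divide powr_minus field_simps)
  finally show ?thesis .
qed

text \<open>By the mean value theorem, one of the n + 1 differences turns into a times a derivative,
  which commutes with the remaining n differences and lowers the order of the symbol by one. The
  condition 2 n a \<le> |\<xi>| keeps all points involved away from the origin, at norms comparable
  with |\<xi>|.\<close>

lemma symbol_class_funpow_fdiff_bound:
  assumes "symbol_class n p F"
  obtains C where "0 \<le> C"
    "\<And>t e \<xi> a. 0 < t \<Longrightarrow> norm e = 1 \<Longrightarrow> \<xi> \<noteq> 0 \<Longrightarrow> 0 < a \<Longrightarrow> 2 * real n * a \<le> norm \<xi> \<Longrightarrow>
       \<bar>(fdiff (a *\<^sub>R e) ^^ n) (F t e) \<xi>\<bar> \<le> C * a ^ n * norm \<xi> powr (p - real n)"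
  using assms
proof (induction n arbitrary: p F thesis)
  case 0
  from 0(2) obtain C where "0 \<le> C" "\<And>t e \<xi>. 0 < t \<Longrightarrow> norm e = 1 \<Longrightarrow> \<xi> \<noteq> 0 \<Longrightarrow> \<bar>F t e \<xi>\<bar> \<le> C * norm \<xi> powr p"
    by (rule symbol_class_0E) blast
  then show ?case by (intro 0(1)[of C]) auto
next
  case (Suc n)
  from Suc.prems(2) obtain F' where F': "symbol_class 0 p F" "symbol_class n (p - 1) F'"
    "\<And>t e \<xi>. 0 < t \<Longrightarrow> norm e = 1 \<Longrightarrow> \<xi> \<noteq> 0 \<Longrightarrow>
          ((\<lambda>r. F t e (\<xi> + r *\<^sub>R e)) has_real_derivative F' t e \<xi>) (at 0)"
    by (rule symbol_class_SucE) blast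
  from Suc.IH[OF _ F'(2)] obtain C where C: "0 \<le> C"
    "\<And>t e \<xi> a. 0 < t \<Longrightarrow> norm e = 1 \<Longrightarrow> \<xi> \<noteq> 0 \<Longrightarrow> 0 < a \<Longrightarrow> 2 * real n * a \<le> norm \<xi> \<Longrightarrow>
       \<bar>(fdiff (a *\<^sub>R e) ^^ n) (F' t e) \<xi>\<bar> \<le> C * a ^ n * norm \<xi> powr (p - 1 - real n)"
    by blast
  let ?s = "p - 1 - real n"
  show ?case
  proof (rule Suc.prems(1)[of "C * 2 powr \<bar>?s\<bar>"])
    show "0 \<le> C * 2 powr \<bar>?s\<bar>" using C(1) by simp
    fix t :: real and e \<xi> :: "real^'a" and a :: real
    assume a: "0 < t" "norm e = 1" "\<xi> \<noteq> 0" "0 < a" "2 * real (Suc n) * a \<le> norm \<xi>"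
    have lower: "norm \<xi> - r \<le> norm (\<xi> + r *\<^sub>R e)" "norm (\<xi> + r *\<^sub>R e) \<le> norm \<xi> + r" if "0 \<le> r" for r
      using norm_triangle_ineq4[of "\<xi> + r *\<^sub>R e" "r *\<^sub>R e"] norm_triangle_ineq[of \<xi> "r *\<^sub>R e"] a that by auto
    have na: "2 * real n * a + 2 * a \<le> norm \<xi>" "0 \<le> real n * a" using a by (auto simp: algebra_simps)
    have D: "((\<lambda>r. F t e (\<xi> + r *\<^sub>R e)) has_real_derivative F' t e (\<xi> + r *\<^sub>R e)) (at r)"
      if r: "0 \<le> r" "r \<le> a + real n * a" for r
    proof -
      have "norm (\<xi> + r *\<^sub>R e) > 0" using lower(1)[OF r(1)] r na a by linarith
      then have "((\<lambda>r'. F t e (\<xi> + r *\<^sub>R e + r' *\<^sub>R e)) has_real_derivative F' t e (\<xi> + r *\<^sub>R e)) (at 0)"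
        using F'(3)[of t e "\<xi> + r *\<^sub>R e"] a by auto
      then have "((\<lambda>r'. F t e (\<xi> + (r' + r) *\<^sub>R e)) has_real_derivative F' t e (\<xi> + r *\<^sub>R e)) (at 0)"
        by (simp add: algebra_simps)
      then show ?thesis using DERIV_shift[of "\<lambda>r. F t e (\<xi> + r *\<^sub>R e)" _ 0 r] by simp
    qed
    let ?g = "\<lambda>r. (fdiff (a *\<^sub>R e) ^^ n) (F t e) (\<xi> + r *\<^sub>R e)"
    let ?g' = "\<lambda>r. (fdiff (a *\<^sub>R e) ^^ n) (F' t e) (\<xi> + r *\<^sub>R e)"
    have "\<exists>z>0. z < a \<and> ?g a - ?g 0 = (a - 0) * ?g' z"
      by (rule MVT2) (use a D in \<open>auto intro!: funpow_fdiff_deriv[where b = a]\<close>)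
    then obtain z where z: "0 < z" "z < a" "?g a - ?g 0 = a * ?g' z" by auto
    let ?v = "norm (\<xi> + z *\<^sub>R e)"
    \<comment> \<open>Moving by z < a costs at most a of the norm. Since 2 (n + 1) a \<le> |\<xi>|,
      the new base point still admits n differences and has a norm within a factor 2 of
      |\<xi>|.\<close>
    have v: "norm \<xi> / 2 \<le> ?v" "?v \<le> 2 * norm \<xi>" "2 * real n * a \<le> ?v" "?v > 0"
      using lower[of z] z na a by linarith+
    have "\<bar>?g' z\<bar> \<le> C * a ^ n * ?v powr ?s"
      using v a by (intro C(2)) auto
    also have "\<dots> \<le> C * a ^ n * (2 powr \<bar>?s\<bar> * norm \<xi> powr ?s)"
      using C(1) a v by (intro mult_left_mono norm_powr_le_comparable) auto
    finally have "a * \<bar>?g' z\<bar> \<le> a * (C * a ^ n * (2 powr \<bar>?s\<bar> * norm \<xi> powr ?s))"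
      using a by (intro mult_left_mono) auto
    moreover have "(fdiff (a *\<^sub>R e) ^^ Suc n) (F t e) \<xi> = a * ?g' z"
      using z(3) unfolding funpow_fdiff_Suc by simp
    ultimately show "\<bar>(fdiff (a *\<^sub>R e) ^^ Suc n) (F t e) \<xi>\<bar> \<le> C * 2 powr \<bar>?s\<bar> * a ^ Suc n * norm \<xi> powr (p - real (Suc n))"
      using a by (simp add: abs_mult algebra_simps)
  qed
qed

section \<open>Decay of cosine transforms\<close>

text \<open>A Fourier transform in real form. The phase c keeps the family closed under
  differentiation in x, because the derivative of the cosine is the cosine shifted by pi/2.\<close>

definition cos_transform :: "real^'n \<Rightarrow> real \<Rightarrow> (real^'n \<Rightarrow> real) \<Rightarrow> real" where
  "cos_transform x c b = (LINT \<xi>|lborel. cos (x \<bullet> \<xi> + c) * b \<xi>)"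

lemma lborel_translation:
  fixes g :: "'a::euclidean_space \<Rightarrow> real"
  assumes "integrable lborel g"
  shows "integrable lborel (\<lambda>\<xi>. g (\<xi> + h))" "(LINT \<xi>|lborel. g (\<xi> + h)) = (LINT \<xi>|lborel. g \<xi>)"
proof -
  have d: "lborel = distr lborel borel (\<lambda>\<xi>::'a. \<xi> + h)"
  proof -
    have "(\<lambda>\<xi>::'a. \<xi> + h) = (+) h" by (auto simp: add.commute)
    then show ?thesis using lborel_distr_plus[of h] by metis
  qed
  have m: "g \<in> borel_measurable borel" using assms by simp
  show "integrable lborel (\<lambda>\<xi>. g (\<xi> + h))"
    using assms m by (subst (asm) d) (subst (asm) integrable_distr_eq, auto)
  have "(LINT \<xi>|lborel. g \<xi>) = (LINT \<xi>|distr lborel borel (\<lambda>\<xi>::'a. \<xi> + h). g \<xi>)" using d by simp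
  also have "\<dots> = (LINT \<xi>|lborel. g (\<xi> + h))" using m by (subst integral_distr) auto
  finally show "(LINT \<xi>|lborel. g (\<xi> + h)) = (LINT \<xi>|lborel. g \<xi>)" by simp
qed

lemma integrable_cos_mult:
  fixes b :: "real^'n \<Rightarrow> real"
  assumes "integrable lborel b"
  shows "integrable lborel (\<lambda>\<xi>. cos (x \<bullet> \<xi> + c) * b \<xi>)"
proof -
  have [measurable]: "b \<in> borel_measurable borel" using assms by simp
  show ?thesis using assms
    by (rule Bochner_Integration.integrable_bound) (measurable, auto simp: abs_mult intro!: mult_left_le_one_le)
qed

lemma cos_transform_fdiff:
  fixes b :: "real^'n \<Rightarrow> real"
  assumes b: "integrable lborel b" and h: "x \<bullet> h = pi"
  shows "integrable lborel (fdiff h b)" "cos_transform x c (fdiff h b) = - 2 * cos_transform x c b"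
proof -
  have b': "integrable lborel (\<lambda>\<xi>. b (\<xi> + h))" using b by (rule lborel_translation)
  show "integrable lborel (fdiff h b)" unfolding fdiff_def using b b' by simp
  have "(LINT \<xi>|lborel. cos (x \<bullet> \<xi> + c) * b (\<xi> + h)) = (LINT \<xi>|lborel. - cos (x \<bullet> (\<xi> + h) + c) * b (\<xi> + h))"
  proof (rule Bochner_Integration.integral_cong)
    fix \<xi>
    have "x \<bullet> (\<xi> + h) + c = (x \<bullet> \<xi> + c) + pi" using h by (simp add: inner_add_right)
    then show "cos (x \<bullet> \<xi> + c) * b (\<xi> + h) = - cos (x \<bullet> (\<xi> + h) + c) * b (\<xi> + h)"
      by (simp only: cos_periodic_pi minus_minus)
  qed simp
  also have "\<dots> = (LINT \<xi>|lborel. - cos (x \<bullet> \<xi> + c) * b \<xi>)"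
    using integrable_cos_mult[OF b, of x c] by (intro lborel_translation(2)[of "\<lambda>\<xi>. - cos (x \<bullet> \<xi> + c) * b \<xi>"]) simp
  also have "\<dots> = - cos_transform x c b" by (simp add: cos_transform_def)
  finally have "(LINT \<xi>|lborel. cos (x \<bullet> \<xi> + c) * b (\<xi> + h)) = - cos_transform x c b" .
  moreover have "cos_transform x c (fdiff h b) = (LINT \<xi>|lborel. cos (x \<bullet> \<xi> + c) * b (\<xi> + h)) - cos_transform x c b"
    unfolding cos_transform_def fdiff_def right_diff_distrib
    by (intro Bochner_Integration.integral_diff integrable_cos_mult b b')
  ultimately show "cos_transform x c (fdiff h b) = - 2 * cos_transform x c b" by simp
qed

lemma cos_transform_funpow_fdiff:
  fixes b :: "real^'n \<Rightarrow> real"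
  assumes b: "integrable lborel b" and h: "x \<bullet> h = pi"
  shows "integrable lborel ((fdiff h ^^ n) b) \<and> cos_transform x c ((fdiff h ^^ n) b) = (- 2) ^ n * cos_transform x c b"
proof (induction n)
  case (Suc n)
  then show ?case using cos_transform_fdiff(1)[of "(fdiff h ^^ n) b" x h] cos_transform_fdiff(2)[of "(fdiff h ^^ n) b" x h c] h by simp
qed (use b in simp)

lemma cos_transform_abs_le:
  fixes b :: "real^'n \<Rightarrow> real"
  assumes "integrable lborel b"
  shows "\<bar>cos_transform x c b\<bar> \<le> (LINT \<xi>|lborel. \<bar>b \<xi>\<bar>)"
proof -
  have "\<bar>cos_transform x c b\<bar> \<le> (LINT \<xi>|lborel. \<bar>cos (x \<bullet> \<xi> + c) * b \<xi>\<bar>)" unfolding cos_transform_def by (rule integral_abs_bound)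
  also have "\<dots> \<le> (LINT \<xi>|lborel. \<bar>b \<xi>\<bar>)"
    using assms integrable_cos_mult[OF assms]
    by (intro integral_mono integrable_abs) (auto simp: abs_mult intro!: mult_left_le_one_le)
  finally show ?thesis .
qed

text \<open>Translating the integration variable by \<open>h = \<pi> x / |x|\<^sup>2\<close> reverses the sign of the
  oscillating factor, so each difference in direction \<open>h\<close> contributes a factor \<open>-2\<close>. This replaces
  integration by parts and needs no cut-off near the singularity of the symbol at the origin.\<close>

lemma cos_transform_decay:
  fixes b :: "real \<Rightarrow> real^'n \<Rightarrow> real"
  assumes sym: "symbol_class n p (\<lambda>t e \<xi>. b t \<xi>)" and p: "0 < p" and n: "p + real CARD('n) < real n"
    and b0: "\<And>t. b t 0 = 0"
  obtains C where "0 \<le> C"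
    "\<And>t x c g. 0 < t \<Longrightarrow> x \<noteq> 0 \<Longrightarrow> integrable lborel g \<Longrightarrow> (\<And>h. (fdiff h ^^ n) g = (fdiff h ^^ n) (b t)) \<Longrightarrow>
       \<bar>cos_transform x c g\<bar> \<le> C * norm x powr (- real CARD('n) - p)"
proof -
  let ?N = "real CARD('n)"
  obtain C1 where C1: "0 \<le> C1" "\<And>t e \<xi> a. 0 < t \<Longrightarrow> norm e = 1 \<Longrightarrow> \<xi> \<noteq> 0 \<Longrightarrow> 0 < a \<Longrightarrow> 2 * real n * a \<le> norm \<xi> \<Longrightarrow>
       \<bar>(fdiff (a *\<^sub>R e) ^^ n) (b t) \<xi>\<bar> \<le> C1 * a ^ n * norm \<xi> powr (p - real n)"
    using symbol_class_funpow_fdiff_bound[OF sym] by metis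
  obtain C2 where C2: "0 \<le> C2" "\<And>t e \<xi>. 0 < t \<Longrightarrow> norm (e::real^'n) = 1 \<Longrightarrow> \<xi> \<noteq> 0 \<Longrightarrow> \<bar>b t \<xi>\<bar> \<le> C2 * norm \<xi> powr p"
    using symbol_class_0D[OF sym] by (rule symbol_class_0E) blast
  \<comment> \<open>With this \<delta>, a^(p+N) times \<open>decay_kernel \<delta> a\<close> equals
    a^n (|\<xi>| + a)^(p-n), the bound expected for an n-th difference of step a. Positivity of
    \<delta> is the integrability of that bound at infinity.\<close>
  define \<delta> where "\<delta> = real n - p - ?N"
  have \<delta>: "0 < \<delta>" using n by (simp add: \<delta>_def)
  obtain D where D: "0 \<le> D" "\<And>r. 0 < r \<Longrightarrow> (\<integral>\<^sup>+x. ennreal (decay_kernel \<delta> r (x :: real^'n)) \<partial>lborel) \<le> ennreal D"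
    using nn_integral_decay_kernel_bounded[OF \<delta>] by metis
  have n1: "1 \<le> real n" using n p by (cases n) auto
  define C3 where "C3 = C1 * 2 powr (real n - p) + 2 ^ n * (C2 * (3 * real n) powr p) * (2 * real n + 1) powr (real n - p)"
  have C3: "0 \<le> C3" unfolding C3_def using C1 C2 by simp
  have pt: "\<bar>(fdiff (a *\<^sub>R e) ^^ n) (b t) \<xi>\<bar> \<le> C3 * a powr (p + ?N) * decay_kernel \<delta> a \<xi>"
    if t: "0 < t" and e: "norm e = 1" and a: "0 < a" for t e a \<xi>
  proof -
    have Q: "a powr (p + ?N) * decay_kernel \<delta> a \<xi> = a ^ n * (norm \<xi> + a) powr (p - real n)"
    proof -
      have "a powr (p + ?N) * a powr \<delta> = a ^ n" using a by (simp add: \<delta>_def powr_realpow flip: powr_add)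
      moreover have "- ?N - \<delta> = p - real n" by (simp add: \<delta>_def)
      ultimately show ?thesis unfolding decay_kernel_def by (simp flip: mult.assoc)
    qed
    have "\<bar>(fdiff (a *\<^sub>R e) ^^ n) (b t) \<xi>\<bar> \<le> C3 * (a ^ n * (norm \<xi> + a) powr (p - real n))"
    \<comment> \<open>Away from the origin the differences gain the factor (a/|\<xi>|)^n. Within
      distance 2 n a of it there is no smoothness to use, but all points evaluated lie within 3 n a
      of the origin, where the symbol itself is of size a^p because p > 0.\<close>
    proof (cases "2 * real n * a \<le> norm \<xi>")
      case True
      have "1 * a \<le> real n * a" using n1 a by (intro mult_right_mono) auto
      then have ax: "a \<le> norm \<xi>" "norm \<xi> > 0" using True a by linarith+
      have "2 powr (p - real n) * norm \<xi> powr (p - real n) = (2 * norm \<xi>) powr (p - real n)"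
        by (simp add: powr_mult)
      also have "\<dots> \<le> (norm \<xi> + a) powr (p - real n)"
        using ax a n by (intro powr_mono2') auto
      finally have "2 powr (real n - p) * (2 powr (p - real n) * norm \<xi> powr (p - real n)) \<le> 2 powr (real n - p) * (norm \<xi> + a) powr (p - real n)"
        by (intro mult_left_mono) auto
      then have "norm \<xi> powr (p - real n) \<le> 2 powr (real n - p) * (norm \<xi> + a) powr (p - real n)"
        by (simp flip: mult.assoc powr_add)
      then have "C1 * a ^ n * norm \<xi> powr (p - real n) \<le> C1 * a ^ n * (2 powr (real n - p) * (norm \<xi> + a) powr (p - real n))"
        using C1 a by (intro mult_left_mono) auto
      also have "\<dots> = C1 * 2 powr (real n - p) * (a ^ n * (norm \<xi> + a) powr (p - real n))" by simp
      also have "\<dots> \<le> C3 * (a ^ n * (norm \<xi> + a) powr (p - real n))"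
        using a C2 by (intro mult_right_mono) (auto simp: C3_def)
      finally show ?thesis using C1(2)[OF t e _ a True] ax by force
    next
      case False
      have "\<bar>(fdiff (a *\<^sub>R e) ^^ n) (b t) \<xi>\<bar> \<le> 2 ^ n * (C2 * (3 * real n * a) powr p)"
      proof (rule funpow_fdiff_bound)
        fix \<eta> assume "norm (\<eta> - \<xi>) \<le> real n * norm (a *\<^sub>R e)"
        then have le: "norm \<eta> \<le> 3 * real n * a"
          using False a e norm_triangle_ineq[of "\<eta> - \<xi>" \<xi>] by simp
        show "\<bar>b t \<eta>\<bar> \<le> C2 * (3 * real n * a) powr p"
        proof (cases "\<eta> = 0")
          case True then show ?thesis using b0 C2 by simp
        next
          case False
          have "\<bar>b t \<eta>\<bar> \<le> C2 * norm \<eta> powr p" by (rule C2(2)[OF t e False])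
          also have "\<dots> \<le> C2 * (3 * real n * a) powr p"
            using le C2 p by (intro mult_left_mono powr_mono2) auto
          finally show ?thesis .
        qed
      qed
      also have "\<dots> = 2 ^ n * (C2 * (3 * real n) powr p) * a powr p"
        using a by (simp add: powr_mult)
      also have "a powr p = a ^ n * ((2 * real n + 1) powr (real n - p) * ((2 * real n + 1) * a) powr (p - real n))"
      proof -
        have "(2 * real n + 1) powr (real n - p) * ((2 * real n + 1) * a) powr (p - real n) = a powr (p - real n)"
          using a by (simp add: powr_mult flip: mult.assoc powr_add)
        moreover have "a ^ n * a powr (p - real n) = a powr p"
          using a by (simp flip: powr_realpow powr_add)
        ultimately show ?thesis by simp
      qed
      also have "2 ^ n * (C2 * (3 * real n) powr p) * \<dots>
          \<le> 2 ^ n * (C2 * (3 * real n) powr p) * (a ^ n * ((2 * real n + 1) powr (real n - p) * (norm \<xi> + a) powr (p - real n)))"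
        using False a n C2 norm_ge_zero[of \<xi>] by (intro mult_left_mono powr_mono2') (auto simp: algebra_simps add_pos_nonneg)
      also have "\<dots> = 2 ^ n * (C2 * (3 * real n) powr p) * (2 * real n + 1) powr (real n - p) * (a ^ n * (norm \<xi> + a) powr (p - real n))"
        by simp
      also have "\<dots> \<le> C3 * (a ^ n * (norm \<xi> + a) powr (p - real n))"
        using a C1 by (intro mult_right_mono) (auto simp: C3_def)
      finally show ?thesis .
    qed
    then show ?thesis using Q by (simp add: mult.assoc)
  qed
  show thesis
  proof (rule that[of "C3 * pi powr (p + ?N) * D"])
    show "0 \<le> C3 * pi powr (p + ?N) * D" using C3 D by simp
    fix t c and x :: "real^'n" and g
    assume t: "0 < t" and x: "x \<noteq> 0" and g: "integrable lborel g" and gb: "\<And>h. (fdiff h ^^ n) g = (fdiff h ^^ n) (b t)"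
    \<comment> \<open>The shift a e has length pi/|x| and satisfies x . (a e) = pi, half a period of
      the oscillation. Only the n-th differences of g are estimated, so g may differ from the symbol
      by a function that these differences annihilate.\<close>
    define a where "a = pi / norm x"
    define e where "e = x /\<^sub>R norm x"
    let ?h = "a *\<^sub>R e"
    have a: "a > 0" and e: "norm e = 1" using x by (auto simp: a_def e_def)
    have xh: "x \<bullet> ?h = pi" using x by (simp add: a_def e_def dot_square_norm power2_eq_square)
    have I: "integrable lborel ((fdiff ?h ^^ n) g)" "cos_transform x c ((fdiff ?h ^^ n) g) = (- 2) ^ n * cos_transform x c g"
      using cos_transform_funpow_fdiff[OF g xh] by auto
    have "\<bar>cos_transform x c g\<bar> \<le> 2 ^ n * \<bar>cos_transform x c g\<bar>" by (simp add: mult_le_cancel_right1)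
    also have "\<dots> = \<bar>cos_transform x c ((fdiff ?h ^^ n) g)\<bar>" by (simp add: I(2) abs_mult power_abs)
    also have "\<dots> \<le> (LINT \<xi>|lborel. \<bar>(fdiff ?h ^^ n) g \<xi>\<bar>)" by (rule cos_transform_abs_le[OF I(1)])
    also have "\<dots> \<le> C3 * a powr (p + ?N) * D"
    proof -
      have "(\<integral>\<^sup>+\<xi>. ennreal \<bar>(fdiff ?h ^^ n) g \<xi>\<bar> \<partial>lborel) \<le> (\<integral>\<^sup>+\<xi>. ennreal (C3 * a powr (p + ?N)) * ennreal (decay_kernel \<delta> a (\<xi> :: real^'n)) \<partial>lborel)"
        by (intro nn_integral_mono) (use pt[OF t e a] C3 gb in \<open>simp add: ennreal_leI flip: ennreal_mult\<close>)
      also have "\<dots> = ennreal (C3 * a powr (p + ?N)) * (\<integral>\<^sup>+\<xi>. ennreal (decay_kernel \<delta> a (\<xi> :: real^'n)) \<partial>lborel)"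
        by (rule nn_integral_cmult) simp
      also have "\<dots> \<le> ennreal (C3 * a powr (p + ?N)) * ennreal D"
        using a by (intro mult_left_mono D) auto
      finally have "(\<integral>\<^sup>+\<xi>. ennreal \<bar>(fdiff ?h ^^ n) g \<xi>\<bar> \<partial>lborel) \<le> ennreal (C3 * a powr (p + ?N) * D)"
        using C3 D by (simp add: ennreal_mult)
      then show ?thesis using C3 D I(1) by (subst integral_eq_nn_integral) (auto intro!: enn2real_leI)
    qed
    also have "a powr (p + ?N) = pi powr (p + ?N) * norm x powr (- ?N - p)"
    proof -
      have "a powr (p + ?N) = pi powr (p + ?N) / norm x powr (p + ?N)" by (simp add: a_def powr_divide)
      also have "\<dots> = pi powr (p + ?N) * norm x powr (- (p + ?N))" by (simp only: powr_minus divide_inverse)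
      also have "- (p + ?N) = - ?N - p" by simp
      finally show ?thesis .
    qed
    finally show "\<bar>cos_transform x c g\<bar> \<le> C3 * pi powr (p + ?N) * D * norm x powr (- ?N - p)"
      by (simp add: mult_ac)
  qed
qed

section \<open>Functions annihilated by iterated differences\<close>

text \<open>A substitute for "polynomial of degree less than n along h" that needs no notion of
  degree, only the algebra of differences.\<close>

definition fdiff_nilpotent :: "'a::real_vector \<Rightarrow> nat \<Rightarrow> ('a \<Rightarrow> real) \<Rightarrow> bool" where
  "fdiff_nilpotent h n f \<longleftrightarrow> (\<forall>\<xi>. (fdiff h ^^ n) f \<xi> = 0)"

lemma fdiff_nilpotent_0: "fdiff_nilpotent h 0 f \<longleftrightarrow> f = (\<lambda>\<xi>. 0)"
  by (auto simp: fdiff_nilpotent_def)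

lemma fdiff_nilpotent_Suc: "fdiff_nilpotent h (Suc n) f \<longleftrightarrow> fdiff_nilpotent h n (fdiff h f)"
  by (simp only: fdiff_nilpotent_def funpow_Suc_right o_apply)

lemma funpow_fdiff_add: "(fdiff h ^^ n) (\<lambda>\<xi>. f \<xi> + g \<xi>) \<xi> = (fdiff h ^^ n) f \<xi> + (fdiff h ^^ n) g \<xi>"
  by (induction n arbitrary: \<xi>) (simp, simp only: funpow_fdiff_Suc)

lemma fdiff_nilpotent_add: "fdiff_nilpotent h n f \<Longrightarrow> fdiff_nilpotent h n g \<Longrightarrow> fdiff_nilpotent h n (\<lambda>\<xi>. f \<xi> + g \<xi>)"
  by (simp add: fdiff_nilpotent_def funpow_fdiff_add)

lemma fdiff_nilpotent_mono:
  assumes "fdiff_nilpotent h n f" "n \<le> m"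
  shows "fdiff_nilpotent h m f"
proof -
  have "fdiff_nilpotent h (n + k) f" for k
  proof (induction k)
    case (Suc k)
    then show ?case unfolding fdiff_nilpotent_def add_Suc_right funpow_fdiff_Suc by simp
  qed (use assms in simp)
  from this[of "m - n"] show ?thesis using assms by simp
qed

text \<open>The discrete Leibniz rule D(fg) = (Df) g + f (Dg) + (Df)(Dg) reduces k + l in each
  summand. If k or l is 0, the corresponding difference vanishes identically and the summand is
  zero.\<close>

lemma fdiff_nilpotent_mult:
  "fdiff_nilpotent h (Suc k) f \<Longrightarrow> fdiff_nilpotent h (Suc l) g \<Longrightarrow> fdiff_nilpotent h (Suc (k + l)) (\<lambda>\<xi>. f \<xi> * g \<xi>)"
proof (induction "k + l" arbitrary: k l f g rule: less_induct)
  case less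
  have eq: "fdiff h (\<lambda>\<xi>. f \<xi> * g \<xi>) = (\<lambda>\<xi>. (fdiff h f \<xi> * g \<xi> + f \<xi> * fdiff h g \<xi>) + fdiff h f \<xi> * fdiff h g \<xi>)"
    by (auto simp: fdiff_def algebra_simps)
  have f: "fdiff_nilpotent h k (fdiff h f)" and g: "fdiff_nilpotent h l (fdiff h g)" using less.prems by (simp_all add: fdiff_nilpotent_Suc)
  have z: "fdiff_nilpotent h n (\<lambda>\<xi>. 0)" for n by (rule fdiff_nilpotent_mono[of h 0]) (auto simp: fdiff_nilpotent_0)
  have 1: "fdiff_nilpotent h (k + l) (\<lambda>\<xi>. fdiff h f \<xi> * g \<xi>)"
  proof (cases k)
    case 0 then show ?thesis using f z by (simp add: fdiff_nilpotent_0)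
  next
    case (Suc k') then show ?thesis using less.hyps[of k' l "fdiff h f" g] f less.prems by simp
  qed
  have 2: "fdiff_nilpotent h (k + l) (\<lambda>\<xi>. f \<xi> * fdiff h g \<xi>)"
  proof (cases l)
    case 0 then show ?thesis using g z by (simp add: fdiff_nilpotent_0)
  next
    case (Suc l') then show ?thesis using less.hyps[of k l' f "fdiff h g"] g less.prems by simp
  qed
  have 3: "fdiff_nilpotent h (k + l) (\<lambda>\<xi>. fdiff h f \<xi> * fdiff h g \<xi>)"
  proof (cases "k = 0 \<or> l = 0")
    case True then show ?thesis using f g z by (auto simp: fdiff_nilpotent_0)
  next
    case False
    then obtain k' l' where kl: "k = Suc k'" "l = Suc l'" by (metis not0_implies_Suc)
    then have "fdiff_nilpotent h (Suc (k' + l')) (\<lambda>\<xi>. fdiff h f \<xi> * fdiff h g \<xi>)"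
      using less.hyps[of k' l' "fdiff h f" "fdiff h g"] f g by simp
    then show ?thesis by (rule fdiff_nilpotent_mono) (use kl in simp)
  qed
  show ?case unfolding fdiff_nilpotent_Suc eq by (intro fdiff_nilpotent_add 1 2 3)
qed

lemma fdiff_nilpotent_const: "fdiff_nilpotent h (Suc 0) (\<lambda>\<xi>. c)"
  by (simp add: fdiff_nilpotent_Suc fdiff_nilpotent_0 fdiff_def)

lemma fdiff_nilpotent_coord: "fdiff_nilpotent h (Suc (Suc 0)) (\<lambda>\<xi>::real^'n. \<xi> $ i)"
proof -
  have "fdiff h (\<lambda>\<xi>::real^'n. \<xi> $ i) = (\<lambda>\<xi>. h $ i)" by (auto simp: fdiff_def)
  then show ?thesis unfolding fdiff_nilpotent_Suc[of h "Suc 0"] by (simp only: fdiff_nilpotent_const)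
qed

lemma fdiff_nilpotent_coord_power: "fdiff_nilpotent h (Suc k) (\<lambda>\<xi>::real^'n. \<xi> $ i ^ k)"
proof (induction k)
  case (Suc k)
  from fdiff_nilpotent_mult[OF fdiff_nilpotent_coord Suc.IH] show ?case by simp
qed (simp only: power_0 fdiff_nilpotent_const)

lemma fdiff_nilpotent_mi_power: "fdiff_nilpotent h (Suc (mi_order \<alpha>)) (\<lambda>\<xi>. mi_power \<xi> \<alpha>)"
proof -
  have "fdiff_nilpotent h (Suc (\<Sum>i\<in>I. \<alpha> i)) (\<lambda>\<xi>. \<Prod>i\<in>I. \<xi> $ i ^ \<alpha> i)" if "finite I" for I
    using that
  proof induction
    case (insert i I)
    from fdiff_nilpotent_mult[OF fdiff_nilpotent_coord_power[of h "\<alpha> i" i] insert.IH] insert.hyps show ?case by simp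
  qed (simp only: sum.empty prod.empty fdiff_nilpotent_const)
  from this[OF finite] show ?thesis unfolding mi_order_def mi_power_def .
qed

section \<open>Derivatives of the heat kernel\<close>

definition heat_symbol :: "real \<Rightarrow> ('n::finite) multi_index \<Rightarrow> nat \<Rightarrow> real \<Rightarrow> real^'n \<Rightarrow> real" where
  "heat_symbol \<theta> \<alpha> m t \<xi> = mi_power \<xi> \<alpha> * (- (norm \<xi> powr \<theta>)) ^ m * exp (- t * norm \<xi> powr \<theta>)"

text \<open>The derivative \<open>\<partial>\<^sub>t\<^sup>m \<partial>\<^sub>x\<^sup>\<alpha> G\<^sub>\<theta>\<close>: each derivative in \<open>x\<close> brings down a coordinate of
  \<open>\<xi>\<close> and shifts the phase of the cosine by \<open>\<pi>/2\<close>, each derivative in \<open>t\<close> brings down \<open>- |\<xi>| powr \<theta>\<close>.\<close>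

definition heat_deriv :: "real \<Rightarrow> 'n multi_index \<Rightarrow> nat \<Rightarrow> real^'n \<Rightarrow> real \<Rightarrow> real" where
  "heat_deriv \<theta> \<alpha> m x t = (2 * pi) powr (- real CARD('n)) * cos_transform x (real (mi_order \<alpha>) * (pi / 2)) (heat_symbol \<theta> \<alpha> m t)"

lemma mi_power_measurable [measurable]: "(\<lambda>x :: real^'n. mi_power x \<alpha>) \<in> borel_measurable borel"
  unfolding mi_power_def by measurable

lemma heat_symbol_measurable [measurable]: "heat_symbol \<theta> \<alpha> m t \<in> borel_measurable borel"
  unfolding heat_symbol_def by measurable

lemma abs_mi_power_le: "\<bar>mi_power x \<alpha>\<bar> \<le> norm x ^ mi_order \<alpha>"
proof -
  have "\<bar>mi_power x \<alpha>\<bar> = (\<Prod>i\<in>UNIV. \<bar>x $ i\<bar> ^ \<alpha> i)" by (simp add: mi_power_def abs_prod power_abs)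
  also have "\<dots> \<le> (\<Prod>i\<in>UNIV. norm x ^ \<alpha> i)"
    by (intro prod_mono) (auto intro!: power_mono component_le_norm_cart)
  also have "\<dots> = norm x ^ mi_order \<alpha>" by (simp add: mi_order_def power_sum)
  finally show ?thesis .
qed

lemma radial_exp_integrable_nat:
  fixes k :: nat
  assumes "0 < \<theta>"
  shows "0 < t \<Longrightarrow> integrable lborel (\<lambda>\<xi> :: real^'n. norm \<xi> ^ k * (norm \<xi> powr \<theta>) ^ m * exp (- t * norm \<xi> powr \<theta>))"
    and "\<exists>C\<ge>0. \<forall>t>0. (LINT \<xi>|lborel. norm (\<xi> :: real^'n) ^ k * (norm \<xi> powr \<theta>) ^ m * exp (- t * norm \<xi> powr \<theta>))
           \<le> C * t powr (- (real k + real m * \<theta> + real CARD('n)) / \<theta>)"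
proof -
  let ?p = "real k + real m * \<theta>"
  have p: "0 \<le> ?p" using assms by simp
  \<comment> \<open>At \<xi> = 0 and k = m = 0 the two integrands differ, since
    \<open>0 powr 0 = 0\<close> while \<open>0 ^ 0 = 1\<close>. A single point does not affect the
    integrals.\<close>
  have "AE \<xi> in lborel. (\<xi> :: real^'n) \<noteq> 0" by (rule AE_lborel_singleton)
  then have AE: "AE \<xi> in lborel. norm (\<xi> :: real^'n) powr ?p * exp (- t * norm \<xi> powr \<theta>)
      = norm \<xi> ^ k * (norm \<xi> powr \<theta>) ^ m * exp (- t * norm \<xi> powr \<theta>)" for t
  proof eventually_elim
    case (elim \<xi>)
    have "norm \<xi> powr ?p = norm \<xi> ^ k * (norm \<xi> powr \<theta>) ^ m"
      using elim by (simp add: powr_add powr_realpow powr_power)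
    then show ?case by simp
  qed
  show "integrable lborel (\<lambda>\<xi> :: real^'n. norm \<xi> ^ k * (norm \<xi> powr \<theta>) ^ m * exp (- t * norm \<xi> powr \<theta>))" if "0 < t" for t
    using radial_exp_integrable(1)[OF assms p that] by (subst (asm) integrable_cong_AE[OF _ _ AE]) auto
  have "(LINT \<xi>|lborel. norm (\<xi> :: real^'n) ^ k * (norm \<xi> powr \<theta>) ^ m * exp (- t * norm \<xi> powr \<theta>))
    = (LINT \<xi>|lborel. norm (\<xi> :: real^'n) powr ?p * exp (- t * norm \<xi> powr \<theta>))" for t
    by (rule integral_cong_AE[OF _ _ AE, symmetric]) auto
  then show "\<exists>C\<ge>0. \<forall>t>0. (LINT \<xi>|lborel. norm (\<xi> :: real^'n) ^ k * (norm \<xi> powr \<theta>) ^ m * exp (- t * norm \<xi> powr \<theta>))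
           \<le> C * t powr (- (?p + real CARD('n)) / \<theta>)"
    using radial_exp_integrable(2)[OF assms p, where 'n = 'n] by simp
qed

lemma heat_symbol_le:
  "\<bar>heat_symbol \<theta> \<alpha> m t \<xi>\<bar> \<le> norm \<xi> ^ mi_order \<alpha> * (norm \<xi> powr \<theta>) ^ m * exp (- t * norm \<xi> powr \<theta>)"
  unfolding heat_symbol_def abs_mult by (intro mult_mono abs_mi_power_le) (auto simp: power_abs)

lemma radial_bounded_integrable:
  fixes g :: "real^'n \<Rightarrow> real"
  assumes "0 < \<theta>" "0 < t" "g \<in> borel_measurable borel"
    and "\<And>\<xi>. \<bar>g \<xi>\<bar> \<le> C * (norm \<xi> ^ k * (norm \<xi> powr \<theta>) ^ m * exp (- t * norm \<xi> powr \<theta>))"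
  shows "integrable lborel g"
proof (rule Bochner_Integration.integrable_bound)
  show "integrable lborel (\<lambda>\<xi>::real^'n. C * (norm \<xi> ^ k * (norm \<xi> powr \<theta>) ^ m * exp (- t * norm \<xi> powr \<theta>)))"
    by (intro integrable_mult_right radial_exp_integrable_nat assms)
  show "AE \<xi> in lborel. norm (g \<xi>) \<le> norm (C * (norm \<xi> ^ k * (norm \<xi> powr \<theta>) ^ m * exp (- t * norm \<xi> powr \<theta>)))"
    using assms(4) by (intro AE_I2) (metis abs_ge_self order_trans real_norm_def)
qed (use assms in simp)

lemma heat_symbol_integrable: "0 < \<theta> \<Longrightarrow> 0 < t \<Longrightarrow> integrable lborel (heat_symbol \<theta> \<alpha> m t)"
  by (rule radial_bounded_integrable[of \<theta> t _ 1 "mi_order \<alpha>" m]) (use heat_symbol_le in auto)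

section \<open>Pointwise bounds on the derivatives of the heat kernel\<close>

text \<open>The transform is bounded by the L^1 norm of its symbol, which scales in t. This is the
  effective bound when |x| is below the natural width t^(1/\<theta>).\<close>

lemma heat_deriv_near:
  assumes "0 < \<theta>"
  obtains C where "0 \<le> C"
    "\<And>t x. 0 < t \<Longrightarrow> \<bar>heat_deriv \<theta> \<alpha> m (x::real^'n) t\<bar> \<le> C * t powr (- (real (mi_order \<alpha>) + real m * \<theta> + real CARD('n)) / \<theta>)"
proof -
  let ?k = "mi_order \<alpha>"
  obtain C where C: "0 \<le> C" "\<And>t. 0 < t \<Longrightarrow> (LINT \<xi>|lborel. norm (\<xi> :: real^'n) ^ ?k * (norm \<xi> powr \<theta>) ^ m * exp (- t * norm \<xi> powr \<theta>))
           \<le> C * t powr (- (real ?k + real m * \<theta> + real CARD('n)) / \<theta>)"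
    using radial_exp_integrable_nat(2)[OF assms, where 'n = 'n and k = ?k and m = m] by blast
  show thesis
  proof (rule that[of "(2 * pi) powr (- real CARD('n)) * C"])
    show "0 \<le> (2 * pi) powr (- real CARD('n)) * C" using C by simp
    fix t :: real and x :: "real^'n" assume t: "0 < t"
    have "\<bar>cos_transform x (real ?k * (pi / 2)) (heat_symbol \<theta> \<alpha> m t)\<bar> \<le> (LINT \<xi>|lborel. \<bar>heat_symbol \<theta> \<alpha> m t \<xi>\<bar>)"
      by (rule cos_transform_abs_le[OF heat_symbol_integrable[OF assms t]])
    also have "\<dots> \<le> (LINT \<xi>|lborel. norm (\<xi> :: real^'n) ^ ?k * (norm \<xi> powr \<theta>) ^ m * exp (- t * norm \<xi> powr \<theta>))"
      by (intro integral_mono integrable_abs heat_symbol_integrable radial_exp_integrable_nat assms t heat_symbol_le)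
    also note C(2)[OF t]
    finally show "\<bar>heat_deriv \<theta> \<alpha> m x t\<bar> \<le> (2 * pi) powr (- real CARD('n)) * C * t powr (- (real ?k + real m * \<theta> + real CARD('n)) / \<theta>)"
      by (simp add: heat_deriv_def abs_mult mult_left_mono mult.assoc)
  qed
qed

lemma symbol_class_heat_symbol:
  assumes "0 < \<theta>"
  shows "symbol_class n (real (mi_order \<alpha>) + real m * \<theta>) (\<lambda>t e \<xi>. heat_symbol \<theta> \<alpha> m t \<xi>)"
proof -
  have "symbol_class n 0 (\<lambda>t e (\<xi>::real^'a). exp (- t * norm \<xi> powr \<theta>))"
    using symbol_class_exp_powr[OF assms, of n 0] by simp
  moreover have "symbol_class n \<theta> (\<lambda>t e (\<xi>::real^'a). - (norm \<xi> powr \<theta>))"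
    using symbol_class_cmult[OF symbol_class_norm_powr, of n \<theta> "- 1"] by simp
  ultimately have "symbol_class n (real (mi_order \<alpha>) + real m * \<theta> + 0) (\<lambda>t e \<xi>. heat_symbol \<theta> \<alpha> m t \<xi>)"
    unfolding heat_symbol_def by (intro symbol_class_mult symbol_class_mi_power symbol_class_power)
  then show ?thesis by simp
qed

text \<open>For \<open>m = 0\<close> the symbol is not small enough at the origin. Since differences of order above \<open>|\<alpha>|\<close>
  annihilate the monomial \<open>\<xi>\<^sup>\<alpha>\<close>, the exponential \<open>e\<close> may be replaced by \<open>e - 1\<close>, which vanishes to order
  \<open>\<theta>\<close> and is proportional to \<open>t\<close>.\<close>

lemma heat_deriv_far:
  assumes "0 < \<theta>"
  obtains C where "0 \<le> C"
    "\<And>t x. 0 < t \<Longrightarrow> (x::real^'n) \<noteq> 0 \<Longrightarrow> \<bar>heat_deriv \<theta> \<alpha> m x t\<bar> \<le> C * (if m = 0 then t else 1) *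
        norm x powr (- real CARD('n) - (real (mi_order \<alpha>) + real (max m 1) * \<theta>))"
proof -
  let ?k = "real (mi_order \<alpha>)" and ?c = "real (mi_order \<alpha>) * (pi / 2)"
  define p where "p = ?k + real (max m 1) * \<theta>"
  \<comment> \<open>Two demands on the number of differences: more than p + N for the decay
    estimate, and more than |\<alpha>| so that the monomial is annihilated.\<close>
  define n where "n = Suc (max (mi_order \<alpha>) (nat \<lceil>p + real CARD('n)\<rceil>))"
  have p: "0 < p" using assms by (auto simp: p_def intro!: add_nonneg_pos)
  have n: "p + real CARD('n) < real n" "n > mi_order \<alpha>" unfolding n_def by linarith+
  have "\<exists>C\<ge>0. \<forall>t x. 0 < t \<longrightarrow> (x::real^'n) \<noteq> 0 \<longrightarrow> \<bar>cos_transform x ?c (heat_symbol \<theta> \<alpha> m t)\<bar> \<le> C * (if m = 0 then t else 1) * norm x powr (- real CARD('n) - p)"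
  proof (cases "m = 0")
    case False
    then have "max m 1 = m" by simp
    then have s: "symbol_class n p (\<lambda>t e \<xi>. heat_symbol \<theta> \<alpha> m t \<xi>)"
      using symbol_class_heat_symbol[OF assms, of n \<alpha> m] by (simp only: p_def)
    have z: "heat_symbol \<theta> \<alpha> m t 0 = 0" for t using False assms by (simp add: heat_symbol_def)
    obtain C where C: "0 \<le> C" "\<And>t (x::real^'n) c g. 0 < t \<Longrightarrow> x \<noteq> 0 \<Longrightarrow> integrable lborel g \<Longrightarrow> (\<And>h. (fdiff h ^^ n) g = (fdiff h ^^ n) (heat_symbol \<theta> \<alpha> m t)) \<Longrightarrow>
       \<bar>cos_transform x c g\<bar> \<le> C * norm x powr (- real CARD('n) - p)"
      using cos_transform_decay[OF s p n(1) z] by metis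
    show ?thesis
    proof (intro exI[of _ C] conjI allI impI C(1))
      fix t :: real and x :: "real^'n" assume t: "0 < t" and x: "x \<noteq> 0"
      show "\<bar>cos_transform x ?c (heat_symbol \<theta> \<alpha> m t)\<bar> \<le> C * (if m = 0 then t else 1) * norm x powr (- real CARD('n) - p)"
        using C(2)[OF t x heat_symbol_integrable[OF assms t] refl] False by simp
    qed
  next
    case True
    define b where "b t \<xi> = mi_power \<xi> \<alpha> * ((exp (- t * norm \<xi> powr \<theta>) - 1) / t)" for t \<xi>
    have s: "symbol_class n p (\<lambda>t e \<xi>. b t \<xi>)"
      using symbol_class_mult[OF symbol_class_mi_power symbol_class_exp_minus_one[OF assms], of n \<alpha>] True by (simp add: p_def b_def)
    have z: "b t 0 = 0" for t using assms by (simp add: b_def)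
    obtain C where C: "0 \<le> C" "\<And>t (x::real^'n) c g. 0 < t \<Longrightarrow> x \<noteq> 0 \<Longrightarrow> integrable lborel g \<Longrightarrow> (\<And>h. (fdiff h ^^ n) g = (fdiff h ^^ n) (b t)) \<Longrightarrow>
       \<bar>cos_transform x c g\<bar> \<le> C * norm x powr (- real CARD('n) - p)"
      using cos_transform_decay[OF s p n(1) z] by metis
    show ?thesis
    proof (intro exI[of _ C] conjI allI impI C(1))
      fix t :: real and x :: "real^'n" assume t: "0 < t" and x: "x \<noteq> 0"
      let ?g = "\<lambda>\<xi>. heat_symbol \<theta> \<alpha> m t \<xi> / t"
      have "(fdiff h ^^ n) ?g = (fdiff h ^^ n) (b t)" for h
      proof
        fix \<xi>
        \<comment> \<open>Here the factor t is gained: the symbol divided by t differs from b, which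
          is bounded uniformly in t, only by a multiple of the monomial. Multiplying back by t at
          the end gives the bound proportional to t.\<close>
        have "?g = (\<lambda>\<xi>. b t \<xi> + (1 / t) * mi_power \<xi> \<alpha>)"
          by (simp add: heat_symbol_def b_def True fun_eq_iff diff_divide_distrib right_diff_distrib)
        moreover have "fdiff_nilpotent h (Suc (0 + mi_order \<alpha>)) (\<lambda>\<xi>. (1 / t) * mi_power \<xi> \<alpha>)"
          by (rule fdiff_nilpotent_mult[OF fdiff_nilpotent_const fdiff_nilpotent_mi_power])
        then have "fdiff_nilpotent h n (\<lambda>\<xi>. (1 / t) * mi_power \<xi> \<alpha>)" by (rule fdiff_nilpotent_mono) (use n in simp)
        ultimately show "(fdiff h ^^ n) ?g \<xi> = (fdiff h ^^ n) (b t) \<xi>"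
          unfolding fdiff_nilpotent_def by (simp only: funpow_fdiff_add)
      qed
      then have "\<bar>cos_transform x ?c ?g\<bar> \<le> C * norm x powr (- real CARD('n) - p)"
        by (intro C(2)[OF t x]) (use heat_symbol_integrable[OF assms t] in auto)
      then have "t * \<bar>cos_transform x ?c ?g\<bar> \<le> t * (C * norm x powr (- real CARD('n) - p))"
        using t by (intro mult_left_mono) auto
      moreover have "cos_transform x ?c (heat_symbol \<theta> \<alpha> m t) = t * cos_transform x ?c ?g" using t by (simp add: cos_transform_def)
      ultimately show "\<bar>cos_transform x ?c (heat_symbol \<theta> \<alpha> m t)\<bar> \<le> C * (if m = 0 then t else 1) * norm x powr (- real CARD('n) - p)"
        using t True by (simp add: abs_mult mult.left_commute)
    qed
  qed
  then obtain C where "0 \<le> C \<and> (\<forall>t x. 0 < t \<longrightarrow> (x::real^'n) \<noteq> 0 \<longrightarrow> \<bar>cos_transform x ?c (heat_symbol \<theta> \<alpha> m t)\<bar> \<le> C * (if m = 0 then t else 1) * norm x powr (- real CARD('n) - p))"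
    by (rule exE)
  then have C: "0 \<le> C" "0 < t \<Longrightarrow> x \<noteq> 0 \<Longrightarrow> \<bar>cos_transform x ?c (heat_symbol \<theta> \<alpha> m t)\<bar> \<le> C * (if m = 0 then t else 1) * norm x powr (- real CARD('n) - p)" for t and x :: "real^'n"
    by simp_all
  show thesis
  proof (rule that[of "(2 * pi) powr (- real CARD('n)) * C"])
    show "0 \<le> (2 * pi) powr (- real CARD('n)) * C" using C by simp
    fix t :: real and x :: "real^'n" assume "0 < t" "x \<noteq> 0"
    from C(2)[OF this] show "\<bar>heat_deriv \<theta> \<alpha> m x t\<bar> \<le> (2 * pi) powr (- real CARD('n)) * C * (if m = 0 then t else 1) *
        norm x powr (- real CARD('n) - (real (mi_order \<alpha>) + real (max m 1) * \<theta>))"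
      unfolding heat_deriv_def p_def abs_mult by (simp add: mult.assoc mult_left_mono)
  qed
qed

text \<open>The near and the far bound agree up to constants at |x| = t^(1/\<theta>), and |x| +
  t^(1/\<theta>) is at most twice the larger of the two quantities. The exponent contains
  \<open>max m 1\<close> because even without a time derivative the kernel decays by an extra
  \<theta> at infinity, at the price of the factor t.\<close>

lemma heat_deriv_bound:
  assumes "0 < \<theta>"
  obtains C where "0 \<le> C"
    "\<And>t x. 0 < t \<Longrightarrow> \<bar>heat_deriv \<theta> \<alpha> m (x::real^'n) t\<bar> \<le> C * (if m = 0 then t else 1) *
        (norm x + t powr (1 / \<theta>)) powr (- real CARD('n) - (real (mi_order \<alpha>) + real (max m 1) * \<theta>))"
proof -
  let ?s = "- real CARD('n) - (real (mi_order \<alpha>) + real (max m 1) * \<theta>)"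
  have "0 \<le> real (mi_order \<alpha>) + real (max m 1) * \<theta>"
    using assms by (intro add_nonneg_nonneg mult_nonneg_nonneg) auto
  then have s0: "?s \<le> 0" by linarith
  obtain C1 where C1: "0 \<le> C1" "\<And>t x. 0 < t \<Longrightarrow> \<bar>heat_deriv \<theta> \<alpha> m (x::real^'n) t\<bar> \<le> C1 * t powr (- (real (mi_order \<alpha>) + real m * \<theta> + real CARD('n)) / \<theta>)"
    using heat_deriv_near[OF assms] by metis
  obtain C2 where C2: "0 \<le> C2" "\<And>t x. 0 < t \<Longrightarrow> (x::real^'n) \<noteq> 0 \<Longrightarrow> \<bar>heat_deriv \<theta> \<alpha> m x t\<bar> \<le> C2 * (if m = 0 then t else 1) * norm x powr ?s"
    using heat_deriv_far[OF assms] by metis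
  show thesis
  proof (rule that[of "(C1 + C2) * 2 powr (- ?s)"])
    show "0 \<le> (C1 + C2) * 2 powr (- ?s)" using C1 C2 by simp
    fix t :: real and x :: "real^'n" assume t: "0 < t"
    let ?r = "t powr (1 / \<theta>)" and ?m = "if m = 0 then t else 1"
    have r: "?r > 0" and rt: "?r powr \<theta> = t" using t assms by (simp_all add: powr_powr)
    have comp: "v powr ?s \<le> 2 powr (- ?s) * (norm x + ?r) powr ?s" if "0 < v" "norm x + ?r \<le> 2 * v" for v
    proof -
      have "(2 * v) powr ?s \<le> (norm x + ?r) powr ?s"
        using that r s0 norm_ge_zero[of x] by (intro powr_mono2') linarith+
      then have "2 powr (- ?s) * (2 powr ?s * v powr ?s) \<le> 2 powr (- ?s) * (norm x + ?r) powr ?s"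
        using that by (intro mult_left_mono) (auto simp: powr_mult)
      then show ?thesis by (simp flip: mult.assoc powr_add)
    qed
    have m0: "0 \<le> ?m" using t by simp
    have "\<bar>heat_deriv \<theta> \<alpha> m x t\<bar> \<le> (C1 + C2) * ?m * (2 powr (- ?s) * (norm x + ?r) powr ?s)"
    proof (cases "?r \<le> norm x")
      case True
      then have "x \<noteq> 0" using r by auto
      then have "\<bar>heat_deriv \<theta> \<alpha> m x t\<bar> \<le> C2 * ?m * norm x powr ?s" by (rule C2(2)[OF t])
      also have "\<dots> \<le> (C1 + C2) * ?m * (2 powr (- ?s) * (norm x + ?r) powr ?s)"
        using C1 C2 m0 True \<open>x \<noteq> 0\<close> by (intro mult_mono comp) auto
      finally show ?thesis .
    next
      case False
      \<comment> \<open>For m = 0 the homogeneity of the near bound exceeds ?s by \<theta>; with r =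
        t^(1/\<theta>) the surplus r^\<theta> is exactly the factor t.\<close>
      have e: "- (real (mi_order \<alpha>) + real m * \<theta> + real CARD('n)) = ?s + (if m = 0 then \<theta> else 0)"
        by (cases "m = 0") (simp_all add: max_def)
      have "t powr (- (real (mi_order \<alpha>) + real m * \<theta> + real CARD('n)) / \<theta>) = ?r powr (- (real (mi_order \<alpha>) + real m * \<theta> + real CARD('n)))"
        by (simp add: powr_powr)
      also have "\<dots> = ?m * ?r powr ?s" unfolding e using rt r by (simp only: powr_add) simp
      finally have eq: "t powr (- (real (mi_order \<alpha>) + real m * \<theta> + real CARD('n)) / \<theta>) = ?m * ?r powr ?s" .
      have "\<bar>heat_deriv \<theta> \<alpha> m x t\<bar> \<le> C1 * (?m * ?r powr ?s)"
        using C1(2)[OF t, of x] unfolding eq .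
      also have "\<dots> \<le> (C1 + C2) * (?m * (2 powr (- ?s) * (norm x + ?r) powr ?s))"
      proof (intro mult_mono mult_left_mono comp)
        show "norm x + ?r \<le> 2 * ?r" using False by linarith
      qed (use C1 C2 m0 r in simp_all)
      finally show ?thesis by (simp only: mult.assoc)
    qed
    moreover have "(C1 + C2) * ?m * (2 powr (- ?s) * (norm x + ?r) powr ?s) = (C1 + C2) * 2 powr (- ?s) * ?m * (norm x + ?r) powr ?s"
      by (simp only: mult_ac)
    ultimately show "\<bar>heat_deriv \<theta> \<alpha> m x t\<bar> \<le> (C1 + C2) * 2 powr (- ?s) * ?m * (norm x + ?r) powr ?s"
      by (simp only:)
  qed
qed

text \<open>For m = 0 the factor t is at most (|x| + t^(1/\<theta>))^\<theta>. The resulting form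
  depends on (x, t) only through |x| + t^(1/\<theta>), which suits Taylor remainders: their
  intermediate points are known only up to this quantity.\<close>

lemma heat_deriv_bound_plain:
  assumes "0 < \<theta>"
  obtains C where "0 \<le> C"
    "\<And>t x. 0 < t \<Longrightarrow> \<bar>heat_deriv \<theta> \<alpha> m (x::real^'n) t\<bar> \<le> C *
        (norm x + t powr (1 / \<theta>)) powr (- real CARD('n) - (real (mi_order \<alpha>) + real m * \<theta>))"
proof -
  let ?s = "- real CARD('n) - (real (mi_order \<alpha>) + real (max m 1) * \<theta>)"
  obtain C where C: "0 \<le> C" "\<And>t x. 0 < t \<Longrightarrow> \<bar>heat_deriv \<theta> \<alpha> m (x::real^'n) t\<bar> \<le> C * (if m = 0 then t else 1) *
        (norm x + t powr (1 / \<theta>)) powr ?s"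
    using heat_deriv_bound[OF assms] by metis
  show thesis
  proof (rule that[OF C(1)])
    fix t :: real and x :: "real^'n" assume t: "0 < t"
    let ?X = "norm x + t powr (1 / \<theta>)"
    have X: "?X > 0" "t powr (1 / \<theta>) \<le> ?X" using t by (simp_all add: add_nonneg_pos)
    show "\<bar>heat_deriv \<theta> \<alpha> m x t\<bar> \<le> C * ?X powr (- real CARD('n) - (real (mi_order \<alpha>) + real m * \<theta>))"
    proof (cases "m = 0")
      case True
      have "(t powr (1 / \<theta>)) powr \<theta> \<le> ?X powr \<theta>" using X assms by (intro powr_mono2) auto
      then have "t \<le> ?X powr \<theta>" using t assms by (simp add: powr_powr)
      then have "t * ?X powr ?s \<le> ?X powr \<theta> * ?X powr ?s" by (intro mult_right_mono) auto
      also have "\<dots> = ?X powr (- real CARD('n) - (real (mi_order \<alpha>) + real m * \<theta>))"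
        using True by (simp flip: powr_add)
      finally have "C * (t * ?X powr ?s) \<le> C * ?X powr (- real CARD('n) - (real (mi_order \<alpha>) + real m * \<theta>))"
        using C(1) by (intro mult_left_mono)
      then show ?thesis using C(2)[OF t, of x] True by (simp add: mult.assoc)
    next
      case False
      then have "max m 1 = m" by simp
      then show ?thesis using C(2)[OF t, of x] False by simp
    qed
  qed
qed

section \<open>Differentiation under the Fourier integral\<close>

text \<open>A quadratic error bound survives integration against a fixed weight, so parameter
  integrals can be differentiated by integrating the pointwise Taylor error instead of passing to a
  limit under the integral.\<close>

lemma DERIV_quadratic_error:
  fixes F :: "real \<Rightarrow> real"
  assumes "0 < \<delta>" "0 \<le> C" "\<And>r. \<bar>r\<bar> < \<delta> \<Longrightarrow> \<bar>F r - F 0 - r * D\<bar> \<le> C * r\<^sup>2"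
  shows "(F has_real_derivative D) (at 0)"
proof -
  have "((\<lambda>r. (F r - F 0) / r - D) \<longlongrightarrow> 0) (at 0)"
  proof (rule Lim_null_comparison)
    have "\<forall>\<^sub>F r in at (0::real). \<bar>r\<bar> < \<delta> \<and> r \<noteq> 0"
      unfolding eventually_at using assms(1) by (auto simp: dist_real_def)
    then show "\<forall>\<^sub>F r in at 0. norm ((F r - F 0) / r - D) \<le> C * \<bar>r\<bar>"
    proof eventually_elim
      case (elim r)
      then have "\<bar>F r - F 0 - r * D\<bar> / \<bar>r\<bar> \<le> C * r\<^sup>2 / \<bar>r\<bar>" by (intro divide_right_mono assms(3)) auto
      also have "C * r\<^sup>2 / \<bar>r\<bar> = C * \<bar>r\<bar>" using elim by (simp add: power2_eq_square abs_if)
      also have "\<bar>F r - F 0 - r * D\<bar> / \<bar>r\<bar> = \<bar>(F r - F 0) / r - D\<bar>"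
        using elim by (simp flip: abs_divide add: diff_divide_distrib)
      finally show ?case by simp
    qed
    show "((\<lambda>r. C * \<bar>r\<bar>) \<longlongrightarrow> 0) (at 0)" by (auto intro!: tendsto_eq_intros)
  qed
  then have "((\<lambda>r. (F r - F 0) / r) \<longlongrightarrow> D) (at 0)" by (simp add: LIM_zero_iff)
  then show ?thesis by (simp add: has_field_derivative_iff)
qed

lemma cos_quadratic_error: "\<bar>cos (a + d) - cos a - d * cos (a + pi / 2)\<bar> \<le> d\<^sup>2" for a d :: real
proof -
  define diff where "diff m d = cos (a + d + real m * (pi / 2))" for m :: nat and d
  have "\<exists>t. \<bar>t\<bar> \<le> \<bar>d\<bar> \<and> cos (a + d) = (\<Sum>m<2. diff m 0 / fact m * d ^ m) + diff 2 t / fact 2 * d ^ 2"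
  proof (rule Maclaurin_all_le)
    show "diff 0 = (\<lambda>d. cos (a + d))" by (auto simp: diff_def fun_eq_iff)
    show "\<forall>m x. DERIV (diff m) x :> diff (Suc m) x"
    proof (intro allI)
      fix m x
      have "cos (a + x + real (Suc m) * (pi / 2)) = - sin (a + x + real m * (pi / 2))"
      proof -
        have "a + x + real (Suc m) * (pi / 2) = (a + x + real m * (pi / 2)) + pi / 2"
          by (simp add: distrib_right)
        then show ?thesis by (simp only: minus_sin_cos_eq of_real_eq_id id_apply)
      qed
      then show "DERIV (diff m) x :> diff (Suc m) x"
        unfolding diff_def by (auto intro!: derivative_eq_intros)
    qed
  qed
  then obtain t where t: "cos (a + d) = (\<Sum>m<2. diff m 0 / fact m * d ^ m) + diff 2 t / fact 2 * d ^ 2" by blast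
  then have "cos (a + d) - cos a - d * cos (a + pi / 2) = diff 2 t / 2 * d\<^sup>2"
    by (simp add: numeral_2_eq_2 diff_def)
  moreover have "\<bar>diff 2 t / 2\<bar> \<le> 1"
    using abs_cos_le_one[of "a + t + real 2 * (pi / 2)"] unfolding diff_def abs_divide by linarith
  then have "\<bar>diff 2 t / 2 * d\<^sup>2\<bar> \<le> 1 * d\<^sup>2"
    unfolding abs_mult by (intro mult_mono) auto
  ultimately show ?thesis by simp
qed

lemma exp_quadratic_error: "\<bar>exp z - 1 - z\<bar> \<le> z\<^sup>2 * exp \<bar>z\<bar>" for z :: real
proof -
  obtain t where t: "\<bar>t\<bar> \<le> \<bar>z\<bar>" "exp z = (\<Sum>m<2. z ^ m / fact m) + exp t / fact 2 * z ^ 2"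
    using Maclaurin_exp_le[of z 2] by blast
  then have "exp z - 1 - z = exp t / 2 * z\<^sup>2" by (simp add: numeral_2_eq_2)
  then have "\<bar>exp z - 1 - z\<bar> = \<bar>exp t / 2 * z\<^sup>2\<bar>" by (simp only:)
  also have "\<dots> = z\<^sup>2 * (exp t / 2)" by (simp add: abs_mult)
  also have "exp t \<le> exp \<bar>z\<bar>" using t(1) by simp
  then have "z\<^sup>2 * (exp t / 2) \<le> z\<^sup>2 * exp \<bar>z\<bar>"
    using exp_ge_zero[of t] by (intro mult_left_mono) (linarith, simp)
  finally show ?thesis .
qed

text \<open>The second order error of the cosine is at most (r (y . \<xi>))^2; integrability of (y .
  \<xi>)^2 b makes the constant of the quadratic error finite.\<close>

lemma cos_transform_has_derivative:
  fixes b :: "real^'n \<Rightarrow> real"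
  assumes b: "integrable lborel b" and b1: "integrable lborel (\<lambda>\<xi>. (y \<bullet> \<xi>) * b \<xi>)"
    and b2: "integrable lborel (\<lambda>\<xi>. (y \<bullet> \<xi>)\<^sup>2 * b \<xi>)"
  shows "((\<lambda>r. cos_transform (x + r *\<^sub>R y) c b) has_real_derivative cos_transform x (c + pi / 2) (\<lambda>\<xi>. (y \<bullet> \<xi>) * b \<xi>)) (at 0)"
proof (rule DERIV_quadratic_error[of 1 "LINT \<xi>|lborel. \<bar>(y \<bullet> \<xi>)\<^sup>2 * b \<xi>\<bar>"])
  fix r :: real
  let ?f = "\<lambda>\<xi>. cos ((x + r *\<^sub>R y) \<bullet> \<xi> + c) * b \<xi> - cos (x \<bullet> \<xi> + c) * b \<xi> - r * (cos (x \<bullet> \<xi> + (c + pi / 2)) * ((y \<bullet> \<xi>) * b \<xi>))"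
  note i0 = integrable_cos_mult[OF b, of "x + r *\<^sub>R y" c] and i1 = integrable_cos_mult[OF b, of x c]
    and i2 = integrable_mult_right[OF integrable_cos_mult[OF b1, of x "c + pi / 2"], of r]
  have I: "integrable lborel ?f"
    by (intro Bochner_Integration.integrable_diff i0 i1 i2)
  have "(LINT \<xi>|lborel. ?f \<xi>) = (LINT \<xi>|lborel. cos ((x + r *\<^sub>R y) \<bullet> \<xi> + c) * b \<xi> - cos (x \<bullet> \<xi> + c) * b \<xi>)
      - (LINT \<xi>|lborel. r * (cos (x \<bullet> \<xi> + (c + pi / 2)) * ((y \<bullet> \<xi>) * b \<xi>)))"
    by (rule Bochner_Integration.integral_diff[OF Bochner_Integration.integrable_diff[OF i0 i1] i2])
  moreover have "(LINT \<xi>|lborel. cos ((x + r *\<^sub>R y) \<bullet> \<xi> + c) * b \<xi> - cos (x \<bullet> \<xi> + c) * b \<xi>)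
      = cos_transform (x + r *\<^sub>R y) c b - cos_transform x c b"
    unfolding cos_transform_def by (rule Bochner_Integration.integral_diff[OF i0 i1])
  moreover have "(LINT \<xi>|lborel. r * (cos (x \<bullet> \<xi> + (c + pi / 2)) * ((y \<bullet> \<xi>) * b \<xi>)))
      = r * cos_transform x (c + pi / 2) (\<lambda>\<xi>. (y \<bullet> \<xi>) * b \<xi>)"
    unfolding cos_transform_def by (rule integral_mult_right_zero)
  moreover have "cos_transform (x + 0 *\<^sub>R y) c b = cos_transform x c b" by simp
  ultimately have "cos_transform (x + r *\<^sub>R y) c b - cos_transform (x + 0 *\<^sub>R y) c b - r * cos_transform x (c + pi / 2) (\<lambda>\<xi>. (y \<bullet> \<xi>) * b \<xi>) = (LINT \<xi>|lborel. ?f \<xi>)"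
    by linarith
  then have "\<bar>cos_transform (x + r *\<^sub>R y) c b - cos_transform (x + 0 *\<^sub>R y) c b - r * cos_transform x (c + pi / 2) (\<lambda>\<xi>. (y \<bullet> \<xi>) * b \<xi>)\<bar>
      \<le> (LINT \<xi>|lborel. \<bar>?f \<xi>\<bar>)" using integral_abs_bound[of lborel "?f"] by (simp only:)
  also have "\<dots> \<le> (LINT \<xi>|lborel. r\<^sup>2 * \<bar>(y \<bullet> \<xi>)\<^sup>2 * b \<xi>\<bar>)"
  proof (intro integral_mono integrable_abs I integrable_mult_right b2)
    fix \<xi>
    have alg: "A * v - B * v - r * (D * (w * v)) = (A - B - r * w * D) * v" for A B D v w :: real
      by (simp add: algebra_simps)
    have a: "(x + r *\<^sub>R y) \<bullet> \<xi> + c = x \<bullet> \<xi> + c + r * (y \<bullet> \<xi>)" "x \<bullet> \<xi> + (c + pi / 2) = x \<bullet> \<xi> + c + pi / 2"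
      by (simp_all add: inner_add_left)
    have "?f \<xi> = (cos (x \<bullet> \<xi> + c + r * (y \<bullet> \<xi>)) - cos (x \<bullet> \<xi> + c) - r * (y \<bullet> \<xi>) * cos (x \<bullet> \<xi> + c + pi / 2)) * b \<xi>"
      unfolding a by (rule alg)
    then have "\<bar>?f \<xi>\<bar> = \<bar>cos (x \<bullet> \<xi> + c + r * (y \<bullet> \<xi>)) - cos (x \<bullet> \<xi> + c) - r * (y \<bullet> \<xi>) * cos (x \<bullet> \<xi> + c + pi / 2)\<bar> * \<bar>b \<xi>\<bar>"
      by (simp only: abs_mult)
    also have "\<dots> \<le> (r * (y \<bullet> \<xi>))\<^sup>2 * \<bar>b \<xi>\<bar>"
      by (intro mult_right_mono cos_quadratic_error) simp
    also have "\<dots> = r\<^sup>2 * \<bar>(y \<bullet> \<xi>)\<^sup>2 * b \<xi>\<bar>" by (simp add: power_mult_distrib abs_mult)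
    finally show "\<bar>?f \<xi>\<bar> \<le> r\<^sup>2 * \<bar>(y \<bullet> \<xi>)\<^sup>2 * b \<xi>\<bar>" .
  qed
  also have "\<dots> = (LINT \<xi>|lborel. \<bar>(y \<bullet> \<xi>)\<^sup>2 * b \<xi>\<bar>) * r\<^sup>2" by simp
  finally show "\<bar>cos_transform (x + r *\<^sub>R y) c b - cos_transform (x + 0 *\<^sub>R y) c b - r * cos_transform x (c + pi / 2) (\<lambda>\<xi>. (y \<bullet> \<xi>) * b \<xi>)\<bar>
      \<le> (LINT \<xi>|lborel. \<bar>(y \<bullet> \<xi>)\<^sup>2 * b \<xi>\<bar>) * r\<^sup>2" .
qed auto

lemma abs_inner_power_le: "\<bar>(y \<bullet> \<xi>) ^ k\<bar> \<le> norm y ^ k * norm \<xi> ^ k" for y \<xi> :: "'a::real_inner"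
  unfolding power_abs power_mult_distrib[symmetric] by (intro power_mono Cauchy_Schwarz_ineq2) auto

lemma inner_power_heat_symbol_integrable:
  assumes "0 < \<theta>" "0 < t"
  shows "integrable lborel (\<lambda>\<xi>. (y \<bullet> \<xi>) ^ k * heat_symbol \<theta> \<alpha> m t \<xi>)"
proof (rule radial_bounded_integrable[OF assms])
  show "(\<lambda>\<xi>. (y \<bullet> \<xi>) ^ k * heat_symbol \<theta> \<alpha> m t \<xi>) \<in> borel_measurable borel" by measurable
  fix \<xi>
  have "\<bar>(y \<bullet> \<xi>) ^ k * heat_symbol \<theta> \<alpha> m t \<xi>\<bar> \<le> (norm y ^ k * norm \<xi> ^ k) * (norm \<xi> ^ mi_order \<alpha> * (norm \<xi> powr \<theta>) ^ m * exp (- t * norm \<xi> powr \<theta>))"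
    unfolding abs_mult[of "(y \<bullet> \<xi>) ^ k"] by (intro mult_mono abs_inner_power_le heat_symbol_le) auto
  then show "\<bar>(y \<bullet> \<xi>) ^ k * heat_symbol \<theta> \<alpha> m t \<xi>\<bar> \<le> norm y ^ k * (norm \<xi> ^ (k + mi_order \<alpha>) * (norm \<xi> powr \<theta>) ^ m * exp (- t * norm \<xi> powr \<theta>))"
    by (simp add: power_add mult_ac)
qed

lemma mi_order_upd_Suc: "mi_order (\<alpha>(i := Suc (\<alpha> i))) = Suc (mi_order \<alpha>)"
proof -
  have "mi_order (\<alpha>(i := Suc (\<alpha> i))) = (\<Sum>j\<in>UNIV. \<alpha> j + (if j = i then 1 else 0))"
    unfolding mi_order_def by (intro sum.cong) auto
  then show ?thesis by (simp add: sum.distrib mi_order_def)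
qed

lemma mi_power_upd_Suc: "mi_power x (\<alpha>(i := Suc (\<alpha> i))) = x $ i * mi_power x \<alpha>"
proof -
  have "mi_power x (\<alpha>(i := Suc (\<alpha> i))) = (\<Prod>j\<in>UNIV. (if j = i then x $ j else 1) * x $ j ^ \<alpha> j)"
    unfolding mi_power_def by (intro prod.cong) auto
  then show ?thesis by (simp add: prod.distrib mi_power_def)
qed

lemma heat_deriv_partial:
  assumes "0 < \<theta>" "0 < t"
  shows "((\<lambda>r. heat_deriv \<theta> \<alpha> m (x + r *\<^sub>R axis i 1) t) has_real_derivative heat_deriv \<theta> (\<alpha>(i := Suc (\<alpha> i))) m x t) (at 0)"
proof -
  have c: "real (mi_order \<alpha>) * (pi / 2) + pi / 2 = real (mi_order (\<alpha>(i := Suc (\<alpha> i)))) * (pi / 2)"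
    by (simp add: mi_order_upd_Suc algebra_simps)
  have s: "(\<lambda>\<xi>. (axis i 1 \<bullet> \<xi>) * heat_symbol \<theta> \<alpha> m t \<xi>) = heat_symbol \<theta> (\<alpha>(i := Suc (\<alpha> i))) m t"
    by (simp add: heat_symbol_def mi_power_upd_Suc inner_axis' fun_eq_iff)
  have I: "integrable lborel (\<lambda>\<xi>. (axis i 1 \<bullet> \<xi>) * heat_symbol \<theta> \<alpha> m t \<xi>)"
    using inner_power_heat_symbol_integrable[OF assms, of "axis i 1" 1 \<alpha> m] by simp
  note cos_transform_has_derivative[OF heat_symbol_integrable[OF assms] I inner_power_heat_symbol_integrable[OF assms], of x "real (mi_order \<alpha>) * (pi / 2)"]
  then show ?thesis unfolding s c heat_deriv_def by (rule DERIV_cmult)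
qed

text \<open>The increment r is restricted to |r| < t/2. Then exp(-t u) exp(|r| u) \<le> exp(-(t/2)
  u) with u = |\<xi>|^\<theta>, so the second order error of the exponential, which brings in u^2,
  is dominated by one integrable function independent of r.\<close>

lemma heat_deriv_time:
  assumes \<theta>: "0 < \<theta>" and t: "0 < t"
  shows "((\<lambda>s. heat_deriv \<theta> \<alpha> m (x :: real^'n) s) has_real_derivative heat_deriv \<theta> \<alpha> (Suc m) x t) (at t)"
proof -
  let ?c = "real (mi_order \<alpha>) * (pi / 2)"
  let ?g = "\<lambda>\<xi>::real^'n. norm \<xi> ^ mi_order \<alpha> * (norm \<xi> powr \<theta>) ^ (m + 2) * exp (- (t / 2) * norm \<xi> powr \<theta>)"
  have I: "integrable lborel (\<lambda>\<xi>. cos (x \<bullet> \<xi> + ?c) * heat_symbol \<theta> \<alpha> m s \<xi>)" if "0 < s" for s m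
    by (intro integrable_cos_mult heat_symbol_integrable \<theta> that)
  have Ig: "integrable lborel ?g" by (intro radial_exp_integrable_nat \<theta>) (use t in simp)
  have "((\<lambda>r. cos_transform x ?c (heat_symbol \<theta> \<alpha> m (t + r))) has_real_derivative cos_transform x ?c (heat_symbol \<theta> \<alpha> (Suc m) t)) (at 0)"
  proof (rule DERIV_quadratic_error[of "t / 2" "LINT \<xi>|lborel. ?g \<xi>"])
    fix r :: real assume r: "\<bar>r\<bar> < t / 2"
    have tr: "0 < t + r" using r by linarith
    let ?f = "\<lambda>\<xi>. cos (x \<bullet> \<xi> + ?c) * heat_symbol \<theta> \<alpha> m (t + r) \<xi> - cos (x \<bullet> \<xi> + ?c) * heat_symbol \<theta> \<alpha> m t \<xi> - r * (cos (x \<bullet> \<xi> + ?c) * heat_symbol \<theta> \<alpha> (Suc m) t \<xi>)"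
    note i0 = I[OF tr, of m] and i1 = I[OF t, of m] and i2 = integrable_mult_right[OF I[OF t, of "Suc m"], of r]
    have If: "integrable lborel ?f"
      by (intro Bochner_Integration.integrable_diff i0 i1 i2)
    have "(LINT \<xi>|lborel. ?f \<xi>) = (LINT \<xi>|lborel. cos (x \<bullet> \<xi> + ?c) * heat_symbol \<theta> \<alpha> m (t + r) \<xi> - cos (x \<bullet> \<xi> + ?c) * heat_symbol \<theta> \<alpha> m t \<xi>)
        - (LINT \<xi>|lborel. r * (cos (x \<bullet> \<xi> + ?c) * heat_symbol \<theta> \<alpha> (Suc m) t \<xi>))"
      by (rule Bochner_Integration.integral_diff[OF Bochner_Integration.integrable_diff[OF i0 i1] i2])
    moreover have "(LINT \<xi>|lborel. cos (x \<bullet> \<xi> + ?c) * heat_symbol \<theta> \<alpha> m (t + r) \<xi> - cos (x \<bullet> \<xi> + ?c) * heat_symbol \<theta> \<alpha> m t \<xi>)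
        = cos_transform x ?c (heat_symbol \<theta> \<alpha> m (t + r)) - cos_transform x ?c (heat_symbol \<theta> \<alpha> m t)"
      unfolding cos_transform_def by (rule Bochner_Integration.integral_diff[OF i0 i1])
    moreover have "(LINT \<xi>|lborel. r * (cos (x \<bullet> \<xi> + ?c) * heat_symbol \<theta> \<alpha> (Suc m) t \<xi>)) = r * cos_transform x ?c (heat_symbol \<theta> \<alpha> (Suc m) t)"
      unfolding cos_transform_def by (rule integral_mult_right_zero)
    ultimately have "cos_transform x ?c (heat_symbol \<theta> \<alpha> m (t + r)) - cos_transform x ?c (heat_symbol \<theta> \<alpha> m (t + 0)) - r * cos_transform x ?c (heat_symbol \<theta> \<alpha> (Suc m) t) = (LINT \<xi>|lborel. ?f \<xi>)"
      unfolding add_0_right by linarith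
    then have "\<bar>cos_transform x ?c (heat_symbol \<theta> \<alpha> m (t + r)) - cos_transform x ?c (heat_symbol \<theta> \<alpha> m (t + 0)) - r * cos_transform x ?c (heat_symbol \<theta> \<alpha> (Suc m) t)\<bar>
        \<le> (LINT \<xi>|lborel. \<bar>?f \<xi>\<bar>)" using integral_abs_bound[of lborel "?f"] by (simp only:)
    also have "\<dots> \<le> (LINT \<xi>|lborel. r\<^sup>2 * ?g \<xi>)"
    proof (intro integral_mono integrable_abs If integrable_mult_right Ig)
      fix \<xi> :: "real^'n"
      let ?L = "norm \<xi> powr \<theta>"
      have l0: "0 \<le> ?L" by simp
      have e: "exp (- (t + r) * ?L) = exp (- t * ?L) * exp (- (r * ?L))" by (simp add: exp_add[symmetric] algebra_simps)
      have "?f \<xi> = cos (x \<bullet> \<xi> + ?c) * (mi_power \<xi> \<alpha> * (- ?L) ^ m * (exp (- t * ?L) * (exp (- (r * ?L)) - 1 - (- (r * ?L)))))"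
      proof -
        have alg: "A * (p * L * (E * e1)) - A * (p * L * E) - r * (A * (p * (- v * L) * E)) = A * (p * L * (E * (e1 - 1 - (- (r * v)))))"
          for A p L E e1 v :: real by (simp add: algebra_simps)
        show ?thesis unfolding heat_symbol_def e power_Suc by (rule alg)
      qed
      then have "\<bar>?f \<xi>\<bar> = \<bar>cos (x \<bullet> \<xi> + ?c)\<bar> * (\<bar>mi_power \<xi> \<alpha>\<bar> * \<bar>(- ?L) ^ m\<bar> * (\<bar>exp (- t * ?L)\<bar> * \<bar>exp (- (r * ?L)) - 1 - (- (r * ?L))\<bar>))"
        by (simp only: abs_mult)
      also have "\<dots> \<le> 1 * (norm \<xi> ^ mi_order \<alpha> * ?L ^ m * (exp (- t * ?L) * ((- (r * ?L))\<^sup>2 * exp \<bar>- (r * ?L)\<bar>)))"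
        by (intro mult_mono abs_mi_power_le exp_quadratic_error) (auto simp: power_abs)
      also have "\<dots> \<le> r\<^sup>2 * ?g \<xi>"
      proof -
        have "exp (- t * ?L) * exp \<bar>- (r * ?L)\<bar> = exp (- (t - \<bar>r\<bar>) * ?L)"
          by (simp add: exp_add[symmetric] abs_mult algebra_simps)
        also have "(t / 2) * ?L \<le> (t - \<bar>r\<bar>) * ?L" using r l0 by (intro mult_right_mono) linarith+
        then have "exp (- (t - \<bar>r\<bar>) * ?L) \<le> exp (- (t / 2) * ?L)"
          by (simp only: exp_le_cancel_iff mult_minus_left neg_le_iff_le)
        finally have "norm \<xi> ^ mi_order \<alpha> * ?L ^ m * (r * ?L)\<^sup>2 * (exp (- t * ?L) * exp \<bar>- (r * ?L)\<bar>)
            \<le> norm \<xi> ^ mi_order \<alpha> * ?L ^ m * (r * ?L)\<^sup>2 * exp (- (t / 2) * ?L)"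
          by (intro mult_left_mono) auto
        then show ?thesis by (simp add: power_mult_distrib power_add power2_eq_square mult_ac)
      qed
      finally show "\<bar>?f \<xi>\<bar> \<le> r\<^sup>2 * ?g \<xi>" .
    qed
    also have "\<dots> = (LINT \<xi>|lborel. ?g \<xi>) * r\<^sup>2" by simp
    finally show "\<bar>cos_transform x ?c (heat_symbol \<theta> \<alpha> m (t + r)) - cos_transform x ?c (heat_symbol \<theta> \<alpha> m (t + 0)) - r * cos_transform x ?c (heat_symbol \<theta> \<alpha> (Suc m) t)\<bar>
      \<le> (LINT \<xi>|lborel. ?g \<xi>) * r\<^sup>2" .
  qed (use t in \<open>auto intro!: integral_nonneg_AE\<close>)
  then have "((\<lambda>s. cos_transform x ?c (heat_symbol \<theta> \<alpha> m s)) has_real_derivative cos_transform x ?c (heat_symbol \<theta> \<alpha> (Suc m) t)) (at t)"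
    using DERIV_shift[of "\<lambda>s. cos_transform x ?c (heat_symbol \<theta> \<alpha> m s)" _ 0 t] by (simp add: add.commute)
  then show ?thesis unfolding heat_deriv_def by (rule DERIV_cmult)
qed

section \<open>Identification with the derivatives in the profile\<close>

text \<open>For t > 0 the Fourier integrand is absolutely integrable, so the real part may be taken
  inside and only the cosine remains. Borel measurability of the integrand allows
  \<open>lebesgue\<close> to be replaced by \<open>lborel\<close>.\<close>

lemma frac_heat_kernel_eq_heat_deriv:
  assumes "0 < \<theta>" "0 < t"
  shows "frac_heat_kernel \<theta> (x :: real^'n) t = heat_deriv \<theta> (\<lambda>_. 0) 0 x t"
proof -
  let ?F = "\<lambda>\<xi>::real^'n. exp (\<i> * of_real (x \<bullet> \<xi>)) * of_real (exp (- t * norm \<xi> powr \<theta>)) :: complex"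
  have p: "heat_symbol \<theta> (\<lambda>_::'n. 0) 0 t = (\<lambda>\<xi>::real^'n. exp (- t * norm \<xi> powr \<theta>))"
    by (simp add: heat_symbol_def mi_power_def fun_eq_iff)
  have e: "integrable lborel (\<lambda>\<xi>::real^'n. exp (- t * norm \<xi> powr \<theta>))"
    using heat_symbol_integrable[OF assms, of "\<lambda>_::'n. 0" 0] by (simp only: p)
  have m: "?F \<in> borel_measurable lborel" by measurable
  have I: "integrable lborel ?F"
    by (rule Bochner_Integration.integrable_bound[OF e m]) (simp add: norm_mult)
  have "(\<integral>\<xi>. ?F \<xi> \<partial>lebesgue) = (\<integral>\<xi>. ?F \<xi> \<partial>lborel)" by (rule integral_completion[OF m])
  then have "Re (\<integral>\<xi>. ?F \<xi> \<partial>lebesgue) = (\<integral>\<xi>. Re (?F \<xi>) \<partial>lborel)"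
    by (simp only: integral_Re[OF I])
  also have "\<dots> = cos_transform x 0 (heat_symbol \<theta> (\<lambda>_. 0) 0 t)"
    unfolding cos_transform_def p by (intro Bochner_Integration.integral_cong) (auto simp: Re_exp)
  finally show ?thesis by (simp add: frac_heat_kernel_def heat_deriv_def mi_order_def)
qed

lemma partial_deriv_heat_deriv:
  assumes "0 < \<theta>" "0 < t"
  shows "(partial_deriv i ^^ k) (\<lambda>z. heat_deriv \<theta> \<alpha> m z t) = (\<lambda>z. heat_deriv \<theta> (\<alpha>(i := \<alpha> i + k)) m z t)"
proof (induction k)
  case (Suc k)
  have "partial_deriv i (\<lambda>z. heat_deriv \<theta> \<beta> m z t) = (\<lambda>z. heat_deriv \<theta> (\<beta>(i := Suc (\<beta> i))) m z t)" for \<beta>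
    unfolding partial_deriv_def by (intro ext DERIV_imp_deriv heat_deriv_partial assms)
  moreover have "(\<alpha>(i := \<alpha> i + k))(i := Suc ((\<alpha>(i := \<alpha> i + k)) i)) = \<alpha>(i := \<alpha> i + Suc k)" by simp
  ultimately show ?case by (simp only: funpow.simps o_apply Suc.IH)
qed simp

text \<open>Each entry of the enumeration raises only its own index of the multi-index. The claim is
  therefore proved for every duplicate-free list, and the particular list picked by
  \<open>SOME\<close> never matters.\<close>

lemma mi_deriv_heat_deriv:
  assumes "0 < \<theta>" "0 < t"
  shows "mi_deriv \<alpha> (\<lambda>z. heat_deriv \<theta> (\<lambda>_. 0) m z t) = (\<lambda>z. heat_deriv \<theta> \<alpha> m z t)"
proof -
  have fold: "distinct xs \<Longrightarrow> foldr (\<lambda>i. partial_deriv i ^^ \<alpha> i) xs (\<lambda>z. heat_deriv \<theta> (\<lambda>_. 0) m z t)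
      = (\<lambda>z. heat_deriv \<theta> (\<lambda>i. if i \<in> set xs then \<alpha> i else 0) m z t)" for xs
  proof (induction xs)
    case (Cons i xs)
    have "(\<lambda>j. if j \<in> set xs then \<alpha> j else 0)(i := (if i \<in> set xs then \<alpha> i else 0) + \<alpha> i) = (\<lambda>j. if j \<in> set (i # xs) then \<alpha> j else 0)"
      using Cons.prems by auto
    then show ?case using Cons by (simp add: partial_deriv_heat_deriv[OF assms])
  qed simp
  define xs :: "'a list" where "xs = (SOME is. distinct is \<and> set is = UNIV)"
  have "\<exists>is :: 'a list. distinct is \<and> set is = UNIV" using finite_distinct_list[of "UNIV :: 'a set"] by auto
  then have "distinct xs \<and> set xs = UNIV" unfolding xs_def by (rule someI_ex)
  then show ?thesis using fold[of xs] by (simp add: mi_deriv_def flip: xs_def)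
qed

text \<open>An iterated \<open>deriv\<close> depends on the function in a whole neighbourhood, so
  the identity is propagated at all times s > 0 simultaneously and specialised to t + 1 only at the
  end.\<close>

lemma kernel_g_eq_heat_deriv:
  assumes "0 < \<theta>" "- 1 < t"
  shows "kernel_g \<theta> \<alpha> m x t = (-1) ^ (mi_order \<alpha> + m) / (mi_fact \<alpha> * fact m) * heat_deriv \<theta> \<alpha> m x (t + 1)"
proof -
  have base: "mi_deriv \<alpha> (\<lambda>z. frac_heat_kernel \<theta> z s) x = heat_deriv \<theta> \<alpha> 0 x s" if "0 < s" for s
  proof -
    have "(\<lambda>z. frac_heat_kernel \<theta> z s) = (\<lambda>z. heat_deriv \<theta> (\<lambda>_. 0) 0 z s)"
      by (rule ext) (rule frac_heat_kernel_eq_heat_deriv[OF assms(1) that])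
    from fun_cong[OF trans[OF arg_cong[where f = "mi_deriv \<alpha>", OF this] mi_deriv_heat_deriv[OF assms(1) that]], of x]
    show ?thesis .
  qed
  have "\<forall>s>0. (deriv ^^ m) (\<lambda>s. mi_deriv \<alpha> (\<lambda>z. frac_heat_kernel \<theta> z s) x) s = heat_deriv \<theta> \<alpha> m x s"
  proof (induction m)
    case 0 then show ?case using base by simp
  next
    case (Suc m)
    show ?case
    proof (intro allI impI)
      fix s :: real assume s: "0 < s"
      have "\<forall>\<^sub>F r in nhds s. (deriv ^^ m) (\<lambda>s. mi_deriv \<alpha> (\<lambda>z. frac_heat_kernel \<theta> z s) x) r = heat_deriv \<theta> \<alpha> m x r"
      proof (rule eventually_mono)
        show "\<forall>\<^sub>F r in nhds s. r \<in> {0<..}" by (rule eventually_nhds_in_open) (use s in auto)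
      qed (use Suc.IH in simp)
      then have "deriv ((deriv ^^ m) (\<lambda>s. mi_deriv \<alpha> (\<lambda>z. frac_heat_kernel \<theta> z s) x)) s = deriv (heat_deriv \<theta> \<alpha> m x) s"
        by (rule deriv_cong_ev) simp
      also have "\<dots> = heat_deriv \<theta> \<alpha> (Suc m) x s" by (rule DERIV_imp_deriv[OF heat_deriv_time[OF assms(1) s]])
      finally show "(deriv ^^ Suc m) (\<lambda>s. mi_deriv \<alpha> (\<lambda>z. frac_heat_kernel \<theta> z s) x) s = heat_deriv \<theta> \<alpha> (Suc m) x s" by simp
    qed
  qed
  from this[rule_format, of "t + 1"] assms(2) show ?thesis by (simp add: kernel_g_def)
qed

section \<open>Taylor expansion of the heat kernel\<close>

lemma mi_fact_pos [simp]: "0 < mi_fact \<alpha>"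
  unfolding mi_fact_def by (intro prod_pos) auto

lemma mi_fact_ge_1: "1 \<le> mi_fact \<alpha>"
  unfolding mi_fact_def by (intro prod_ge_1) (auto simp: fact_ge_1)

lemma mi_fact_upd_Suc: "mi_fact (\<alpha>(i := Suc (\<alpha> i))) = real (Suc (\<alpha> i)) * mi_fact \<alpha>"
proof -
  have "mi_fact (\<alpha>(i := Suc (\<alpha> i))) = (\<Prod>j\<in>UNIV. (if j = i then real (Suc (\<alpha> j)) else 1) * fact (\<alpha> j))"
    unfolding mi_fact_def by (intro prod.cong) auto
  then show ?thesis by (simp add: prod.distrib mi_fact_def)
qed

lemma finite_mi_order_le_nat: "finite {\<alpha> :: ('n::finite) multi_index. mi_order \<alpha> \<le> k}"
  using finite_mi_order_le[of "real k", where 'n = 'n] by simp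

lemma finite_mi_order_eq: "finite {\<alpha> :: ('n::finite) multi_index. mi_order \<alpha> = k}"
  by (rule finite_subset[OF _ finite_mi_order_le_nat[of k]]) auto

section \<open>Multinomial expansion of directional derivatives\<close>

text \<open>Terms with \<beta> i = 0 vanish; on the others, lowering the i-th entry is the inverse
  of raising it.\<close>

lemma mi_order_Suc_reindex:
  fixes g :: "('n::finite) multi_index \<Rightarrow> real"
  shows "(\<Sum>\<beta> | mi_order \<beta> = Suc j. real (\<beta> i) * g \<beta>)
      = (\<Sum>\<alpha> | mi_order \<alpha> = j. real (Suc (\<alpha> i)) * g (\<alpha>(i := Suc (\<alpha> i))))"
proof -
  have "(\<Sum>\<beta> | mi_order \<beta> = Suc j. real (\<beta> i) * g \<beta>) = (\<Sum>\<beta> | mi_order \<beta> = Suc j \<and> \<beta> i \<noteq> 0. real (\<beta> i) * g \<beta>)"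
    by (rule sum.mono_neutral_right) (auto intro: finite_mi_order_eq)
  also have "\<dots> = (\<Sum>\<alpha> | mi_order \<alpha> = j. real (Suc (\<alpha> i)) * g (\<alpha>(i := Suc (\<alpha> i))))"
  proof (rule sum.reindex_bij_witness[of _ "\<lambda>\<alpha>. \<alpha>(i := Suc (\<alpha> i))" "\<lambda>\<beta>. \<beta>(i := \<beta> i - 1)"])
    fix \<beta> :: "'n multi_index" assume b: "\<beta> \<in> {\<beta>. mi_order \<beta> = Suc j \<and> \<beta> i \<noteq> 0}"
    then have eq: "(\<beta>(i := \<beta> i - 1))(i := Suc ((\<beta>(i := \<beta> i - 1)) i)) = \<beta>" by auto
    show "(\<beta>(i := \<beta> i - 1))(i := Suc ((\<beta>(i := \<beta> i - 1)) i)) = \<beta>" by (rule eq)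
    have "Suc (mi_order (\<beta>(i := \<beta> i - 1))) = mi_order \<beta>"
      using mi_order_upd_Suc[of "\<beta>(i := \<beta> i - 1)" i] unfolding eq by simp
    then show "\<beta>(i := \<beta> i - 1) \<in> {\<alpha>. mi_order \<alpha> = j}" using b by simp
    show "real (Suc ((\<beta>(i := \<beta> i - 1)) i)) * g ((\<beta>(i := \<beta> i - 1))(i := Suc ((\<beta>(i := \<beta> i - 1)) i))) = real (\<beta> i) * g \<beta>"
      unfolding eq using b by simp
  next
    fix \<alpha> :: "'n multi_index" assume "\<alpha> \<in> {\<alpha>. mi_order \<alpha> = j}"
    then show "\<alpha>(i := Suc (\<alpha> i)) \<in> {\<beta>. mi_order \<beta> = Suc j \<and> \<beta> i \<noteq> 0}"
      using mi_order_upd_Suc[of \<alpha> i] by simp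
    show "(\<alpha>(i := Suc (\<alpha> i)))(i := (\<alpha>(i := Suc (\<alpha> i))) i - 1) = \<alpha>" by auto
  qed
  finally show ?thesis .
qed

text \<open>At order j + 1, the factor j + 1 is written as the sum of the entries \<beta> i. Each
  entry cancels against the factorial, lowers its index and releases a factor v $ i, which leaves
  (sum of the v $ i) times the identity at order j.\<close>

lemma multinomial_theorem:
  fixes v :: "real^'n"
  shows "(\<Sum>i\<in>UNIV. v $ i) ^ j / fact j = (\<Sum>\<alpha> | mi_order \<alpha> = j. mi_power v \<alpha> / mi_fact \<alpha>)"
proof (induction j)
  case 0
  have "{\<alpha> :: 'n multi_index. mi_order \<alpha> = 0} = {\<lambda>_. 0}"
    by (auto simp: mi_order_def fun_eq_iff)
  then show ?case by (simp add: mi_power_def mi_fact_def)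
next
  case (Suc j)
  let ?T = "\<lambda>j. \<Sum>\<alpha> | mi_order \<alpha> = j. mi_power v \<alpha> / mi_fact \<alpha>"
  have "real (Suc j) * ?T (Suc j) = (\<Sum>\<beta> | mi_order \<beta> = Suc j. \<Sum>i\<in>UNIV. real (\<beta> i) * (mi_power v \<beta> / mi_fact \<beta>))"
    unfolding sum_distrib_left
  proof (rule sum.cong)
    fix \<beta> :: "'n multi_index" assume "\<beta> \<in> {\<beta>. mi_order \<beta> = Suc j}"
    then have "real (Suc j) = (\<Sum>i\<in>UNIV. real (\<beta> i))" by (simp add: mi_order_def flip: of_nat_sum)
    then show "real (Suc j) * (mi_power v \<beta> / mi_fact \<beta>) = (\<Sum>i\<in>UNIV. real (\<beta> i) * (mi_power v \<beta> / mi_fact \<beta>))"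
      by (simp only: sum_distrib_right)
  qed simp
  also have "\<dots> = (\<Sum>i\<in>UNIV. \<Sum>\<beta> | mi_order \<beta> = Suc j. real (\<beta> i) * (mi_power v \<beta> / mi_fact \<beta>))"
    by (rule sum.swap)
  also have "\<dots> = (\<Sum>i\<in>UNIV. v $ i * ?T j)"
  proof (rule sum.cong)
    fix i :: 'n
    have "(\<Sum>\<beta> | mi_order \<beta> = Suc j. real (\<beta> i) * (mi_power v \<beta> / mi_fact \<beta>))
        = (\<Sum>\<alpha> | mi_order \<alpha> = j. real (Suc (\<alpha> i)) * (mi_power v (\<alpha>(i := Suc (\<alpha> i))) / mi_fact (\<alpha>(i := Suc (\<alpha> i)))))"
      by (rule mi_order_Suc_reindex)
    also have "\<dots> = (\<Sum>\<alpha> | mi_order \<alpha> = j. v $ i * (mi_power v \<alpha> / mi_fact \<alpha>))"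
    proof (rule sum.cong)
      fix \<alpha> :: "'n multi_index"
      have "real (Suc (\<alpha> i)) * (v $ i * mi_power v \<alpha> / (real (Suc (\<alpha> i)) * mi_fact \<alpha>)) = v $ i * (mi_power v \<alpha> / mi_fact \<alpha>)"
        by simp
      then show "real (Suc (\<alpha> i)) * (mi_power v (\<alpha>(i := Suc (\<alpha> i))) / mi_fact (\<alpha>(i := Suc (\<alpha> i)))) = v $ i * (mi_power v \<alpha> / mi_fact \<alpha>)"
        by (simp only: mi_power_upd_Suc mi_fact_upd_Suc)
    qed simp
    finally show "(\<Sum>\<beta> | mi_order \<beta> = Suc j. real (\<beta> i) * (mi_power v \<beta> / mi_fact \<beta>)) = v $ i * ?T j"
      by (simp only: sum_distrib_left)
  qed simp
  also have "\<dots> = (\<Sum>i\<in>UNIV. v $ i) * ?T j" by (simp only: sum_distrib_right)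
  also have "\<dots> = (\<Sum>i\<in>UNIV. v $ i) ^ Suc j / fact j" by (simp add: Suc.IH[symmetric])
  finally have "?T (Suc j) = (\<Sum>i\<in>UNIV. v $ i) ^ Suc j / fact j / real (Suc j)"
    by (metis nonzero_mult_div_cancel_left of_nat_eq_0_iff nat.distinct(1))
  then show ?case by (simp add: mult.commute)
qed

lemma inner_power_expansion:
  fixes y \<xi> :: "real^'n"
  shows "(y \<bullet> \<xi>) ^ j / fact j = (\<Sum>\<alpha> | mi_order \<alpha> = j. mi_power y \<alpha> * mi_power \<xi> \<alpha> / mi_fact \<alpha>)"
proof -
  have "mi_power (\<chi> i. y $ i * \<xi> $ i) \<alpha> = mi_power y \<alpha> * mi_power \<xi> \<alpha>" for \<alpha>
    by (simp add: mi_power_def power_mult_distrib prod.distrib)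
  then show ?thesis
    using multinomial_theorem[of "\<chi> i. y $ i * \<xi> $ i" j] by (simp add: inner_vec_def)
qed

text \<open>The \<open>j\<close>-th derivative of \<open>G\<^sub>\<theta>(\<cdot>, t)\<close> at \<open>x\<close> in the direction \<open>y\<close>.\<close>

definition heat_dir_deriv :: "real \<Rightarrow> nat \<Rightarrow> real^'n \<Rightarrow> real^'n \<Rightarrow> real \<Rightarrow> real" where
  "heat_dir_deriv \<theta> j y x t = (2 * pi) powr (- real CARD('n)) * cos_transform x (real j * (pi / 2)) (\<lambda>\<xi>. (y \<bullet> \<xi>) ^ j * heat_symbol \<theta> (\<lambda>_. 0) 0 t \<xi>)"

text \<open>All derivatives with |\<alpha>| = j carry the same phase j pi/2, so the multinomial
  expansion of (y . \<xi>)^j can be carried out under the integral.\<close>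

lemma heat_dir_deriv_expansion:
  fixes x y :: "real^'n"
  assumes "0 < \<theta>" "0 < t"
  shows "heat_dir_deriv \<theta> j y x t / fact j = (\<Sum>\<alpha> | mi_order \<alpha> = j. mi_power y \<alpha> / mi_fact \<alpha> * heat_deriv \<theta> \<alpha> 0 x t)"
proof -
  let ?c = "real j * (pi / 2)"
  have eq: "(y \<bullet> \<xi>) ^ j * heat_symbol \<theta> (\<lambda>_. 0) 0 t \<xi> / fact j = (\<Sum>\<alpha> | mi_order \<alpha> = j. mi_power y \<alpha> / mi_fact \<alpha> * heat_symbol \<theta> \<alpha> 0 t \<xi>)" for \<xi>
  proof -
    have "(y \<bullet> \<xi>) ^ j * heat_symbol \<theta> (\<lambda>_. 0) 0 t \<xi> / fact j = ((y \<bullet> \<xi>) ^ j / fact j) * heat_symbol \<theta> (\<lambda>_. 0) 0 t \<xi>" by simp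
    also have "\<dots> = (\<Sum>\<alpha> | mi_order \<alpha> = j. (mi_power y \<alpha> * mi_power \<xi> \<alpha> / mi_fact \<alpha>) * heat_symbol \<theta> (\<lambda>_. 0) 0 t \<xi>)"
      by (simp only: inner_power_expansion sum_distrib_right)
    also have "\<dots> = (\<Sum>\<alpha> | mi_order \<alpha> = j. mi_power y \<alpha> / mi_fact \<alpha> * heat_symbol \<theta> \<alpha> 0 t \<xi>)"
      by (rule sum.cong) (simp_all add: heat_symbol_def mi_power_def)
    finally show ?thesis .
  qed
  have "cos_transform x ?c (\<lambda>\<xi>. (y \<bullet> \<xi>) ^ j * heat_symbol \<theta> (\<lambda>_. 0) 0 t \<xi>) / fact j
      = (LINT \<xi>|lborel. cos (x \<bullet> \<xi> + ?c) * ((y \<bullet> \<xi>) ^ j * heat_symbol \<theta> (\<lambda>_. 0) 0 t \<xi>) / fact j)"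
    unfolding cos_transform_def by (rule integral_divide_zero[symmetric])
  also have "\<dots> = (LINT \<xi>|lborel. (\<Sum>\<alpha> | mi_order \<alpha> = j. mi_power y \<alpha> / mi_fact \<alpha> * (cos (x \<bullet> \<xi> + ?c) * heat_symbol \<theta> \<alpha> 0 t \<xi>)))"
  proof (rule Bochner_Integration.integral_cong[OF refl])
    fix \<xi>
    have "cos (x \<bullet> \<xi> + ?c) * ((y \<bullet> \<xi>) ^ j * heat_symbol \<theta> (\<lambda>_. 0) 0 t \<xi>) / fact j = cos (x \<bullet> \<xi> + ?c) * ((y \<bullet> \<xi>) ^ j * heat_symbol \<theta> (\<lambda>_. 0) 0 t \<xi> / fact j)"
      by simp
    then show "cos (x \<bullet> \<xi> + ?c) * ((y \<bullet> \<xi>) ^ j * heat_symbol \<theta> (\<lambda>_. 0) 0 t \<xi>) / fact j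
        = (\<Sum>\<alpha> | mi_order \<alpha> = j. mi_power y \<alpha> / mi_fact \<alpha> * (cos (x \<bullet> \<xi> + ?c) * heat_symbol \<theta> \<alpha> 0 t \<xi>))"
      by (simp only: eq sum_distrib_left mult.left_commute)
  qed
  also have "\<dots> = (\<Sum>\<alpha> | mi_order \<alpha> = j. LINT \<xi>|lborel. mi_power y \<alpha> / mi_fact \<alpha> * (cos (x \<bullet> \<xi> + ?c) * heat_symbol \<theta> \<alpha> 0 t \<xi>))"
    by (intro Bochner_Integration.integral_sum integrable_mult_right integrable_cos_mult heat_symbol_integrable assms)
  also have "\<dots> = (\<Sum>\<alpha> | mi_order \<alpha> = j. mi_power y \<alpha> / mi_fact \<alpha> * cos_transform x (real (mi_order \<alpha>) * (pi / 2)) (heat_symbol \<theta> \<alpha> 0 t))"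
  proof (intro sum.cong refl)
    fix \<alpha> :: "'n multi_index" assume "\<alpha> \<in> {\<alpha>. mi_order \<alpha> = j}"
    then have j: "mi_order \<alpha> = j" by simp
    show "(LINT \<xi>|lborel. mi_power y \<alpha> / mi_fact \<alpha> * (cos (x \<bullet> \<xi> + ?c) * heat_symbol \<theta> \<alpha> 0 t \<xi>))
        = mi_power y \<alpha> / mi_fact \<alpha> * cos_transform x (real (mi_order \<alpha>) * (pi / 2)) (heat_symbol \<theta> \<alpha> 0 t)"
      unfolding cos_transform_def j by (rule integral_mult_right_zero)
  qed
  finally have "cos_transform x ?c (\<lambda>\<xi>. (y \<bullet> \<xi>) ^ j * heat_symbol \<theta> (\<lambda>_. 0) 0 t \<xi>) / fact j
      = (\<Sum>\<alpha> | mi_order \<alpha> = j. mi_power y \<alpha> / mi_fact \<alpha> * cos_transform x (real (mi_order \<alpha>) * (pi / 2)) (heat_symbol \<theta> \<alpha> 0 t))" .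
  then have "heat_dir_deriv \<theta> j y x t / fact j = (2 * pi) powr (- real CARD('n)) * (\<Sum>\<alpha> | mi_order \<alpha> = j. mi_power y \<alpha> / mi_fact \<alpha> * cos_transform x (real (mi_order \<alpha>) * (pi / 2)) (heat_symbol \<theta> \<alpha> 0 t))"
    unfolding heat_dir_deriv_def times_divide_eq_right[symmetric] by (rule arg_cong)
  then show ?thesis
    unfolding heat_deriv_def by (simp only: sum_distrib_left mult.left_commute)
qed

lemma heat_dir_deriv_deriv:
  fixes x y :: "real^'n"
  assumes "0 < \<theta>" "0 < t"
  shows "((\<lambda>r. heat_dir_deriv \<theta> j y (x + r *\<^sub>R y) t) has_real_derivative heat_dir_deriv \<theta> (Suc j) y (x + r *\<^sub>R y) t) (at r)"
proof -
  let ?b = "\<lambda>j \<xi>. (y \<bullet> \<xi>) ^ j * heat_symbol \<theta> (\<lambda>_. 0) 0 t \<xi>"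
  have c: "real j * (pi / 2) + pi / 2 = real (Suc j) * (pi / 2)" by (simp add: distrib_right)
  have b1: "(\<lambda>\<xi>. (y \<bullet> \<xi>) * ?b j \<xi>) = ?b (Suc j)" by (simp add: mult.assoc)
  have b2: "(\<lambda>\<xi>. (y \<bullet> \<xi>)\<^sup>2 * ?b j \<xi>) = ?b (Suc (Suc j))" by (simp add: power2_eq_square mult.assoc)
  have "((\<lambda>r'. cos_transform ((x + r *\<^sub>R y) + r' *\<^sub>R y) (real j * (pi / 2)) (?b j)) has_real_derivative
      cos_transform (x + r *\<^sub>R y) (real j * (pi / 2) + pi / 2) (\<lambda>\<xi>. (y \<bullet> \<xi>) * ?b j \<xi>)) (at 0)"
    by (rule cos_transform_has_derivative, unfold b1 b2) (intro inner_power_heat_symbol_integrable assms)+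
  then have "((\<lambda>r'. cos_transform ((x + r *\<^sub>R y) + r' *\<^sub>R y) (real j * (pi / 2)) (?b j)) has_real_derivative
      cos_transform (x + r *\<^sub>R y) (real (Suc j) * (pi / 2)) (?b (Suc j))) (at 0)"
    unfolding c b1 .
  then have "((\<lambda>r'. heat_dir_deriv \<theta> j y ((x + r *\<^sub>R y) + r' *\<^sub>R y) t) has_real_derivative heat_dir_deriv \<theta> (Suc j) y (x + r *\<^sub>R y) t) (at 0)"
    unfolding heat_dir_deriv_def by (rule DERIV_cmult)
  moreover have "(x + r *\<^sub>R y) + r' *\<^sub>R y = x + (r' + r) *\<^sub>R y" for r' by (simp add: scaleR_add_left)
  ultimately show ?thesis using DERIV_shift[of "\<lambda>r. heat_dir_deriv \<theta> j y (x + r *\<^sub>R y) t" _ 0 r] by simp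
qed

lemma mi_power_minus: "mi_power (- y) \<alpha> = (-1) ^ mi_order \<alpha> * mi_power y \<alpha>"
proof -
  have "mi_power (- y) \<alpha> = (\<Prod>i\<in>UNIV. (-1) ^ \<alpha> i * y $ i ^ \<alpha> i)"
    unfolding mi_power_def by (intro prod.cong refl) (simp add: power_minus[of "y $ _"])
  then show ?thesis by (simp add: prod.distrib power_sum mi_order_def mi_power_def)
qed

section \<open>Taylor formulas in space and in time\<close>

lemma sum_mi_order_le_group:
  fixes g :: "('n::finite) multi_index \<Rightarrow> real"
  shows "(\<Sum>j<Suc k. \<Sum>\<alpha> | mi_order \<alpha> = j. g \<alpha>) = (\<Sum>\<alpha> | mi_order \<alpha> \<le> k. g \<alpha>)"
proof -
  have "(\<Sum>j<Suc k. sum g {\<alpha> \<in> {\<alpha>. mi_order \<alpha> \<le> k}. mi_order \<alpha> = j}) = (\<Sum>\<alpha> | mi_order \<alpha> \<le> k. g \<alpha>)"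
    by (rule sum.group) (auto simp: finite_mi_order_le_nat)
  moreover have "(\<Sum>j<Suc k. sum g {\<alpha> \<in> {\<alpha>. mi_order \<alpha> \<le> k}. mi_order \<alpha> = j}) = (\<Sum>j<Suc k. \<Sum>\<alpha> | mi_order \<alpha> = j. g \<alpha>)"
    by (intro sum.cong refl) auto
  ultimately show ?thesis by simp
qed

text \<open>A Maclaurin formula in one variable along the segment from x to x - y. It yields one
  intermediate point \<eta>, shared by all multi-indices of the top order.\<close>

lemma heat_deriv_space_Taylor:
  fixes x y :: "real^'n"
  assumes "0 < \<theta>" "0 < t"
  obtains \<eta> where "0 \<le> \<eta>" "\<eta> \<le> 1"
    "heat_deriv \<theta> (\<lambda>_. 0) 0 (x - y) t = (\<Sum>\<alpha> | mi_order \<alpha> \<le> k. (-1) ^ mi_order \<alpha> * mi_power y \<alpha> / mi_fact \<alpha> * heat_deriv \<theta> \<alpha> 0 x t)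
       + (\<Sum>\<alpha> | mi_order \<alpha> = Suc k. (-1) ^ mi_order \<alpha> * mi_power y \<alpha> / mi_fact \<alpha> * heat_deriv \<theta> \<alpha> 0 (x - \<eta> *\<^sub>R y) t)"
proof -
  define diff where "diff j r = heat_dir_deriv \<theta> j (- y) (x + r *\<^sub>R (- y)) t" for j r
  have "\<exists>r>0. r < 1 \<and> diff 0 1 = (\<Sum>m<Suc k. diff m 0 / fact m * 1 ^ m) + diff (Suc k) r / fact (Suc k) * 1 ^ Suc k"
    by (rule Maclaurin) (auto simp: diff_def fun_eq_iff intro!: heat_dir_deriv_deriv[OF assms, of _ "- y", simplified])
  then obtain r where r: "0 < r" "r < 1" "diff 0 1 = (\<Sum>m<Suc k. diff m 0 / fact m) + diff (Suc k) r / fact (Suc k)"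
    by auto
  have d0: "diff 0 1 = heat_deriv \<theta> (\<lambda>_. 0) 0 (x - y) t"
    by (simp add: diff_def heat_dir_deriv_def heat_deriv_def mi_order_def)
  have dm: "diff m r / fact m = (\<Sum>\<alpha> | mi_order \<alpha> = m. (-1) ^ mi_order \<alpha> * mi_power y \<alpha> / mi_fact \<alpha> * heat_deriv \<theta> \<alpha> 0 (x - r *\<^sub>R y) t)" for m r
    unfolding diff_def heat_dir_deriv_expansion[OF assms] mi_power_minus by simp
  have "heat_deriv \<theta> (\<lambda>_. 0) 0 (x - y) t = (\<Sum>m<Suc k. \<Sum>\<alpha> | mi_order \<alpha> = m. (-1) ^ mi_order \<alpha> * mi_power y \<alpha> / mi_fact \<alpha> * heat_deriv \<theta> \<alpha> 0 (x - 0 *\<^sub>R y) t)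
       + (\<Sum>\<alpha> | mi_order \<alpha> = Suc k. (-1) ^ mi_order \<alpha> * mi_power y \<alpha> / mi_fact \<alpha> * heat_deriv \<theta> \<alpha> 0 (x - r *\<^sub>R y) t)"
    using r(3) unfolding d0 dm .
  then show thesis unfolding sum_mi_order_le_group scaleR_zero_left diff_zero
    using r by (intro that[of r]) auto
qed

text \<open>The expansion point c lies to the right of the point of evaluation: the profile lives at
  time t + 1, the kernel to be approximated at the earlier time t - s.\<close>

lemma heat_deriv_time_Taylor:
  assumes "0 < \<theta>" "0 < a" "a < c"
  obtains \<tau> where "a \<le> \<tau>" "\<tau> \<le> c"
    "heat_deriv \<theta> \<alpha> 0 x a = (\<Sum>m<Suc M. heat_deriv \<theta> \<alpha> m x c / fact m * (a - c) ^ m) + heat_deriv \<theta> \<alpha> (Suc M) x \<tau> / fact (Suc M) * (a - c) ^ Suc M"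
proof -
  have "\<exists>t>a. t < c \<and> heat_deriv \<theta> \<alpha> 0 x a = (\<Sum>m<Suc M. heat_deriv \<theta> \<alpha> m x c / fact m * (a - c) ^ m) + heat_deriv \<theta> \<alpha> (Suc M) x t / fact (Suc M) * (a - c) ^ Suc M"
    by (rule Taylor_down[where b = c and diff = "\<lambda>m. heat_deriv \<theta> \<alpha> m x"]) (use assms in \<open>auto intro!: heat_deriv_time\<close>)
  then obtain \<tau> where "a < \<tau>" "\<tau> < c" "heat_deriv \<theta> \<alpha> 0 x a = (\<Sum>m<Suc M. heat_deriv \<theta> \<alpha> m x c / fact m * (a - c) ^ m) + heat_deriv \<theta> \<alpha> (Suc M) x \<tau> / fact (Suc M) * (a - c) ^ Suc M"
    by blast
  then show thesis by (intro that[of \<tau>]) linarith+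
qed

text \<open>Only finitely many pairs (\<alpha>, m) satisfy the order restrictions, and the sum of
  their constants serves them all. The homogeneous form is meant for Taylor remainders, the sharper
  one for terms estimated individually.\<close>

lemma heat_deriv_bounds_uniform:
  assumes "0 < \<theta>"
  obtains C where "0 \<le> C"
    "\<And>\<alpha> m t (x::real^'n). mi_order \<alpha> \<le> k \<Longrightarrow> m \<le> M \<Longrightarrow> 0 < t \<Longrightarrow>
       \<bar>heat_deriv \<theta> \<alpha> m x t\<bar> \<le> C * (norm x + t powr (1 / \<theta>)) powr (- real CARD('n) - (real (mi_order \<alpha>) + real m * \<theta>))"
    "\<And>\<alpha> m t (x::real^'n). mi_order \<alpha> \<le> k \<Longrightarrow> m \<le> M \<Longrightarrow> 0 < t \<Longrightarrow>
       \<bar>heat_deriv \<theta> \<alpha> m x t\<bar> \<le> C * (if m = 0 then t else 1) * (norm x + t powr (1 / \<theta>)) powr (- real CARD('n) - (real (mi_order \<alpha>) + real (max m 1) * \<theta>))"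
proof -
  let ?A = "{\<alpha> :: 'n multi_index. mi_order \<alpha> \<le> k} \<times> {..M}"
  have fin: "finite ?A" by (simp add: finite_mi_order_le_nat)
  define b1 where "b1 p t x = (norm x + t powr (1 / \<theta>)) powr (- real CARD('n) - (real (mi_order (fst p)) + real (snd p) * \<theta>))"
    for p :: "'n multi_index \<times> nat" and t and x :: "real^'n"
  define b2 where "b2 p t x = (if snd p = 0 then t else 1) * (norm x + t powr (1 / \<theta>)) powr (- real CARD('n) - (real (mi_order (fst p)) + real (max (snd p) 1) * \<theta>))"
    for p :: "'n multi_index \<times> nat" and t and x :: "real^'n"
  have "\<exists>C. 0 \<le> C \<and> (\<forall>t x. 0 < t \<longrightarrow> \<bar>heat_deriv \<theta> (fst p) (snd p) x t\<bar> \<le> C * b1 p t x)" for p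
    by (rule heat_deriv_bound_plain[OF assms, of "fst p" "snd p"]) (auto simp: b1_def)
  then obtain C1 where C1: "\<And>p. 0 \<le> C1 p" "\<And>p t x. 0 < t \<Longrightarrow> \<bar>heat_deriv \<theta> (fst p) (snd p) x t\<bar> \<le> C1 p * b1 p t x"
    by metis
  have "\<exists>C. 0 \<le> C \<and> (\<forall>t x. 0 < t \<longrightarrow> \<bar>heat_deriv \<theta> (fst p) (snd p) x t\<bar> \<le> C * b2 p t x)" for p
    by (rule heat_deriv_bound[OF assms, of "fst p" "snd p"]) (auto simp: b2_def mult.assoc)
  then obtain C2 where C2: "\<And>p. 0 \<le> C2 p" "\<And>p t x. 0 < t \<Longrightarrow> \<bar>heat_deriv \<theta> (fst p) (snd p) x t\<bar> \<le> C2 p * b2 p t x"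
    by metis
  define C where "C = (\<Sum>p\<in>?A. C1 p) + (\<Sum>p\<in>?A. C2 p)"
  have ge: "C1 p \<le> C" "C2 p \<le> C" if "p \<in> ?A" for p
    using member_le_sum[OF that, of C1] member_le_sum[OF that, of C2] C1(1) C2(1) fin
      sum_nonneg[of ?A C1] sum_nonneg[of ?A C2] unfolding C_def by (simp_all add: add_increasing add_increasing2)
  show thesis
  proof (rule that[of C])
    show "0 \<le> C" unfolding C_def by (intro add_nonneg_nonneg sum_nonneg C1 C2)
    fix \<alpha> :: "'n multi_index" and m t and x :: "real^'n"
    assume a: "mi_order \<alpha> \<le> k" "m \<le> M" "0 < (t::real)"
    have m: "(\<alpha>, m) \<in> ?A" using a by simp
    have "\<bar>heat_deriv \<theta> \<alpha> m x t\<bar> \<le> C1 (\<alpha>, m) * b1 (\<alpha>, m) t x"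
      using C1(2)[OF a(3), of "(\<alpha>, m)" x] by simp
    also have "\<dots> \<le> C * b1 (\<alpha>, m) t x" using ge(1)[OF m] by (rule mult_right_mono) (simp add: b1_def)
    finally show "\<bar>heat_deriv \<theta> \<alpha> m x t\<bar> \<le> C * (norm x + t powr (1 / \<theta>)) powr (- real CARD('n) - (real (mi_order \<alpha>) + real m * \<theta>))"
      by (simp only: b1_def fst_conv snd_conv)
    have "\<bar>heat_deriv \<theta> \<alpha> m x t\<bar> \<le> C2 (\<alpha>, m) * b2 (\<alpha>, m) t x"
      using C2(2)[OF a(3), of "(\<alpha>, m)" x] by simp
    also have "\<dots> \<le> C * b2 (\<alpha>, m) t x" using ge(2)[OF m] by (rule mult_right_mono) (use a in \<open>simp add: b2_def\<close>)
    finally show "\<bar>heat_deriv \<theta> \<alpha> m x t\<bar> \<le> C * (if m = 0 then t else 1) * (norm x + t powr (1 / \<theta>)) powr (- real CARD('n) - (real (mi_order \<alpha>) + real (max m 1) * \<theta>))"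
      by (simp only: b2_def fst_conv snd_conv mult.assoc)
  qed
qed

section \<open>The remainder kernel\<close>

definition remainder_kernel :: "real \<Rightarrow> real \<Rightarrow> real^'n \<Rightarrow> real^'n \<Rightarrow> real \<Rightarrow> real \<Rightarrow> real" where
  "remainder_kernel \<theta> K x y t s = frac_heat_kernel \<theta> (x - y) (t - s) -
     (\<Sum>m = 0..nat \<lfloor>K / \<theta>\<rfloor>. \<Sum>\<alpha> | real (mi_order \<alpha>) \<le> K. (s + 1) ^ m * mi_power y \<alpha> * kernel_g \<theta> \<alpha> m x t)"

lemma real_le_iff_le_nat_floor: "0 \<le> K \<Longrightarrow> real n \<le> K \<longleftrightarrow> n \<le> nat \<lfloor>K\<rfloor>"
  by linarith

text \<open>The space expansion is made at time t - s; then each coefficient with |\<alpha>| \<le>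
  [K] is expanded in time from t + 1 back to t - s, the increment being -(s + 1). The top order
  spatial terms stay at time t - s. Hence \<eta> is common to all terms, whereas the intermediate
  time depends on \<alpha>, and no time that occurs lies below t - s.\<close>

lemma remainder_kernel_eq_remainders:
  fixes x y :: "real^'n"
  assumes \<theta>: "0 < \<theta>" and K: "0 \<le> K" and s: "0 \<le> s" "s < t"
  defines "k \<equiv> nat \<lfloor>K\<rfloor>" and "M \<equiv> nat \<lfloor>K / \<theta>\<rfloor>"
  obtains \<eta> \<tau> where "0 \<le> \<eta>" "\<eta> \<le> 1" "\<forall>\<alpha>. t - s \<le> \<tau> \<alpha>"
    "remainder_kernel \<theta> K x y t s =
       (\<Sum>\<alpha> | mi_order \<alpha> = Suc k. (-1) ^ mi_order \<alpha> * mi_power y \<alpha> / mi_fact \<alpha> * heat_deriv \<theta> \<alpha> 0 (x - \<eta> *\<^sub>R y) (t - s))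
     + (\<Sum>\<alpha> | mi_order \<alpha> \<le> k. (-1) ^ mi_order \<alpha> * mi_power y \<alpha> / mi_fact \<alpha> *
          (heat_deriv \<theta> \<alpha> (Suc M) x (\<tau> \<alpha>) / fact (Suc M) * (- (s + 1)) ^ Suc M))"
proof -
  have ts: "0 < t - s" "t - s < t + 1" using s by auto
  define c where "c \<alpha> = (-1) ^ mi_order \<alpha> * mi_power y \<alpha> / mi_fact \<alpha>" for \<alpha>
  define E where "E \<eta> \<longleftrightarrow> heat_deriv \<theta> (\<lambda>_. 0) 0 (x - y) (t - s) = (\<Sum>\<alpha> | mi_order \<alpha> \<le> k. c \<alpha> * heat_deriv \<theta> \<alpha> 0 x (t - s))
       + (\<Sum>\<alpha> | mi_order \<alpha> = Suc k. c \<alpha> * heat_deriv \<theta> \<alpha> 0 (x - \<eta> *\<^sub>R y) (t - s))" for \<eta>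
  have "\<exists>\<eta>. 0 \<le> \<eta> \<and> \<eta> \<le> 1 \<and> E \<eta>"
    unfolding E_def c_def by (rule heat_deriv_space_Taylor[OF \<theta> ts(1), of x y k]) (rule exI, intro conjI)
  then obtain \<eta> where \<eta>: "0 \<le> \<eta>" "\<eta> \<le> 1" "E \<eta>" by blast
  define P where "P \<alpha> = (\<Sum>m<Suc M. heat_deriv \<theta> \<alpha> m x (t + 1) / fact m * ((t - s) - (t + 1)) ^ m)" for \<alpha>
  define F where "F \<alpha> \<tau> \<longleftrightarrow> heat_deriv \<theta> \<alpha> 0 x (t - s) = P \<alpha>
      + heat_deriv \<theta> \<alpha> (Suc M) x \<tau> / fact (Suc M) * ((t - s) - (t + 1)) ^ Suc M" for \<alpha> \<tau>
  have "\<exists>\<tau>. t - s \<le> \<tau> \<and> \<tau> \<le> t + 1 \<and> F \<alpha> \<tau>" for \<alpha>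
    unfolding F_def P_def by (rule heat_deriv_time_Taylor[OF \<theta> ts, of \<alpha> x M]) (rule exI, intro conjI)
  then obtain \<tau> where \<tau>: "\<And>\<alpha>. t - s \<le> \<tau> \<alpha>" "\<And>\<alpha>. \<tau> \<alpha> \<le> t + 1" "\<And>\<alpha>. F \<alpha> (\<tau> \<alpha>)"
    by metis
  have d: "(t - s) - (t + 1) = - (s + 1)" by simp
  have A: "{\<alpha> :: 'n multi_index. real (mi_order \<alpha>) \<le> K} = {\<alpha>. mi_order \<alpha> \<le> k}"
    using K by (simp only: real_le_iff_le_nat_floor k_def)
  have I: "{0..M} = {..<Suc M}" by auto
  have "(\<Sum>m = 0..M. \<Sum>\<alpha> | real (mi_order \<alpha>) \<le> K. (s + 1) ^ m * mi_power y \<alpha> * kernel_g \<theta> \<alpha> m x t)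
      = (\<Sum>m<Suc M. \<Sum>\<alpha> | mi_order \<alpha> \<le> k. c \<alpha> * (heat_deriv \<theta> \<alpha> m x (t + 1) / fact m * (- (s + 1)) ^ m))"
    unfolding A I
  proof (intro sum.cong refl)
    fix m and \<alpha> :: "'n multi_index"
    have g: "kernel_g \<theta> \<alpha> m x t = (-1) ^ (mi_order \<alpha> + m) / (mi_fact \<alpha> * fact m) * heat_deriv \<theta> \<alpha> m x (t + 1)"
      using s by (intro kernel_g_eq_heat_deriv \<theta>) simp
    have "(- (s + 1)) ^ m = (-1) ^ m * (s + 1) ^ m" by (rule power_minus)
    then show "(s + 1) ^ m * mi_power y \<alpha> * kernel_g \<theta> \<alpha> m x t = c \<alpha> * (heat_deriv \<theta> \<alpha> m x (t + 1) / fact m * (- (s + 1)) ^ m)"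
      unfolding g c_def by (simp add: power_add)
  qed
  also have "\<dots> = (\<Sum>\<alpha> | mi_order \<alpha> \<le> k. c \<alpha> * (\<Sum>m<Suc M. heat_deriv \<theta> \<alpha> m x (t + 1) / fact m * (- (s + 1)) ^ m))"
    by (subst sum.swap) (simp only: sum_distrib_left)
  finally have W: "(\<Sum>m = 0..M. \<Sum>\<alpha> | real (mi_order \<alpha>) \<le> K. (s + 1) ^ m * mi_power y \<alpha> * kernel_g \<theta> \<alpha> m x t)
      = (\<Sum>\<alpha> | mi_order \<alpha> \<le> k. c \<alpha> * (\<Sum>m<Suc M. heat_deriv \<theta> \<alpha> m x (t + 1) / fact m * (- (s + 1)) ^ m))" .
  define R where "R \<alpha> = heat_deriv \<theta> \<alpha> (Suc M) x (\<tau> \<alpha>) / fact (Suc M) * (- (s + 1)) ^ Suc M" for \<alpha>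
  have PR: "heat_deriv \<theta> \<alpha> 0 x (t - s) = P \<alpha> + R \<alpha>" for \<alpha>
    using \<tau>(3)[of \<alpha>] unfolding F_def R_def d .
  have "(\<Sum>\<alpha> | mi_order \<alpha> \<le> k. c \<alpha> * heat_deriv \<theta> \<alpha> 0 x (t - s)) = (\<Sum>\<alpha> | mi_order \<alpha> \<le> k. c \<alpha> * P \<alpha>) + (\<Sum>\<alpha> | mi_order \<alpha> \<le> k. c \<alpha> * R \<alpha>)"
    by (simp only: PR distrib_left sum.distrib)
  then have G: "frac_heat_kernel \<theta> (x - y) (t - s) = (\<Sum>\<alpha> | mi_order \<alpha> \<le> k. c \<alpha> * P \<alpha>)
      + (\<Sum>\<alpha> | mi_order \<alpha> \<le> k. c \<alpha> * R \<alpha>)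
      + (\<Sum>\<alpha> | mi_order \<alpha> = Suc k. c \<alpha> * heat_deriv \<theta> \<alpha> 0 (x - \<eta> *\<^sub>R y) (t - s))"
    using \<eta>(3) unfolding E_def frac_heat_kernel_eq_heat_deriv[OF \<theta> ts(1)] by linarith
  have "remainder_kernel \<theta> K x y t s = (\<Sum>\<alpha> | mi_order \<alpha> = Suc k. c \<alpha> * heat_deriv \<theta> \<alpha> 0 (x - \<eta> *\<^sub>R y) (t - s))
      + (\<Sum>\<alpha> | mi_order \<alpha> \<le> k. c \<alpha> * R \<alpha>)"
    using W G unfolding remainder_kernel_def M_def[symmetric] P_def d by linarith
  then show thesis unfolding c_def R_def using \<tau>(1) by (intro that[OF \<eta>(1,2)]) simp_all
qed

lemma abs_sum_le_card:
  fixes g :: "'a \<Rightarrow> real"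
  assumes "\<And>a. a \<in> A \<Longrightarrow> \<bar>g a\<bar> \<le> B"
  shows "\<bar>sum g A\<bar> \<le> real (card A) * B"
proof -
  have "\<bar>sum g A\<bar> \<le> (\<Sum>a\<in>A. \<bar>g a\<bar>)" by (rule sum_abs)
  also have "\<dots> \<le> real (card A) * B" by (rule sum_bounded_above) (use assms in auto)
  finally show ?thesis .
qed

lemma abs_coeff_le: "\<bar>(-1) ^ mi_order \<alpha> * mi_power y \<alpha> / mi_fact \<alpha>\<bar> \<le> norm y ^ mi_order \<alpha>"
proof -
  have "\<bar>(-1) ^ mi_order \<alpha> * mi_power y \<alpha> / mi_fact \<alpha>\<bar> = \<bar>mi_power y \<alpha>\<bar> / mi_fact \<alpha>"
    by (simp add: abs_mult power_abs abs_of_pos)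
  also have "\<dots> \<le> \<bar>mi_power y \<alpha>\<bar> / 1" by (intro divide_left_mono) (auto simp: mi_fact_ge_1)
  also have "\<dots> \<le> norm y ^ mi_order \<alpha>" using abs_mi_power_le by simp
  finally show ?thesis .
qed

text \<open>The quotient of the two sides is (z/X)^(\<kappa> - \<kappa>'), which is at most 1. In
  this way remainders of different homogeneity are all reduced to the smallest one.\<close>

lemma powr_ratio_mono:
  fixes z X \<kappa> \<kappa>' N :: real
  assumes "0 < z" "z \<le> X" "\<kappa>' \<le> \<kappa>"
  shows "z powr \<kappa> * X powr (- N - \<kappa>) \<le> z powr \<kappa>' * X powr (- N - \<kappa>')"
proof -
  have X: "0 < X" using assms by linarith
  have "z powr \<kappa> * X powr (- N - \<kappa>) = (z powr \<kappa>' * X powr (- N - \<kappa>')) * (z powr (\<kappa> - \<kappa>') * X powr (- (\<kappa> - \<kappa>')))"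
  proof -
    have "z powr \<kappa> = z powr \<kappa>' * z powr (\<kappa> - \<kappa>')" "X powr (- N - \<kappa>) = X powr (- N - \<kappa>') * X powr (- (\<kappa> - \<kappa>'))"
      by (simp_all flip: powr_add)
    then show ?thesis by simp
  qed
  also have "z powr (\<kappa> - \<kappa>') * X powr (- (\<kappa> - \<kappa>')) = (z / X) powr (\<kappa> - \<kappa>')"
  proof -
    have "(z / X) powr (\<kappa> - \<kappa>') = z powr (\<kappa> - \<kappa>') / X powr (\<kappa> - \<kappa>')" using assms X by (simp add: powr_divide)
    then show ?thesis by (simp only: powr_minus divide_inverse)
  qed
  also have "(z powr \<kappa>' * X powr (- N - \<kappa>')) * (z / X) powr (\<kappa> - \<kappa>') \<le> (z powr \<kappa>' * X powr (- N - \<kappa>')) * 1"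
    using assms X by (intro mult_left_mono powr_le1) auto
  finally show ?thesis by simp
qed

text \<open>The choice of \<open>\<epsilon>\<close> keeps all intermediate points of the Taylor expansions as far from the space-time
  origin as \<open>(x, t + 1)\<close>, up to the factor \<open>\<epsilon>\<close>: if \<open>|x|\<close> is small against \<open>\<rho>\<close>, then \<open>s\<close> is small
  against \<open>t\<close>.\<close>

lemma taylor_zone_lower_bound:
  fixes x y :: "real^'n"
  assumes \<theta>: "0 < \<theta>" and s: "0 \<le> s" "s < t"
  defines "\<epsilon> \<equiv> 2 powr (- 2 - 1 / \<theta>)" and "\<rho> \<equiv> (t + 1) powr (1 / \<theta>)"
  assumes z: "norm y + (s + 1) powr (1 / \<theta>) \<le> \<epsilon> * (norm x + \<rho>)"
    and \<eta>: "0 \<le> \<eta>" "\<eta> \<le> 1" and \<tau>: "t - s \<le> \<tau>"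
  shows "\<epsilon> * (norm x + \<rho>) \<le> norm (x - \<eta> *\<^sub>R y) + \<tau> powr (1 / \<theta>)"
proof -
  let ?X = "norm x + \<rho>"
  have \<rho>: "\<rho> > 0" using s by (simp add: \<rho>_def)
  have X: "?X > 0" using \<rho> by (simp add: add_nonneg_pos)
  have "2 powr (- 2 - 1 / \<theta>) \<le> 2 powr (- 2::real)" using \<theta> by (intro powr_mono) auto
  then have e4: "\<epsilon> \<le> 1 / 4" by (simp add: \<epsilon>_def powr_minus)
  have e0: "\<epsilon> > 0" by (simp add: \<epsilon>_def)
  have y: "norm y \<le> \<epsilon> * ?X" and sX: "(s + 1) powr (1 / \<theta>) \<le> \<epsilon> * ?X"
    using z norm_ge_zero[of y] powr_ge_zero[of "s + 1" "1 / \<theta>"] by linarith+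
  have eX: "\<epsilon> * ?X \<le> ?X / 4" using mult_right_mono[OF e4, of ?X] X by simp
  show ?thesis
  \<comment> \<open>At least half of X comes either from |x| or from \<rho>. In the first case the
    moved space point keeps a fixed part of X, in the second the time \<tau> does.\<close>
  proof (cases "?X / 2 \<le> norm x")
    case True
    have "norm x \<le> norm (x - \<eta> *\<^sub>R y) + norm (\<eta> *\<^sub>R y)" using norm_triangle_ineq[of "x - \<eta> *\<^sub>R y" "\<eta> *\<^sub>R y"] by simp
    moreover have "norm (\<eta> *\<^sub>R y) \<le> norm y" using \<eta> by (simp add: mult_left_le_one_le)
    ultimately have "?X / 4 \<le> norm (x - \<eta> *\<^sub>R y)" using True y eX by linarith
    then show ?thesis using eX powr_ge_zero[of \<tau> "1 / \<theta>"] by linarith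
  next
    case False
    then have X2: "?X \<le> 2 * \<rho>" by (simp add: field_simps)
    then have "(s + 1) powr (1 / \<theta>) \<le> \<epsilon> * (2 * \<rho>)" using sX mult_left_mono[OF X2 less_imp_le[OF e0]] by linarith
    then have "((s + 1) powr (1 / \<theta>)) powr \<theta> \<le> (\<epsilon> * 2 * \<rho>) powr \<theta>" using \<theta> by (intro powr_mono2) auto
    moreover have "((s + 1) powr (1 / \<theta>)) powr \<theta> = s + 1" "\<rho> powr \<theta> = t + 1"
      using \<theta> s by (simp_all add: powr_powr \<rho>_def)
    moreover have "(\<epsilon> * 2 * \<rho>) powr \<theta> = (\<epsilon> * 2) powr \<theta> * \<rho> powr \<theta>" by (rule powr_mult)
    ultimately have "s + 1 \<le> (\<epsilon> * 2) powr \<theta> * (t + 1)" by (simp only:)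
    \<comment> \<open>The value of \<epsilon> is made for this step: (2 \<epsilon>)^\<theta> =
      2^(-\<theta>-1) \<le> 1/2 gives s + 1 \<le> (t + 1)/2, and therefore t - s = (t + 1) - (s + 1)
      is still at least (t + 1)/2.\<close>
    also have "(\<epsilon> * 2) powr \<theta> = 2 powr (- \<theta> - 1)"
    proof -
      have "\<epsilon> * 2 = 2 powr (- 1 - 1 / \<theta>)" unfolding \<epsilon>_def using powr_add[of 2 "- 2 - 1 / \<theta>" 1] by simp
      moreover have "(- 1 - 1 / \<theta>) * \<theta> = - \<theta> - 1" using \<theta> by (simp add: left_diff_distrib)
      ultimately show ?thesis by (simp only: powr_powr)
    qed
    also have "\<dots> \<le> 2 powr (- 1)" using \<theta> by (intro powr_mono) auto
    also have "(2::real) powr (- 1) = 1 / 2" by (simp add: powr_minus)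
    finally have "s + 1 \<le> 1 / 2 * (t + 1)" using s by simp
    then have "(t + 1) / 2 \<le> \<tau>" using \<tau> by (simp add: field_simps)
    then have "((t + 1) / 2) powr (1 / \<theta>) \<le> \<tau> powr (1 / \<theta>)" using \<theta> s by (intro powr_mono2) auto
    moreover have "((t + 1) / 2) powr (1 / \<theta>) = \<rho> * 2 powr (- 1 / \<theta>)"
    proof -
      have "((t + 1) / 2) powr (1 / \<theta>) = \<rho> / 2 powr (1 / \<theta>)" using s by (simp add: \<rho>_def powr_divide)
      moreover have "(2::real) powr (- 1 / \<theta>) = inverse (2 powr (1 / \<theta>))" using powr_minus[of 2 "1 / \<theta>"] by simp
      ultimately show ?thesis by (simp only: divide_inverse)
    qed
    moreover have "\<epsilon> * (2 * \<rho>) \<le> \<rho> * 2 powr (- 1 / \<theta>)"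
    proof -
      have "\<epsilon> * 2 = 2 powr (- 1 - 1 / \<theta>)" unfolding \<epsilon>_def using powr_add[of 2 "- 2 - 1 / \<theta>" 1] by simp
      also have "\<dots> \<le> 2 powr (- 1 / \<theta>)" by (intro powr_mono) auto
      finally have "(\<epsilon> * 2) * \<rho> \<le> 2 powr (- 1 / \<theta>) * \<rho>" using \<rho> by (intro mult_right_mono) auto
      then show ?thesis by (simp only: mult_ac)
    qed
    moreover have "\<epsilon> * ?X \<le> \<epsilon> * (2 * \<rho>)" using X2 e0 by (intro mult_left_mono) auto
    ultimately show ?thesis using norm_ge_zero[of "x - \<eta> *\<^sub>R y"] by linarith
  qed
qed

text \<open>Since |y| \<le> z and s + 1 \<le> z^\<theta>, a remainder of order j in space and m in
  time is of size z^p X^(-N-p) with p = j + m \<theta>. Every such p is at least \<kappa>, the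
  smaller of the first omitted orders in space and in time, and z \<le> X allows p to be lowered to
  \<kappa>.\<close>

lemma remainder_kernel_taylor_zone:
  assumes \<theta>: "0 < \<theta>" and K: "0 \<le> K"
  defines "\<epsilon> \<equiv> 2 powr (- 2 - 1 / \<theta>)"
    and "\<kappa> \<equiv> min (real (Suc (nat \<lfloor>K\<rfloor>))) (real (Suc (nat \<lfloor>K / \<theta>\<rfloor>)) * \<theta>)"
  obtains C where "0 \<le> C" "\<And>(x::real^'n) y t s. 0 \<le> s \<Longrightarrow> s < t \<Longrightarrow>
     norm y + (s + 1) powr (1 / \<theta>) \<le> \<epsilon> * (norm x + (t + 1) powr (1 / \<theta>)) \<Longrightarrow>
     \<bar>remainder_kernel \<theta> K x y t s\<bar> \<le> C * ((norm y + (s + 1) powr (1 / \<theta>)) powr \<kappa> * (norm x + (t + 1) powr (1 / \<theta>)) powr (- real CARD('n) - \<kappa>))"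
proof -
  define k where "k = nat \<lfloor>K\<rfloor>"
  define M where "M = nat \<lfloor>K / \<theta>\<rfloor>"
  let ?N = "real CARD('n)"
  \<comment> \<open>An upper bound for every order that occurs: as \<epsilon> \<le> 1, the single
    constant \<epsilon>^(-N-\<kappa>1) dominates the powers of \<epsilon> from all terms.\<close>
  define \<kappa>1 where "\<kappa>1 = real (Suc k) + real (Suc M) * \<theta>"
  have \<kappa>: "\<kappa> \<le> real (Suc k)" "\<kappa> \<le> real (Suc M) * \<theta>" unfolding \<kappa>_def k_def M_def by auto
  have \<kappa>1: "\<kappa>1 \<ge> 0" using \<theta> by (simp add: \<kappa>1_def)
  obtain C where C: "0 \<le> C" "\<And>\<alpha> m t (x::real^'n). mi_order \<alpha> \<le> Suc k \<Longrightarrow> m \<le> Suc M \<Longrightarrow> 0 < t \<Longrightarrow>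
       \<bar>heat_deriv \<theta> \<alpha> m x t\<bar> \<le> C * (norm x + t powr (1 / \<theta>)) powr (- ?N - (real (mi_order \<alpha>) + real m * \<theta>))"
    by (rule heat_deriv_bounds_uniform[OF \<theta>, of "Suc k" "Suc M"]) blast
  have e0: "\<epsilon> > 0" by (simp add: \<epsilon>_def)
  have "0 < 1 / \<theta>" using \<theta> by simp
  then have "2 powr (- 2 - 1 / \<theta>) \<le> 2 powr 0" by (intro powr_mono) linarith+
  then have e1: "\<epsilon> \<le> 1" by (simp add: \<epsilon>_def)
  define A where "A = C * \<epsilon> powr (- ?N - \<kappa>1)"
  have A: "0 \<le> A" using C by (simp add: A_def)
  define c1 where "c1 = real (card {\<alpha> :: 'n multi_index. mi_order \<alpha> = Suc k})"
  define c2 where "c2 = real (card {\<alpha> :: 'n multi_index. mi_order \<alpha> \<le> k})"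
  show thesis
  proof (rule that[of "(c1 + c2) * A"])
    show "0 \<le> (c1 + c2) * A" using A by (simp add: c1_def c2_def)
    fix x y :: "real^'n" and t s :: real
    assume s: "0 \<le> s" "s < t"
    define z where "z = norm y + (s + 1) powr (1 / \<theta>)"
    define X where "X = norm x + (t + 1) powr (1 / \<theta>)"
    assume "norm y + (s + 1) powr (1 / \<theta>) \<le> \<epsilon> * (norm x + (t + 1) powr (1 / \<theta>))"
    then have zX: "z \<le> \<epsilon> * X" by (simp add: z_def X_def)
    have z0: "z > 0" using s by (simp add: z_def add_nonneg_pos)
    have X0: "X > 0" using s by (simp add: X_def add_nonneg_pos)
    have "\<epsilon> * X \<le> 1 * X" using e1 X0 by (intro mult_right_mono) auto
    then have zX1: "z \<le> X" using zX by simp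
    have yz: "norm y \<le> z" by (simp add: z_def)
    have sz: "s + 1 \<le> z powr \<theta>"
    proof -
      have "((s + 1) powr (1 / \<theta>)) powr \<theta> \<le> z powr \<theta>" using \<theta> by (intro powr_mono2) (auto simp: z_def)
      then show ?thesis using \<theta> s by (simp add: powr_powr)
    qed
    have lower: "\<epsilon> * X \<le> norm (x - \<eta> *\<^sub>R y) + \<tau> powr (1 / \<theta>)" if "0 \<le> \<eta>" "\<eta> \<le> 1" "t - s \<le> \<tau>" for \<eta> \<tau>
      using taylor_zone_lower_bound[OF \<theta> s, of y x \<eta> \<tau>] that zX by (simp add: \<epsilon>_def X_def z_def)
    have P: "\<bar>heat_deriv \<theta> \<alpha> m (x - \<eta> *\<^sub>R y) \<tau>\<bar> \<le> A * X powr (- ?N - (real (mi_order \<alpha>) + real m * \<theta>))"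
      if \<alpha>: "mi_order \<alpha> \<le> Suc k" and m: "m \<le> Suc M" and h: "0 \<le> \<eta>" "\<eta> \<le> 1" "t - s \<le> \<tau>" for \<alpha> :: "'n multi_index" and m \<eta> \<tau>
    proof -
      let ?p = "- ?N - (real (mi_order \<alpha>) + real m * \<theta>)"
      have "real (mi_order \<alpha>) + real m * \<theta> \<le> \<kappa>1"
        unfolding \<kappa>1_def using \<alpha> m \<theta> by (intro add_mono mult_right_mono) auto
      then have p: "- ?N - \<kappa>1 \<le> ?p" by simp
      have "0 \<le> real (mi_order \<alpha>) + real m * \<theta>" using \<theta> by simp
      then have p0: "?p \<le> 0" by linarith
      have "0 < \<tau>" using h s by linarith
      then have "\<bar>heat_deriv \<theta> \<alpha> m (x - \<eta> *\<^sub>R y) \<tau>\<bar> \<le> C * (norm (x - \<eta> *\<^sub>R y) + \<tau> powr (1 / \<theta>)) powr ?p"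
        by (intro C(2) \<alpha> m)
      also have "\<dots> \<le> C * (\<epsilon> * X) powr ?p"
        using lower[OF h] e0 X0 p0 by (intro mult_left_mono C(1) powr_mono2') auto
      also have "\<dots> = C * \<epsilon> powr ?p * X powr ?p" using e0 X0 by (simp add: powr_mult)
      also have "\<dots> \<le> C * \<epsilon> powr (- ?N - \<kappa>1) * X powr ?p"
        using e0 e1 C(1) p by (intro mult_right_mono mult_left_mono powr_mono') auto
      finally show ?thesis by (simp add: A_def)
    qed
    obtain \<eta> \<tau> where \<eta>: "0 \<le> \<eta>" "\<eta> \<le> 1" and \<tau>: "\<forall>\<alpha>. t - s \<le> \<tau> \<alpha>"
      and S: "remainder_kernel \<theta> K x y t s =
       (\<Sum>\<alpha> | mi_order \<alpha> = Suc k. (-1) ^ mi_order \<alpha> * mi_power y \<alpha> / mi_fact \<alpha> * heat_deriv \<theta> \<alpha> 0 (x - \<eta> *\<^sub>R y) (t - s))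
     + (\<Sum>\<alpha> | mi_order \<alpha> \<le> k. (-1) ^ mi_order \<alpha> * mi_power y \<alpha> / mi_fact \<alpha> *
          (heat_deriv \<theta> \<alpha> (Suc M) x (\<tau> \<alpha>) / fact (Suc M) * (- (s + 1)) ^ Suc M))"
      by (rule remainder_kernel_eq_remainders[OF \<theta> K s, of x y, folded k_def M_def]) (rule that, assumption+)
    let ?B = "A * (z powr \<kappa> * X powr (- ?N - \<kappa>))"
    have "\<bar>\<Sum>\<alpha> | mi_order \<alpha> = Suc k. (-1) ^ mi_order \<alpha> * mi_power y \<alpha> / mi_fact \<alpha> * heat_deriv \<theta> \<alpha> 0 (x - \<eta> *\<^sub>R y) (t - s)\<bar> \<le> c1 * ?B"
      unfolding c1_def
    proof (rule abs_sum_le_card)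
      fix \<alpha> :: "'n multi_index" assume "\<alpha> \<in> {\<alpha>. mi_order \<alpha> = Suc k}"
      then have \<alpha>: "mi_order \<alpha> = Suc k" by simp
      have "\<bar>heat_deriv \<theta> \<alpha> 0 (x - \<eta> *\<^sub>R y) (t - s)\<bar> \<le> A * X powr (- ?N - (real (mi_order \<alpha>) + real 0 * \<theta>))"
        using \<alpha> \<eta> by (intro P) auto
      then have "\<bar>(-1) ^ mi_order \<alpha> * mi_power y \<alpha> / mi_fact \<alpha> * heat_deriv \<theta> \<alpha> 0 (x - \<eta> *\<^sub>R y) (t - s)\<bar>
          \<le> norm y ^ mi_order \<alpha> * (A * X powr (- ?N - (real (mi_order \<alpha>) + real 0 * \<theta>)))"
        unfolding abs_mult[of _ "heat_deriv _ _ _ _ _"] by (intro mult_mono abs_coeff_le) auto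
      also have "\<dots> \<le> z ^ Suc k * (A * X powr (- ?N - real (Suc k)))"
        unfolding \<alpha> using yz A z0 by (intro mult_mono power_mono zero_le_power) auto
      also have "\<dots> = A * (z powr real (Suc k) * X powr (- ?N - real (Suc k)))"
        using z0 by (simp only: powr_realpow mult.left_commute)
      also have "\<dots> \<le> ?B" by (intro mult_left_mono powr_ratio_mono z0 zX1 \<kappa> A)
      finally show "\<bar>(-1) ^ mi_order \<alpha> * mi_power y \<alpha> / mi_fact \<alpha> * heat_deriv \<theta> \<alpha> 0 (x - \<eta> *\<^sub>R y) (t - s)\<bar> \<le> ?B" .
    qed
    moreover have "\<bar>\<Sum>\<alpha> | mi_order \<alpha> \<le> k. (-1) ^ mi_order \<alpha> * mi_power y \<alpha> / mi_fact \<alpha> *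
          (heat_deriv \<theta> \<alpha> (Suc M) x (\<tau> \<alpha>) / fact (Suc M) * (- (s + 1)) ^ Suc M)\<bar> \<le> c2 * ?B"
      unfolding c2_def
    proof (rule abs_sum_le_card)
      fix \<alpha> :: "'n multi_index" assume "\<alpha> \<in> {\<alpha>. mi_order \<alpha> \<le> k}"
      then have \<alpha>: "mi_order \<alpha> \<le> Suc k" by simp
      let ?p = "real (mi_order \<alpha>) + real (Suc M) * \<theta>"
      have "\<bar>heat_deriv \<theta> \<alpha> (Suc M) (x - 0 *\<^sub>R y) (\<tau> \<alpha>)\<bar> \<le> A * X powr (- ?N - ?p)"
        using \<alpha> \<tau> by (intro P) auto
      then have P1: "\<bar>heat_deriv \<theta> \<alpha> (Suc M) x (\<tau> \<alpha>)\<bar> \<le> A * X powr (- ?N - ?p)" by simp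
      have "\<bar>heat_deriv \<theta> \<alpha> (Suc M) x (\<tau> \<alpha>)\<bar> / fact (Suc M) \<le> \<bar>heat_deriv \<theta> \<alpha> (Suc M) x (\<tau> \<alpha>)\<bar> / 1"
        by (intro divide_left_mono fact_ge_1) auto
      then have P2: "\<bar>heat_deriv \<theta> \<alpha> (Suc M) x (\<tau> \<alpha>)\<bar> / fact (Suc M) \<le> A * X powr (- ?N - ?p)" using P1 by linarith
      have "\<bar>(- (s + 1)) ^ Suc M\<bar> = (s + 1) ^ Suc M" using s by (simp only: power_abs abs_minus_cancel abs_of_nonneg add_nonneg_nonneg zero_le_one)
      also have "\<dots> \<le> (z powr \<theta>) ^ Suc M" using sz s by (intro power_mono) auto
      finally have P3: "\<bar>(- (s + 1)) ^ Suc M\<bar> \<le> (z powr \<theta>) ^ Suc M" .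
      have "\<bar>(-1) ^ mi_order \<alpha> * mi_power y \<alpha> / mi_fact \<alpha> * (heat_deriv \<theta> \<alpha> (Suc M) x (\<tau> \<alpha>) / fact (Suc M) * (- (s + 1)) ^ Suc M)\<bar>
          = \<bar>(-1) ^ mi_order \<alpha> * mi_power y \<alpha> / mi_fact \<alpha>\<bar> * (\<bar>heat_deriv \<theta> \<alpha> (Suc M) x (\<tau> \<alpha>)\<bar> / fact (Suc M) * \<bar>(- (s + 1)) ^ Suc M\<bar>)"
        by (simp only: abs_mult[of "_ / _" "_ * _"] abs_mult[of "_ / _" "_ ^ _"] abs_divide[of "heat_deriv _ _ _ _ _"] abs_of_pos[OF fact_gt_zero])
      also have "\<dots> \<le> norm y ^ mi_order \<alpha> * (A * X powr (- ?N - ?p) * (z powr \<theta>) ^ Suc M)"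
        using A by (intro mult_mono abs_coeff_le P2 P3 mult_nonneg_nonneg divide_nonneg_nonneg) auto
      also have "\<dots> \<le> z ^ mi_order \<alpha> * (A * X powr (- ?N - ?p) * (z powr \<theta>) ^ Suc M)"
        using yz A by (intro mult_right_mono power_mono) auto
      also have "\<dots> = A * ((z ^ mi_order \<alpha> * (z powr \<theta>) ^ Suc M) * X powr (- ?N - ?p))" by (simp only: mult_ac)
      also have "z ^ mi_order \<alpha> * (z powr \<theta>) ^ Suc M = z powr ?p"
        using z0 by (simp add: powr_add powr_realpow powr_power del: of_nat_Suc power_Suc)
      also have "A * (z powr ?p * X powr (- ?N - ?p)) \<le> ?B"
        using \<kappa>(2) by (intro mult_left_mono powr_ratio_mono z0 zX1 A) simp
      finally show "\<bar>(-1) ^ mi_order \<alpha> * mi_power y \<alpha> / mi_fact \<alpha> * (heat_deriv \<theta> \<alpha> (Suc M) x (\<tau> \<alpha>) / fact (Suc M) * (- (s + 1)) ^ Suc M)\<bar> \<le> ?B" .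
    qed
    ultimately have "\<bar>remainder_kernel \<theta> K x y t s\<bar> \<le> c1 * ?B + c2 * ?B" unfolding S by linarith
    also have "\<dots> = (c1 + c2) * A * (z powr \<kappa> * X powr (- ?N - \<kappa>))" by (simp add: algebra_simps)
    finally show "\<bar>remainder_kernel \<theta> K x y t s\<bar> \<le> (c1 + c2) * A * ((norm y + (s + 1) powr (1 / \<theta>)) powr \<kappa> * (norm x + (t + 1) powr (1 / \<theta>)) powr (- ?N - \<kappa>))"
      unfolding z_def X_def .
  qed
qed

text \<open>Without any cancellation, z > \<epsilon> X allows each factor X to be traded for z, and
  z \<ge> \<epsilon> \<rho> allows negative powers of z to be traded for \<rho>. For the heat kernel
  this reads |x|^l \<le> C z^l = C z^K z^(l-K) \<le> C' z^K \<rho>^(l-K). The terms of the profile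
  use part of their own decay as well.\<close>

lemma remainder_kernel_crude_zone:
  assumes \<theta>: "0 < \<theta>" and l: "0 \<le> l" "l \<le> K" and d: "0 < d" "d \<le> \<theta> / 2" and e: "0 < \<epsilon>" "\<epsilon> \<le> 1"
  obtains C where "0 \<le> C" "\<And>(x::real^'n) y t s. 0 \<le> s \<Longrightarrow> s < t \<Longrightarrow>
     \<epsilon> * (norm x + (t + 1) powr (1 / \<theta>)) < norm y + (s + 1) powr (1 / \<theta>) \<Longrightarrow>
     norm x powr l * \<bar>remainder_kernel \<theta> K x y t s\<bar> \<le> C * (((t + 1) powr (1 / \<theta>)) powr (l - K) * (norm y + (s + 1) powr (1 / \<theta>)) powr K *
       (decay_kernel d ((t - s) powr (1 / \<theta>)) (x - y) + decay_kernel d ((t + 1) powr (1 / \<theta>)) x))"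
proof -
  define k where "k = nat \<lfloor>K\<rfloor>"
  define M where "M = nat \<lfloor>K / \<theta>\<rfloor>"
  let ?N = "real CARD('n)"
  obtain C where C: "0 \<le> C" "\<And>\<alpha> m t (x::real^'n). mi_order \<alpha> \<le> k \<Longrightarrow> m \<le> M \<Longrightarrow> 0 < t \<Longrightarrow>
       \<bar>heat_deriv \<theta> \<alpha> m x t\<bar> \<le> C * (if m = 0 then t else 1) * (norm x + t powr (1 / \<theta>)) powr (- ?N - (real (mi_order \<alpha>) + real (max m 1) * \<theta>))"
    by (rule heat_deriv_bounds_uniform[OF \<theta>, of k M]) blast
  define c where "c = real (card {\<alpha> :: 'n multi_index. real (mi_order \<alpha>) \<le> K})"
  define B where "B = C * \<epsilon> powr (- K)"
  have B: "0 \<le> B" using C by (simp add: B_def)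
  show thesis
  proof (rule that[of "(1 + real (card {0..M}) * c) * B"])
    show "0 \<le> (1 + real (card {0..M}) * c) * B" using B by (simp add: c_def)
    fix x y :: "real^'n" and t s :: real
    assume s: "0 \<le> s" "s < t"
    define z where "z = norm y + (s + 1) powr (1 / \<theta>)"
    define \<rho> where "\<rho> = (t + 1) powr (1 / \<theta>)"
    define X where "X = norm x + \<rho>"
    define r where "r = (t - s) powr (1 / \<theta>)"
    define Z where "Z = \<rho> powr (l - K) * z powr K"
    assume "\<epsilon> * (norm x + (t + 1) powr (1 / \<theta>)) < norm y + (s + 1) powr (1 / \<theta>)"
    then have zX: "\<epsilon> * X < z" by (simp add: z_def X_def \<rho>_def)
    have \<rho>0: "0 < \<rho>" using s by (simp add: \<rho>_def)
    have r0: "0 < r" using s by (simp add: r_def)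
    have \<rho>t: "\<rho> powr \<theta> = t + 1" using s \<theta> by (simp add: \<rho>_def powr_powr)
    have rt: "r powr \<theta> = t - s" using s \<theta> by (simp add: r_def powr_powr)
    have X: "\<rho> \<le> X" "norm x \<le> X" "0 < X" using \<rho>0 norm_ge_zero[of x] unfolding X_def by linarith+
    have "\<epsilon> * \<rho> \<le> \<epsilon> * X" using X e by (intro mult_left_mono) auto
    then have ze: "\<epsilon> * \<rho> \<le> z" using zX by linarith
    have z0: "0 < z" using zX e X by (smt (verit) mult_pos_pos)
    have yz: "norm y \<le> z" by (simp add: z_def)
    have Z0: "0 \<le> Z" by (simp add: Z_def)
    have Xl: "X powr p \<le> \<epsilon> powr (- p) * z powr p" if "0 \<le> p" for p
    proof -
      have "X powr p \<le> (z / \<epsilon>) powr p" using zX e X that by (intro powr_mono2) (auto simp: field_simps)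
      also have "\<dots> = z powr p / \<epsilon> powr p" using z0 e by (simp add: powr_divide)
      also have "\<dots> = \<epsilon> powr (- p) * z powr p" by (simp add: powr_minus divide_inverse)
      finally show ?thesis .
    qed
    have zneg: "z powr p \<le> \<epsilon> powr p * \<rho> powr p" if "p \<le> 0" for p
    proof -
      have "z powr p \<le> (\<epsilon> * \<rho>) powr p" using ze e \<rho>0 that by (intro powr_mono2') auto
      also have "\<dots> = \<epsilon> powr p * \<rho> powr p" using e \<rho>0 by (simp add: powr_mult)
      finally show ?thesis .
    qed
    have G: "norm x powr l * \<bar>frac_heat_kernel \<theta> (x - y) (t - s)\<bar> \<le> B * (Z * decay_kernel d r (x - y))"
    proof -
      have "\<bar>heat_deriv \<theta> (\<lambda>_. 0) 0 (x - y) (t - s)\<bar> \<le> C * (if (0::nat) = 0 then t - s else 1) * (norm (x - y) + (t - s) powr (1 / \<theta>)) powr (- ?N - (real (mi_order (\<lambda>_::'n. 0)) + real (max 0 1) * \<theta>))"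
        using s by (intro C(2)) (auto simp: mi_order_def)
      also have "\<dots> = C * decay_kernel \<theta> r (x - y)" unfolding decay_kernel_def rt by (simp add: r_def mi_order_def)
      also have "\<dots> \<le> C * decay_kernel d r (x - y)" using C d \<theta> r0 by (intro mult_left_mono decay_kernel_antimono) auto
      finally have 1: "\<bar>frac_heat_kernel \<theta> (x - y) (t - s)\<bar> \<le> C * decay_kernel d r (x - y)"
        using frac_heat_kernel_eq_heat_deriv[OF \<theta>, of "t - s" "x - y"] s by simp
      have "norm x powr l \<le> X powr l" using X l by (intro powr_mono2) auto
      also have "\<dots> \<le> \<epsilon> powr (- l) * z powr l" using l(1) by (rule Xl)
      also have "z powr l = z powr K * z powr (l - K)" by (simp flip: powr_add)
      also have "\<epsilon> powr (- l) * (z powr K * z powr (l - K)) \<le> \<epsilon> powr (- l) * (z powr K * (\<epsilon> powr (l - K) * \<rho> powr (l - K)))"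
        using l by (intro mult_left_mono zneg) auto
      also have "\<dots> = (\<epsilon> powr (- l) * \<epsilon> powr (l - K)) * Z" by (simp add: Z_def)
      also have "\<epsilon> powr (- l) * \<epsilon> powr (l - K) = \<epsilon> powr (- K)" by (simp flip: powr_add)
      finally have 2: "norm x powr l \<le> \<epsilon> powr (- K) * Z" .
      have "norm x powr l * \<bar>frac_heat_kernel \<theta> (x - y) (t - s)\<bar> \<le> (\<epsilon> powr (- K) * Z) * (C * decay_kernel d r (x - y))"
        using Z0 by (intro mult_mono 1 2) auto
      then show ?thesis by (simp add: B_def mult_ac)
    qed
    have T: "\<bar>norm x powr l * ((s + 1) ^ m * mi_power y \<alpha> * kernel_g \<theta> \<alpha> m x t)\<bar> \<le> B * (Z * decay_kernel d \<rho> x)"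
      if m: "m \<in> {0..M}" and \<alpha>: "\<alpha> \<in> {\<alpha> :: 'n multi_index. real (mi_order \<alpha>) \<le> K}" for m \<alpha>
    proof -
      define a where "a = real (mi_order \<alpha>)"
      define \<mu> where "\<mu> = real (max m 1)"
      \<comment> \<open>The decay X^(-N-a-\<theta>) of a profile term can absorb a weight of order
        up to a + \<theta>/2 and still keep the rate \<theta>/2 \<ge> d. The remaining l - l' is
        turned into powers of z; in both cases of the minimum, a + l - l' does not exceed K.\<close>
      define l' where "l' = min l (a + \<theta> / 2)"
      have a: "0 \<le> a" "a \<le> K" "mi_order \<alpha> \<le> k" using \<alpha> l by (auto simp: a_def k_def real_le_iff_le_nat_floor[symmetric])
      have \<mu>: "1 \<le> \<mu>" by (simp add: \<mu>_def)
      have l': "0 \<le> l'" "l' \<le> l" "l' \<le> a + \<theta> / 2" "a + l - l' - K \<le> 0" using l a \<theta> by (auto simp: l'_def min_def)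
      have "\<bar>kernel_g \<theta> \<alpha> m x t\<bar> \<le> \<bar>heat_deriv \<theta> \<alpha> m x (t + 1)\<bar>"
      proof -
        have "kernel_g \<theta> \<alpha> m x t = (-1) ^ (mi_order \<alpha> + m) / (mi_fact \<alpha> * fact m) * heat_deriv \<theta> \<alpha> m x (t + 1)"
          using s by (intro kernel_g_eq_heat_deriv \<theta>) simp
        then have "\<bar>kernel_g \<theta> \<alpha> m x t\<bar> = \<bar>heat_deriv \<theta> \<alpha> m x (t + 1)\<bar> / (mi_fact \<alpha> * fact m)"
          by (simp add: abs_mult power_abs abs_of_pos)
        also have "\<dots> \<le> \<bar>heat_deriv \<theta> \<alpha> m x (t + 1)\<bar> / 1"
        proof (intro divide_left_mono)
          have "1 * 1 \<le> mi_fact \<alpha> * fact m"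
            by (intro mult_mono mi_fact_ge_1 fact_ge_1) (auto intro: less_imp_le)
          then show "1 \<le> mi_fact \<alpha> * fact m" by simp
        qed auto
        finally show ?thesis by simp
      qed
      also have "\<dots> \<le> C * (if m = 0 then t + 1 else 1) * X powr (- ?N - (a + \<mu> * \<theta>))"
        unfolding X_def \<rho>_def a_def \<mu>_def using m s a(3) by (intro C(2)) auto
      finally have g: "\<bar>kernel_g \<theta> \<alpha> m x t\<bar> \<le> C * (if m = 0 then t + 1 else 1) * X powr (- ?N - (a + \<mu> * \<theta>))" .
      \<comment> \<open>Each factor s + 1 is at most t + 1 = \<rho>^\<theta>. For m = 0 the factor t
        + 1 of the kernel bound takes the place of one such power, so the exponent is \<mu> \<theta>
        in either case.\<close>
      have tm: "(s + 1) ^ m * (if m = 0 then t + 1 else 1) \<le> \<rho> powr (\<mu> * \<theta>)"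
      proof (cases "m = 0")
        case False
        have "(s + 1) ^ m \<le> (\<rho> powr \<theta>) ^ m" unfolding \<rho>t using s by (intro power_mono) auto
        also have "\<dots> = \<rho> powr (\<mu> * \<theta>)"
        proof -
          have "max m 1 = m" using False by simp
          then show ?thesis using \<rho>0 by (simp only: \<mu>_def) (simp add: powr_power)
        qed
        finally show ?thesis using False by simp
      qed (use \<rho>t in \<open>simp add: \<mu>_def\<close>)
      have my: "\<bar>mi_power y \<alpha>\<bar> \<le> z powr a"
      proof -
        have "\<bar>mi_power y \<alpha>\<bar> \<le> norm y ^ mi_order \<alpha>" by (rule abs_mi_power_le)
        also have "\<dots> \<le> z ^ mi_order \<alpha>" using yz by (intro power_mono) auto
        finally show ?thesis using z0 by (simp add: a_def powr_realpow)
      qed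
      have "\<bar>(s + 1) ^ m * mi_power y \<alpha> * kernel_g \<theta> \<alpha> m x t\<bar> = (s + 1) ^ m * \<bar>mi_power y \<alpha>\<bar> * \<bar>kernel_g \<theta> \<alpha> m x t\<bar>"
        using s by (simp add: abs_mult power_abs)
      also have "\<dots> \<le> (s + 1) ^ m * z powr a * (C * (if m = 0 then t + 1 else 1) * X powr (- ?N - (a + \<mu> * \<theta>)))"
        using s by (intro mult_mono mult_left_mono my g) auto
      also have "\<dots> = C * z powr a * (((s + 1) ^ m * (if m = 0 then t + 1 else 1)) * X powr (- ?N - (a + \<mu> * \<theta>)))"
        by (simp only: mult_ac)
      also have "\<dots> \<le> C * z powr a * (\<rho> powr (\<mu> * \<theta>) * X powr (- ?N - (a + \<mu> * \<theta>)))"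
        using C by (intro mult_left_mono mult_right_mono tm) auto
      \<comment> \<open>Further time derivatives only help: because \<rho> \<le> X, the factor
        (\<rho>/X)^(\<mu> \<theta>) is at most (\<rho>/X)^\<theta>.\<close>
      also have "\<rho> powr (\<mu> * \<theta>) * X powr (- ?N - (a + \<mu> * \<theta>)) \<le> \<rho> powr \<theta> * X powr (- ?N - (a + \<theta>))"
      proof -
        have "- ?N - (a + v) = - (?N + a) - v" for v by simp
        moreover have "\<theta> \<le> \<mu> * \<theta>" using mult_right_mono[OF \<mu>, of \<theta>] \<theta> by simp
        ultimately show ?thesis using powr_ratio_mono[OF \<rho>0 X(1), of \<theta> "\<mu> * \<theta>" "?N + a"] by (simp only:)
      qed
      then have "C * z powr a * (\<rho> powr (\<mu> * \<theta>) * X powr (- ?N - (a + \<mu> * \<theta>))) \<le> C * z powr a * (\<rho> powr \<theta> * X powr (- ?N - (a + \<theta>)))"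
        using C by (intro mult_left_mono) auto
      finally have 1: "\<bar>(s + 1) ^ m * mi_power y \<alpha> * kernel_g \<theta> \<alpha> m x t\<bar> \<le> C * z powr a * (\<rho> powr \<theta> * X powr (- ?N - (a + \<theta>)))" .
      have "norm x powr l \<le> X powr l" using X l by (intro powr_mono2) auto
      also have "\<dots> = X powr l' * X powr (l - l')" by (simp flip: powr_add)
      also have "\<dots> \<le> X powr l' * (\<epsilon> powr (- (l - l')) * z powr (l - l'))"
        using l' by (intro mult_left_mono Xl) auto
      finally have 2: "norm x powr l \<le> X powr l' * (\<epsilon> powr (- (l - l')) * z powr (l - l'))" .
      have "\<bar>norm x powr l * ((s + 1) ^ m * mi_power y \<alpha> * kernel_g \<theta> \<alpha> m x t)\<bar>
          = norm x powr l * \<bar>(s + 1) ^ m * mi_power y \<alpha> * kernel_g \<theta> \<alpha> m x t\<bar>" by (simp add: abs_mult)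
      also have "\<dots> \<le> (X powr l' * (\<epsilon> powr (- (l - l')) * z powr (l - l'))) * (C * z powr a * (\<rho> powr \<theta> * X powr (- ?N - (a + \<theta>))))"
        by (intro mult_mono 1 2) auto
      also have "\<dots> = C * \<epsilon> powr (- (l - l')) * (z powr a * z powr (l - l')) * (\<rho> powr \<theta> * (X powr l' * X powr (- ?N - (a + \<theta>))))"
        by (simp only: mult_ac)
      also have "z powr a * z powr (l - l') = z powr K * z powr (a + l - l' - K)" by (simp flip: powr_add add: algebra_simps)
      also have "X powr l' * X powr (- ?N - (a + \<theta>)) = X powr (- ?N - (a + \<theta> - l'))" by (simp flip: powr_add add: algebra_simps)
      also have "X powr (- ?N - (a + \<theta> - l')) = \<rho> powr (- (a + \<theta> - l')) * decay_kernel (a + \<theta> - l') \<rho> x"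
        using \<rho>0 unfolding decay_kernel_def X_def by (simp flip: mult.assoc powr_add)
      also have "C * \<epsilon> powr (- (l - l')) * (z powr K * z powr (a + l - l' - K)) * (\<rho> powr \<theta> * (\<rho> powr (- (a + \<theta> - l')) * decay_kernel (a + \<theta> - l') \<rho> x))
          \<le> C * \<epsilon> powr (- (l - l')) * (z powr K * (\<epsilon> powr (a + l - l' - K) * \<rho> powr (a + l - l' - K))) * (\<rho> powr \<theta> * (\<rho> powr (- (a + \<theta> - l')) * decay_kernel d \<rho> x))"
        using C l' d \<rho>0 by (intro mult_mono mult_left_mono zneg decay_kernel_antimono mult_nonneg_nonneg) auto
      also have "\<dots> = C * (\<epsilon> powr (- (l - l')) * \<epsilon> powr (a + l - l' - K)) * (z powr K * (\<rho> powr (a + l - l' - K) * (\<rho> powr \<theta> * \<rho> powr (- (a + \<theta> - l'))))) * decay_kernel d \<rho> x"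
        by (simp only: mult_ac)
      also have "\<rho> powr (a + l - l' - K) * (\<rho> powr \<theta> * \<rho> powr (- (a + \<theta> - l'))) = \<rho> powr (l - K)"
        by (simp flip: powr_add add: algebra_simps)
      also have "\<epsilon> powr (- (l - l')) * \<epsilon> powr (a + l - l' - K) = \<epsilon> powr (a - K)"
        by (simp flip: powr_add add: algebra_simps)
      also have "C * \<epsilon> powr (a - K) * (z powr K * \<rho> powr (l - K)) * decay_kernel d \<rho> x \<le> C * \<epsilon> powr (- K) * (z powr K * \<rho> powr (l - K)) * decay_kernel d \<rho> x"
        using C e a by (intro mult_right_mono mult_left_mono powr_mono') auto
      finally show ?thesis by (simp add: B_def Z_def mult_ac)
    qed
    let ?W = "\<Sum>m = 0..M. \<Sum>\<alpha> | real (mi_order \<alpha>) \<le> K. norm x powr l * ((s + 1) ^ m * mi_power y \<alpha> * kernel_g \<theta> \<alpha> m x t)"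
    have "\<bar>?W\<bar> \<le> real (card {0..M}) * (c * (B * (Z * decay_kernel d \<rho> x)))"
      unfolding c_def by (intro abs_sum_le_card T)
    moreover have "norm x powr l * \<bar>remainder_kernel \<theta> K x y t s\<bar> = \<bar>norm x powr l * frac_heat_kernel \<theta> (x - y) (t - s) - ?W\<bar>"
    proof -
      have "norm x powr l * \<bar>remainder_kernel \<theta> K x y t s\<bar> = \<bar>norm x powr l * remainder_kernel \<theta> K x y t s\<bar>" by (simp add: abs_mult)
      then show ?thesis unfolding remainder_kernel_def M_def[symmetric] right_diff_distrib sum_distrib_left .
    qed
    moreover have "\<bar>norm x powr l * frac_heat_kernel \<theta> (x - y) (t - s)\<bar> \<le> B * (Z * decay_kernel d r (x - y))"
      using G by (simp add: abs_mult)
    ultimately have "norm x powr l * \<bar>remainder_kernel \<theta> K x y t s\<bar> \<le> B * (Z * decay_kernel d r (x - y)) + real (card {0..M}) * (c * (B * (Z * decay_kernel d \<rho> x)))"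
      by linarith
    also have "\<dots> \<le> (1 + real (card {0..M}) * c) * (B * (Z * decay_kernel d r (x - y))) + (1 + real (card {0..M}) * c) * (B * (Z * decay_kernel d \<rho> x))"
    proof -
      have "0 \<le> real (card {0..M}) * c" by (simp add: c_def)
      then have "0 \<le> real (card {0..M}) * c * (B * (Z * decay_kernel d r (x - y)))" "0 \<le> B * (Z * decay_kernel d \<rho> x)" using B Z0 by simp_all
      then show ?thesis by (simp add: distrib_right mult.assoc)
    qed
    also have "\<dots> = (1 + real (card {0..M}) * c) * B * (\<rho> powr (l - K) * z powr K * (decay_kernel d r (x - y) + decay_kernel d \<rho> x))"
      unfolding Z_def by (simp only: distrib_left mult_ac)
    finally show "norm x powr l * \<bar>remainder_kernel \<theta> K x y t s\<bar> \<le> (1 + real (card {0..M}) * c) * B * (((t + 1) powr (1 / \<theta>)) powr (l - K) * (norm y + (s + 1) powr (1 / \<theta>)) powr K *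
       (decay_kernel d ((t - s) powr (1 / \<theta>)) (x - y) + decay_kernel d ((t + 1) powr (1 / \<theta>)) x))"
      unfolding \<rho>_def z_def r_def .
  qed
qed

text \<open>The exponent d is limited by \<theta>/2 in the crude zone, through the decay of the
  individual terms, and by \<kappa> - K in the Taylor zone. The latter is positive because an
  integer part plus one strictly exceeds its argument.\<close>

lemma remainder_kernel_estimate:
  assumes \<theta>: "0 < \<theta>" and l: "0 \<le> l" "l \<le> K"
  obtains C d where "0 \<le> C" "0 < d" "\<And>(x::real^'n) y t s. 0 \<le> s \<Longrightarrow> s < t \<Longrightarrow>
     norm x powr l * \<bar>remainder_kernel \<theta> K x y t s\<bar> \<le> C * ((t + 1) powr (1 / \<theta>)) powr (l - K) *
       ((norm y + (s + 1) powr (1 / \<theta>)) powr K * (min 1 ((norm y + (s + 1) powr (1 / \<theta>)) / (t + 1) powr (1 / \<theta>))) powr d) *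
       (decay_kernel d ((t - s) powr (1 / \<theta>)) (x - y) + decay_kernel d ((t + 1) powr (1 / \<theta>)) x +
        decay_kernel d (max ((t + 1) powr (1 / \<theta>)) (norm y + (s + 1) powr (1 / \<theta>))) x)"
proof -
  let ?N = "real CARD('n)"
  have K: "0 \<le> K" using l by simp
  define \<epsilon> :: real where "\<epsilon> = 2 powr (- 2 - 1 / \<theta>)"
  define \<kappa> where "\<kappa> = min (real (Suc (nat \<lfloor>K\<rfloor>))) (real (Suc (nat \<lfloor>K / \<theta>\<rfloor>)) * \<theta>)"
  define d where "d = min (\<theta> / 2) (\<kappa> - K)"
  have "K < real (Suc (nat \<lfloor>K\<rfloor>))" by linarith
  moreover have "K / \<theta> < real (Suc (nat \<lfloor>K / \<theta>\<rfloor>))" by linarith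
  then have "K < real (Suc (nat \<lfloor>K / \<theta>\<rfloor>)) * \<theta>" using \<theta> by (simp only: pos_divide_less_eq)
  ultimately have \<kappa>: "K < \<kappa>" by (simp add: \<kappa>_def)
  have d: "0 < d" "d \<le> \<theta> / 2" "d \<le> \<kappa> - K"
    using \<theta> \<kappa> unfolding d_def by (simp, intro min.cobounded1, intro min.cobounded2)
  have "0 < 1 / \<theta>" using \<theta> by simp
  then have "2 powr (- 2 - 1 / \<theta>) \<le> 2 powr 0" by (intro powr_mono) linarith+
  then have e: "0 < \<epsilon>" "\<epsilon> \<le> 1" by (auto simp: \<epsilon>_def)
  obtain C1 where C1: "0 \<le> C1" "\<And>(x::real^'n) y t s. 0 \<le> s \<Longrightarrow> s < t \<Longrightarrow>
     norm y + (s + 1) powr (1 / \<theta>) \<le> \<epsilon> * (norm x + (t + 1) powr (1 / \<theta>)) \<Longrightarrow>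
     \<bar>remainder_kernel \<theta> K x y t s\<bar> \<le> C1 * ((norm y + (s + 1) powr (1 / \<theta>)) powr \<kappa> * (norm x + (t + 1) powr (1 / \<theta>)) powr (- ?N - \<kappa>))"
    by (rule remainder_kernel_taylor_zone[OF \<theta> K, folded \<epsilon>_def \<kappa>_def, where 'n = 'n]) blast
  obtain C2 where C2: "0 \<le> C2" "\<And>(x::real^'n) y t s. 0 \<le> s \<Longrightarrow> s < t \<Longrightarrow>
     \<epsilon> * (norm x + (t + 1) powr (1 / \<theta>)) < norm y + (s + 1) powr (1 / \<theta>) \<Longrightarrow>
     norm x powr l * \<bar>remainder_kernel \<theta> K x y t s\<bar> \<le> C2 * (((t + 1) powr (1 / \<theta>)) powr (l - K) * (norm y + (s + 1) powr (1 / \<theta>)) powr K *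
       (decay_kernel d ((t - s) powr (1 / \<theta>)) (x - y) + decay_kernel d ((t + 1) powr (1 / \<theta>)) x))"
    by (rule remainder_kernel_crude_zone[OF \<theta> l d(1,2) e, where 'n = 'n]) blast
  define A1 where "A1 = C1 * 2 powr (?N + (\<kappa> - l))"
  define A2 where "A2 = C2 * \<epsilon> powr (- d)"
  have A: "0 \<le> A1" "0 \<le> A2" using C1 C2 by (auto simp: A1_def A2_def)
  show thesis
  proof (rule that[of "A1 + A2" d])
    show "0 \<le> A1 + A2" using A by simp
    show "0 < d" by (rule d)
    fix x y :: "real^'n" and t s :: real
    assume s: "0 \<le> s" "s < t"
    define z where "z = norm y + (s + 1) powr (1 / \<theta>)"
    define \<rho> where "\<rho> = (t + 1) powr (1 / \<theta>)"
    define X where "X = norm x + \<rho>"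
    define r where "r = max \<rho> z"
    define Q1 where "Q1 = decay_kernel d ((t - s) powr (1 / \<theta>)) (x - y)"
    define \<omega> where "\<omega> = min 1 (z / \<rho>)"
    have Q1: "0 \<le> Q1" by (simp add: Q1_def)
    have \<rho>0: "0 < \<rho>" using s by (simp add: \<rho>_def)
    have z0: "0 < z" using s by (simp add: z_def add_nonneg_pos)
    have X: "\<rho> \<le> X" "norm x \<le> X" "0 < X" using \<rho>0 norm_ge_zero[of x] unfolding X_def by linarith+
    have r: "0 < r" "\<rho> \<le> r" "z \<le> r" using \<rho>0 by (auto simp: r_def)
    \<comment> \<open>In the Taylor zone z may exceed \<rho> when |x| is large, and then powers of
      z/\<rho> would not be bounded. The width r = max \<rho> z of the third kernel repairs this:
      z/r is exactly min 1 (z/\<rho>), and both z and \<rho> remain below X, so that |x| + r is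
      comparable with X.\<close>
    have \<omega>: "\<omega> = z / r" using \<rho>0 z0 by (auto simp: \<omega>_def r_def min_def max_def field_simps)
    have \<omega>0: "0 < \<omega>" "\<omega> \<le> 1" using z0 \<rho>0 by (auto simp: \<omega>_def)
    have goal: "norm x powr l * \<bar>remainder_kernel \<theta> K x y t s\<bar> \<le> (A1 + A2) * (\<rho> powr (l - K) * (z powr K * \<omega> powr d) * (Q1 + decay_kernel d \<rho> x + decay_kernel d r x))"
    proof (cases "z \<le> \<epsilon> * X")
      case True
      have "\<epsilon> * X \<le> 1 * X" using e X by (intro mult_right_mono) auto
      then have "z \<le> X" using True by simp
      then have "r \<le> X" using X by (simp add: r_def)
      then have Xr: "norm x + r \<le> 2 * X" using X by linarith
      have pos: "0 < norm x + r" using r by (simp add: add_nonneg_pos)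
      have "norm x powr l * \<bar>remainder_kernel \<theta> K x y t s\<bar> \<le> X powr l * (C1 * (z powr \<kappa> * X powr (- ?N - \<kappa>)))"
        using C1(2)[OF s, of y x] True X l unfolding z_def \<rho>_def X_def by (intro mult_mono powr_mono2) auto
      also have "\<dots> = C1 * z powr \<kappa> * X powr (- ?N - (\<kappa> - l))"
      proof -
        have "X powr l * X powr (- ?N - \<kappa>) = X powr (- ?N - (\<kappa> - l))" by (simp flip: powr_add add: algebra_simps)
        then show ?thesis by (metis (no_types, lifting) mult.left_commute mult.assoc)
      qed
      also have "X powr (- ?N - (\<kappa> - l)) \<le> 2 powr (?N + (\<kappa> - l)) * (norm x + r) powr (- ?N - (\<kappa> - l))"
      proof -
        have "X powr (- ?N - (\<kappa> - l)) \<le> ((norm x + r) / 2) powr (- ?N - (\<kappa> - l))"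
          using Xr pos \<kappa> l by (intro powr_mono2') auto
        also have "\<dots> = (norm x + r) powr (- ?N - (\<kappa> - l)) / 2 powr (- ?N - (\<kappa> - l))" using pos by (simp add: powr_divide)
        also have "\<dots> = (norm x + r) powr (- ?N - (\<kappa> - l)) * 2 powr (- (- ?N - (\<kappa> - l)))" by (simp only: powr_minus divide_inverse)
        finally show ?thesis by (simp add: mult.commute algebra_simps)
      qed
      then have "C1 * z powr \<kappa> * X powr (- ?N - (\<kappa> - l)) \<le> C1 * z powr \<kappa> * (2 powr (?N + (\<kappa> - l)) * (norm x + r) powr (- ?N - (\<kappa> - l)))"
        using C1 by (intro mult_left_mono) auto
      also have "(norm x + r) powr (- ?N - (\<kappa> - l)) = r powr (- (\<kappa> - l)) * decay_kernel (\<kappa> - l) r x"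
        using r unfolding decay_kernel_def by (simp flip: mult.assoc powr_add)
      also have "C1 * z powr \<kappa> * (2 powr (?N + (\<kappa> - l)) * (r powr (- (\<kappa> - l)) * decay_kernel (\<kappa> - l) r x))
          = A1 * ((z powr \<kappa> * r powr (- (\<kappa> - l))) * decay_kernel (\<kappa> - l) r x)"
        by (simp only: A1_def mult_ac)
      also have "z powr \<kappa> * r powr (- (\<kappa> - l)) = z powr K * \<omega> powr (\<kappa> - K) * r powr (l - K)"
      proof -
        have "\<omega> powr (\<kappa> - K) = z powr (\<kappa> - K) * r powr (- (\<kappa> - K))"
          unfolding \<omega> using z0 r by (simp add: powr_divide) (simp only: powr_minus[symmetric] divide_inverse minus_diff_eq)
        moreover have "z powr K * z powr (\<kappa> - K) = z powr \<kappa>" by (simp flip: powr_add)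
        moreover have "r powr (- (\<kappa> - K)) * r powr (l - K) = r powr (- (\<kappa> - l))" by (simp flip: powr_add add: algebra_simps)
        ultimately show ?thesis by (metis mult.assoc)
      qed
      also have "A1 * (z powr K * \<omega> powr (\<kappa> - K) * r powr (l - K) * decay_kernel (\<kappa> - l) r x) \<le> A1 * (z powr K * \<omega> powr d * \<rho> powr (l - K) * decay_kernel d r x)"
        using A \<omega>0 d l r \<rho>0 by (intro mult_left_mono mult_mono powr_mono' powr_mono2' decay_kernel_antimono mult_nonneg_nonneg) auto
      also have "\<dots> = A1 * (\<rho> powr (l - K) * (z powr K * \<omega> powr d) * decay_kernel d r x)" by (simp only: mult_ac)
      also have "\<dots> \<le> (A1 + A2) * (\<rho> powr (l - K) * (z powr K * \<omega> powr d) * (Q1 + decay_kernel d \<rho> x + decay_kernel d r x))"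
        using A Q1 by (intro mult_mono mult_left_mono) auto
      finally show ?thesis .
    next
      case False
      have "norm x powr l * \<bar>remainder_kernel \<theta> K x y t s\<bar> \<le> C2 * (\<rho> powr (l - K) * z powr K * (Q1 + decay_kernel d \<rho> x))"
        using C2(2)[OF s, of x y] False unfolding z_def \<rho>_def X_def Q1_def by simp
      \<comment> \<open>Here z > \<epsilon> X \<ge> \<epsilon> \<rho>, so \<omega> \<ge> \<epsilon>,
        and inserting the damping factor \<omega>^d costs only the constant \<epsilon>^(-d).\<close>
      also have "C2 \<le> A2 * \<omega> powr d"
      proof -
        have "\<epsilon> * \<rho> \<le> \<epsilon> * X" using X e by (intro mult_left_mono) auto
        then have "\<epsilon> \<le> z / \<rho>" using False \<rho>0 by (simp add: field_simps)
        then have "\<epsilon> \<le> \<omega>" using e by (simp add: \<omega>_def)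
        then have "\<epsilon> powr d \<le> \<omega> powr d" using e d by (intro powr_mono2) auto
        then have "C2 * (\<epsilon> powr (- d) * \<epsilon> powr d) \<le> C2 * (\<epsilon> powr (- d) * \<omega> powr d)"
          using C2 by (intro mult_left_mono) auto
        moreover have "\<epsilon> powr (- d) * \<epsilon> powr d = 1" using e by (simp flip: powr_add)
        ultimately show ?thesis by (simp add: A2_def)
      qed
      then have "C2 * (\<rho> powr (l - K) * z powr K * (Q1 + decay_kernel d \<rho> x)) \<le> (A2 * \<omega> powr d) * (\<rho> powr (l - K) * z powr K * (Q1 + decay_kernel d \<rho> x))"
        using Q1 by (intro mult_right_mono) auto
      also have "\<dots> = A2 * (\<rho> powr (l - K) * (z powr K * \<omega> powr d) * (Q1 + decay_kernel d \<rho> x))" by (simp only: mult_ac)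
      also have "\<dots> \<le> (A1 + A2) * (\<rho> powr (l - K) * (z powr K * \<omega> powr d) * (Q1 + decay_kernel d \<rho> x + decay_kernel d r x))"
        using A Q1 by (intro mult_mono mult_left_mono) auto
      finally show ?thesis .
    qed
    then have "norm x powr l * \<bar>remainder_kernel \<theta> K x y t s\<bar> \<le> (A1 + A2) * \<rho> powr (l - K) * (z powr K * \<omega> powr d) * (Q1 + decay_kernel d \<rho> x + decay_kernel d r x)"
      by (simp only: mult.assoc)
    then show "norm x powr l * \<bar>remainder_kernel \<theta> K x y t s\<bar> \<le> (A1 + A2) * ((t + 1) powr (1 / \<theta>)) powr (l - K) *
       ((norm y + (s + 1) powr (1 / \<theta>)) powr K * (min 1 ((norm y + (s + 1) powr (1 / \<theta>)) / (t + 1) powr (1 / \<theta>))) powr d) *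
       (decay_kernel d ((t - s) powr (1 / \<theta>)) (x - y) + decay_kernel d ((t + 1) powr (1 / \<theta>)) x +
        decay_kernel d (max ((t + 1) powr (1 / \<theta>)) (norm y + (s + 1) powr (1 / \<theta>))) x)"
      unfolding \<rho>_def z_def r_def Q1_def \<omega>_def .
  qed
qed

section \<open>Bounds in \<open>L\<^sup>q\<close>\<close>

text \<open>A bound for the L^q norm of a nonnegative function by an explicit real number, free of
  roots and of infinite values. All estimates are made in this form over \<open>lborel\<close>;
  \<open>Lnorm\<close> enters only through conversions at both ends.\<close>

definition Lq_le :: "ennreal \<Rightarrow> (real^'n \<Rightarrow> real) \<Rightarrow> real \<Rightarrow> bool" where
  "Lq_le q h B \<longleftrightarrow> (if q = \<infinity> then AE x in lborel. h x \<le> B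
     else (\<integral>\<^sup>+x. ennreal (h x powr enn2real q) \<partial>lborel) \<le> ennreal (B powr enn2real q))"

lemma finite_exponentE:
  assumes "1 \<le> q" "q \<noteq> (\<infinity>::ennreal)"
  obtains p where "1 \<le> p" "q = ennreal p" "enn2real q = p" "enn2real (1 / q) = 1 / p"
proof -
  obtain p where p: "0 \<le> p" "q = ennreal p" using assms by (cases q) auto
  have p1: "1 \<le> p" using assms(1) p by (simp flip: ennreal_1)
  have "1 / q = ennreal (1 / p)" using p p1 divide_ennreal[of 1 p] by simp
  then show thesis using p p1 by (intro that[of p]) auto
qed

lemma Lq_le_finite: "1 \<le> p \<Longrightarrow> Lq_le (ennreal p) h B \<longleftrightarrow> (\<integral>\<^sup>+x. ennreal (h x powr p) \<partial>lborel) \<le> ennreal (B powr p)"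
  by (simp add: Lq_le_def)

lemma Lq_le_infinity: "Lq_le top h B \<longleftrightarrow> (AE x in lborel. h x \<le> B)"
  by (simp add: Lq_le_def)

text \<open>From h^p \<le> (T M)^(p-1) h the integral of h^p is at most T^(p-1) M^p, whose p-th root
  is T^(1-1/p) M. With T = t^(-N/\<theta>) the power of T becomes the decay factor of the
  theorem.\<close>

lemma Lq_le_interpolation:
  fixes h :: "real^'n \<Rightarrow> real"
  assumes q: "1 \<le> q" and T: "0 < T" and M: "0 \<le> M" and h0: "\<And>x. 0 \<le> h x" and sup: "\<And>x. h x \<le> T * M"
    and int: "(\<integral>\<^sup>+x. ennreal (h x) \<partial>lborel) \<le> ennreal M" and m[measurable]: "h \<in> borel_measurable borel"
  shows "Lq_le q h (T powr (1 - enn2real (1 / q)) * M)"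
proof (cases "q = \<infinity>")
  case True
  then show ?thesis using sup T by (simp add: Lq_le_infinity)
next
  case False
  then obtain p where p: "1 \<le> p" "q = ennreal p" "enn2real (1 / q) = 1 / p"
    using finite_exponentE[OF q] by metis
  have pt: "h x powr p \<le> (T * M) powr (p - 1) * h x" for x
  proof (cases "h x = 0")
    case False
    then have "h x > 0" using h0[of x] by simp
    then have "h x powr p = h x powr (p - 1) * h x" using powr_add[of "h x" "p - 1" 1] by simp
    also have "\<dots> \<le> (T * M) powr (p - 1) * h x"
      using h0[of x] sup[of x] p by (intro mult_right_mono powr_mono2) auto
    finally show ?thesis .
  qed (use h0 p in simp)
  have "(\<integral>\<^sup>+x. ennreal (h x powr p) \<partial>lborel) \<le> (\<integral>\<^sup>+x. ennreal ((T * M) powr (p - 1)) * ennreal (h x) \<partial>lborel)"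
    using pt h0 by (intro nn_integral_mono) (simp add: ennreal_leI flip: ennreal_mult)
  also have "\<dots> = ennreal ((T * M) powr (p - 1)) * (\<integral>\<^sup>+x. ennreal (h x) \<partial>lborel)"
    by (rule nn_integral_cmult) simp
  also have "\<dots> \<le> ennreal ((T * M) powr (p - 1)) * ennreal M" by (intro mult_left_mono int) simp
  also have "\<dots> = ennreal ((T * M) powr (p - 1) * M)" using M by (simp add: ennreal_mult)
  also have "(T * M) powr (p - 1) * M = (T powr (1 - 1 / p) * M) powr p"
  proof (cases "M = 0")
    case False
    then have "M > 0" using M by simp
    have "(T powr (1 - 1 / p) * M) powr p = T powr ((1 - 1 / p) * p) * M powr p" by (simp add: powr_mult powr_powr)
    also have "(1 - 1 / p) * p = p - 1" using p by (simp add: left_diff_distrib)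
    also have "M powr p = M powr (p - 1) * M" using \<open>M > 0\<close> powr_add[of M "p - 1" 1] by simp
    finally show ?thesis by (simp add: powr_mult)
  qed simp
  finally show ?thesis using p by (simp add: Lq_le_finite)
qed

lemma Lq_le_cmult_mono:
  fixes h g :: "real^'n \<Rightarrow> real"
  assumes q: "1 \<le> q" and h: "Lq_le q h B" and c: "0 \<le> c" and B: "0 \<le> B" and h0: "\<And>x. 0 \<le> h x" and g0: "\<And>x. 0 \<le> g x"
    and g: "AE x in lborel. g x \<le> c * h x" and m[measurable]: "h \<in> borel_measurable borel"
  shows "Lq_le q g (c * B)"
proof (cases "q = \<infinity>")
  case True
  then have "AE x in lborel. h x \<le> B" using h by (simp add: Lq_le_infinity)
  then have "AE x in lborel. g x \<le> c * B"
    using g by eventually_elim (use c mult_left_mono in fastforce)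
  then show ?thesis using True by (simp add: Lq_le_infinity)
next
  case False
  then obtain p where p: "1 \<le> p" "q = ennreal p" using finite_exponentE[OF q] by metis
  have "(\<integral>\<^sup>+x. ennreal (g x powr p) \<partial>lborel) \<le> (\<integral>\<^sup>+x. ennreal (c powr p) * ennreal (h x powr p) \<partial>lborel)"
  proof (rule nn_integral_mono_AE)
    show "AE x in lborel. ennreal (g x powr p) \<le> ennreal (c powr p) * ennreal (h x powr p)"
      using g
    proof eventually_elim
      case (elim x)
      have "g x powr p \<le> (c * h x) powr p" using elim g0[of x] p by (intro powr_mono2) auto
      also have "\<dots> = c powr p * h x powr p" by (simp add: powr_mult)
      finally show ?case by (simp add: ennreal_leI flip: ennreal_mult)
    qed
  qed
  also have "\<dots> = ennreal (c powr p) * (\<integral>\<^sup>+x. ennreal (h x powr p) \<partial>lborel)" by (rule nn_integral_cmult) simp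
  also have "\<dots> \<le> ennreal (c powr p) * ennreal (B powr p)"
    using h p by (intro mult_left_mono) (simp_all add: Lq_le_finite)
  also have "\<dots> = ennreal ((c * B) powr p)" by (simp add: powr_mult ennreal_mult)
  finally show ?thesis using p by (simp add: Lq_le_finite)
qed

text \<open>A quasi-triangle inequality in place of Minkowski's: one factor 2 comes from (h + g)^p
  \<le> 2^p (h^p + g^p), the other from A^p + B^p \<le> 2 (A + B)^p \<le> 2^p (A + B)^p.\<close>

lemma Lq_le_add:
  fixes h g :: "real^'n \<Rightarrow> real"
  assumes q: "1 \<le> q" and h: "Lq_le q h A" and g: "Lq_le q g B" and AB: "0 \<le> A" "0 \<le> B"
    and h0: "\<And>x. 0 \<le> h x" and g0: "\<And>x. 0 \<le> g x"
    and m[measurable]: "h \<in> borel_measurable borel" "g \<in> borel_measurable borel"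
  shows "Lq_le q (\<lambda>x. h x + g x) (4 * (A + B))"
proof (cases "q = \<infinity>")
  case True
  then have "AE x in lborel. h x \<le> A" "AE x in lborel. g x \<le> B" using h g by (simp_all add: Lq_le_infinity)
  then have "AE x in lborel. h x + g x \<le> 4 * (A + B)"
  proof eventually_elim
    case (elim x)
    then show ?case using AB by simp
  qed
  then show ?thesis using True by (simp add: Lq_le_infinity)
next
  case False
  then obtain p where p: "1 \<le> p" "q = ennreal p" using finite_exponentE[OF q] by metis
  have pt: "(h x + g x) powr p \<le> 2 powr p * (h x powr p + g x powr p)" for x
  proof -
    have "(h x + g x) powr p \<le> (2 * max (h x) (g x)) powr p" using h0[of x] g0[of x] p by (intro powr_mono2) auto
    also have "\<dots> = 2 powr p * max (h x) (g x) powr p" by (simp add: powr_mult)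
    also have "max (h x) (g x) powr p \<le> h x powr p + g x powr p" by (simp add: max_def)
    finally show ?thesis by simp
  qed
  have "(\<integral>\<^sup>+x. ennreal ((h x + g x) powr p) \<partial>lborel) \<le> (\<integral>\<^sup>+x. ennreal (2 powr p) * (ennreal (h x powr p) + ennreal (g x powr p)) \<partial>lborel)"
    using pt by (intro nn_integral_mono) (simp add: ennreal_leI flip: ennreal_mult ennreal_plus)
  also have "\<dots> = ennreal (2 powr p) * ((\<integral>\<^sup>+x. ennreal (h x powr p) \<partial>lborel) + (\<integral>\<^sup>+x. ennreal (g x powr p) \<partial>lborel))"
    by (simp add: nn_integral_cmult nn_integral_add)
  also have "\<dots> \<le> ennreal (2 powr p) * (ennreal (A powr p) + ennreal (B powr p))"
    using h g p by (intro mult_left_mono add_mono) (simp_all add: Lq_le_finite)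
  also have "\<dots> = ennreal (2 powr p * (A powr p + B powr p))" by (simp add: ennreal_mult flip: ennreal_plus)
  also have "\<dots> \<le> ennreal ((4 * (A + B)) powr p)"
  proof (rule ennreal_leI)
    have "A powr p + B powr p \<le> 2 * (A + B) powr p"
      using powr_mono2[of p A "A + B"] powr_mono2[of p B "A + B"] p AB by simp
    also have "\<dots> \<le> 2 powr p * (A + B) powr p"
      using powr_mono[of 1 p 2] p by (intro mult_right_mono) auto
    finally have "2 powr p * (A powr p + B powr p) \<le> 2 powr p * (2 powr p * (A + B) powr p)" by (intro mult_left_mono) auto
    also have "\<dots> = (2 * (2 * (A + B))) powr p" by (simp only: powr_mult)
    finally show "2 powr p * (A powr p + B powr p) \<le> (4 * (A + B)) powr p" by simp
  qed
  finally show ?thesis using p by (simp add: Lq_le_finite)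
qed

lemma Lnorm_le_of_Lq_le:
  fixes h g :: "real^'n \<Rightarrow> real"
  assumes q: "1 \<le> q" and h: "Lq_le q h B" and B: "0 \<le> B"
    and g: "AE x in lborel. \<bar>g x\<bar> \<le> h x" and m[measurable]: "g \<in> borel_measurable borel"
  shows "Lnorm q g \<le> ennreal B"
proof (cases "q = \<infinity>")
  case True
  then have "AE x in lborel. h x \<le> B" using h by (simp add: Lq_le_infinity)
  then have "AE x in lborel. ennreal \<bar>g x\<bar> \<le> ennreal B" using g by eventually_elim (rule ennreal_leI, linarith)
  then have AE: "AE x in lebesgue. ennreal \<bar>g x\<bar> \<le> ennreal B" by (rule AE_completion)
  have "(\<lambda>x. ennreal \<bar>g x\<bar>) \<in> borel_measurable lborel" by measurable
  then have "(\<lambda>x. ennreal \<bar>g x\<bar>) \<in> borel_measurable lebesgue" by (rule measurable_completion)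
  from esssup_I[OF this AE] show ?thesis using True by (simp add: Lnorm_def)
next
  case False
  then obtain p where p: "1 \<le> p" "q = ennreal p" "enn2real q = p" using finite_exponentE[OF q] by metis
  define I where "I = (\<integral>\<^sup>+ x. ennreal (\<bar>g x\<bar> powr p) \<partial>lebesgue)"
  have "I = (\<integral>\<^sup>+ x. ennreal (\<bar>g x\<bar> powr p) \<partial>lborel)" unfolding I_def by (rule nn_integral_completion)
  also have "\<dots> \<le> (\<integral>\<^sup>+x. ennreal (h x powr p) \<partial>lborel)"
    using g by (intro nn_integral_mono_AE) (auto elim!: eventually_mono intro!: ennreal_leI powr_mono2 simp: p order_trans[OF zero_le_one p(1)])
  also have "\<dots> \<le> ennreal (B powr p)" using h p by (simp add: Lq_le_finite)
  finally have I: "I \<le> ennreal (B powr p)" .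
  then have "I \<noteq> \<infinity>" by (auto simp: top_unique)
  moreover have "enn2real I \<le> B powr p" using I by (intro enn2real_leI) auto
  then have "enn2real I powr (1 / p) \<le> (B powr p) powr (1 / p)" using p by (intro powr_mono2) auto
  then have "enn2real I powr (1 / p) \<le> B" using p B by (simp add: powr_powr)
  ultimately show ?thesis using False p by (simp add: Lnorm_def I_def[symmetric] Let_def ennreal_leI)
qed

lemma Lq_le_of_Lnorm:
  fixes h g :: "real^'n \<Rightarrow> real"
  assumes q: "1 \<le> q" and fin: "Lnorm q g < \<infinity>" and h: "AE x in lebesgue. h x = \<bar>g x\<bar>"
  shows "Lq_le q h (enn2real (Lnorm q g))"
proof (cases "q = \<infinity>")
  case True
  let ?S = "esssup lebesgue (\<lambda>x. ennreal \<bar>g x\<bar>)"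
  have S: "?S < \<infinity>" "Lnorm q g = ?S" using fin True by (simp_all add: Lnorm_def)
  have "AE x in lebesgue. ennreal \<bar>g x\<bar> \<le> ?S" by (rule esssup_AE)
  then have "AE x in lebesgue. h x \<le> enn2real ?S" using h
  proof eventually_elim
    case (elim x)
    then have "enn2real (ennreal \<bar>g x\<bar>) \<le> enn2real ?S" using S by (intro enn2real_mono) auto
    then show ?case using elim by simp
  qed
  then have "AE x in lborel. h x \<le> enn2real ?S" by (simp add: AE_completion_iff)
  then show ?thesis using True S by (simp add: Lq_le_infinity)
next
  case False
  then obtain p where p: "1 \<le> p" "q = ennreal p" "enn2real q = p" using finite_exponentE[OF q] by metis
  define I where "I = (\<integral>\<^sup>+ x. ennreal (\<bar>g x\<bar> powr p) \<partial>lebesgue)"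
  have L: "Lnorm q g = (if I = \<infinity> then \<infinity> else ennreal (enn2real I powr (1 / p)))"
    using False p by (simp add: Lnorm_def I_def Let_def)
  have I: "I \<noteq> \<infinity>" using fin unfolding L by (auto split: if_splits)
  have "(\<integral>\<^sup>+x. ennreal (h x powr p) \<partial>lborel) = (\<integral>\<^sup>+x. ennreal (h x powr p) \<partial>lebesgue)" by (simp add: nn_integral_completion)
  also have "\<dots> = I" unfolding I_def using h by (intro nn_integral_cong_AE) (auto elim!: eventually_mono)
  also have "I = ennreal (enn2real I)" using I by (simp add: top.not_eq_extremum ennreal_enn2real)
  also have "enn2real I = enn2real (Lnorm q g) powr p" using I p unfolding L by (simp add: powr_powr)
  finally show ?thesis using p by (simp add: Lq_le_finite)
qed

section \<open>Jensen's inequality for powers\<close>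

text \<open>The convex function g^p lies above its tangent at v. The rearranged form is Young's
  inequality for g and v^(p-1).\<close>

lemma powr_tangent_le:
  fixes p g v :: real
  assumes "1 \<le> p" "0 \<le> g" "0 \<le> v"
  shows "p * v powr (p - 1) * g \<le> g powr p + (p - 1) * v powr p"
proof (cases "p = 1 \<or> v = 0 \<or> g = 0")
  case True
  then show ?thesis using assms by auto
next
  case False
  then have p: "1 < p" and g: "0 < g" and v: "0 < v" using assms by auto
  have "g * v powr (p - 1) \<le> g powr p / p + (v powr (p - 1)) powr (p / (p - 1)) / (p / (p - 1))"
    using p assms by (intro Youngs_inequality) (auto simp: field_simps)
  also have "(v powr (p - 1)) powr (p / (p - 1)) = v powr p" using p by (simp add: powr_powr)
  finally have "p * (g * v powr (p - 1)) \<le> p * (g powr p / p + v powr p / (p / (p - 1)))" using p by (intro mult_left_mono) auto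
  also have "\<dots> = g powr p + (p - 1) * v powr p" using p by (simp add: field_simps)
  finally show ?thesis by (simp add: mult_ac)
qed

text \<open>The tangent inequality, taken at v = H/M, is multiplied by the density k and integrated.
  Because v^(p-1) H = v^p M, all but one copy of v^p M cancels. M has only to bound the mass of k
  from above, so no normalisation is involved.\<close>

lemma nn_integral_Jensen_powr:
  fixes g k :: "'a \<Rightarrow> real"
  assumes p: "1 \<le> p" and M: "0 \<le> M" and k0: "\<And>w. 0 \<le> k w" and g0: "\<And>w. 0 \<le> g w"
    and kM: "(\<integral>\<^sup>+w. ennreal (k w) \<partial>P) \<le> ennreal M"
    and m[measurable]: "k \<in> borel_measurable P" "g \<in> borel_measurable P"
    and fin: "(\<integral>\<^sup>+w. ennreal (k w * g w) \<partial>P) < \<infinity>"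
  shows "ennreal (enn2real (\<integral>\<^sup>+w. ennreal (k w * g w) \<partial>P) powr p) \<le> ennreal (M powr (p - 1)) * (\<integral>\<^sup>+w. ennreal (k w * g w powr p) \<partial>P)"
proof -
  define H where "H = enn2real (\<integral>\<^sup>+w. ennreal (k w * g w) \<partial>P)"
  have H: "(\<integral>\<^sup>+w. ennreal (k w * g w) \<partial>P) = ennreal H" "0 \<le> H" using fin by (simp_all add: H_def ennreal_enn2real)
  define G where "G = (\<integral>\<^sup>+w. ennreal (k w * g w powr p) \<partial>P)"
  show ?thesis unfolding H_def[symmetric] G_def[symmetric]
  proof (cases "H = 0 \<or> G = \<infinity>")
    case True
    show "ennreal (H powr p) \<le> ennreal (M powr (p - 1)) * G"
    proof (cases "H = 0")
      case False
      \<comment> \<open>A vanishing mass bound forces k = 0 almost everywhere and hence H = 0.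
        Positivity of M is what makes the product with an infinite right-hand side infinite.\<close>
      have "M \<noteq> 0"
      proof
        assume "M = 0"
        then have "(\<integral>\<^sup>+w. ennreal (k w) \<partial>P) = 0" using kM by simp
        then have "AE w in P. k w = 0" by (subst (asm) nn_integral_0_iff_AE) (auto simp: ennreal_eq_0_iff intro: eventually_mono dest: antisym[OF _ k0])
        then have "(\<integral>\<^sup>+w. ennreal (k w * g w) \<partial>P) = 0" by (subst nn_integral_0_iff_AE) (auto elim: eventually_mono)
        then show False using H False by simp
      qed
      then show ?thesis using True False M by (simp add: ennreal_mult_top)
    qed simp
  next
    case False
    then have H0: "0 < H" and Gf: "G \<noteq> \<infinity>" using H by auto
    have M0: "0 < M"
    proof (rule ccontr)
      assume "\<not> 0 < M"
      then have "(\<integral>\<^sup>+w. ennreal (k w) \<partial>P) = 0" using kM M by simp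
      then have "AE w in P. k w = 0" by (subst (asm) nn_integral_0_iff_AE) (auto simp: ennreal_eq_0_iff intro: eventually_mono dest: antisym[OF _ k0])
      then have "(\<integral>\<^sup>+w. ennreal (k w * g w) \<partial>P) = 0" by (subst nn_integral_0_iff_AE) (auto elim: eventually_mono)
      then show False using H H0 by simp
    qed
    define v where "v = H / M"
    have v: "0 < v" using H0 M0 by (simp add: v_def)
    have "ennreal (p * v powr (p - 1) * H) = ennreal (p * v powr (p - 1)) * (\<integral>\<^sup>+w. ennreal (k w * g w) \<partial>P)"
      unfolding H(1) using p H0 by (simp add: ennreal_mult)
    also have "\<dots> = (\<integral>\<^sup>+w. ennreal (p * v powr (p - 1)) * ennreal (k w * g w) \<partial>P)"
      by (rule nn_integral_cmult[symmetric]) measurable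
    also have "\<dots> \<le> (\<integral>\<^sup>+w. ennreal (k w * g w powr p) + ennreal ((p - 1) * v powr p) * ennreal (k w) \<partial>P)"
    proof (rule nn_integral_mono)
      fix w
      have "k w * (p * v powr (p - 1) * g w) \<le> k w * (g w powr p + (p - 1) * v powr p)"
        using p g0 v k0 by (intro mult_left_mono powr_tangent_le) auto
      then have "p * v powr (p - 1) * (k w * g w) \<le> k w * g w powr p + (p - 1) * v powr p * k w"
        by (simp add: algebra_simps)
      then have "ennreal (p * v powr (p - 1) * (k w * g w)) \<le> ennreal (k w * g w powr p + (p - 1) * v powr p * k w)" by (rule ennreal_leI)
      then show "ennreal (p * v powr (p - 1)) * ennreal (k w * g w) \<le> ennreal (k w * g w powr p) + ennreal ((p - 1) * v powr p) * ennreal (k w)"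
        using p k0 g0 by (simp add: ennreal_mult ennreal_plus)
    qed
    also have "\<dots> = G + ennreal ((p - 1) * v powr p) * (\<integral>\<^sup>+w. ennreal (k w) \<partial>P)"
      unfolding G_def by (subst nn_integral_add) (auto simp: nn_integral_cmult)
    also have "\<dots> \<le> G + ennreal ((p - 1) * v powr p) * ennreal M" by (intro add_left_mono mult_left_mono kM) simp
    finally have le: "ennreal (p * v powr (p - 1) * H) \<le> G + ennreal ((p - 1) * v powr p * M)"
      using p M by (simp add: ennreal_mult)
    obtain G' where G': "G = ennreal G'" "0 \<le> G'" using Gf by (cases G) auto
    have "p * v powr (p - 1) * H \<le> G' + (p - 1) * v powr p * M"
      using le p M G' by (simp flip: ennreal_plus)
    moreover have "v powr (p - 1) * H = v powr p * M"
    proof -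
      have "v powr p = v powr (p - 1) * v" using v powr_add[of v "p - 1" 1] by simp
      then show ?thesis using M0 by (simp add: v_def)
    qed
    moreover have "p * (v powr (p - 1) * H) \<le> G' + (p - 1) * (v powr p * M)"
      using \<open>p * v powr (p - 1) * H \<le> G' + (p - 1) * v powr p * M\<close> by (simp only: mult.assoc)
    ultimately have "p * (v powr p * M) \<le> G' + (p - 1) * (v powr p * M)" by (simp only:)
    then have "v powr p * M \<le> G'" by (simp add: left_diff_distrib)
    moreover have "v powr p * M * M powr (p - 1) = H powr p"
    proof -
      have "v powr p * M powr p = H powr p" using M0 H0 by (simp add: v_def powr_divide)
      moreover have "M powr p = M * M powr (p - 1)" using M0 powr_add[of M 1 "p - 1"] by simp
      ultimately show ?thesis by simp
    qed
    ultimately have "H powr p \<le> M powr (p - 1) * G'" by (metis mult.commute mult_left_mono powr_ge_zero)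
    then show "ennreal (H powr p) \<le> ennreal (M powr (p - 1)) * G" using G' by (simp add: ennreal_leI flip: ennreal_mult)
  qed
qed

section \<open>Tonelli's theorem on products of Euclidean spaces\<close>

lemma nn_integral_lborel_pair:
  fixes F :: "'a::euclidean_space \<times> 'b::euclidean_space \<Rightarrow> ennreal"
  assumes "F \<in> borel_measurable borel"
  shows "(\<integral>\<^sup>+w. F w \<partial>lborel) = (\<integral>\<^sup>+s. \<integral>\<^sup>+y. F (s, y) \<partial>lborel \<partial>lborel)"
proof -
  have "F \<in> borel_measurable (lborel \<Otimes>\<^sub>M lborel)" using assms by (simp add: lborel_prod)
  from lborel.nn_integral_fst[OF this] show ?thesis by (simp add: lborel_prod)
qed

lemma nn_integral_lborel_swap:
  fixes F :: "'a::euclidean_space \<Rightarrow> 'b::euclidean_space \<Rightarrow> ennreal"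
  assumes "(\<lambda>(x, w). F x w) \<in> borel_measurable borel"
  shows "(\<integral>\<^sup>+x. \<integral>\<^sup>+w. F x w \<partial>lborel \<partial>lborel) = (\<integral>\<^sup>+w. \<integral>\<^sup>+x. F x w \<partial>lborel \<partial>lborel)"
proof -
  have m: "(\<lambda>(x, w). F x w) \<in> borel_measurable (lborel \<Otimes>\<^sub>M lborel)" using assms by (simp add: lborel_prod)
  show ?thesis using lborel_pair.Fubini'[OF m] by simp
qed

lemma nn_integral_lborel_section_measurable:
  fixes F :: "'a::euclidean_space \<Rightarrow> 'b::euclidean_space \<Rightarrow> ennreal"
  assumes "(\<lambda>(x, w). F x w) \<in> borel_measurable borel"
  shows "(\<lambda>x. \<integral>\<^sup>+w. F x w \<partial>lborel) \<in> borel_measurable borel"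
proof -
  have m: "(\<lambda>(x, w). F x w) \<in> borel_measurable (borel \<Otimes>\<^sub>M lborel)"
    using assms by (simp add: borel_prod[symmetric] cong: measurable_cong_sets sets_pair_measure_cong)
  show ?thesis using lborel.borel_measurable_nn_integral[OF m] .
qed

lemma fst_borel_measurable [measurable]: "fst \<in> borel_measurable (borel :: ('a::second_countable_topology \<times> 'b::second_countable_topology) measure)"
  by (intro borel_measurable_continuous_onI continuous_intros)

lemma snd_borel_measurable [measurable]: "snd \<in> borel_measurable (borel :: ('a::second_countable_topology \<times> 'b::second_countable_topology) measure)"
  by (intro borel_measurable_continuous_onI continuous_intros)

lemma nn_integral_decay_kernel_translate:
  fixes y :: "real^'n"
  shows "(\<integral>\<^sup>+x. ennreal (decay_kernel d r (x - y)) \<partial>lborel) = (\<integral>\<^sup>+x. ennreal (decay_kernel d r (x :: real^'n)) \<partial>lborel)"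
    and "(\<integral>\<^sup>+x. ennreal (decay_kernel d r (y - x)) \<partial>lborel) = (\<integral>\<^sup>+x. ennreal (decay_kernel d r (x :: real^'n)) \<partial>lborel)"
proof -
  have "(\<integral>\<^sup>+x. ennreal (decay_kernel d r (x :: real^'n)) \<partial>lborel) = (\<integral>\<^sup>+x. ennreal (decay_kernel d r (x :: real^'n)) \<partial>distr lborel borel ((+) (- y)))"
    by (simp add: lborel_distr_plus)
  also have "\<dots> = (\<integral>\<^sup>+x. ennreal (decay_kernel d r (- y + x)) \<partial>lborel)" by (rule nn_integral_distr) auto
  finally show 1: "(\<integral>\<^sup>+x. ennreal (decay_kernel d r (x - y)) \<partial>lborel) = (\<integral>\<^sup>+x. ennreal (decay_kernel d r (x :: real^'n)) \<partial>lborel)" by simp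
  have "decay_kernel d r (y - x) = decay_kernel d r (x - y)" for x using decay_kernel_minus[of d r "x - y"] by simp
  then show "(\<integral>\<^sup>+x. ennreal (decay_kernel d r (y - x)) \<partial>lborel) = (\<integral>\<^sup>+x. ennreal (decay_kernel d r (x :: real^'n)) \<partial>lborel)" using 1 by simp
qed

text \<open>Jensen's inequality is applied to the function \<open>A (s, y) / b s\<close> and to the measure with density
  \<open>b s * decay_kernel d (r s) (x - y)\<close>, whose total mass is at most \<open>D * I\<close> for every \<open>x\<close>.\<close>

lemma Lq_le_time_convolution:
  fixes A :: "real \<times> (real^'n) \<Rightarrow> real" and b r :: "real \<Rightarrow> real"
  assumes q: "1 \<le> q" and D: "0 \<le> D" "\<And>r. 0 < r \<Longrightarrow> (\<integral>\<^sup>+x. ennreal (decay_kernel d r (x :: real^'n)) \<partial>lborel) \<le> ennreal D"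
    and J[measurable]: "J \<in> sets borel" and r[measurable]: "r \<in> borel_measurable borel" and r0: "\<And>s. s \<in> J \<Longrightarrow> 0 < r s"
    and A[measurable]: "A \<in> borel_measurable borel" and A0: "\<And>w. 0 \<le> A w"
    and b[measurable]: "b \<in> borel_measurable borel" and b0: "\<And>s. 0 \<le> b s"
    and v: "0 \<le> v" and I: "0 \<le> I" "(\<integral>\<^sup>+s. ennreal (indicator J s * b s) \<partial>lborel) \<le> ennreal I"
    and Lq: "AE s in lborel. s \<in> J \<longrightarrow> Lq_le q (\<lambda>y. A (s, y)) (b s * v)"
    and fin: "(\<integral>\<^sup>+w. ennreal (indicator J (fst w) * A w) \<partial>lborel) < \<infinity>"
  defines "H \<equiv> \<lambda>x. \<integral>\<^sup>+w. ennreal (indicator J (fst w) * A w * decay_kernel d (r (fst w)) (x - snd w)) \<partial>lborel"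
  shows "AE x in lborel. H x < \<infinity>" "Lq_le q (\<lambda>x. enn2real (H x)) (D * I * v)" "H \<in> borel_measurable borel"
proof -
  have Fm: "(\<lambda>(x, w). ennreal (indicator J (fst w) * A w * decay_kernel d (r (fst w)) (x - snd w))) \<in> borel_measurable (borel :: ((real^'n) \<times> real \<times> (real^'n)) measure)"
    unfolding decay_kernel_def split_beta by measurable
  show Hm[measurable]: "H \<in> borel_measurable borel"
    unfolding H_def by (rule nn_integral_lborel_section_measurable[OF Fm])
  have QD: "(\<integral>\<^sup>+x. ennreal (decay_kernel d (r s) (x - y)) \<partial>lborel) \<le> ennreal D" "(\<integral>\<^sup>+x. ennreal (decay_kernel d (r s) (y - x)) \<partial>lborel) \<le> ennreal D"
    if "s \<in> J" for s and y :: "real^'n"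
    unfolding nn_integral_decay_kernel_translate using D(2)[OF r0[OF that]] by auto
  \<comment> \<open>Integrating first in x replaces each kernel by its mass, at most D. This is used
    for A itself, to see that H is finite almost everywhere, and again for the p-th powers produced
    by Jensen's inequality.\<close>
  have push: "(\<integral>\<^sup>+x. \<integral>\<^sup>+w. ennreal (indicator J (fst w) * a w * decay_kernel d (r (fst w)) (x - snd w)) \<partial>lborel \<partial>lborel)
      \<le> ennreal D * (\<integral>\<^sup>+w. ennreal (indicator J (fst w) * a w) \<partial>lborel)"
    if a[measurable]: "a \<in> borel_measurable borel" and a0: "\<And>w. 0 \<le> a w" for a :: "real \<times> (real^'n) \<Rightarrow> real"
  proof -
    have m: "(\<lambda>(x, w). ennreal (indicator J (fst w) * a w * decay_kernel d (r (fst w)) (x - snd w))) \<in> borel_measurable (borel :: ((real^'n) \<times> real \<times> (real^'n)) measure)"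
      unfolding decay_kernel_def split_beta by measurable
    have "(\<integral>\<^sup>+x. \<integral>\<^sup>+w. ennreal (indicator J (fst w) * a w * decay_kernel d (r (fst w)) (x - snd w)) \<partial>lborel \<partial>lborel)
        = (\<integral>\<^sup>+w. \<integral>\<^sup>+x. ennreal (indicator J (fst w) * a w * decay_kernel d (r (fst w)) (x - snd w)) \<partial>lborel \<partial>lborel)"
      by (rule nn_integral_lborel_swap[OF m])
    also have "\<dots> \<le> (\<integral>\<^sup>+w. ennreal D * ennreal (indicator J (fst w) * a w) \<partial>lborel)"
    proof (rule nn_integral_mono)
      fix w :: "real \<times> (real^'n)"
      have Qm: "(\<lambda>x. ennreal (decay_kernel d (r (fst w)) (x - snd w))) \<in> borel_measurable lborel" unfolding decay_kernel_def by measurable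
      have "(\<integral>\<^sup>+x. ennreal (indicator J (fst w) * a w * decay_kernel d (r (fst w)) (x - snd w)) \<partial>lborel)
          = (\<integral>\<^sup>+x. ennreal (indicator J (fst w) * a w) * ennreal (decay_kernel d (r (fst w)) (x - snd w)) \<partial>lborel)"
        using a0 by (intro nn_integral_cong) (simp add: ennreal_mult)
      also have "\<dots> = ennreal (indicator J (fst w) * a w) * (\<integral>\<^sup>+x. ennreal (decay_kernel d (r (fst w)) (x - snd w)) \<partial>lborel)"
        by (rule nn_integral_cmult[OF Qm])
      also have "\<dots> \<le> ennreal D * ennreal (indicator J (fst w) * a w)"
      proof (cases "fst w \<in> J")
        case True
        then show ?thesis using QD(1)[OF True, of "snd w"] by (subst mult.commute) (rule mult_right_mono, auto)
      qed simp
      finally show "(\<integral>\<^sup>+x. ennreal (indicator J (fst w) * a w * decay_kernel d (r (fst w)) (x - snd w)) \<partial>lborel)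
          \<le> ennreal D * ennreal (indicator J (fst w) * a w)" .
    qed
    also have "\<dots> = ennreal D * (\<integral>\<^sup>+w. ennreal (indicator J (fst w) * a w) \<partial>lborel)"
      by (rule nn_integral_cmult) measurable
    finally show ?thesis .
  qed
  have "(\<integral>\<^sup>+x. H x \<partial>lborel) \<le> ennreal D * (\<integral>\<^sup>+w. ennreal (indicator J (fst w) * A w) \<partial>lborel)"
    unfolding H_def by (rule push[OF A A0])
  also have "\<dots> < \<infinity>" using fin by (simp add: ennreal_mult_less_top)
  finally have "(\<integral>\<^sup>+x. H x \<partial>lborel) \<noteq> \<infinity>" by simp
  then show AEfin: "AE x in lborel. H x < \<infinity>"
    using nn_integral_PInf_AE[of H lborel] by (auto simp: top.not_eq_extremum elim: eventually_mono)
  have Hs: "H x = (\<integral>\<^sup>+s. \<integral>\<^sup>+y. ennreal (indicator J s * A (s, y) * decay_kernel d (r s) (x - y)) \<partial>lborel \<partial>lborel)" for x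
    unfolding H_def by (subst nn_integral_lborel_pair) (auto simp: decay_kernel_def)
  have kI: "(\<integral>\<^sup>+s. \<integral>\<^sup>+y. ennreal (indicator J s * b s * decay_kernel d (r s) (x - y)) \<partial>lborel \<partial>lborel) \<le> ennreal (D * I)" for x :: "real^'n"
  proof -
    have "(\<integral>\<^sup>+s. \<integral>\<^sup>+y. ennreal (indicator J s * b s * decay_kernel d (r s) (x - y)) \<partial>lborel \<partial>lborel)
        \<le> (\<integral>\<^sup>+s. ennreal D * ennreal (indicator J s * b s) \<partial>lborel)"
    proof (rule nn_integral_mono)
      fix s :: real
      have Qm: "(\<lambda>y. ennreal (decay_kernel d (r s) (x - y))) \<in> borel_measurable lborel" unfolding decay_kernel_def by measurable
      have "(\<integral>\<^sup>+y. ennreal (indicator J s * b s * decay_kernel d (r s) (x - y)) \<partial>lborel)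
          = (\<integral>\<^sup>+y. ennreal (indicator J s * b s) * ennreal (decay_kernel d (r s) (x - y)) \<partial>lborel)"
        using b0 by (intro nn_integral_cong) (simp add: ennreal_mult)
      also have "\<dots> = ennreal (indicator J s * b s) * (\<integral>\<^sup>+y. ennreal (decay_kernel d (r s) (x - y)) \<partial>lborel)"
        by (rule nn_integral_cmult[OF Qm])
      also have "\<dots> \<le> ennreal D * ennreal (indicator J s * b s)"
      proof (cases "s \<in> J")
        case True
        then show ?thesis using QD(2)[OF True, of x] by (subst mult.commute) (rule mult_right_mono, auto)
      qed simp
      finally show "(\<integral>\<^sup>+y. ennreal (indicator J s * b s * decay_kernel d (r s) (x - y)) \<partial>lborel) \<le> ennreal D * ennreal (indicator J s * b s)" .
    qed
    also have "\<dots> = ennreal D * (\<integral>\<^sup>+s. ennreal (indicator J s * b s) \<partial>lborel)" by (rule nn_integral_cmult) measurable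
    also have "\<dots> \<le> ennreal D * ennreal I" by (intro mult_left_mono I) simp
    finally show ?thesis using D I by (simp add: ennreal_mult)
  qed
  show "Lq_le q (\<lambda>x. enn2real (H x)) (D * I * v)"
  proof (cases "q = \<infinity>")
    case True
    have "H x \<le> ennreal (D * I * v)" for x
    proof -
      have "H x \<le> (\<integral>\<^sup>+s. \<integral>\<^sup>+y. ennreal v * ennreal (indicator J s * b s * decay_kernel d (r s) (x - y)) \<partial>lborel \<partial>lborel)"
        unfolding Hs
      proof (rule nn_integral_mono_AE)
        show "AE s in lborel. (\<integral>\<^sup>+y. ennreal (indicator J s * A (s, y) * decay_kernel d (r s) (x - y)) \<partial>lborel)
            \<le> (\<integral>\<^sup>+y. ennreal v * ennreal (indicator J s * b s * decay_kernel d (r s) (x - y)) \<partial>lborel)"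
          using Lq
        proof eventually_elim
          case (elim s)
          show ?case
          proof (cases "s \<in> J")
            case sJ: True
            then have "AE y in lborel. A (s, y) \<le> b s * v" using elim True by (simp add: Lq_le_infinity)
            then show ?thesis
            proof (intro nn_integral_mono_AE, eventually_elim)
              case (elim y)
              have "indicator J s * A (s, y) * decay_kernel d (r s) (x - y) \<le> v * (indicator J s * b s * decay_kernel d (r s) (x - y))"
                using sJ mult_right_mono[OF elim(2), of "decay_kernel d (r s) (x - y)"] by (simp add: mult_ac)
              then show ?case using v b0 by (simp add: ennreal_leI flip: ennreal_mult)
            qed
          qed simp
        qed
      qed
      also have "\<dots> = ennreal v * (\<integral>\<^sup>+s. \<integral>\<^sup>+y. ennreal (indicator J s * b s * decay_kernel d (r s) (x - y)) \<partial>lborel \<partial>lborel)"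
      proof -
        have m: "(\<lambda>(s, y). ennreal (indicator J s * b s * decay_kernel d (r s) (x - y))) \<in> borel_measurable borel"
          unfolding decay_kernel_def split_beta by measurable
        have m2: "(\<lambda>s. \<integral>\<^sup>+y. ennreal (indicator J s * b s * decay_kernel d (r s) (x - y)) \<partial>lborel) \<in> borel_measurable lborel"
          using nn_integral_lborel_section_measurable[OF m] by simp
        have m3: "(\<lambda>y. ennreal (indicator J s * b s * decay_kernel d (r s) (x - y))) \<in> borel_measurable lborel" for s
          unfolding decay_kernel_def by measurable
        show ?thesis by (simp only: nn_integral_cmult[OF m3] nn_integral_cmult[OF m2])
      qed
      also have "\<dots> \<le> ennreal v * ennreal (D * I)" by (intro mult_left_mono kI) simp
      finally show ?thesis using v D I by (simp add: mult_ac flip: ennreal_mult)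
    qed
    then have "enn2real (H x) \<le> D * I * v" for x using v D I by (intro enn2real_leI) auto
    then show ?thesis using True by (simp add: Lq_le_infinity)
  next
    case False
    then obtain p where p: "1 \<le> p" "q = ennreal p" using finite_exponentE[OF q] by metis
    define k where "k x w = indicator J (fst w) * b (fst w) * decay_kernel d (r (fst w)) (x - snd w)" for x :: "real^'n" and w
    define g where "g w = A w / b (fst w)" for w
    have k0: "0 \<le> k x w" and g0: "0 \<le> g w" for x w using b0 A0 by (simp_all add: k_def g_def)
    have km[measurable]: "k x \<in> borel_measurable borel" for x unfolding k_def decay_kernel_def by measurable
    have gm[measurable]: "g \<in> borel_measurable borel" unfolding g_def by measurable
    have Lp: "AE s in lborel. s \<in> J \<longrightarrow> (\<integral>\<^sup>+y. ennreal (A (s, y) powr p) \<partial>lborel) \<le> ennreal ((b s * v) powr p)"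
      using Lq p by (simp add: Lq_le_finite)
    have Am: "(\<lambda>y. A (s, y)) \<in> borel_measurable borel" for s by measurable
    have kg: "(\<integral>\<^sup>+w. ennreal (k x w * g w) \<partial>lborel) = H x" for x
    proof -
      have "(\<integral>\<^sup>+w. ennreal (k x w * g w) \<partial>lborel) = (\<integral>\<^sup>+s. \<integral>\<^sup>+y. ennreal (k x (s, y) * g (s, y)) \<partial>lborel \<partial>lborel)"
        by (rule nn_integral_lborel_pair) measurable
      also have "\<dots> = H x" unfolding Hs
      proof (rule nn_integral_cong_AE)
        show "AE s in lborel. (\<integral>\<^sup>+y. ennreal (k x (s, y) * g (s, y)) \<partial>lborel) = (\<integral>\<^sup>+y. ennreal (indicator J s * A (s, y) * decay_kernel d (r s) (x - y)) \<partial>lborel)"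
          using Lp
        proof eventually_elim
          case (elim s)
          show ?case
          \<comment> \<open>Where b vanishes, the quotient A / b is 0 by convention. Nothing is
            lost: there the L^p bound forces A (s, .) to vanish almost everywhere.\<close>
          proof (cases "s \<in> J \<and> b s = 0")
            case True
            then have "(\<integral>\<^sup>+y. ennreal (A (s, y) powr p) \<partial>lborel) = 0" using elim by simp
            then have "AE y in lborel. ennreal (A (s, y) powr p) = 0"
              by (subst (asm) nn_integral_0_iff_AE) (use Am[of s] in measurable)
            then have "AE y in lborel. A (s, y) = 0" by eventually_elim (simp add: ennreal_eq_0_iff)
            then have "AE y in lborel. ennreal (k x (s, y) * g (s, y)) = ennreal (indicator J s * A (s, y) * decay_kernel d (r s) (x - y))"
              by eventually_elim (simp add: g_def)
            then show ?thesis by (rule nn_integral_cong_AE)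
          next
            case False
            then show ?thesis by (intro nn_integral_cong) (auto simp: k_def g_def indicator_def mult.commute)
          qed
        qed
      qed
      finally show ?thesis .
    qed
    have kle: "(\<integral>\<^sup>+w. ennreal (k x w) \<partial>lborel) \<le> ennreal (D * I)" for x
    proof -
      have "(\<integral>\<^sup>+w. ennreal (k x w) \<partial>lborel) = (\<integral>\<^sup>+s. \<integral>\<^sup>+y. ennreal (k x (s, y)) \<partial>lborel \<partial>lborel)"
        by (rule nn_integral_lborel_pair) measurable
      then show ?thesis using kI[of x] by (simp add: k_def)
    qed
    have gint: "(\<integral>\<^sup>+w. ennreal (indicator J (fst w) * (b (fst w) * g w powr p)) \<partial>lborel) \<le> ennreal (v powr p * I)"
    proof -
      have "(\<integral>\<^sup>+w. ennreal (indicator J (fst w) * (b (fst w) * g w powr p)) \<partial>lborel)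
          = (\<integral>\<^sup>+s. \<integral>\<^sup>+y. ennreal (indicator J s * (b s * g (s, y) powr p)) \<partial>lborel \<partial>lborel)"
        by (subst nn_integral_lborel_pair) auto
      also have "\<dots> \<le> (\<integral>\<^sup>+s. ennreal (v powr p) * ennreal (indicator J s * b s) \<partial>lborel)"
      proof (rule nn_integral_mono_AE)
        show "AE s in lborel. (\<integral>\<^sup>+y. ennreal (indicator J s * (b s * g (s, y) powr p)) \<partial>lborel) \<le> ennreal (v powr p) * ennreal (indicator J s * b s)"
          using Lp
        proof eventually_elim
          case (elim s)
          show ?case
          proof (cases "s \<in> J \<and> b s \<noteq> 0")
            case True
            then have bs: "0 < b s" using b0[of s] by auto
            have Apm: "(\<lambda>y. ennreal (A (s, y) powr p)) \<in> borel_measurable lborel" using Am[of s] by measurable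
            have "(\<integral>\<^sup>+y. ennreal (indicator J s * (b s * g (s, y) powr p)) \<partial>lborel)
                = (\<integral>\<^sup>+y. ennreal (b s * b s powr (- p)) * ennreal (A (s, y) powr p) \<partial>lborel)"
            proof (rule nn_integral_cong)
              fix y
              have "g (s, y) powr p = A (s, y) powr p * b s powr (- p)"
              proof -
                have "g (s, y) powr p = A (s, y) powr p / b s powr p"
                  unfolding g_def using bs A0[of "(s, y)"] by (simp add: powr_divide)
                then show ?thesis by (simp only: powr_minus divide_inverse)
              qed
              then show "ennreal (indicator J s * (b s * g (s, y) powr p)) = ennreal (b s * b s powr (- p)) * ennreal (A (s, y) powr p)"
                using True bs by (simp add: mult_ac flip: ennreal_mult)
            qed
            also have "\<dots> = ennreal (b s * b s powr (- p)) * (\<integral>\<^sup>+y. ennreal (A (s, y) powr p) \<partial>lborel)"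
              by (rule nn_integral_cmult[OF Apm])
            also have "\<dots> \<le> ennreal (b s * b s powr (- p)) * ennreal ((b s * v) powr p)"
              using elim True by (intro mult_left_mono) auto
            also have "\<dots> = ennreal (b s * (b s powr (- p) * b s powr p) * v powr p)"
              using bs by (simp add: powr_mult mult_ac flip: ennreal_mult)
            also have "b s powr (- p) * b s powr p = 1" using bs by (simp flip: powr_add)
            finally show ?thesis using True bs by (simp add: mult_ac flip: ennreal_mult)
          qed auto
        qed
      qed
      also have "\<dots> = ennreal (v powr p) * (\<integral>\<^sup>+s. ennreal (indicator J s * b s) \<partial>lborel)" by (rule nn_integral_cmult) measurable
      also have "\<dots> \<le> ennreal (v powr p) * ennreal I" by (intro mult_left_mono I) simp
      finally show ?thesis using I by (simp add: ennreal_mult)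
    qed
    have "(\<integral>\<^sup>+x. ennreal (enn2real (H x) powr p) \<partial>lborel)
        \<le> (\<integral>\<^sup>+x. ennreal ((D * I) powr (p - 1)) * (\<integral>\<^sup>+w. ennreal (k x w * g w powr p) \<partial>lborel) \<partial>lborel)"
    proof (rule nn_integral_mono_AE)
      show "AE x in lborel. ennreal (enn2real (H x) powr p) \<le> ennreal ((D * I) powr (p - 1)) * (\<integral>\<^sup>+w. ennreal (k x w * g w powr p) \<partial>lborel)"
        using AEfin
      proof eventually_elim
        case (elim x)
        have "ennreal (enn2real (\<integral>\<^sup>+w. ennreal (k x w * g w) \<partial>lborel) powr p) \<le> ennreal ((D * I) powr (p - 1)) * (\<integral>\<^sup>+w. ennreal (k x w * g w powr p) \<partial>lborel)"
          using elim D I by (intro nn_integral_Jensen_powr p k0 g0 kle) (auto simp: kg)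
        then show ?case unfolding kg .
      qed
    qed
    also have "\<dots> = ennreal ((D * I) powr (p - 1)) * (\<integral>\<^sup>+x. \<integral>\<^sup>+w. ennreal (k x w * g w powr p) \<partial>lborel \<partial>lborel)"
    proof (rule nn_integral_cmult)
      have "(\<lambda>(x, w). ennreal (k x w * g w powr p)) \<in> borel_measurable (borel :: ((real^'n) \<times> real \<times> (real^'n)) measure)"
        unfolding k_def decay_kernel_def split_beta by measurable
      from nn_integral_lborel_section_measurable[OF this]
      show "(\<lambda>x. \<integral>\<^sup>+w. ennreal (k x w * g w powr p) \<partial>lborel) \<in> borel_measurable lborel" by simp
    qed
    also have "(\<integral>\<^sup>+x. \<integral>\<^sup>+w. ennreal (k x w * g w powr p) \<partial>lborel \<partial>lborel)
        \<le> ennreal D * (\<integral>\<^sup>+w. ennreal (indicator J (fst w) * (b (fst w) * g w powr p)) \<partial>lborel)"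
    proof -
      have "k x w * g w powr p = indicator J (fst w) * (b (fst w) * g w powr p) * decay_kernel d (r (fst w)) (x - snd w)" for x w
        by (simp add: k_def mult_ac)
      moreover have "(\<integral>\<^sup>+x. \<integral>\<^sup>+w. ennreal (indicator J (fst w) * (b (fst w) * g w powr p) * decay_kernel d (r (fst w)) (x - snd w)) \<partial>lborel \<partial>lborel)
        \<le> ennreal D * (\<integral>\<^sup>+w. ennreal (indicator J (fst w) * (b (fst w) * g w powr p)) \<partial>lborel)"
        by (rule push) (use b0 in \<open>measurable, simp\<close>)
      ultimately show ?thesis by (simp only:)
    qed
    also have "\<dots> \<le> ennreal D * ennreal (v powr p * I)" by (intro mult_left_mono gint) simp
    finally have "(\<integral>\<^sup>+x. ennreal (enn2real (H x) powr p) \<partial>lborel) \<le> ennreal ((D * I) powr (p - 1) * (D * (v powr p * I)))"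
      using D I by (simp add: mult_left_mono flip: ennreal_mult)
    also have "(D * I) powr (p - 1) * (D * (v powr p * I)) = (D * I * v) powr p"
    proof (cases "D * I = 0")
      case False
      then have "0 < D * I" using D I by (metis mult_nonneg_nonneg order_less_le)
      then have "(D * I) powr p = (D * I) powr (p - 1) * (D * I)" using powr_add[of "D * I" "p - 1" 1] by simp
      then show ?thesis by (simp add: powr_mult[of "D * I" v])
    qed (auto simp: powr_mult)
    finally show ?thesis using p by (simp add: Lq_le_finite)
  qed
qed

text \<open>A superposition of kernels with total weight at most M: its supremum is at most T c M,
  its integral at most c M by Tonelli's theorem, and the two bounds are interpolated.\<close>

lemma Lq_le_bounded_kernel:
  fixes m :: "'b::euclidean_space \<Rightarrow> real" and \<kappa> :: "real^'n \<Rightarrow> 'b \<Rightarrow> real"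
  assumes q: "1 \<le> q" and T: "0 < T" and c: "0 \<le> c" and M: "0 \<le> M"
    and m[measurable]: "m \<in> borel_measurable borel" and m0: "\<And>w. 0 \<le> m w"
    and mM: "(\<integral>\<^sup>+w. ennreal (m w) \<partial>lborel) \<le> ennreal M"
    and \<kappa>m: "(\<lambda>(x, w). \<kappa> x w) \<in> borel_measurable borel" and \<kappa>0: "\<And>x w. 0 \<le> \<kappa> x w"
    and sup: "\<And>x w. m w \<noteq> 0 \<Longrightarrow> \<kappa> x w \<le> T * c"
    and int: "\<And>w. m w \<noteq> 0 \<Longrightarrow> (\<integral>\<^sup>+x. ennreal (\<kappa> x w) \<partial>lborel) \<le> ennreal c"
  defines "H \<equiv> \<lambda>x. \<integral>\<^sup>+w. ennreal (m w * \<kappa> x w) \<partial>lborel"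
  shows "H \<in> borel_measurable borel" "\<And>x. H x < \<infinity>"
    "Lq_le q (\<lambda>x. enn2real (H x)) (T powr (1 - enn2real (1 / q)) * (c * M))"
proof -
  have [measurable]: "(\<lambda>p. \<kappa> (fst p) (snd p)) \<in> borel_measurable borel" using \<kappa>m by (simp only: case_prod_beta')
  have jm: "(\<lambda>(x, w). ennreal (m w * \<kappa> x w)) \<in> borel_measurable borel" unfolding split_beta by measurable
  show Hm[measurable]: "H \<in> borel_measurable borel" unfolding H_def by (rule nn_integral_lborel_section_measurable[OF jm])
  have Hle: "H x \<le> ennreal (T * (c * M))" for x
  proof -
    have "H x \<le> (\<integral>\<^sup>+w. ennreal (T * c) * ennreal (m w) \<partial>lborel)"
      unfolding H_def
    proof (rule nn_integral_mono)
      fix w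
      have "m w * \<kappa> x w \<le> T * c * m w"
      proof (cases "m w = 0")
        case False
        then show ?thesis using mult_left_mono[OF sup[OF False, of x] m0[of w]] by (simp add: mult.commute)
      qed simp
      then show "ennreal (m w * \<kappa> x w) \<le> ennreal (T * c) * ennreal (m w)"
        using T c m0 by (simp add: ennreal_leI flip: ennreal_mult)
    qed
    also have "\<dots> = ennreal (T * c) * (\<integral>\<^sup>+w. ennreal (m w) \<partial>lborel)" by (rule nn_integral_cmult) simp
    also have "\<dots> \<le> ennreal (T * c) * ennreal M" by (intro mult_left_mono mM) simp
    also have "\<dots> = ennreal (T * (c * M))" using T c M by (simp add: mult.assoc flip: ennreal_mult)
    finally show ?thesis .
  qed
  show Hfin: "H x < \<infinity>" for x by (rule order.strict_trans1[OF Hle[of x]]) simp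
  have "(\<integral>\<^sup>+x. H x \<partial>lborel) = (\<integral>\<^sup>+w. \<integral>\<^sup>+x. ennreal (m w * \<kappa> x w) \<partial>lborel \<partial>lborel)"
    unfolding H_def by (rule nn_integral_lborel_swap[OF jm])
  also have "\<dots> \<le> (\<integral>\<^sup>+w. ennreal c * ennreal (m w) \<partial>lborel)"
  proof (rule nn_integral_mono)
    fix w
    have km: "(\<lambda>x. ennreal (\<kappa> x w)) \<in> borel_measurable lborel"
    proof -
      have "(\<lambda>x. (\<lambda>p. \<kappa> (fst p) (snd p)) (x, w)) \<in> borel_measurable borel" by measurable
      then show ?thesis by simp
    qed
    have "(\<integral>\<^sup>+x. ennreal (m w * \<kappa> x w) \<partial>lborel) = (\<integral>\<^sup>+x. ennreal (m w) * ennreal (\<kappa> x w) \<partial>lborel)"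
      using m0 \<kappa>0 by (intro nn_integral_cong) (simp add: ennreal_mult)
    also have "\<dots> = ennreal (m w) * (\<integral>\<^sup>+x. ennreal (\<kappa> x w) \<partial>lborel)" by (rule nn_integral_cmult[OF km])
    also have "\<dots> \<le> ennreal c * ennreal (m w)"
    proof (cases "m w = 0")
      case False
      then show ?thesis using int[OF False] by (subst mult.commute) (rule mult_right_mono, auto)
    qed simp
    finally show "(\<integral>\<^sup>+x. ennreal (m w * \<kappa> x w) \<partial>lborel) \<le> ennreal c * ennreal (m w)" .
  qed
  also have "\<dots> = ennreal c * (\<integral>\<^sup>+w. ennreal (m w) \<partial>lborel)" by (rule nn_integral_cmult) simp
  also have "\<dots> \<le> ennreal c * ennreal M" by (intro mult_left_mono mM) simp
  finally have intH: "(\<integral>\<^sup>+x. H x \<partial>lborel) \<le> ennreal (c * M)" using c M by (simp add: ennreal_mult)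
  have eH: "ennreal (enn2real (H x)) = H x" for x using Hfin[of x] by (simp add: ennreal_enn2real)
  show "Lq_le q (\<lambda>x. enn2real (H x)) (T powr (1 - enn2real (1 / q)) * (c * M))"
  proof (rule Lq_le_interpolation[OF q T])
    show "enn2real (H x) \<le> T * (c * M)" for x using Hle[of x] T c M by (intro enn2real_leI) auto
    show "(\<integral>\<^sup>+x. ennreal (enn2real (H x)) \<partial>lborel) \<le> ennreal (c * M)" using intH by (simp only: eH)
  qed (use c M in auto)
qed

lemma Lq_le_mono:
  assumes "1 \<le> q" "Lq_le q h B" "0 \<le> B" "B \<le> B'"
  shows "Lq_le q h B'"
proof (cases "q = \<infinity>")
  case True
  then have "AE x in lborel. h x \<le> B" using assms(2) by (simp add: Lq_le_infinity)
  then have "AE x in lborel. h x \<le> B'" by eventually_elim (use assms(4) in simp)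
  then show ?thesis using True by (simp add: Lq_le_infinity)
next
  case False
  then obtain p where p: "1 \<le> p" "q = ennreal p" using finite_exponentE[OF assms(1)] by metis
  have "ennreal (B powr p) \<le> ennreal (B' powr p)" using p assms by (intro ennreal_leI powr_mono2) auto
  then show ?thesis using assms(2) p by (auto simp: Lq_le_finite intro: order_trans)
qed

section \<open>Weighted estimate of the difference\<close>

text \<open>The quantity z of the overview, as a function of the source point (s, y).\<close>

definition weight_scale :: "real \<Rightarrow> real \<Rightarrow> real^'n \<Rightarrow> real" where
  "weight_scale \<theta> s y = norm y + (s + 1) powr (1 / \<theta>)"

text \<open>The part of the remainder estimate that depends on the source point. It has the two
  properties that dominated convergence requires: it stays below z^K, and it tends to 0 as t grows
  with (s, y) fixed, provided d > 0.\<close>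

definition damped_weight :: "real \<Rightarrow> real \<Rightarrow> real \<Rightarrow> real \<Rightarrow> real \<Rightarrow> real^'n \<Rightarrow> real" where
  "damped_weight \<theta> K d t s y = weight_scale \<theta> s y powr K * (min 1 (weight_scale \<theta> s y / (t + 1) powr (1 / \<theta>))) powr d"

lemma weight_scale_nonneg [simp]: "0 \<le> weight_scale \<theta> s y"
  by (simp add: weight_scale_def)

lemma damped_weight_nonneg [simp]: "0 \<le> damped_weight \<theta> K d t s y"
  by (simp add: damped_weight_def)

lemma damped_weight_le: "0 \<le> d \<Longrightarrow> damped_weight \<theta> K d t s y \<le> weight_scale \<theta> s y powr K"
  unfolding damped_weight_def by (intro mult_left_le powr_le1) auto

lemma remainder_kernel_estimate_damped_weight:
  assumes "0 < \<theta>" "0 \<le> l" "l \<le> K"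
  shows "\<exists>C d. 0 \<le> C \<and> 0 < d \<and> (\<forall>(x::real^'n) y t s. 0 \<le> s \<longrightarrow> s < t \<longrightarrow>
     norm x powr l * \<bar>remainder_kernel \<theta> K x y t s\<bar> \<le> C * ((t + 1) powr (1 / \<theta>)) powr (l - K) * damped_weight \<theta> K d t s y *
       (decay_kernel d ((t - s) powr (1 / \<theta>)) (x - y) + decay_kernel d ((t + 1) powr (1 / \<theta>)) x + decay_kernel d (max ((t + 1) powr (1 / \<theta>)) (weight_scale \<theta> s y)) x))"
proof (rule remainder_kernel_estimate[OF assms, where 'n = 'n, folded weight_scale_def, folded damped_weight_def])
  fix C d :: real
  assume "0 \<le> C" "0 < d" "\<And>(x::real^'n) y t s. 0 \<le> s \<Longrightarrow> s < t \<Longrightarrow>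
     norm x powr l * \<bar>remainder_kernel \<theta> K x y t s\<bar> \<le> C * ((t + 1) powr (1 / \<theta>)) powr (l - K) * damped_weight \<theta> K d t s y *
       (decay_kernel d ((t - s) powr (1 / \<theta>)) (x - y) + decay_kernel d ((t + 1) powr (1 / \<theta>)) x + decay_kernel d (max ((t + 1) powr (1 / \<theta>)) (weight_scale \<theta> s y)) x)"
  then show ?thesis by (intro exI[of _ C] exI[of _ d] conjI allI impI)
qed

lemma decay_exponent_bounds:
  assumes "0 < \<theta>" "1 \<le> q"
  shows "0 \<le> decay_exponent N \<theta> q" "decay_exponent N \<theta> q \<le> real N / \<theta>"
proof -
  have "enn2real (1 / q) \<le> 1"
  proof (cases "q = \<infinity>")
    case False
    then obtain p where "1 \<le> p" "enn2real (1 / q) = 1 / p" using finite_exponentE[OF assms(2)] by metis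
    then show ?thesis by simp
  qed simp
  then show "0 \<le> decay_exponent N \<theta> q" using assms by (simp add: decay_exponent_def)
  have "real N / \<theta> * (1 - enn2real (1 / q)) \<le> real N / \<theta> * 1" using assms by (intro mult_left_mono) auto
  then show "decay_exponent N \<theta> q \<le> real N / \<theta>" by (simp add: decay_exponent_def)
qed

text \<open>The initial datum, and the source against all kernels of width at least
  (t/2)^(1/\<theta>), are treated by interpolation; the singular kernel at times s > t/2 is treated
  by the time convolution estimate. The function g is only assumed to be dominated pointwise by the
  two remainder integrals, which separates these estimates from the derivation of the integral
  representation.\<close>

lemma weighted_difference_bound:
  assumes \<theta>: "0 < \<theta>" and l: "0 \<le> l" "l \<le> K" and q: "1 \<le> q"
  obtains C d where "0 \<le> C" "0 < d"
    "\<And>(\<phi>0 :: real^'n \<Rightarrow> real) f0 e c t g.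
      \<lbrakk>\<phi>0 \<in> borel_measurable borel; f0 \<in> borel_measurable borel; e \<in> borel_measurable borel; g \<in> borel_measurable borel;
       0 \<le> c; 0 < t;
       (\<integral>\<^sup>+y. ennreal (weight_scale \<theta> 0 y powr K * \<bar>\<phi>0 y\<bar>) \<partial>lborel) < \<infinity>;
       (\<integral>\<^sup>+s. indicator {0<..<t} s * e s \<partial>lborel) < \<infinity>;
       AE s in lborel. 0 < s \<longrightarrow> (\<integral>\<^sup>+y. ennreal (weight_scale \<theta> s y powr K * \<bar>f0 (s, y)\<bar>) \<partial>lborel) \<le> ennreal c * e s;
       AE s in lborel. 0 < s \<longrightarrow> e s < \<infinity> \<longrightarrow>
         Lq_le q (\<lambda>y. weight_scale \<theta> s y powr K * \<bar>f0 (s, y)\<bar>) (c * s powr (- decay_exponent CARD('n) \<theta> q) * enn2real (e s));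
       \<And>x. ennreal \<bar>g x\<bar> \<le> (\<integral>\<^sup>+y. ennreal (norm x powr l * \<bar>remainder_kernel \<theta> K x y t 0\<bar> * \<bar>\<phi>0 y\<bar>) \<partial>lborel)
         + (\<integral>\<^sup>+w. ennreal (indicator {0<..<t} (fst w) * (norm x powr l * \<bar>remainder_kernel \<theta> K x (snd w) t (fst w)\<bar> * \<bar>f0 w\<bar>)) \<partial>lborel)\<rbrakk>
     \<Longrightarrow> Lnorm q g \<le> ennreal (C * (1 + c) * ((t + 1) powr (1 / \<theta>)) powr (l - K) * t powr (- decay_exponent CARD('n) \<theta> q) *
          (enn2real (\<integral>\<^sup>+y. ennreal (damped_weight \<theta> K d t 0 y * \<bar>\<phi>0 y\<bar>) \<partial>lborel)
         + enn2real (\<integral>\<^sup>+w. ennreal (indicator {0<..<t} (fst w) * damped_weight \<theta> K d t (fst w) (snd w) * \<bar>f0 w\<bar>) \<partial>lborel)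
         + enn2real (\<integral>\<^sup>+s. indicator {t/2<..<t} s * e s \<partial>lborel)))"
proof -
  let ?N = "real CARD('n)"
  define a where "a = decay_exponent CARD('n) \<theta> q"
  have a: "0 \<le> a" "a \<le> ?N / \<theta>" unfolding a_def using decay_exponent_bounds[OF \<theta> q] by auto
  obtain C d where Sb: "0 \<le> C \<and> 0 < d \<and> (\<forall>(x::real^'n) y t s. 0 \<le> s \<longrightarrow> s < t \<longrightarrow>
     norm x powr l * \<bar>remainder_kernel \<theta> K x y t s\<bar> \<le> C * ((t + 1) powr (1 / \<theta>)) powr (l - K) * damped_weight \<theta> K d t s y *
       (decay_kernel d ((t - s) powr (1 / \<theta>)) (x - y) + decay_kernel d ((t + 1) powr (1 / \<theta>)) x + decay_kernel d (max ((t + 1) powr (1 / \<theta>)) (weight_scale \<theta> s y)) x))"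
    using remainder_kernel_estimate_damped_weight[OF \<theta> l, where 'n = 'n] by (elim exE)
  then have C: "0 \<le> C" and d: "0 < d" by simp_all
  have S: "norm x powr l * \<bar>remainder_kernel \<theta> K x y t s\<bar> \<le> C * ((t + 1) powr (1 / \<theta>)) powr (l - K) * damped_weight \<theta> K d t s y *
       (decay_kernel d ((t - s) powr (1 / \<theta>)) (x - y) + decay_kernel d ((t + 1) powr (1 / \<theta>)) x + decay_kernel d (max ((t + 1) powr (1 / \<theta>)) (weight_scale \<theta> s y)) x)"
    if "0 \<le> s" "s < t" for x y :: "real^'n" and t s
    using Sb that by simp
  obtain D where D: "0 \<le> D" "\<And>r. 0 < r \<Longrightarrow> (\<integral>\<^sup>+x. ennreal (decay_kernel d r (x :: real^'n)) \<partial>lborel) \<le> ennreal D"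
    using nn_integral_decay_kernel_bounded[OF d] by metis
  \<comment> \<open>The price of replacing t/2 by t: it covers the suprema of the kernels and, since
    the decay exponent is at most N/\<theta>, also the weights s^(-a) for s > t/2.\<close>
  define b where "b = 2 powr (?N / \<theta>)"
  define c0 where "c0 = 3 * (b + D)"
  have b: "0 \<le> b" and c0: "0 \<le> c0" using D by (simp_all add: b_def c0_def)
  show thesis
  \<comment> \<open>Two nested applications of \<open>Lq_le_add\<close> cost 4 * 4 = 16. The
    constant \<open>c0\<close> belongs to the bounded kernels, \<open>D * b\<close> to the
    convolution with the singular one.\<close>
  proof (rule that[of "16 * C * (c0 + D * b)" d])
    show "0 \<le> 16 * C * (c0 + D * b)" using C c0 D b by simp
    show "0 < d" by (rule d)
    fix \<phi>0 g :: "real^'n \<Rightarrow> real" and f0 :: "real \<times> (real^'n) \<Rightarrow> real" and e :: "real \<Rightarrow> ennreal" and c t :: real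
    assume [measurable]: "\<phi>0 \<in> borel_measurable borel" "f0 \<in> borel_measurable borel" "e \<in> borel_measurable borel" "g \<in> borel_measurable borel"
      and c: "0 \<le> c" and t: "0 < t"
      and \<phi>fin: "(\<integral>\<^sup>+y. ennreal (weight_scale \<theta> 0 y powr K * \<bar>\<phi>0 y\<bar>) \<partial>lborel) < \<infinity>"
      and efin: "(\<integral>\<^sup>+s. indicator {0<..<t} s * e s \<partial>lborel) < \<infinity>"
      and L1: "AE s in lborel. 0 < s \<longrightarrow> (\<integral>\<^sup>+y. ennreal (weight_scale \<theta> s y powr K * \<bar>f0 (s, y)\<bar>) \<partial>lborel) \<le> ennreal c * e s"
      and LQ: "AE s in lborel. 0 < s \<longrightarrow> e s < \<infinity> \<longrightarrow>
         Lq_le q (\<lambda>y. weight_scale \<theta> s y powr K * \<bar>f0 (s, y)\<bar>) (c * s powr (- decay_exponent CARD('n) \<theta> q) * enn2real (e s))"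
      and g: "\<And>x. ennreal \<bar>g x\<bar> \<le> (\<integral>\<^sup>+y. ennreal (norm x powr l * \<bar>remainder_kernel \<theta> K x y t 0\<bar> * \<bar>\<phi>0 y\<bar>) \<partial>lborel)
         + (\<integral>\<^sup>+w. ennreal (indicator {0<..<t} (fst w) * (norm x powr l * \<bar>remainder_kernel \<theta> K x (snd w) t (fst w)\<bar> * \<bar>f0 w\<bar>)) \<partial>lborel)"
    define \<rho> where "\<rho> = (t + 1) powr (1 / \<theta>)"
    define T where "T = t powr (- ?N / \<theta>)"
    define J where "J = {t/2<..<t}"
    define r where "r s = (t - s) powr (1 / \<theta>)" for s
    define Z where "Z w = weight_scale \<theta> (fst w) (snd w) powr K * \<bar>f0 w\<bar>" for w :: "real \<times> (real^'n)"
    have T0: "0 < T" using t by (simp add: T_def)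
    have Ta: "T powr (1 - enn2real (1 / q)) = t powr (- a)"
      unfolding T_def a_def decay_exponent_def by (simp add: powr_powr)
    have \<rho>0: "0 < \<rho>" using t by (simp add: \<rho>_def)
    have [measurable]: "Z \<in> borel_measurable borel" unfolding Z_def weight_scale_def by measurable
    have [measurable]: "r \<in> borel_measurable borel" unfolding r_def by measurable
    have Z0: "0 \<le> Z w" for w by (simp add: Z_def)
    have Qb: "decay_kernel d r' x \<le> T * b" if "(t / 2) powr (1 / \<theta>) \<le> r'" for r' and x :: "real^'n"
    proof -
      have pos: "0 < (t / 2) powr (1 / \<theta>)" using t by simp
      then have "0 < r'" using that by (rule order.strict_trans2)
      then have "decay_kernel d r' x \<le> r' powr (- ?N)" using d by (intro decay_kernel_le) auto
      also have "\<dots> \<le> ((t / 2) powr (1 / \<theta>)) powr (- ?N)" using that pos by (intro powr_mono2') auto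
      also have "\<dots> = (t / 2) powr (- ?N / \<theta>)" by (simp add: powr_powr)
      also have "\<dots> = T / 2 powr (- ?N / \<theta>)" using t by (simp add: T_def powr_divide)
      also have "\<dots> = T * b" by (simp add: b_def powr_minus_divide)
      finally show ?thesis .
    qed
    have t\<rho>: "(t / 2) powr (1 / \<theta>) \<le> \<rho>" "(t / 2) powr (1 / \<theta>) \<le> t powr (1 / \<theta>)"
      using t \<theta> by (auto simp: \<rho>_def intro!: powr_mono2)
    have three_sup: "A1 + A2 + A3 \<le> T * c0" if "A1 \<le> T * b" "A2 \<le> T * b" "A3 \<le> T * b" for A1 A2 A3
    proof -
      have "A1 + A2 + A3 \<le> T * (3 * b)" using that by simp
      also have "\<dots> \<le> T * c0" using T0 D by (intro mult_left_mono) (auto simp: c0_def)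
      finally show ?thesis .
    qed
    have three_int: "(\<integral>\<^sup>+x. ennreal (B1 x + B2 x + B3 x) \<partial>lborel) \<le> ennreal c0"
      if [measurable]: "B1 \<in> borel_measurable borel" "B2 \<in> borel_measurable borel" "B3 \<in> borel_measurable borel"
        and nn: "\<And>x. 0 \<le> B1 x" "\<And>x. 0 \<le> B2 x" "\<And>x. 0 \<le> B3 x"
        and i: "(\<integral>\<^sup>+x. ennreal (B1 x) \<partial>lborel) \<le> ennreal D" "(\<integral>\<^sup>+x. ennreal (B2 x) \<partial>lborel) \<le> ennreal D" "(\<integral>\<^sup>+x. ennreal (B3 x) \<partial>lborel) \<le> ennreal D"
      for B1 B2 B3 :: "real^'n \<Rightarrow> real"
    proof -
      have "(\<integral>\<^sup>+x. ennreal (B1 x + B2 x + B3 x) \<partial>lborel) = (\<integral>\<^sup>+x. ennreal (B1 x) + ennreal (B2 x) + ennreal (B3 x) \<partial>lborel)"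
        using nn by (intro nn_integral_cong) (simp add: ennreal_plus)
      also have "\<dots> = (\<integral>\<^sup>+x. ennreal (B1 x) \<partial>lborel) + (\<integral>\<^sup>+x. ennreal (B2 x) \<partial>lborel) + (\<integral>\<^sup>+x. ennreal (B3 x) \<partial>lborel)"
        by (simp add: nn_integral_add)
      also have "\<dots> \<le> ennreal D + ennreal D + ennreal D" by (intro add_mono i)
      also have "\<dots> = ennreal (3 * D)" using D by (simp flip: ennreal_plus)
      also have "\<dots> \<le> ennreal c0" using b by (intro ennreal_leI) (simp add: c0_def)
      finally show ?thesis .
    qed
    have Qm: "(\<lambda>x. decay_kernel d r' (x - y)) \<in> borel_measurable borel" for r' and y :: "real^'n" unfolding decay_kernel_def by measurable
    have Qtr: "(\<integral>\<^sup>+x. ennreal (decay_kernel d r' (x - y)) \<partial>lborel) \<le> ennreal D" if "0 < r'" for r' and y :: "real^'n"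
      unfolding nn_integral_decay_kernel_translate by (rule D(2)[OF that])

    define m\<phi> where "m\<phi> y = damped_weight \<theta> K d t 0 y * \<bar>\<phi>0 y\<bar>" for y
    define \<kappa>\<phi> where "\<kappa>\<phi> x y = decay_kernel d (t powr (1 / \<theta>)) (x - y) + decay_kernel d \<rho> x + decay_kernel d (max \<rho> (weight_scale \<theta> 0 y)) x" for x y :: "real^'n"
    define M\<phi> where "M\<phi> = enn2real (\<integral>\<^sup>+y. ennreal (m\<phi> y) \<partial>lborel)"
    have m\<phi>m: "m\<phi> \<in> borel_measurable borel" unfolding m\<phi>_def damped_weight_def weight_scale_def by measurable
    have m\<phi>0: "0 \<le> m\<phi> y" for y by (simp add: m\<phi>_def)
    have "(\<integral>\<^sup>+y. ennreal (m\<phi> y) \<partial>lborel) \<le> (\<integral>\<^sup>+y. ennreal (weight_scale \<theta> 0 y powr K * \<bar>\<phi>0 y\<bar>) \<partial>lborel)"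
      unfolding m\<phi>_def using d by (intro nn_integral_mono ennreal_leI mult_right_mono damped_weight_le) auto
    then have M\<phi>: "(\<integral>\<^sup>+y. ennreal (m\<phi> y) \<partial>lborel) = ennreal M\<phi>"
      unfolding M\<phi>_def using \<phi>fin by (subst ennreal_enn2real) auto
    have \<kappa>\<phi>m: "(\<lambda>(x, y). \<kappa>\<phi> x y) \<in> borel_measurable borel" unfolding \<kappa>\<phi>_def decay_kernel_def weight_scale_def split_beta by measurable
    have \<kappa>\<phi>0: "0 \<le> \<kappa>\<phi> x y" for x y by (simp add: \<kappa>\<phi>_def)
    have \<kappa>\<phi>s: "\<kappa>\<phi> x y \<le> T * c0" for x y
      unfolding \<kappa>\<phi>_def using t\<rho> by (intro three_sup Qb) auto
    have \<kappa>\<phi>i: "(\<integral>\<^sup>+x. ennreal (\<kappa>\<phi> x y) \<partial>lborel) \<le> ennreal c0" for y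
      unfolding \<kappa>\<phi>_def using t \<rho>0 by (intro three_int Qtr D Qm decay_kernel_measurable decay_kernel_nonneg) auto
    define H\<phi> where "H\<phi> x = (\<integral>\<^sup>+y. ennreal (m\<phi> y * \<kappa>\<phi> x y) \<partial>lborel)" for x
    have M\<phi>0: "0 \<le> M\<phi>" by (simp add: M\<phi>_def)
    note bk = Lq_le_bounded_kernel[OF q T0 c0 M\<phi>0 m\<phi>m m\<phi>0 eq_refl[OF M\<phi>] \<kappa>\<phi>m \<kappa>\<phi>0 \<kappa>\<phi>s \<kappa>\<phi>i, folded H\<phi>_def, unfolded Ta]
    note H\<phi> = bk

    define mf where "mf w = indicator {0<..<t} (fst w) * damped_weight \<theta> K d t (fst w) (snd w) * \<bar>f0 w\<bar>" for w :: "real \<times> (real^'n)"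
    \<comment> \<open>The indicator keeps the kernel of width (t - s)^(1/\<theta>) only while this
      width is at least (t/2)^(1/\<theta>); its singular part, s > t/2, is collected in
      \<open>H2\<close>. The other two kernels have width at least \<rho> at all times.\<close>
    define \<kappa>f where "\<kappa>f x w = indicator {..t/2} (fst w) * decay_kernel d (r (fst w)) (x - snd w) + decay_kernel d \<rho> x + decay_kernel d (max \<rho> (weight_scale \<theta> (fst w) (snd w))) x"
      for x and w :: "real \<times> (real^'n)"
    define Mf where "Mf = enn2real (\<integral>\<^sup>+w. ennreal (mf w) \<partial>lborel)"
    have mfm: "mf \<in> borel_measurable borel" unfolding mf_def damped_weight_def weight_scale_def by measurable
    have mf0: "0 \<le> mf w" for w by (simp add: mf_def)
    have Zint: "(\<integral>\<^sup>+w. ennreal (indicator {0<..<t} (fst w) * Z w) \<partial>lborel) < \<infinity>"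
    proof -
      have "(\<integral>\<^sup>+w. ennreal (indicator {0<..<t} (fst w) * Z w) \<partial>lborel) = (\<integral>\<^sup>+s. \<integral>\<^sup>+y. ennreal (indicator {0<..<t} s * Z (s, y)) \<partial>lborel \<partial>lborel)"
        by (subst nn_integral_lborel_pair) auto
      also have "\<dots> \<le> (\<integral>\<^sup>+s. ennreal c * (indicator {0<..<t} s * e s) \<partial>lborel)"
      proof (rule nn_integral_mono_AE)
        show "AE s in lborel. (\<integral>\<^sup>+y. ennreal (indicator {0<..<t} s * Z (s, y)) \<partial>lborel) \<le> ennreal c * (indicator {0<..<t} s * e s)"
          using L1
        proof eventually_elim
          case (elim s)
          then show ?case by (cases "s \<in> {0<..<t}") (auto simp: Z_def)
        qed
      qed
      also have "\<dots> = ennreal c * (\<integral>\<^sup>+s. indicator {0<..<t} s * e s \<partial>lborel)" by (rule nn_integral_cmult) measurable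
      also have "\<dots> < \<infinity>" using efin by (simp add: ennreal_mult_less_top)
      finally show ?thesis .
    qed
    have "(\<integral>\<^sup>+w. ennreal (mf w) \<partial>lborel) \<le> (\<integral>\<^sup>+w. ennreal (indicator {0<..<t} (fst w) * Z w) \<partial>lborel)"
      unfolding mf_def Z_def mult.assoc using d by (intro nn_integral_mono ennreal_leI mult_left_mono mult_right_mono damped_weight_le) auto
    then have Mf: "(\<integral>\<^sup>+w. ennreal (mf w) \<partial>lborel) = ennreal Mf"
      unfolding Mf_def using Zint by (subst ennreal_enn2real) auto
    have \<kappa>fm: "(\<lambda>(x, w). \<kappa>f x w) \<in> borel_measurable borel" unfolding \<kappa>f_def decay_kernel_def weight_scale_def split_beta by measurable
    have \<kappa>f0: "0 \<le> \<kappa>f x w" for x w by (simp add: \<kappa>f_def)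
    have rs: "(t / 2) powr (1 / \<theta>) \<le> r s" if "s \<le> t / 2" for s
      unfolding r_def using that t \<theta> by (intro powr_mono2) auto
    have th2: "0 < (t / 2) powr (1 / \<theta>)" using t by simp
    have \<kappa>fs: "\<kappa>f x w \<le> T * c0" for x w
      unfolding \<kappa>f_def
    proof (intro three_sup Qb)
      show "indicator {..t/2} (fst w) * decay_kernel d (r (fst w)) (x - snd w) \<le> T * b"
        using Qb[OF rs, of "fst w" "x - snd w"] T0 b by (cases "fst w \<le> t / 2") auto
    qed (use t\<rho> in auto)
    have \<kappa>fi: "(\<integral>\<^sup>+x. ennreal (\<kappa>f x w) \<partial>lborel) \<le> ennreal c0" for w
      unfolding \<kappa>f_def
    proof (intro three_int)
      show "(\<integral>\<^sup>+x. ennreal (indicator {..t/2} (fst w) * decay_kernel d (r (fst w)) (x - snd w)) \<partial>lborel) \<le> ennreal D"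
      proof (cases "fst w \<le> t / 2")
        case True
        then have "0 < r (fst w)" using rs[OF True] th2 by linarith
        then show ?thesis using True Qtr by simp
      qed simp
    qed (use \<rho>0 Qm in \<open>auto intro!: D\<close>)
    define Hf where "Hf x = (\<integral>\<^sup>+w. ennreal (mf w * \<kappa>f x w) \<partial>lborel)" for x
    have Mf0: "0 \<le> Mf" by (simp add: Mf_def)
    note bk = Lq_le_bounded_kernel[OF q T0 c0 Mf0 mfm mf0 eq_refl[OF Mf] \<kappa>fm \<kappa>f0 \<kappa>fs \<kappa>fi, folded Hf_def, unfolded Ta]
    note Hf = bk

    define I where "I = enn2real (\<integral>\<^sup>+s. indicator J s * e s \<partial>lborel)"
    have J[measurable]: "J \<in> sets borel" by (simp add: J_def)
    have Je: "(\<integral>\<^sup>+s. indicator J s * e s \<partial>lborel) \<le> (\<integral>\<^sup>+s. indicator {0<..<t} s * e s \<partial>lborel)"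
      using t by (intro nn_integral_mono mult_right_mono) (auto simp: J_def indicator_def)
    then have I: "(\<integral>\<^sup>+s. indicator J s * e s \<partial>lborel) = ennreal I"
      unfolding I_def using efin by (subst ennreal_enn2real) auto
    have "AE s in lborel. indicator {0<..<t} s * e s \<noteq> \<infinity>"
      using efin by (intro nn_integral_PInf_AE) auto
    then have efinAE: "AE s in lborel. s \<in> {0<..<t} \<longrightarrow> e s < \<infinity>"
      by eventually_elim (auto simp: indicator_def top.not_eq_extremum)
    \<comment> \<open>For s > t/2 one has s^(-a) \<le> b t^(-a). The L^q bound of the slice thus
      splits into a function of s and the constant v, as the convolution estimate demands.\<close>
    define v where "v = c * b * t powr (- a)"
    define H2 where "H2 x = (\<integral>\<^sup>+w. ennreal (indicator J (fst w) * Z w * decay_kernel d (r (fst w)) (x - snd w)) \<partial>lborel)" for x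
    have rm: "r \<in> borel_measurable borel" by measurable
    have r0: "0 < r s" if "s \<in> J" for s using that by (simp add: r_def J_def)
    have Zm: "Z \<in> borel_measurable borel" by measurable
    have em: "(\<lambda>s. enn2real (e s)) \<in> borel_measurable borel" by measurable
    have v0: "0 \<le> v" using c b by (simp add: v_def)
    have I0: "0 \<le> I" by (simp add: I_def)
      have "(\<integral>\<^sup>+s. ennreal (indicator J s * enn2real (e s)) \<partial>lborel) \<le> (\<integral>\<^sup>+s. indicator J s * e s \<partial>lborel)"
      proof (rule nn_integral_mono)
        fix s
        show "ennreal (indicator J s * enn2real (e s)) \<le> indicator J s * e s"
          by (cases "e s") (auto simp: indicator_def)
      qed
      then have Ile: "(\<integral>\<^sup>+s. ennreal (indicator J s * enn2real (e s)) \<partial>lborel) \<le> ennreal I" by (simp only: I)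
      have LqJ: "AE s in lborel. s \<in> J \<longrightarrow> Lq_le q (\<lambda>y. Z (s, y)) (enn2real (e s) * v)"
        using LQ efinAE
      proof eventually_elim
        case (elim s)
        show ?case
        proof
          assume sJ: "s \<in> J"
          then have s: "t / 2 < s" "s < t" "0 < s" using t by (auto simp: J_def)
          then have "e s < \<infinity>" using elim(2) by simp
          then have L: "Lq_le q (\<lambda>y. Z (s, y)) (c * s powr (- a) * enn2real (e s))" using elim(1) s by (simp add: Z_def a_def)
          have "s powr (- a) \<le> (t / 2) powr (- a)" using s t a by (intro powr_mono2') auto
          also have "\<dots> = t powr (- a) * 2 powr a" using t by (simp add: powr_divide powr_minus_divide)
          also have "\<dots> \<le> t powr (- a) * b" unfolding b_def using a by (intro mult_left_mono powr_mono) auto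
          finally have "c * s powr (- a) * enn2real (e s) \<le> c * (t powr (- a) * b) * enn2real (e s)"
            using c by (intro mult_right_mono mult_left_mono) auto
          also have "\<dots> = enn2real (e s) * v" by (simp add: v_def mult_ac)
          finally show "Lq_le q (\<lambda>y. Z (s, y)) (enn2real (e s) * v)"
            using c by (intro Lq_le_mono[OF q L]) auto
        qed
      qed
      have "(\<integral>\<^sup>+w. ennreal (indicator J (fst w) * Z w) \<partial>lborel) \<le> (\<integral>\<^sup>+w. ennreal (indicator {0<..<t} (fst w) * Z w) \<partial>lborel)"
        using t Z0 by (intro nn_integral_mono ennreal_leI mult_right_mono) (auto simp: J_def indicator_def)
      then have Zfin: "(\<integral>\<^sup>+w. ennreal (indicator J (fst w) * Z w) \<partial>lborel) < \<infinity>" using Zint by (rule order.strict_trans1)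
    note time_conv = Lq_le_time_convolution[OF q D(1) _ J rm _ Zm Z0 em enn2real_nonneg v0 I0 Ile LqJ Zfin, where d = d, folded H2_def]
    have conv1: "AE x in lborel. H2 x < \<infinity>" by (rule time_conv(1)) (use D(2) r0 in auto)
    have conv2: "Lq_le q (\<lambda>x. enn2real (H2 x)) (D * I * v)" by (rule time_conv(2)) (use D(2) r0 in auto)
    have conv3: "H2 \<in> borel_measurable borel" by (rule time_conv(3)) (use D(2) r0 in auto)
    note conv = conv1 conv2 conv3

    define B where "B = C * \<rho> powr (l - K)"
    have B: "0 \<le> B" using C by (simp add: B_def)
    have pt: "ennreal \<bar>g x\<bar> \<le> ennreal B * (H\<phi> x + Hf x + H2 x)" for x
    proof -
      have "(\<integral>\<^sup>+y. ennreal (norm x powr l * \<bar>remainder_kernel \<theta> K x y t 0\<bar> * \<bar>\<phi>0 y\<bar>) \<partial>lborel) \<le> (\<integral>\<^sup>+y. ennreal B * ennreal (m\<phi> y * \<kappa>\<phi> x y) \<partial>lborel)"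
      proof (rule nn_integral_mono)
        fix y
        have "norm x powr l * \<bar>remainder_kernel \<theta> K x y t 0\<bar> * \<bar>\<phi>0 y\<bar> \<le> (B * damped_weight \<theta> K d t 0 y * \<kappa>\<phi> x y) * \<bar>\<phi>0 y\<bar>"
          using S[of 0 t x y] t unfolding B_def \<kappa>\<phi>_def \<rho>_def by (intro mult_right_mono) auto
        also have "\<dots> = B * (m\<phi> y * \<kappa>\<phi> x y)" by (simp add: m\<phi>_def)
        finally show "ennreal (norm x powr l * \<bar>remainder_kernel \<theta> K x y t 0\<bar> * \<bar>\<phi>0 y\<bar>) \<le> ennreal B * ennreal (m\<phi> y * \<kappa>\<phi> x y)"
          using B m\<phi>0 \<kappa>\<phi>0 by (simp add: ennreal_leI flip: ennreal_mult)
      qed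
      also have "\<dots> = ennreal B * H\<phi> x"
      proof -
        have "(\<lambda>y. (\<lambda>(x, y). \<kappa>\<phi> x y) (x, y)) \<in> borel_measurable borel"
          by (rule measurable_compose[OF _ \<kappa>\<phi>m]) measurable
        then have "(\<lambda>y. ennreal (m\<phi> y * \<kappa>\<phi> x y)) \<in> borel_measurable lborel" using m\<phi>m by simp
        then show ?thesis unfolding H\<phi>_def by (rule nn_integral_cmult)
      qed
      finally have 1: "(\<integral>\<^sup>+y. ennreal (norm x powr l * \<bar>remainder_kernel \<theta> K x y t 0\<bar> * \<bar>\<phi>0 y\<bar>) \<partial>lborel) \<le> ennreal B * H\<phi> x" .
      have fm: "(\<lambda>w. ennreal (mf w * \<kappa>f x w)) \<in> borel_measurable lborel"
      proof -
        have "(\<lambda>w. (\<lambda>(x, w). \<kappa>f x w) (x, w)) \<in> borel_measurable borel"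
          by (rule measurable_compose[OF _ \<kappa>fm]) measurable
        then show ?thesis using mfm by simp
      qed
      have zm: "(\<lambda>w. ennreal (indicator J (fst w) * Z w * decay_kernel d (r (fst w)) (x - snd w))) \<in> borel_measurable lborel"
        unfolding decay_kernel_def by measurable
      have "(\<integral>\<^sup>+w. ennreal (indicator {0<..<t} (fst w) * (norm x powr l * \<bar>remainder_kernel \<theta> K x (snd w) t (fst w)\<bar> * \<bar>f0 w\<bar>)) \<partial>lborel)
          \<le> (\<integral>\<^sup>+w. ennreal B * (ennreal (mf w * \<kappa>f x w) + ennreal (indicator J (fst w) * Z w * decay_kernel d (r (fst w)) (x - snd w))) \<partial>lborel)"
      proof (rule nn_integral_mono)
        fix w :: "real \<times> (real^'n)"
        obtain s y where w: "w = (s, y)" by (cases w)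
        let ?Q = "decay_kernel d (r s) (x - y)" and ?Q' = "decay_kernel d \<rho> x + decay_kernel d (max \<rho> (weight_scale \<theta> s y)) x"
        have "indicator {0<..<t} s * (norm x powr l * \<bar>remainder_kernel \<theta> K x y t s\<bar> * \<bar>f0 w\<bar>) \<le> B * (mf w * \<kappa>f x w + indicator J s * Z w * ?Q)"
        proof (cases "s \<in> {0<..<t}")
          case True
          let ?O = "damped_weight \<theta> K d t s y * \<bar>f0 w\<bar>"
          have "norm x powr l * \<bar>remainder_kernel \<theta> K x y t s\<bar> * \<bar>f0 w\<bar> \<le> (B * damped_weight \<theta> K d t s y * (?Q + decay_kernel d \<rho> x + decay_kernel d (max \<rho> (weight_scale \<theta> s y)) x)) * \<bar>f0 w\<bar>"
            using S[of s t x y] True unfolding B_def \<rho>_def r_def by (intro mult_right_mono) auto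
          also have "\<dots> = B * (?O * (?Q + ?Q'))" by (simp add: algebra_simps)
          also have "\<dots> \<le> B * (?O * (indicator {..t/2} s * ?Q + ?Q') + indicator J s * Z w * ?Q)"
          proof (intro mult_left_mono B)
            \<comment> \<open>For s > t/2 the damping is given up on the singular kernel, where the
              full weight is used; this part is controlled by the source size over (t/2, t)
              alone.\<close>
            show "?O * (?Q + ?Q') \<le> ?O * (indicator {..t/2} s * ?Q + ?Q') + indicator J s * Z w * ?Q"
            proof (cases "s \<le> t / 2")
              case True
              then show ?thesis using Z0[of w] by simp
            next
              case False
              then have "s \<in> J" using True by (simp add: J_def)
              have "?O \<le> Z w" unfolding Z_def w fst_conv snd_conv using d by (intro mult_right_mono damped_weight_le) auto
              then have "?O * ?Q \<le> Z w * ?Q" by (rule mult_right_mono) simp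
              then show ?thesis using False \<open>s \<in> J\<close> by (simp add: distrib_left)
            qed
          qed
          also have "?O * (indicator {..t/2} s * ?Q + ?Q') = mf w * \<kappa>f x w" using True by (simp add: mf_def \<kappa>f_def w)
          finally show ?thesis using True by simp
        next
          case False
          then show ?thesis using B mf0 \<kappa>f0 Z0 by simp
        qed
        then have "ennreal (indicator {0<..<t} s * (norm x powr l * \<bar>remainder_kernel \<theta> K x y t s\<bar> * \<bar>f0 w\<bar>)) \<le> ennreal (B * (mf w * \<kappa>f x w + indicator J s * Z w * ?Q))"
          by (rule ennreal_leI)
        also have "\<dots> = ennreal B * (ennreal (mf w * \<kappa>f x w) + ennreal (indicator J s * Z w * ?Q))"
          using B mf0 \<kappa>f0 Z0 by (simp add: ennreal_mult ennreal_plus)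
        finally show "ennreal (indicator {0<..<t} (fst w) * (norm x powr l * \<bar>remainder_kernel \<theta> K x (snd w) t (fst w)\<bar> * \<bar>f0 w\<bar>))
            \<le> ennreal B * (ennreal (mf w * \<kappa>f x w) + ennreal (indicator J (fst w) * Z w * decay_kernel d (r (fst w)) (x - snd w)))"
          by (simp add: w)
      qed
      also have "\<dots> = ennreal B * (Hf x + H2 x)"
        unfolding Hf_def H2_def using fm zm by (simp only: nn_integral_cmult nn_integral_add borel_measurable_add)
      finally have 2: "(\<integral>\<^sup>+w. ennreal (indicator {0<..<t} (fst w) * (norm x powr l * \<bar>remainder_kernel \<theta> K x (snd w) t (fst w)\<bar> * \<bar>f0 w\<bar>)) \<partial>lborel)
          \<le> ennreal B * (Hf x + H2 x)" .
      from order_trans[OF g[of x] add_mono[OF 1 2]] show ?thesis by (simp add: distrib_left add.assoc)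
    qed
    define h where "h x = enn2real (H\<phi> x) + enn2real (Hf x) + enn2real (H2 x)" for x
    have AEg: "AE x in lborel. \<bar>g x\<bar> \<le> B * h x"
      using conv(1)
    proof eventually_elim
      case (elim x)
      have "H\<phi> x + Hf x + H2 x = ennreal (h x)"
        unfolding h_def using elim H\<phi>(2)[of x] Hf(2)[of x] by (simp add: ennreal_plus ennreal_enn2real)
      then have "ennreal \<bar>g x\<bar> \<le> ennreal (B * h x)" using pt[of x] B by (simp add: ennreal_mult h_def)
      then show ?case using B by (simp add: h_def)
    qed
    have hm: "h \<in> borel_measurable borel" unfolding h_def using H\<phi>(1) Hf(1) conv(3) by measurable
    have M0: "0 \<le> M\<phi>" "0 \<le> Mf" "0 \<le> I" "0 \<le> v" using c b by (simp_all add: M\<phi>_def Mf_def I_def v_def)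
    have "Lq_le q (\<lambda>x. enn2real (H\<phi> x) + enn2real (Hf x)) (4 * (t powr (- a) * (c0 * M\<phi>) + t powr (- a) * (c0 * Mf)))"
      using H\<phi>(1) Hf(1) c0 M0 by (intro Lq_le_add[OF q H\<phi>(3) Hf(3)]) auto
    then have hL: "Lq_le q h (4 * (4 * (t powr (- a) * (c0 * M\<phi>) + t powr (- a) * (c0 * Mf)) + D * I * v))"
      unfolding h_def[abs_def] using H\<phi>(1) Hf(1) conv(3) c0 M0 D by (intro Lq_le_add[OF q _ conv(2)]) auto
    have "Lq_le q (\<lambda>x. \<bar>g x\<bar>) (B * (4 * (4 * (t powr (- a) * (c0 * M\<phi>) + t powr (- a) * (c0 * Mf)) + D * I * v)))"
      using B c0 M0 D AEg hm by (intro Lq_le_cmult_mono[OF q hL]) (auto simp: h_def)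
    then have "Lnorm q g \<le> ennreal (B * (4 * (4 * (t powr (- a) * (c0 * M\<phi>) + t powr (- a) * (c0 * Mf)) + D * I * v)))"
      using B c0 M0 D by (intro Lnorm_le_of_Lq_le[OF q]) auto
    also have "\<dots> \<le> ennreal (16 * C * (c0 + D * b) * (1 + c) * \<rho> powr (l - K) * t powr (- a) * (M\<phi> + Mf + I))"
    proof (rule ennreal_leI)
      let ?k = "(c0 + D * b) * (1 + c)"
      have Db: "0 \<le> D * b" using D b by simp
      have k1: "c0 \<le> ?k"
      proof -
        have "c0 * 1 \<le> ?k" using c0 Db c by (intro mult_mono) auto
        then show ?thesis by simp
      qed
      have k2: "D * b * c \<le> ?k" using c0 Db c by (intro mult_mono) auto
      have "4 * (4 * (t powr (- a) * (c0 * M\<phi>) + t powr (- a) * (c0 * Mf)) + D * I * v)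
          \<le> 16 * (t powr (- a) * (c0 * M\<phi>) + t powr (- a) * (c0 * Mf) + D * I * v)"
        using D M0 by simp
      also have "\<dots> = 16 * t powr (- a) * (c0 * M\<phi> + c0 * Mf + D * b * c * I)" by (simp add: v_def algebra_simps)
      also have "\<dots> \<le> 16 * t powr (- a) * (?k * M\<phi> + ?k * Mf + ?k * I)"
        using M0 k1 k2 by (intro mult_left_mono add_mono mult_right_mono) auto
      finally have "B * (4 * (4 * (t powr (- a) * (c0 * M\<phi>) + t powr (- a) * (c0 * Mf)) + D * I * v)) \<le> B * (16 * t powr (- a) * (?k * M\<phi> + ?k * Mf + ?k * I))"
        using B by (rule mult_left_mono)
      also have "\<dots> = 16 * C * (c0 + D * b) * (1 + c) * \<rho> powr (l - K) * t powr (- a) * (M\<phi> + Mf + I)"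
        unfolding B_def distrib_left[symmetric] by (simp only: mult_ac)
      finally show "B * (4 * (4 * (t powr (- a) * (c0 * M\<phi>) + t powr (- a) * (c0 * Mf)) + D * I * v))
          \<le> 16 * C * (c0 + D * b) * (1 + c) * \<rho> powr (l - K) * t powr (- a) * (M\<phi> + Mf + I)" .
    qed
    finally show "Lnorm q g \<le> ennreal (16 * C * (c0 + D * b) * (1 + c) * ((t + 1) powr (1 / \<theta>)) powr (l - K) * t powr (- decay_exponent CARD('n) \<theta> q) *
          (enn2real (\<integral>\<^sup>+y. ennreal (damped_weight \<theta> K d t 0 y * \<bar>\<phi>0 y\<bar>) \<partial>lborel)
         + enn2real (\<integral>\<^sup>+w. ennreal (indicator {0<..<t} (fst w) * damped_weight \<theta> K d t (fst w) (snd w) * \<bar>f0 w\<bar>) \<partial>lborel)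
         + enn2real (\<integral>\<^sup>+s. indicator {t/2<..<t} s * e s \<partial>lborel)))"
      unfolding \<rho>_def a_def M\<phi>_def m\<phi>_def Mf_def mf_def I_def J_def .
  qed
qed

section \<open>Reduction to Borel representatives\<close>

lemma Lnorm_1: "Lnorm 1 h = (\<integral>\<^sup>+x. ennreal \<bar>h x\<bar> \<partial>lebesgue)"
proof -
  define I where "I = (\<integral>\<^sup>+x. ennreal \<bar>h x\<bar> \<partial>lebesgue)"
  have "Lnorm 1 h = (if I = \<infinity> then \<infinity> else ennreal (enn2real I powr (1 / 1)))"
    by (simp add: Lnorm_def I_def Let_def)
  also have "\<dots> = I" by (cases I) auto
  finally show ?thesis by (simp add: I_def)
qed

text \<open>The power z^K splits into the two weights |y|^K and (s + 1)^(K/\<theta>), precisely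
  those that occur in the source size.\<close>

lemma weight_scale_powr_le:
  assumes "0 < \<theta>" "0 \<le> K" "0 \<le> s"
  shows "weight_scale \<theta> s y powr K \<le> 2 powr K * (norm y powr K + (s + 1) powr (K / \<theta>))"
proof -
  let ?\<sigma> = "(s + 1) powr (1 / \<theta>)"
  have "weight_scale \<theta> s y powr K \<le> (2 * max (norm y) ?\<sigma>) powr K" unfolding weight_scale_def using assms by (intro powr_mono2) auto
  also have "\<dots> = 2 powr K * max (norm y) ?\<sigma> powr K" by (simp add: powr_mult)
  also have "max (norm y) ?\<sigma> powr K \<le> norm y powr K + ?\<sigma> powr K" by (simp add: max_def)
  also have "?\<sigma> powr K = (s + 1) powr (K / \<theta>)" by (simp add: powr_powr)
  finally show ?thesis by simp
qed

lemma weight_scale_ge_1: "0 < \<theta> \<Longrightarrow> 0 \<le> s \<Longrightarrow> 1 \<le> weight_scale \<theta> s y"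
  unfolding weight_scale_def by (intro add_increasing ge_one_powr_ge_zero) auto

lemma weight_scale_measurable [measurable]:
  "(\<lambda>w. weight_scale \<theta> (fst w) (snd w)) \<in> borel_measurable (borel :: (real \<times> (real^'n)) measure)"
  "(\<lambda>y. weight_scale \<theta> s (y :: real^'n)) \<in> borel_measurable borel"
  unfolding weight_scale_def by measurable

lemma weight_scale_mass_le_source_size:
  fixes h h0 :: "real^'n \<Rightarrow> real"
  assumes \<theta>: "0 < \<theta>" and K: "0 \<le> K" and s: "0 < s" and h: "AE y in lborel. h y = h0 y" and m[measurable]: "h0 \<in> borel_measurable borel"
  shows "(\<integral>\<^sup>+y. ennreal (weight_scale \<theta> s y powr K * \<bar>h0 y\<bar>) \<partial>lborel)
     \<le> ennreal (2 powr K) * (wnorm 1 K h + ennreal ((s + 1) powr (K / \<theta>)) * Lnorm 1 h)"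
proof -
  have L: "Lnorm 1 h = (\<integral>\<^sup>+y. ennreal \<bar>h0 y\<bar> \<partial>lborel)"
    unfolding Lnorm_1 nn_integral_completion using h by (intro nn_integral_cong_AE) (auto elim: eventually_mono)
  have W: "wnorm 1 K h = (\<integral>\<^sup>+y. ennreal (norm y powr K * \<bar>h0 y\<bar>) \<partial>lborel)"
    unfolding wnorm_def Lnorm_1 nn_integral_completion using h by (intro nn_integral_cong_AE) (auto elim: eventually_mono simp: abs_mult)
  have "(\<integral>\<^sup>+y. ennreal (weight_scale \<theta> s y powr K * \<bar>h0 y\<bar>) \<partial>lborel)
      \<le> (\<integral>\<^sup>+y. ennreal (2 powr K) * (ennreal (norm y powr K * \<bar>h0 y\<bar>) + ennreal ((s + 1) powr (K / \<theta>)) * ennreal \<bar>h0 y\<bar>) \<partial>lborel)"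
  proof (rule nn_integral_mono)
    fix y
    have "weight_scale \<theta> s y powr K * \<bar>h0 y\<bar> \<le> 2 powr K * (norm y powr K + (s + 1) powr (K / \<theta>)) * \<bar>h0 y\<bar>"
      using weight_scale_powr_le[OF \<theta> K, of s y] s by (intro mult_right_mono) auto
    also have "\<dots> = 2 powr K * (norm y powr K * \<bar>h0 y\<bar> + (s + 1) powr (K / \<theta>) * \<bar>h0 y\<bar>)" by (simp add: algebra_simps)
    finally have "ennreal (weight_scale \<theta> s y powr K * \<bar>h0 y\<bar>) \<le> ennreal (2 powr K * (norm y powr K * \<bar>h0 y\<bar> + (s + 1) powr (K / \<theta>) * \<bar>h0 y\<bar>))"
      by (rule ennreal_leI)
    then show "ennreal (weight_scale \<theta> s y powr K * \<bar>h0 y\<bar>) \<le> ennreal (2 powr K) * (ennreal (norm y powr K * \<bar>h0 y\<bar>) + ennreal ((s + 1) powr (K / \<theta>)) * ennreal \<bar>h0 y\<bar>)"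
      by (simp add: ennreal_mult ennreal_plus)
  qed
  also have "\<dots> = ennreal (2 powr K) * (wnorm 1 K h + ennreal ((s + 1) powr (K / \<theta>)) * Lnorm 1 h)"
    unfolding L W by (simp add: nn_integral_cmult nn_integral_add)
  finally show ?thesis .
qed

lemma weight_scale_Lq_le:
  fixes h h0 :: "real^'n \<Rightarrow> real"
  assumes \<theta>: "0 < \<theta>" and K: "0 \<le> K" and s: "0 < s" and q: "1 \<le> q"
    and h: "AE y in lborel. h y = h0 y" and m[measurable]: "h0 \<in> borel_measurable borel"
    and fin: "wnorm q K h < \<infinity>" "Lnorm q h < \<infinity>"
  shows "Lq_le q (\<lambda>y. weight_scale \<theta> s y powr K * \<bar>h0 y\<bar>)
     (2 powr K * (4 * (enn2real (wnorm q K h) + (s + 1) powr (K / \<theta>) * enn2real (Lnorm q h))))"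
proof -
  have AE: "AE y in lebesgue. h y = h0 y" using h by (rule AE_completion)
  have 1: "Lq_le q (\<lambda>y. norm y powr K * \<bar>h0 y\<bar>) (enn2real (wnorm q K h))"
    unfolding wnorm_def using AE fin(1) by (intro Lq_le_of_Lnorm q) (auto elim: eventually_mono simp: wnorm_def abs_mult)
  have "Lq_le q (\<lambda>y. \<bar>h0 y\<bar>) (enn2real (Lnorm q h))"
    using AE fin(2) by (intro Lq_le_of_Lnorm q) (auto elim: eventually_mono)
  then have 2: "Lq_le q (\<lambda>y. (s + 1) powr (K / \<theta>) * \<bar>h0 y\<bar>) ((s + 1) powr (K / \<theta>) * enn2real (Lnorm q h))"
    by (rule Lq_le_cmult_mono[OF q]) auto
  have 3: "Lq_le q (\<lambda>y. norm y powr K * \<bar>h0 y\<bar> + (s + 1) powr (K / \<theta>) * \<bar>h0 y\<bar>) (4 * (enn2real (wnorm q K h) + (s + 1) powr (K / \<theta>) * enn2real (Lnorm q h)))"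
    by (rule Lq_le_add[OF q 1 2]) auto
  show ?thesis
  proof (rule Lq_le_cmult_mono[OF q 3])
    show "AE y in lborel. weight_scale \<theta> s y powr K * \<bar>h0 y\<bar> \<le> 2 powr K * (norm y powr K * \<bar>h0 y\<bar> + (s + 1) powr (K / \<theta>) * \<bar>h0 y\<bar>)"
    proof (rule AE_I2)
      fix y
      have "weight_scale \<theta> s y powr K * \<bar>h0 y\<bar> \<le> 2 powr K * (norm y powr K + (s + 1) powr (K / \<theta>)) * \<bar>h0 y\<bar>"
        using weight_scale_powr_le[OF \<theta> K, of s y] s by (intro mult_right_mono) auto
      also have "\<dots> = 2 powr K * (norm y powr K * \<bar>h0 y\<bar> + (s + 1) powr (K / \<theta>) * \<bar>h0 y\<bar>)" by (simp add: algebra_simps)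
      finally show "weight_scale \<theta> s y powr K * \<bar>h0 y\<bar> \<le> 2 powr K * (norm y powr K * \<bar>h0 y\<bar> + (s + 1) powr (K / \<theta>) * \<bar>h0 y\<bar>)" .
    qed
  qed auto
qed

text \<open>The factor 4 is chosen so that the same constant serves here and in the L^q
  counterpart.\<close>

lemma source_size_L1:
  fixes f :: "real^'n \<Rightarrow> real \<Rightarrow> real"
  assumes \<theta>: "0 < \<theta>" and K: "0 \<le> K" and s: "0 < s" and h: "AE y in lborel. f y s = h0 y" and m: "h0 \<in> borel_measurable borel"
  shows "(\<integral>\<^sup>+y. ennreal (weight_scale \<theta> s y powr K * \<bar>h0 y\<bar>) \<partial>lborel) \<le> ennreal (4 * 2 powr K) * source_size \<theta> K q f s"
proof -
  let ?f = "\<lambda>x. f x s"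
  have "(\<integral>\<^sup>+y. ennreal (weight_scale \<theta> s y powr K * \<bar>h0 y\<bar>) \<partial>lborel)
     \<le> ennreal (2 powr K) * (wnorm 1 K ?f + ennreal ((s + 1) powr (K / \<theta>)) * Lnorm 1 ?f)"
    by (rule weight_scale_mass_le_source_size[OF \<theta> K s h m])
  also have "\<dots> \<le> ennreal (4 * 2 powr K) * source_size \<theta> K q f s"
  proof (intro mult_mono ennreal_leI)
    show "wnorm 1 K ?f + ennreal ((s + 1) powr (K / \<theta>)) * Lnorm 1 ?f \<le> source_size \<theta> K q f s"
      unfolding source_size_def Let_def distrib_left
      by (subst add.commute) (intro add_mono order_refl add_increasing add_increasing2, auto)
  qed auto
  finally show ?thesis .
qed

text \<open>The source size contains the L^q norms multiplied by s^a. As s^a > 0, its finiteness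
  passes to the norms, and dividing by s^a produces the factor s^(-a), which is harmless away from s
  = 0.\<close>

lemma source_size_Lq:
  fixes f :: "real^'n \<Rightarrow> real \<Rightarrow> real"
  assumes \<theta>: "0 < \<theta>" and K: "0 \<le> K" and s: "0 < s" and q: "1 \<le> q" and h: "AE y in lborel. f y s = h0 y" and m: "h0 \<in> borel_measurable borel"
    and fin: "source_size \<theta> K q f s < \<infinity>"
  shows "Lq_le q (\<lambda>y. weight_scale \<theta> s y powr K * \<bar>h0 y\<bar>)
     (4 * 2 powr K * s powr (- decay_exponent CARD('n) \<theta> q) * enn2real (source_size \<theta> K q f s))"
proof -
  let ?f = "\<lambda>x. f x s" and ?E = "source_size \<theta> K q f s"
  define a where "a = decay_exponent CARD('n) \<theta> q"
  let ?\<sigma> = "(s + 1) powr (K / \<theta>)"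
  have sa: "0 < s powr a" using s by simp
  have le: "ennreal ?\<sigma> * (ennreal (s powr a) * Lnorm q ?f) + ennreal (s powr a) * wnorm q K ?f \<le> ?E"
    unfolding source_size_def Let_def a_def[symmetric] distrib_left by (intro add_increasing2 add_mono add_increasing2 order_refl) auto
  then have "ennreal ?\<sigma> * (ennreal (s powr a) * Lnorm q ?f) < \<infinity>" "ennreal (s powr a) * wnorm q K ?f < \<infinity>"
    using order.strict_trans1[OF le fin] by (simp_all add: less_top[symmetric])
  then have F: "Lnorm q ?f < \<infinity>" "wnorm q K ?f < \<infinity>"
    using sa s by (auto simp: ennreal_mult_less_top ennreal_eq_0_iff)
  obtain L where L: "Lnorm q ?f = ennreal L" "0 \<le> L" using F(1) by (cases "Lnorm q ?f") auto
  obtain W where W: "wnorm q K ?f = ennreal W" "0 \<le> W" using F(2) by (cases "wnorm q K ?f") auto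
  obtain E where E: "?E = ennreal E" "0 \<le> E" using fin by (cases ?E) auto
  have "?\<sigma> * (s powr a * L) + s powr a * W \<le> E"
    using le L W E by (simp flip: ennreal_mult ennreal_plus)
  then have "s powr (- a) * (s powr a * (?\<sigma> * L + W)) \<le> s powr (- a) * E" by (intro mult_left_mono) (auto simp: algebra_simps)
  moreover have "s powr (- a) * s powr a = 1" using s by (simp flip: powr_add)
  ultimately have WL: "W + ?\<sigma> * L \<le> s powr (- a) * E" by (simp flip: mult.assoc)
  have "Lq_le q (\<lambda>y. weight_scale \<theta> s y powr K * \<bar>h0 y\<bar>) (2 powr K * (4 * (enn2real (wnorm q K ?f) + ?\<sigma> * enn2real (Lnorm q ?f))))"
    by (rule weight_scale_Lq_le[OF \<theta> K s q h m F(2,1)])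
  then have B: "Lq_le q (\<lambda>y. weight_scale \<theta> s y powr K * \<bar>h0 y\<bar>) (2 powr K * (4 * (W + ?\<sigma> * L)))" using L W by simp
  show ?thesis
  proof (rule Lq_le_mono[OF q B])
    show "0 \<le> 2 powr K * (4 * (W + ?\<sigma> * L))" using L W by simp
    have "2 powr K * (4 * (W + ?\<sigma> * L)) \<le> 2 powr K * (4 * (s powr (- a) * E))" using WL by (intro mult_left_mono) auto
    then show "2 powr K * (4 * (W + ?\<sigma> * L)) \<le> 4 * 2 powr K * s powr (- decay_exponent CARD('n) \<theta> q) * enn2real ?E"
      using E by (simp add: a_def)
  qed
qed

section \<open>Measurability and integration of the remainder kernel\<close>

text \<open>Tonelli's theorem in space-time needs the kernel to be measurable jointly in all its
  arguments; a parameter integral of a jointly measurable integrand has this property.\<close>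

lemma cos_transform_measurable:
  fixes b :: "'b::euclidean_space \<Rightarrow> real^'n \<Rightarrow> real" and X :: "'b \<Rightarrow> real^'n"
  assumes b: "(\<lambda>(w, \<xi>). b w \<xi>) \<in> borel_measurable borel" and X: "X \<in> borel_measurable borel"
  shows "(\<lambda>w. cos_transform (X w) c (b w)) \<in> borel_measurable borel"
proof -
  have b'[measurable]: "(\<lambda>p. b (fst p) (snd p)) \<in> borel_measurable borel" using b by (simp only: case_prod_beta')
  have "(\<lambda>p. cos (X (fst p) \<bullet> snd p + c) * b (fst p) (snd p)) \<in> borel_measurable borel"
    using X by measurable
  then have "(\<lambda>(w, \<xi>). cos (X w \<bullet> \<xi> + c) * b w \<xi>) \<in> borel_measurable (borel \<Otimes>\<^sub>M lborel)"
    by (simp add: case_prod_beta' borel_prod[symmetric] cong: measurable_cong_sets sets_pair_measure_cong)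
  from lborel.borel_measurable_lebesgue_integral[OF this] show ?thesis unfolding cos_transform_def .
qed

lemma heat_deriv_measurable:
  fixes X :: "'b::euclidean_space \<Rightarrow> real^'n" and T :: "'b \<Rightarrow> real"
  assumes [measurable]: "X \<in> borel_measurable borel" "T \<in> borel_measurable borel"
  shows "(\<lambda>w. heat_deriv \<theta> \<alpha> m (X w) (T w)) \<in> borel_measurable borel"
proof -
  have "(\<lambda>p. heat_symbol \<theta> \<alpha> m (T (fst p)) (snd p)) \<in> borel_measurable (borel :: ('b \<times> (real^'n)) measure)"
  proof -
    have s: "snd \<in> borel_measurable (borel :: ('b \<times> (real^'n)) measure)" by (rule snd_borel_measurable)
    have f: "fst \<in> borel_measurable (borel :: ('b \<times> (real^'n)) measure)" by (rule fst_borel_measurable)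
    have [measurable]: "(\<lambda>p. mi_power (snd p) \<alpha>) \<in> borel_measurable (borel :: ('b \<times> (real^'n)) measure)"
      by (rule measurable_compose[OF s mi_power_measurable])
    have [measurable]: "(\<lambda>p. norm (snd p) powr \<theta>) \<in> borel_measurable (borel :: ('b \<times> (real^'n)) measure)"
      by (rule measurable_compose[OF s]) measurable
    have [measurable]: "(\<lambda>p. T (fst p)) \<in> borel_measurable (borel :: ('b \<times> (real^'n)) measure)"
      by (rule measurable_compose[OF f]) measurable
    show ?thesis unfolding heat_symbol_def by measurable
  qed
  then have "(\<lambda>(w, \<xi>). heat_symbol \<theta> \<alpha> m (T w) \<xi>) \<in> borel_measurable (borel :: ('b \<times> (real^'n)) measure)"
    by (simp only: case_prod_beta')
  then have "(\<lambda>w. cos_transform (X w) (real (mi_order \<alpha>) * (pi / 2)) (heat_symbol \<theta> \<alpha> m (T w))) \<in> borel_measurable borel"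
    by (rule cos_transform_measurable) measurable
  then show ?thesis unfolding heat_deriv_def by measurable
qed

lemma kernel_g_measurable: "0 < \<theta> \<Longrightarrow> - 1 < t \<Longrightarrow> (\<lambda>x :: real^'n. kernel_g \<theta> \<alpha> m x t) \<in> borel_measurable borel"
  using heat_deriv_measurable[of "\<lambda>x. x" "\<lambda>_. t + 1" \<theta> \<alpha> m] by (simp add: kernel_g_eq_heat_deriv)

text \<open>Since z \<ge> 1, every monomial of order at most K is dominated by z^K. One finite
  weighted integral therefore makes all moments converge and lets the finite sum be exchanged with
  the integral. The second claim serves to integrate the moments in time.\<close>

lemma remainder_kernel_integral:
  fixes h :: "real^'n \<Rightarrow> real"
  assumes \<theta>: "0 < \<theta>" and K: "0 \<le> K" and s: "0 \<le> s" "s < t" and h: "h \<in> borel_measurable lebesgue"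
    and fin: "(\<integral>\<^sup>+y. ennreal (weight_scale \<theta> s y powr K * \<bar>h y\<bar>) \<partial>lebesgue) < \<infinity>"
    and G: "integrable lebesgue (\<lambda>y. frac_heat_kernel \<theta> (x - y) (t - s) * h y)"
  shows "(\<integral>y. frac_heat_kernel \<theta> (x - y) (t - s) * h y \<partial>lebesgue)
      - (\<Sum>m = 0..nat \<lfloor>K / \<theta>\<rfloor>. \<Sum>\<alpha> | real (mi_order \<alpha>) \<le> K. (s + 1) ^ m * moment \<alpha> h * kernel_g \<theta> \<alpha> m x t)
      = (\<integral>y. remainder_kernel \<theta> K x y t s * h y \<partial>lebesgue)"
    and "real (mi_order \<alpha>) \<le> K \<Longrightarrow> \<bar>moment \<alpha> h\<bar> \<le> enn2real (\<integral>\<^sup>+y. ennreal (weight_scale \<theta> s y powr K * \<bar>h y\<bar>) \<partial>lebesgue)"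
proof -
  have mp: "\<bar>mi_power y \<alpha> * h y\<bar> \<le> weight_scale \<theta> s y powr K * \<bar>h y\<bar>" if "real (mi_order \<alpha>) \<le> K" for \<alpha> y
  proof -
    have z1: "1 \<le> weight_scale \<theta> s y" by (rule weight_scale_ge_1[OF \<theta> s(1)])
    have "\<bar>mi_power y \<alpha>\<bar> \<le> norm y ^ mi_order \<alpha>" by (rule abs_mi_power_le)
    also have "\<dots> \<le> weight_scale \<theta> s y ^ mi_order \<alpha>" by (intro power_mono) (auto simp: weight_scale_def)
    also have "\<dots> = weight_scale \<theta> s y powr real (mi_order \<alpha>)" using z1 by (simp add: powr_realpow)
    also have "\<dots> \<le> weight_scale \<theta> s y powr K" using that z1 by (intro powr_mono) auto
    finally show ?thesis unfolding abs_mult by (rule mult_right_mono) simp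
  qed
  have mm: "(\<lambda>y. mi_power y \<alpha>) \<in> borel_measurable lebesgue" for \<alpha> :: "'n multi_index"
    by (rule measurable_completion) measurable
  have "(\<lambda>y :: real^'n. weight_scale \<theta> s y powr K) \<in> borel_measurable lborel" by measurable
  then have zm: "(\<lambda>y :: real^'n. weight_scale \<theta> s y powr K) \<in> borel_measurable lebesgue" by (rule measurable_completion)
  have Iz: "integrable lebesgue (\<lambda>y. weight_scale \<theta> s y powr K * \<bar>h y\<bar>)"
    using fin h zm by (intro integrableI_nonneg) auto
  have Im: "integrable lebesgue (\<lambda>y. mi_power y \<alpha> * h y)" if "real (mi_order \<alpha>) \<le> K" for \<alpha>
    using h mm by (intro Bochner_Integration.integrable_bound[OF Iz]) (auto intro!: AE_I2 mp[OF that, THEN order_trans])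
  show "\<bar>moment \<alpha> h\<bar> \<le> enn2real (\<integral>\<^sup>+y. ennreal (weight_scale \<theta> s y powr K * \<bar>h y\<bar>) \<partial>lebesgue)" if "real (mi_order \<alpha>) \<le> K"
  proof -
    have "\<bar>moment \<alpha> h\<bar> \<le> (\<integral>y. \<bar>mi_power y \<alpha> * h y\<bar> \<partial>lebesgue)" unfolding moment_def by (rule integral_abs_bound)
    also have "\<dots> \<le> (\<integral>y. weight_scale \<theta> s y powr K * \<bar>h y\<bar> \<partial>lebesgue)"
      by (intro integral_mono integrable_abs Im that Iz mp)
    also have "\<dots> = enn2real (\<integral>\<^sup>+y. ennreal (weight_scale \<theta> s y powr K * \<bar>h y\<bar>) \<partial>lebesgue)"
      using h zm by (intro integral_eq_nn_integral) auto
    finally show ?thesis .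
  qed
  have fin: "finite {\<alpha> :: 'n multi_index. real (mi_order \<alpha>) \<le> K}" by (rule finite_mi_order_le)
  let ?A = "{\<alpha> :: 'n multi_index. real (mi_order \<alpha>) \<le> K}"
  let ?W = "\<lambda>y. \<Sum>m = 0..nat \<lfloor>K / \<theta>\<rfloor>. \<Sum>\<alpha>\<in>?A. ((s + 1) ^ m * kernel_g \<theta> \<alpha> m x t) * (mi_power y \<alpha> * h y)"
  have IW: "integrable lebesgue ?W"
    by (intro Bochner_Integration.integrable_sum integrable_mult_right Im) auto
  have "(\<integral>y. ?W y \<partial>lebesgue) = (\<Sum>m = 0..nat \<lfloor>K / \<theta>\<rfloor>. \<integral>y. (\<Sum>\<alpha>\<in>?A. ((s + 1) ^ m * kernel_g \<theta> \<alpha> m x t) * (mi_power y \<alpha> * h y)) \<partial>lebesgue)"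
    by (intro Bochner_Integration.integral_sum Bochner_Integration.integrable_sum integrable_mult_right Im) auto
  also have "\<dots> = (\<Sum>m = 0..nat \<lfloor>K / \<theta>\<rfloor>. \<Sum>\<alpha>\<in>?A. \<integral>y. ((s + 1) ^ m * kernel_g \<theta> \<alpha> m x t) * (mi_power y \<alpha> * h y) \<partial>lebesgue)"
    by (intro sum.cong refl Bochner_Integration.integral_sum integrable_mult_right Im) auto
  also have "\<dots> = (\<Sum>m = 0..nat \<lfloor>K / \<theta>\<rfloor>. \<Sum>\<alpha>\<in>?A. (s + 1) ^ m * moment \<alpha> h * kernel_g \<theta> \<alpha> m x t)"
  proof (intro sum.cong refl)
    fix m and \<alpha> :: "'n multi_index"
    have "(\<integral>y. ((s + 1) ^ m * kernel_g \<theta> \<alpha> m x t) * (mi_power y \<alpha> * h y) \<partial>lebesgue) = ((s + 1) ^ m * kernel_g \<theta> \<alpha> m x t) * moment \<alpha> h"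
      unfolding moment_def by (rule integral_mult_right_zero)
    then show "(\<integral>y. ((s + 1) ^ m * kernel_g \<theta> \<alpha> m x t) * (mi_power y \<alpha> * h y) \<partial>lebesgue) = (s + 1) ^ m * moment \<alpha> h * kernel_g \<theta> \<alpha> m x t"
      by (simp only: mult_ac)
  qed
  finally have W: "(\<integral>y. ?W y \<partial>lebesgue) = (\<Sum>m = 0..nat \<lfloor>K / \<theta>\<rfloor>. \<Sum>\<alpha>\<in>?A. (s + 1) ^ m * moment \<alpha> h * kernel_g \<theta> \<alpha> m x t)" .
  have S: "(\<lambda>y. remainder_kernel \<theta> K x y t s * h y) = (\<lambda>y. frac_heat_kernel \<theta> (x - y) (t - s) * h y - ?W y)"
    unfolding remainder_kernel_def left_diff_distrib sum_distrib_right by (simp only: mult_ac)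
  show "(\<integral>y. frac_heat_kernel \<theta> (x - y) (t - s) * h y \<partial>lebesgue)
      - (\<Sum>m = 0..nat \<lfloor>K / \<theta>\<rfloor>. \<Sum>\<alpha> | real (mi_order \<alpha>) \<le> K. (s + 1) ^ m * moment \<alpha> h * kernel_g \<theta> \<alpha> m x t)
      = (\<integral>y. remainder_kernel \<theta> K x y t s * h y \<partial>lebesgue)"
    unfolding S W[symmetric] by (rule Bochner_Integration.integral_diff[OF G IW, symmetric])
qed

lemma borel_measurable_lebesgue_AE:
  fixes f g :: "'a::euclidean_space \<Rightarrow> real"
  assumes g: "g \<in> borel_measurable borel" and AE: "AE x in lborel. f x = g x"
  shows "f \<in> borel_measurable lebesgue"
proof (rule measurableI)
  fix A :: "real set" assume A: "A \<in> sets borel"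
  have "g \<in> borel_measurable lebesgue" using g by (intro measurable_completion) simp
  then have gA: "g -` A \<inter> space lebesgue \<in> sets lebesgue" using A by (rule measurable_sets)
  have "AE x in lebesgue. x \<in> g -` A \<inter> space lebesgue \<longleftrightarrow> x \<in> f -` A \<inter> space lebesgue"
    using AE_completion[OF AE] by eventually_elim auto
  from completion.in_sets_AE[OF this gA] show "f -` A \<inter> space lebesgue \<in> sets lebesgue" by simp
qed simp

text \<open>No integrability has to be assumed, because the Bochner integral of a non-integrable
  function is 0.\<close>

lemma ennreal_abs_integral_le:
  fixes g :: "'a \<Rightarrow> real"
  shows "ennreal \<bar>integral\<^sup>L M g\<bar> \<le> (\<integral>\<^sup>+x. ennreal \<bar>g x\<bar> \<partial>M)"
proof (cases "integrable M g")
  case True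
  then show ?thesis using integral_norm_bound_ennreal[OF True] by simp
qed (simp add: not_integrable_integral_eq)

text \<open>The indicator restricts to s < t, where the kernel coincides with a
  \<open>heat_deriv\<close>, whose joint measurability is known.\<close>

lemma remainder_kernel_pair_measurable:
  fixes x :: "real^'n" and f0 :: "real \<times> (real^'n) \<Rightarrow> real"
  assumes \<theta>: "0 < \<theta>" and f0[measurable]: "f0 \<in> borel_measurable borel"
  shows "(\<lambda>w. ennreal (indicator {0<..<t} (fst w) * (c * \<bar>remainder_kernel \<theta> K x (snd w) t (fst w)\<bar> * \<bar>f0 w\<bar>))) \<in> borel_measurable borel"
proof -
  define S where "S w = heat_deriv \<theta> (\<lambda>_. 0) 0 (x - snd w) (t - fst w) -
     (\<Sum>m = 0..nat \<lfloor>K / \<theta>\<rfloor>. \<Sum>\<alpha> | real (mi_order \<alpha>) \<le> K. (fst w + 1) ^ m * mi_power (snd w) \<alpha> * kernel_g \<theta> \<alpha> m x t)"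
    for w :: "real \<times> (real^'n)"
  have [measurable]: "(\<lambda>w. heat_deriv \<theta> (\<lambda>_. 0) 0 (x - snd w) (t - fst w)) \<in> borel_measurable (borel :: (real \<times> (real^'n)) measure)"
    by (rule heat_deriv_measurable) measurable
  have [measurable]: "(\<lambda>w. mi_power (snd w) \<alpha>) \<in> borel_measurable (borel :: (real \<times> (real^'n)) measure)" for \<alpha>
    by (rule measurable_compose[OF snd_borel_measurable mi_power_measurable])
  have [measurable]: "S \<in> borel_measurable borel" unfolding S_def by measurable
  have eq: "indicator {0<..<t} (fst w) * (c * \<bar>remainder_kernel \<theta> K x (snd w) t (fst w)\<bar> * \<bar>f0 w\<bar>) = indicator {0<..<t} (fst w) * (c * \<bar>S w\<bar> * \<bar>f0 w\<bar>)" for w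
    by (cases "fst w \<in> {0<..<t}") (simp_all add: S_def remainder_kernel_def frac_heat_kernel_eq_heat_deriv[OF \<theta>])
  show ?thesis unfolding eq by measurable
qed

text \<open>The difference u - w splits into a contribution of \<phi>, acting as a slice at time 0,
  and the slices 0 < s < t of f. In each slice the moments recombine with the heat kernel into the
  remainder kernel. Borel representatives appear on the right so that Tonelli's theorem applies
  there.\<close>

lemma solution_minus_profile_le:
  fixes \<theta> K l t :: real and \<phi> \<phi>0 :: "real^'n \<Rightarrow> real" and f u :: "real^'n \<Rightarrow> real \<Rightarrow> real" and f0 :: "real \<times> (real^'n) \<Rightarrow> real"
    and e :: "real \<Rightarrow> ennreal" and x :: "real^'n"
  assumes \<theta>: "0 < \<theta>" and K: "0 \<le> K" and t: "0 < t" and c: "0 \<le> c"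
    and \<phi>m: "\<phi> \<in> borel_measurable lebesgue" and \<phi>0[measurable]: "\<phi>0 \<in> borel_measurable borel" and \<phi>\<phi>0: "AE y in lborel. \<phi> y = \<phi>0 y"
    and f0[measurable]: "f0 \<in> borel_measurable borel" and ff0: "AE s in lborel. 0 < s \<longrightarrow> (AE y in lborel. f y s = f0 (s, y))"
    and e[measurable]: "e \<in> borel_measurable borel"
    and \<phi>fin: "(\<integral>\<^sup>+y. ennreal (weight_scale \<theta> 0 y powr K * \<bar>\<phi>0 y\<bar>) \<partial>lborel) < \<infinity>"
    and efin: "(\<integral>\<^sup>+s. indicator {0<..<t} s * e s \<partial>lborel) < \<infinity>"
    and L1: "AE s in lborel. 0 < s \<longrightarrow> (\<integral>\<^sup>+y. ennreal (weight_scale \<theta> s y powr K * \<bar>f0 (s, y)\<bar>) \<partial>lborel) \<le> ennreal c * e s"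
    and sol: "frac_heat_solution \<theta> \<phi> f u"
  shows "ennreal \<bar>norm x powr l * (u x t - asymptotic_profile \<theta> K \<phi> f x t)\<bar>
     \<le> (\<integral>\<^sup>+y. ennreal (norm x powr l * \<bar>remainder_kernel \<theta> K x y t 0\<bar> * \<bar>\<phi>0 y\<bar>) \<partial>lborel)
       + (\<integral>\<^sup>+w. ennreal (indicator {0<..<t} (fst w) * (norm x powr l * \<bar>remainder_kernel \<theta> K x (snd w) t (fst w)\<bar> * \<bar>f0 w\<bar>)) \<partial>lborel)"
proof -
  let ?X = "norm x powr l" and ?J = "lebesgue_on {0<..<t}" and ?n = "nat \<lfloor>K / \<theta>\<rfloor>"
  let ?A = "{\<alpha> :: 'n multi_index. real (mi_order \<alpha>) \<le> K}"
  let ?G = "\<lambda>s. \<integral>y. frac_heat_kernel \<theta> (x - y) (t - s) * f y s \<partial>lebesgue"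
  have finA: "finite ?A" by (rule finite_mi_order_le)
  have J: "{0<..<t} \<inter> space lebesgue \<in> sets lebesgue" by simp
  note S = sol[unfolded frac_heat_solution_def, THEN conjunct2, THEN spec, of x, THEN spec, of t, THEN mp, OF t]
  have Gint: "AE s in ?J. integrable lebesgue (\<lambda>y. frac_heat_kernel \<theta> (x - y) (t - s) * f y s)"
    and GJ: "integrable ?J ?G"
    and ux: "u x t = (\<integral>y. frac_heat_kernel \<theta> (x - y) t * \<phi> y \<partial>lebesgue) + (\<integral>s. ?G s \<partial>?J)"
    by (rule S[THEN conjunct1], rule S[THEN conjunct2, THEN conjunct1], rule S[THEN conjunct2, THEN conjunct2])

  have fin0: "(\<integral>\<^sup>+y. ennreal (weight_scale \<theta> 0 y powr K * \<bar>\<phi> y\<bar>) \<partial>lebesgue) < \<infinity>"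
  proof -
    have "(\<integral>\<^sup>+y. ennreal (weight_scale \<theta> 0 y powr K * \<bar>\<phi> y\<bar>) \<partial>lebesgue) = (\<integral>\<^sup>+y. ennreal (weight_scale \<theta> 0 y powr K * \<bar>\<phi>0 y\<bar>) \<partial>lborel)"
      unfolding nn_integral_completion using \<phi>\<phi>0 by (intro nn_integral_cong_AE) (auto elim: eventually_mono)
    then show ?thesis using \<phi>fin by simp
  qed
  \<comment> \<open>For t > 0 the kernel is bounded in x, and \<phi> is integrable because its
    weighted mass is finite with a weight of at least 1.\<close>
  have G\<phi>: "integrable lebesgue (\<lambda>y. frac_heat_kernel \<theta> (x - y) (t - 0) * \<phi> y)"
  proof -
    obtain B where B: "\<And>y. \<bar>heat_deriv \<theta> (\<lambda>_. 0) 0 (x - y) t\<bar> \<le> B"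
    proof (rule heat_deriv_near[OF \<theta>, where \<alpha> = "\<lambda>_::'n. 0" and m = 0])
      fix C assume "\<And>t x. 0 < t \<Longrightarrow> \<bar>heat_deriv \<theta> (\<lambda>_. 0) 0 (x::real^'n) t\<bar> \<le> C * t powr (- (real (mi_order (\<lambda>_::'n. 0)) + real 0 * \<theta> + real CARD('n)) / \<theta>)"
      from that[OF this[OF t]] show thesis .
    qed
    have "(\<lambda>y. weight_scale \<theta> 0 y powr K :: real) \<in> borel_measurable (lborel :: (real^'n) measure)" by measurable
    then have zm: "(\<lambda>y :: real^'n. weight_scale \<theta> 0 y powr K) \<in> borel_measurable lebesgue" by (rule measurable_completion)
    have Iz: "integrable lebesgue (\<lambda>y. weight_scale \<theta> 0 y powr K * \<bar>\<phi> y\<bar>)"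
      using fin0 \<phi>m zm by (intro integrableI_nonneg) auto
    have "(\<lambda>y. heat_deriv \<theta> (\<lambda>_. 0) 0 (x - y) t) \<in> borel_measurable lborel" using heat_deriv_measurable[of "\<lambda>y. x - y" "\<lambda>_. t"] by simp
    then have Pm: "(\<lambda>y. heat_deriv \<theta> (\<lambda>_. 0) 0 (x - y) t) \<in> borel_measurable lebesgue" by (rule measurable_completion)
    have "integrable lebesgue (\<lambda>y. heat_deriv \<theta> (\<lambda>_. 0) 0 (x - y) t * \<phi> y)"
    proof (rule Bochner_Integration.integrable_bound)
      show "integrable lebesgue (\<lambda>y. B * (weight_scale \<theta> 0 y powr K * \<bar>\<phi> y\<bar>))" by (intro integrable_mult_right Iz)
      show "(\<lambda>y. heat_deriv \<theta> (\<lambda>_. 0) 0 (x - y) t * \<phi> y) \<in> borel_measurable lebesgue" using Pm \<phi>m by simp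
      show "AE y in lebesgue. norm (heat_deriv \<theta> (\<lambda>_. 0) 0 (x - y) t * \<phi> y) \<le> norm (B * (weight_scale \<theta> 0 y powr K * \<bar>\<phi> y\<bar>))"
      proof (rule AE_I2)
        fix y
        have "1 * \<bar>\<phi> y\<bar> \<le> weight_scale \<theta> 0 y powr K * \<bar>\<phi> y\<bar>"
          using weight_scale_ge_1[OF \<theta>, of 0 y] K by (intro mult_right_mono ge_one_powr_ge_zero) auto
        then have "\<bar>heat_deriv \<theta> (\<lambda>_. 0) 0 (x - y) t\<bar> * \<bar>\<phi> y\<bar> \<le> B * (weight_scale \<theta> 0 y powr K * \<bar>\<phi> y\<bar>)"
          using order_trans[OF abs_ge_zero B[of y]] by (intro mult_mono B) auto
        then show "norm (heat_deriv \<theta> (\<lambda>_. 0) 0 (x - y) t * \<phi> y) \<le> norm (B * (weight_scale \<theta> 0 y powr K * \<bar>\<phi> y\<bar>))"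
          using order_trans[OF abs_ge_zero B[of y]] by (simp add: abs_mult)
      qed
    qed
    then show ?thesis by (simp add: frac_heat_kernel_eq_heat_deriv[OF \<theta> t])
  qed
  \<comment> \<open>The initial datum corresponds to s = 0, where (s + 1)^m = 1; hence its moments
    enter the profile with the same coefficient for every m.\<close>
  define D\<phi> where "D\<phi> = (\<integral>y. frac_heat_kernel \<theta> (x - y) t * \<phi> y \<partial>lebesgue) - (\<Sum>m = 0..?n. \<Sum>\<alpha>\<in>?A. moment \<alpha> \<phi> * kernel_g \<theta> \<alpha> m x t)"
  have D\<phi>: "D\<phi> = (\<integral>y. remainder_kernel \<theta> K x y t 0 * \<phi> y \<partial>lebesgue)"
    using remainder_kernel_integral(1)[OF \<theta> K order_refl t \<phi>m fin0 G\<phi>] by (simp add: D\<phi>_def)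
  have b\<phi>: "ennreal \<bar>?X * D\<phi>\<bar> \<le> (\<integral>\<^sup>+y. ennreal (?X * \<bar>remainder_kernel \<theta> K x y t 0\<bar> * \<bar>\<phi>0 y\<bar>) \<partial>lborel)"
  proof -
    have "ennreal \<bar>?X * D\<phi>\<bar> = ennreal \<bar>\<integral>y. ?X * (remainder_kernel \<theta> K x y t 0 * \<phi> y) \<partial>lebesgue\<bar>" unfolding D\<phi> by simp
    also have "\<dots> \<le> (\<integral>\<^sup>+y. ennreal \<bar>?X * (remainder_kernel \<theta> K x y t 0 * \<phi> y)\<bar> \<partial>lebesgue)" by (rule ennreal_abs_integral_le)
    also have "\<dots> = (\<integral>\<^sup>+y. ennreal (?X * \<bar>remainder_kernel \<theta> K x y t 0\<bar> * \<bar>\<phi>0 y\<bar>) \<partial>lborel)"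
      unfolding nn_integral_completion
      by (rule nn_integral_cong_AE, use \<phi>\<phi>0 in eventually_elim) (simp add: abs_mult mult.assoc)
    finally show ?thesis .
  qed

  have efinAE: "AE s in lborel. s \<in> {0<..<t} \<longrightarrow> e s < \<infinity>"
  proof -
    have "AE s in lborel. indicator {0<..<t} s * e s \<noteq> \<infinity>" using efin by (intro nn_integral_PInf_AE) auto
    then show ?thesis by eventually_elim (auto simp: indicator_def top.not_eq_extremum)
  qed
  have slice: "AE s in lborel. s \<in> {0<..<t} \<longrightarrow> (\<lambda>y. f y s) \<in> borel_measurable lebesgue \<and> (AE y in lborel. f y s = f0 (s, y))
      \<and> (\<integral>\<^sup>+y. ennreal (weight_scale \<theta> s y powr K * \<bar>f y s\<bar>) \<partial>lebesgue) \<le> ennreal c * e s \<and> e s < \<infinity>"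
    using ff0 L1 efinAE
  proof eventually_elim
    case (elim s)
    show ?case
    proof
      assume s: "s \<in> {0<..<t}"
      then have AE: "AE y in lborel. f y s = f0 (s, y)" using elim(1) by simp
      have "(\<lambda>y. f0 (s, y)) \<in> borel_measurable borel" by measurable
      then have 1: "(\<lambda>y. f y s) \<in> borel_measurable lebesgue" using AE by (rule borel_measurable_lebesgue_AE)
      have "(\<integral>\<^sup>+y. ennreal (weight_scale \<theta> s y powr K * \<bar>f y s\<bar>) \<partial>lebesgue) = (\<integral>\<^sup>+y. ennreal (weight_scale \<theta> s y powr K * \<bar>f0 (s, y)\<bar>) \<partial>lborel)"
        unfolding nn_integral_completion using AE by (intro nn_integral_cong_AE) (auto elim: eventually_mono)
      then show "(\<lambda>y. f y s) \<in> borel_measurable lebesgue \<and> (AE y in lborel. f y s = f0 (s, y))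
        \<and> (\<integral>\<^sup>+y. ennreal (weight_scale \<theta> s y powr K * \<bar>f y s\<bar>) \<partial>lebesgue) \<le> ennreal c * e s \<and> e s < \<infinity>"
        using 1 AE elim(2,3) s by simp
    qed
  qed
  have slice_fin: "(\<integral>\<^sup>+y. ennreal (weight_scale \<theta> s y powr K * \<bar>f y s\<bar>) \<partial>lebesgue) < \<infinity>"
    if "(\<integral>\<^sup>+y. ennreal (weight_scale \<theta> s y powr K * \<bar>f y s\<bar>) \<partial>lebesgue) \<le> ennreal c * e s" "e s < \<infinity>" for s
    using that by (auto intro: order.strict_trans1 simp: ennreal_mult_less_top)

  have mom: "integrable ?J (\<lambda>s. (s + 1) ^ m * moment \<alpha> (\<lambda>y. f y s))" if \<alpha>: "real (mi_order \<alpha>) \<le> K" for m \<alpha>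
    unfolding integrable_restrict_space[OF J]
  proof (rule integrableI_bounded)
    \<comment> \<open>The moment of the Borel representative is Borel in s. It agrees with the
      moment of f(s) for almost every s, and this transfers Lebesgue measurability.\<close>
    define m0 where "m0 s = (LINT y|lborel. mi_power y \<alpha> * f0 (s, y))" for s
    have m0m[measurable]: "m0 \<in> borel_measurable borel"
    proof -
      have [measurable]: "(\<lambda>w. mi_power (snd w) \<alpha>) \<in> borel_measurable (borel :: (real \<times> (real^'n)) measure)"
        by (rule measurable_compose[OF snd_borel_measurable mi_power_measurable])
      have "(\<lambda>w. mi_power (snd w) \<alpha> * f0 w) \<in> borel_measurable borel" by measurable
      then have "(\<lambda>(s, y). mi_power y \<alpha> * f0 (s, y)) \<in> borel_measurable (borel \<Otimes>\<^sub>M lborel)"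
        by (simp add: case_prod_beta' borel_prod[symmetric] cong: measurable_cong_sets sets_pair_measure_cong)
      from lborel.borel_measurable_lebesgue_integral[OF this] show ?thesis unfolding m0_def .
    qed
    show "(\<lambda>s. indicator {0<..<t} s *\<^sub>R ((s + 1) ^ m * moment \<alpha> (\<lambda>y. f y s))) \<in> borel_measurable lebesgue"
    proof (rule borel_measurable_lebesgue_AE)
      show "(\<lambda>s. indicator {0<..<t} s *\<^sub>R ((s + 1) ^ m * m0 s)) \<in> borel_measurable borel" by measurable
      show "AE s in lborel. indicator {0<..<t} s *\<^sub>R ((s + 1) ^ m * moment \<alpha> (\<lambda>y. f y s)) = indicator {0<..<t} s *\<^sub>R ((s + 1) ^ m * m0 s)"
        using slice
      proof eventually_elim
        case (elim s)
        show ?case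
        proof (cases "s \<in> {0<..<t}")
          case True
          then have m: "(\<lambda>y. f y s) \<in> borel_measurable lebesgue" and AE: "AE y in lborel. f y s = f0 (s, y)" using elim by auto
          have mp: "(\<lambda>y. mi_power y \<alpha>) \<in> borel_measurable (lebesgue :: (real^'n) measure)" by (rule measurable_completion) measurable
          have b: "(\<lambda>y. mi_power y \<alpha> * f0 (s, y)) \<in> borel_measurable lborel" by measurable
          have "moment \<alpha> (\<lambda>y. f y s) = (\<integral>y. mi_power y \<alpha> * f0 (s, y) \<partial>lebesgue)"
            unfolding moment_def using AE_completion[OF AE] m mp measurable_completion[OF b]
            by (intro integral_cong_AE) (auto elim: eventually_mono)
          also have "\<dots> = m0 s" unfolding m0_def by (rule integral_completion[OF b])
          finally show ?thesis by simp
        qed simp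
      qed
    qed
    have "(\<integral>\<^sup>+s. ennreal (norm (indicator {0<..<t} s *\<^sub>R ((s + 1) ^ m * moment \<alpha> (\<lambda>y. f y s)))) \<partial>lebesgue)
        \<le> (\<integral>\<^sup>+s. ennreal ((t + 1) ^ m * c) * (indicator {0<..<t} s * e s) \<partial>lborel)"
      unfolding nn_integral_completion
    proof (rule nn_integral_mono_AE)
      show "AE s in lborel. ennreal (norm (indicator {0<..<t} s *\<^sub>R ((s + 1) ^ m * moment \<alpha> (\<lambda>y. f y s)))) \<le> ennreal ((t + 1) ^ m * c) * (indicator {0<..<t} s * e s)"
        using slice AE_restrict_space_iff[OF J, THEN iffD1, OF Gint, unfolded AE_completion_iff]
      proof eventually_elim
        case (elim s)
        show ?case
        proof (cases "s \<in> {0<..<t}")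
          case True
          then have s: "0 \<le> s" "s < t" by auto
          have sl: "(\<lambda>y. f y s) \<in> borel_measurable lebesgue" "(\<integral>\<^sup>+y. ennreal (weight_scale \<theta> s y powr K * \<bar>f y s\<bar>) \<partial>lebesgue) \<le> ennreal c * e s" "e s < \<infinity>"
            using elim(1) True by auto
          have I: "integrable lebesgue (\<lambda>y. frac_heat_kernel \<theta> (x - y) (t - s) * f y s)" using elim(2) True by simp
          obtain r where r: "e s = ennreal r" "0 \<le> r" using sl(3) by (cases "e s") auto
          have "\<bar>moment \<alpha> (\<lambda>y. f y s)\<bar> \<le> enn2real (\<integral>\<^sup>+y. ennreal (weight_scale \<theta> s y powr K * \<bar>f y s\<bar>) \<partial>lebesgue)"
            by (rule remainder_kernel_integral(2)[OF \<theta> K s sl(1) slice_fin[OF sl(2,3)] I \<alpha>])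
          also have "\<dots> \<le> enn2real (ennreal c * e s)" using sl by (intro enn2real_mono) (auto simp: ennreal_mult_less_top)
          also have "\<dots> = c * r" using r c by (simp flip: ennreal_mult)
          finally have "(s + 1) ^ m * \<bar>moment \<alpha> (\<lambda>y. f y s)\<bar> \<le> (t + 1) ^ m * (c * r)"
            using s by (intro mult_mono power_mono) auto
          then show ?thesis using True s r c t by (simp add: abs_mult power_abs ennreal_leI mult.assoc flip: ennreal_mult)
        qed simp
      qed
    qed
    also have "\<dots> = ennreal ((t + 1) ^ m * c) * (\<integral>\<^sup>+s. indicator {0<..<t} s * e s \<partial>lborel)" by (rule nn_integral_cmult) measurable
    also have "\<dots> < \<infinity>" using efin by (simp add: ennreal_mult_less_top)
    finally show "(\<integral>\<^sup>+s. ennreal (norm (indicator {0<..<t} s *\<^sub>R ((s + 1) ^ m * moment \<alpha> (\<lambda>y. f y s)))) \<partial>lebesgue) < \<infinity>" .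
  qed

  \<comment> \<open>The contribution of the slice at time s to u - w. Its integral equals the
    difference of the Duhamel term and the source part of the profile because every moment is
    integrable in time.\<close>
  define h where "h s = ?G s - (\<Sum>m = 0..?n. \<Sum>\<alpha>\<in>?A. (s + 1) ^ m * moment \<alpha> (\<lambda>y. f y s) * kernel_g \<theta> \<alpha> m x t)" for s
  have hint: "(\<integral>s. h s \<partial>?J) = (\<integral>s. ?G s \<partial>?J) - (\<Sum>m = 0..?n. \<Sum>\<alpha>\<in>?A. (\<integral>s. (s + 1) ^ m * moment \<alpha> (\<lambda>y. f y s) \<partial>?J) * kernel_g \<theta> \<alpha> m x t)"
  proof -
    have "(\<integral>s. h s \<partial>?J) = (\<integral>s. ?G s \<partial>?J) - (\<integral>s. (\<Sum>m = 0..?n. \<Sum>\<alpha>\<in>?A. (s + 1) ^ m * moment \<alpha> (\<lambda>y. f y s) * kernel_g \<theta> \<alpha> m x t) \<partial>?J)"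
      unfolding h_def by (intro Bochner_Integration.integral_diff GJ Bochner_Integration.integrable_sum integrable_mult_left mom) auto
    also have "(\<integral>s. (\<Sum>m = 0..?n. \<Sum>\<alpha>\<in>?A. (s + 1) ^ m * moment \<alpha> (\<lambda>y. f y s) * kernel_g \<theta> \<alpha> m x t) \<partial>?J)
        = (\<Sum>m = 0..?n. \<integral>s. (\<Sum>\<alpha>\<in>?A. (s + 1) ^ m * moment \<alpha> (\<lambda>y. f y s) * kernel_g \<theta> \<alpha> m x t) \<partial>?J)"
      by (intro Bochner_Integration.integral_sum Bochner_Integration.integrable_sum integrable_mult_left mom) auto
    also have "\<dots> = (\<Sum>m = 0..?n. \<Sum>\<alpha>\<in>?A. \<integral>s. (s + 1) ^ m * moment \<alpha> (\<lambda>y. f y s) * kernel_g \<theta> \<alpha> m x t \<partial>?J)"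
      by (intro sum.cong refl Bochner_Integration.integral_sum integrable_mult_left mom) auto
    also have "\<dots> = (\<Sum>m = 0..?n. \<Sum>\<alpha>\<in>?A. (\<integral>s. (s + 1) ^ m * moment \<alpha> (\<lambda>y. f y s) \<partial>?J) * kernel_g \<theta> \<alpha> m x t)"
      by (intro sum.cong refl integral_mult_left_zero)
    finally show ?thesis .
  qed
  have uw: "u x t - asymptotic_profile \<theta> K \<phi> f x t = D\<phi> + (\<integral>s. h s \<partial>?J)"
    unfolding asymptotic_profile_def ux hint D\<phi>_def distrib_right sum.distrib by linarith
  have bh: "ennreal \<bar>?X * (\<integral>s. h s \<partial>?J)\<bar>
      \<le> (\<integral>\<^sup>+w. ennreal (indicator {0<..<t} (fst w) * (?X * \<bar>remainder_kernel \<theta> K x (snd w) t (fst w)\<bar> * \<bar>f0 w\<bar>)) \<partial>lborel)"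
  proof -
    have "ennreal \<bar>?X * (\<integral>s. h s \<partial>?J)\<bar> = ennreal \<bar>\<integral>s. ?X * h s \<partial>?J\<bar>" by simp
    also have "\<dots> \<le> (\<integral>\<^sup>+s. ennreal \<bar>?X * h s\<bar> \<partial>?J)" by (rule ennreal_abs_integral_le)
    also have "\<dots> = (\<integral>\<^sup>+s. ennreal \<bar>?X * h s\<bar> * indicator {0<..<t} s \<partial>lborel)"
      by (simp only: nn_integral_restrict_space[OF J] nn_integral_completion)
    also have "\<dots> \<le> (\<integral>\<^sup>+s. \<integral>\<^sup>+y. ennreal (indicator {0<..<t} s * (?X * \<bar>remainder_kernel \<theta> K x y t s\<bar> * \<bar>f0 (s, y)\<bar>)) \<partial>lborel \<partial>lborel)"
    proof (rule nn_integral_mono_AE)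
      show "AE s in lborel. ennreal \<bar>?X * h s\<bar> * indicator {0<..<t} s \<le> (\<integral>\<^sup>+y. ennreal (indicator {0<..<t} s * (?X * \<bar>remainder_kernel \<theta> K x y t s\<bar> * \<bar>f0 (s, y)\<bar>)) \<partial>lborel)"
        using slice AE_restrict_space_iff[OF J, THEN iffD1, OF Gint, unfolded AE_completion_iff]
      proof eventually_elim
        case (elim s)
        show ?case
        proof (cases "s \<in> {0<..<t}")
          case True
          then have s: "0 \<le> s" "s < t" by auto
          have sl: "(\<lambda>y. f y s) \<in> borel_measurable lebesgue" "(\<integral>\<^sup>+y. ennreal (weight_scale \<theta> s y powr K * \<bar>f y s\<bar>) \<partial>lebesgue) \<le> ennreal c * e s" "e s < \<infinity>"
            and AE: "AE y in lborel. f y s = f0 (s, y)"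
            using elim(1) True by auto
          have I: "integrable lebesgue (\<lambda>y. frac_heat_kernel \<theta> (x - y) (t - s) * f y s)" using elim(2) True by simp
          have "h s = (\<integral>y. remainder_kernel \<theta> K x y t s * f y s \<partial>lebesgue)"
            unfolding h_def by (rule remainder_kernel_integral(1)[OF \<theta> K s sl(1) slice_fin[OF sl(2,3)] I])
          then have "ennreal \<bar>?X * h s\<bar> = ennreal \<bar>\<integral>y. ?X * (remainder_kernel \<theta> K x y t s * f y s) \<partial>lebesgue\<bar>" by simp
          also have "\<dots> \<le> (\<integral>\<^sup>+y. ennreal \<bar>?X * (remainder_kernel \<theta> K x y t s * f y s)\<bar> \<partial>lebesgue)" by (rule ennreal_abs_integral_le)
          also have "\<dots> = (\<integral>\<^sup>+y. ennreal (?X * \<bar>remainder_kernel \<theta> K x y t s\<bar> * \<bar>f0 (s, y)\<bar>) \<partial>lborel)"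
            unfolding nn_integral_completion
            by (rule nn_integral_cong_AE, use AE in eventually_elim) (simp add: abs_mult mult.assoc)
          finally show ?thesis using True by simp
        qed simp
      qed
    qed
    also have "\<dots> = (\<integral>\<^sup>+w. ennreal (indicator {0<..<t} (fst w) * (?X * \<bar>remainder_kernel \<theta> K x (snd w) t (fst w)\<bar> * \<bar>f0 w\<bar>)) \<partial>lborel)"
      by (simp only: nn_integral_lborel_pair[OF remainder_kernel_pair_measurable[OF \<theta> f0]] fst_conv snd_conv)
    finally show ?thesis .
  qed
  have "ennreal \<bar>?X * (u x t - asymptotic_profile \<theta> K \<phi> f x t)\<bar> \<le> ennreal (\<bar>?X * D\<phi>\<bar> + \<bar>?X * (\<integral>s. h s \<partial>?J)\<bar>)"
    unfolding uw distrib_left by (intro ennreal_leI abs_triangle_ineq)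
  also have "\<dots> = ennreal \<bar>?X * D\<phi>\<bar> + ennreal \<bar>?X * (\<integral>s. h s \<partial>?J)\<bar>" by (intro ennreal_plus) auto
  also have "\<dots> \<le> (\<integral>\<^sup>+y. ennreal (?X * \<bar>remainder_kernel \<theta> K x y t 0\<bar> * \<bar>\<phi>0 y\<bar>) \<partial>lborel)
       + (\<integral>\<^sup>+w. ennreal (indicator {0<..<t} (fst w) * (?X * \<bar>remainder_kernel \<theta> K x (snd w) t (fst w)\<bar> * \<bar>f0 w\<bar>)) \<partial>lborel)"
    by (intro add_mono b\<phi> bh)
  finally show ?thesis .
qed

lemma ennreal_enn2real_le: "ennreal (enn2real x) \<le> x"
  by (cases x) auto

text \<open>At a fixed point z/(t + 1)^(1/\<theta>) tends to 0, and so does its positive power d;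
  z^K h is the dominating function. The general measure and the maps \<sigma> and y cover both the
  initial datum, with \<sigma> = 0 on space, and the source on space-time.\<close>

lemma nn_integral_damped_weight_tendsto_0:
  fixes y :: "'a \<Rightarrow> real^'n"
  assumes \<theta>: "0 < \<theta>" and d: "0 < d" and h: "\<And>w. 0 \<le> h w"
    and meas: "\<And>t. (\<lambda>w. ennreal (damped_weight \<theta> K d t (\<sigma> w) (y w) * h w)) \<in> borel_measurable M"
      "(\<lambda>w. ennreal (weight_scale \<theta> (\<sigma> w) (y w) powr K * h w)) \<in> borel_measurable M"
    and fin: "(\<integral>\<^sup>+w. ennreal (weight_scale \<theta> (\<sigma> w) (y w) powr K * h w) \<partial>M) < \<infinity>"
  shows "((\<lambda>t. \<integral>\<^sup>+w. ennreal (damped_weight \<theta> K d t (\<sigma> w) (y w) * h w) \<partial>M) \<longlongrightarrow> 0) at_top"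
proof (rule tendsto_at_topI_sequentially)
  fix X :: "nat \<Rightarrow> real" assume X: "filterlim X at_top sequentially"
  have "(\<lambda>n. \<integral>\<^sup>+w. ennreal (damped_weight \<theta> K d (X n) (\<sigma> w) (y w) * h w) \<partial>M) \<longlonglongrightarrow> (\<integral>\<^sup>+w. 0 \<partial>M)"
  proof (rule nn_integral_dominated_convergence[where w = "\<lambda>w. ennreal (weight_scale \<theta> (\<sigma> w) (y w) powr K * h w)"])
    show "AE w in M. (\<lambda>n. ennreal (damped_weight \<theta> K d (X n) (\<sigma> w) (y w) * h w)) \<longlonglongrightarrow> 0"
    proof (rule AE_I2)
      fix w
      let ?z = "weight_scale \<theta> (\<sigma> w) (y w)"
      have "filterlim (\<lambda>t::real. t + 1) at_top at_top"
        using filterlim_tendsto_add_at_top[OF tendsto_const[of 1] filterlim_ident] by (simp add: add.commute)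
      then have "((\<lambda>t::real. ?z * (t + 1) powr (- (1 / \<theta>))) \<longlongrightarrow> ?z * 0) at_top"
        using \<theta> by (intro tendsto_mult tendsto_const tendsto_neg_powr) auto
      then have "((\<lambda>t::real. ?z / (t + 1) powr (1 / \<theta>)) \<longlongrightarrow> 0) at_top"
        by (simp add: powr_minus divide_inverse)
      then have "((\<lambda>t. (min 1 (?z / (t + 1) powr (1 / \<theta>))) powr d) \<longlongrightarrow> (min 1 0) powr d) at_top"
        using d by (intro tendsto_powr2 tendsto_min tendsto_const) auto
      then have "((\<lambda>t. ?z powr K * (min 1 (?z / (t + 1) powr (1 / \<theta>))) powr d * h w) \<longlongrightarrow> ?z powr K * 0 * h w) at_top"
        using d by (intro tendsto_mult tendsto_const) auto
      then have "((\<lambda>t. damped_weight \<theta> K d t (\<sigma> w) (y w) * h w) \<longlongrightarrow> 0) at_top" by (simp add: damped_weight_def)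
      then have "((\<lambda>t. ennreal (damped_weight \<theta> K d t (\<sigma> w) (y w) * h w)) \<longlongrightarrow> ennreal 0) at_top" by (rule tendsto_ennrealI)
      from filterlim_compose[OF this X] show "(\<lambda>n. ennreal (damped_weight \<theta> K d (X n) (\<sigma> w) (y w) * h w)) \<longlonglongrightarrow> 0" by simp
    qed
    show "AE w in M. ennreal (damped_weight \<theta> K d (X n) (\<sigma> w) (y w) * h w) \<le> ennreal (weight_scale \<theta> (\<sigma> w) (y w) powr K * h w)" for n
      using d h by (intro AE_I2 ennreal_leI mult_right_mono damped_weight_le) auto
  qed (use meas fin in auto)
  then show "(\<lambda>n. \<integral>\<^sup>+w. ennreal (damped_weight \<theta> K d (X n) (\<sigma> w) (y w) * h w) \<partial>M) \<longlonglongrightarrow> 0" by simp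
qed

section \<open>Borel representatives of the data\<close>

text \<open>Measurability is known on bounded time intervals only; the truncations to (0, n + 1)
  increase to the function on the whole half-line.\<close>

lemma borel_measurable_lebesgue_on_Ioi:
  fixes E :: "real \<Rightarrow> ennreal"
  assumes "\<And>\<tau>. 0 < \<tau> \<Longrightarrow> E \<in> borel_measurable (lebesgue_on {0<..<\<tau>})"
  shows "(\<lambda>s. E s * indicator {0<..} s) \<in> borel_measurable lebesgue"
proof -
  define F where "F n s = E s * indicator {0<..<real (Suc n)} s" for n s
  have "F n \<in> borel_measurable lebesgue" for n
    using assms[of "real (Suc n)"] unfolding F_def
    by (subst borel_measurable_restrict_space_iff_ennreal[symmetric]) auto
  then have "(\<lambda>s. SUP n. F n s) \<in> borel_measurable lebesgue" by measurable
  moreover have "(SUP n. F n s) = E s * indicator {0<..} s" for s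
  proof (rule antisym)
    show "(SUP n. F n s) \<le> E s * indicator {0<..} s" by (rule SUP_least) (simp add: F_def indicator_def)
    obtain n where "s < real n" using reals_Archimedean2 by blast
    then have "F n s = E s * indicator {0<..} s" by (simp add: F_def indicator_def)
    then show "E s * indicator {0<..} s \<le> (SUP n. F n s)" by (metis SUP_upper UNIV_I)
  qed
  ultimately show ?thesis by simp
qed

lemma borel_source_size:
  fixes f :: "real^'n \<Rightarrow> real \<Rightarrow> real"
  assumes "\<forall>\<tau>>0. source_size \<theta> K q f \<in> borel_measurable (lebesgue_on {0<..<\<tau>})"
  obtains e where "e \<in> borel_measurable borel" "AE s in lborel. 0 < s \<longrightarrow> e s = source_size \<theta> K q f s"
proof -
  from assms have "(\<lambda>s. source_size \<theta> K q f s * indicator {0<..} s) \<in> borel_measurable lebesgue"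
    by (intro borel_measurable_lebesgue_on_Ioi) blast
  from completion_ex_borel_measurable[OF this]
  obtain e where e: "e \<in> borel_measurable lborel" "AE s in lborel. source_size \<theta> K q f s * indicator {0<..} s = e s" by auto
  then show thesis by (intro that[of e]) (auto elim!: eventually_mono)
qed

text \<open>A Borel function agrees with f outside a null set of space-time, and almost every time
  slice of that set is null. The representative takes the time first, to match the space-time
  variable w = (s, y).\<close>

lemma borel_slices:
  fixes f :: "real^'n \<Rightarrow> real \<Rightarrow> real"
  assumes f: "(\<lambda>(x, t). f x t) \<in> borel_measurable (lebesgue_on (UNIV \<times> {0<..}))"
  obtains f0 where "f0 \<in> borel_measurable borel"
    "AE s in lborel. 0 < s \<longrightarrow> (AE y in lborel. f y s = f0 (s, y))"
proof -
  have S: "UNIV \<times> {0<..} \<in> sets (lebesgue :: ((real^'n) \<times> real) measure)"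
    by (intro sets_completionI_sets) (simp add: borel_open open_Times)
  have "(\<lambda>w. indicator (UNIV \<times> {0<..}) w *\<^sub>R (case w of (x, t) \<Rightarrow> f x t)) \<in> borel_measurable lebesgue"
    using f S by (subst borel_measurable_restrict_space_iff[symmetric]) auto
  from completion_ex_borel_measurable_real[OF this]
  obtain F where F: "F \<in> borel_measurable lborel"
    "AE w in lborel. indicator (UNIV \<times> {0<..}) w *\<^sub>R (case w of (x, t) \<Rightarrow> f x t) = F w" by auto
  from F(2) obtain Nz where Nz: "Nz \<in> null_sets lborel"
    "{w \<in> space lborel. \<not> indicator (UNIV \<times> {0<..}) w *\<^sub>R (case w of (x, t) \<Rightarrow> f x t) = F w} \<subseteq> Nz"
    by (auto simp: eventually_ae_filter)
  have Nb: "Nz \<in> sets borel" using Nz by auto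
  have "AE w in (lborel \<Otimes>\<^sub>M lborel). w \<notin> Nz"
    unfolding lborel_prod using Nz(1) by (rule AE_not_in)
  then have "AE x in lborel. AE s in lborel. (x, s) \<notin> Nz" by (rule lborel_pair.AE_pair)
  then have "AE s in lborel. AE x in lborel. (x, s) \<notin> Nz"
  proof (subst (asm) lborel_pair.AE_commute)
    have "{w \<in> space (lborel \<Otimes>\<^sub>M lborel). (fst w, snd w) \<notin> Nz} = - Nz" by (auto simp: space_pair_measure)
    then show "{w \<in> space (lborel \<Otimes>\<^sub>M lborel). (fst w, snd w) \<notin> Nz} \<in> sets (lborel \<Otimes>\<^sub>M lborel)"
      using Nb unfolding lborel_prod by (simp add: Compl_eq)
  qed
  then have "AE s in lborel. 0 < s \<longrightarrow> (AE y in lborel. f y s = F (y, s))"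
  proof eventually_elim
    case (elim s)
    show ?case
    proof
      assume s: "0 < s"
      show "AE y in lborel. f y s = F (y, s)" using elim
      proof eventually_elim
        case (elim y)
        then have "indicator (UNIV \<times> {0<..}) (y, s) *\<^sub>R (case (y, s) of (x, t) \<Rightarrow> f x t) = F (y, s)" using Nz(2) by (auto simp: subset_iff)
        then show ?case using s by (simp add: indicator_def)
      qed
    qed
  qed
  moreover have "(\<lambda>w. F (snd w, fst w)) \<in> borel_measurable borel"
    using F(1) by (simp add: borel_prod[symmetric])
  ultimately show thesis by (intro that[of "\<lambda>w. F (snd w, fst w)"]) auto
qed

text \<open>All that the theorem needs, in one bound of two forms. For t \<ge> 2 T, \<psi> collects
  what dominated convergence sends to 0, namely the initial datum and the source up to time T. For t
  < \<tau>, the same quantities are replaced by masses independent of t.\<close>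

lemma wnorm_solution_minus_profile_le:
  fixes \<theta> l K :: real and q :: ennreal
    and \<phi> :: "real^'n \<Rightarrow> real" and f u :: "real^'n \<Rightarrow> real \<Rightarrow> real"
  assumes \<theta>: "0 < \<theta>" and l: "0 \<le> l" "l \<le> K" and q: "1 \<le> q"
    and \<phi>: "\<phi> \<in> weighted_L 1 K"
    and f: "(\<lambda>(x, t). f x t) \<in> borel_measurable (lebesgue_on (UNIV \<times> {0<..}))"
    and E: "\<forall>\<tau>>0. source_size \<theta> K q f \<in> borel_measurable (lebesgue_on {0<..<\<tau>}) \<and>
                 (\<integral>\<^sup>+ t. source_size \<theta> K q f t \<partial>lebesgue_on {0<..<\<tau>}) < \<infinity>"
    and sol: "frac_heat_solution \<theta> \<phi> f u"
  obtains C \<psi> m where "0 \<le> C" "m < \<infinity>" "\<And>T. 0 < T \<Longrightarrow> (\<psi> T \<longlongrightarrow> (0::ennreal)) at_top"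
    "\<And>T t. 0 < T \<Longrightarrow> 2 * T \<le> t \<Longrightarrow> wnorm q l (\<lambda>x. u x t - asymptotic_profile \<theta> K \<phi> f x t)
       \<le> ennreal (C * ((t + 1) powr (1 / \<theta>)) powr (l - K) * t powr (- decay_exponent CARD('n) \<theta> q)) *
         (\<psi> T t + (\<integral>\<^sup>+ s. source_size \<theta> K q f s \<partial>lebesgue_on {T<..<t}))"
    "\<And>\<tau> t. 0 < t \<Longrightarrow> t < \<tau> \<Longrightarrow> wnorm q l (\<lambda>x. u x t - asymptotic_profile \<theta> K \<phi> f x t)
       \<le> ennreal (C * ((t + 1) powr (1 / \<theta>)) powr (l - K) * t powr (- decay_exponent CARD('n) \<theta> q)) *
         (m + (\<integral>\<^sup>+ s. source_size \<theta> K q f s \<partial>lebesgue_on {0<..<\<tau>}))"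
proof -
  let ?a = "decay_exponent CARD('n) \<theta> q"
  define c :: real where "c = 4 * 2 powr K"
  have c: "0 \<le> c" by (simp add: c_def)
  have K: "0 \<le> K" using l by simp
  obtain e where e[measurable]: "e \<in> borel_measurable borel" and eE: "AE s in lborel. 0 < s \<longrightarrow> e s = source_size \<theta> K q f s"
    using borel_source_size E by blast
  obtain f0 where f0[measurable]: "f0 \<in> borel_measurable borel" and ff0: "AE s in lborel. 0 < s \<longrightarrow> (AE y in lborel. f y s = f0 (s, y))"
    using borel_slices[OF f] by blast
  have \<phi>m: "\<phi> \<in> borel_measurable lebesgue" and \<phi>n: "Lnorm 1 \<phi> + wnorm 1 K \<phi> < \<infinity>" using \<phi> by (auto simp: weighted_L_def)
  obtain \<phi>0 where \<phi>0[measurable]: "\<phi>0 \<in> borel_measurable borel" and \<phi>\<phi>0: "AE y in lborel. \<phi> y = \<phi>0 y"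
    using completion_ex_borel_measurable_real[OF \<phi>m] by auto
  have f0s[measurable]: "(\<lambda>y. f0 (s, y)) \<in> borel_measurable borel" for s by measurable
  have L1: "AE s in lborel. 0 < s \<longrightarrow> (\<integral>\<^sup>+y. ennreal (weight_scale \<theta> s y powr K * \<bar>f0 (s, y)\<bar>) \<partial>lborel) \<le> ennreal c * e s"
    using eE ff0
  proof eventually_elim
    case (elim s)
    then show ?case using source_size_L1[OF \<theta> K, of s f "\<lambda>y. f0 (s, y)" q] f0s by (auto simp: c_def)
  qed
  have Lq: "AE s in lborel. 0 < s \<longrightarrow> e s < \<infinity> \<longrightarrow>
         Lq_le q (\<lambda>y. weight_scale \<theta> s y powr K * \<bar>f0 (s, y)\<bar>) (c * s powr (- ?a) * enn2real (e s))"
    using eE ff0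
  proof eventually_elim
    case (elim s)
    then show ?case using source_size_Lq[OF \<theta> K _ q, of s f "\<lambda>y. f0 (s, y)"] f0s by (auto simp: c_def)
  qed
  have eint: "(\<integral>\<^sup>+ s. source_size \<theta> K q f s \<partial>lebesgue_on {a<..<b}) = (\<integral>\<^sup>+s. indicator {a<..<b} s * e s \<partial>lborel)"
    if "0 \<le> a" for a b
  proof -
    have "(\<integral>\<^sup>+ s. source_size \<theta> K q f s \<partial>lebesgue_on {a<..<b}) = (\<integral>\<^sup>+s. source_size \<theta> K q f s * indicator {a<..<b} s \<partial>lborel)"
      by (subst nn_integral_restrict_space) (simp_all add: nn_integral_completion)
    also have "\<dots> = (\<integral>\<^sup>+s. indicator {a<..<b} s * e s \<partial>lborel)"
      by (rule nn_integral_cong_AE, use eE in eventually_elim) (use that in \<open>auto simp: indicator_def\<close>)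
    finally show ?thesis .
  qed
  have efin: "(\<integral>\<^sup>+s. indicator {0<..<t} s * e s \<partial>lborel) < \<infinity>" if "0 < t" for t
    using E that eint[of 0 t] by auto
  have weight_scale0: "weight_scale \<theta> 0 y powr K \<le> 2 powr K * (norm y powr K + 1)" for y :: "real^'n"
    using weight_scale_powr_le[OF \<theta> K, of 0 y] by simp
  define m where "m = (\<integral>\<^sup>+y. ennreal (weight_scale \<theta> 0 y powr K * \<bar>\<phi>0 y\<bar>) \<partial>lborel)"
  have m: "m < \<infinity>"
  proof -
    have "m \<le> (\<integral>\<^sup>+y. ennreal (2 powr K) * (ennreal \<bar>\<phi>0 y\<bar> + ennreal \<bar>norm y powr K * \<phi>0 y\<bar>) \<partial>lborel)"
      unfolding m_def
    proof (rule nn_integral_mono)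
      fix y
      have "weight_scale \<theta> 0 y powr K * \<bar>\<phi>0 y\<bar> \<le> 2 powr K * (norm y powr K + 1) * \<bar>\<phi>0 y\<bar>"
        by (intro mult_right_mono weight_scale0) auto
      also have "\<dots> = 2 powr K * (\<bar>\<phi>0 y\<bar> + \<bar>norm y powr K * \<phi>0 y\<bar>)" by (simp add: algebra_simps abs_mult)
      finally show "ennreal (weight_scale \<theta> 0 y powr K * \<bar>\<phi>0 y\<bar>) \<le> ennreal (2 powr K) * (ennreal \<bar>\<phi>0 y\<bar> + ennreal \<bar>norm y powr K * \<phi>0 y\<bar>)"
        by (simp add: ennreal_leI flip: ennreal_mult ennreal_plus)
    qed
    also have "\<dots> = ennreal (2 powr K) * ((\<integral>\<^sup>+y. ennreal \<bar>\<phi>0 y\<bar> \<partial>lborel) + (\<integral>\<^sup>+y. ennreal \<bar>norm y powr K * \<phi>0 y\<bar> \<partial>lborel))"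
      by (simp add: nn_integral_cmult nn_integral_add)
    also have "(\<integral>\<^sup>+y. ennreal \<bar>\<phi>0 y\<bar> \<partial>lborel) = Lnorm 1 \<phi>"
      unfolding Lnorm_1 nn_integral_completion using \<phi>\<phi>0 by (intro nn_integral_cong_AE) (auto elim: eventually_mono)
    also have "(\<integral>\<^sup>+y. ennreal \<bar>norm y powr K * \<phi>0 y\<bar> \<partial>lborel) = wnorm 1 K \<phi>"
      unfolding wnorm_def Lnorm_1 nn_integral_completion using \<phi>\<phi>0 by (intro nn_integral_cong_AE) (auto elim: eventually_mono)
    finally show ?thesis using \<phi>n by (auto simp: ennreal_mult_less_top elim: order.strict_trans1)
  qed

  obtain C d where C: "0 \<le> C" and d: "0 < d" and bound: "\<And>(\<phi>0 :: real^'n \<Rightarrow> real) f0 e c t g.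
      \<lbrakk>\<phi>0 \<in> borel_measurable borel; f0 \<in> borel_measurable borel; e \<in> borel_measurable borel; g \<in> borel_measurable borel;
       0 \<le> c; 0 < t;
       (\<integral>\<^sup>+y. ennreal (weight_scale \<theta> 0 y powr K * \<bar>\<phi>0 y\<bar>) \<partial>lborel) < \<infinity>;
       (\<integral>\<^sup>+s. indicator {0<..<t} s * e s \<partial>lborel) < \<infinity>;
       AE s in lborel. 0 < s \<longrightarrow> (\<integral>\<^sup>+y. ennreal (weight_scale \<theta> s y powr K * \<bar>f0 (s, y)\<bar>) \<partial>lborel) \<le> ennreal c * e s;
       AE s in lborel. 0 < s \<longrightarrow> e s < \<infinity> \<longrightarrow>
         Lq_le q (\<lambda>y. weight_scale \<theta> s y powr K * \<bar>f0 (s, y)\<bar>) (c * s powr (- decay_exponent CARD('n) \<theta> q) * enn2real (e s));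
       \<And>x. ennreal \<bar>g x\<bar> \<le> (\<integral>\<^sup>+y. ennreal (norm x powr l * \<bar>remainder_kernel \<theta> K x y t 0\<bar> * \<bar>\<phi>0 y\<bar>) \<partial>lborel)
         + (\<integral>\<^sup>+w. ennreal (indicator {0<..<t} (fst w) * (norm x powr l * \<bar>remainder_kernel \<theta> K x (snd w) t (fst w)\<bar> * \<bar>f0 w\<bar>)) \<partial>lborel)\<rbrakk>
     \<Longrightarrow> Lnorm q g \<le> ennreal (C * (1 + c) * ((t + 1) powr (1 / \<theta>)) powr (l - K) * t powr (- decay_exponent CARD('n) \<theta> q) *
          (enn2real (\<integral>\<^sup>+y. ennreal (damped_weight \<theta> K d t 0 y * \<bar>\<phi>0 y\<bar>) \<partial>lborel)
         + enn2real (\<integral>\<^sup>+w. ennreal (indicator {0<..<t} (fst w) * damped_weight \<theta> K d t (fst w) (snd w) * \<bar>f0 w\<bar>) \<partial>lborel)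
         + enn2real (\<integral>\<^sup>+s. indicator {t/2<..<t} s * e s \<partial>lborel)))"
    by (rule weighted_difference_bound[OF \<theta> l q, where 'n = 'n]) blast

  define A where "A t = (\<integral>\<^sup>+y. ennreal (damped_weight \<theta> K d t 0 y * \<bar>\<phi>0 y\<bar>) \<partial>lborel)" for t
  define B where "B I t = (\<integral>\<^sup>+w. ennreal (indicator I (fst w) * damped_weight \<theta> K d t (fst w) (snd w) * \<bar>f0 w\<bar>) \<partial>lborel)" for I :: "real set" and t
  let ?D = "\<lambda>a b. \<integral>\<^sup>+s. indicator {a<..<b} s * e s \<partial>lborel"
  define \<kappa> where "\<kappa> t = C * (1 + c) * ((t + 1) powr (1 / \<theta>)) powr (l - K) * t powr (- ?a)" for t
  have \<kappa>0: "0 \<le> \<kappa> t" for t using C c by (simp add: \<kappa>_def)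
  have main: "wnorm q l (\<lambda>x. u x t - asymptotic_profile \<theta> K \<phi> f x t) \<le> ennreal (\<kappa> t) * (A t + B {0<..<t} t + ?D (t/2) t)"
    if t: "0 < t" for t
  proof -
    have gm: "(\<lambda>x. norm x powr l * (u x t - asymptotic_profile \<theta> K \<phi> f x t)) \<in> borel_measurable borel"
    proof -
      have "continuous_on (UNIV \<times> {0<..}) (\<lambda>(x, t). u x t)" using sol by (simp add: frac_heat_solution_def)
      then have "continuous_on UNIV (\<lambda>x. case (x, t) of (x, t) \<Rightarrow> u x t)"
        by (rule continuous_on_compose2) (use t in \<open>auto intro!: continuous_intros\<close>)
      then have [measurable]: "(\<lambda>x. u x t) \<in> borel_measurable borel" by (simp add: borel_measurable_continuous_onI)
      have [measurable]: "(\<lambda>x :: real^'n. kernel_g \<theta> \<alpha> m x t) \<in> borel_measurable borel" for \<alpha> m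
        using t by (intro kernel_g_measurable[OF \<theta>]) auto
      show ?thesis unfolding asymptotic_profile_def by measurable
    qed
    have "wnorm q l (\<lambda>x. u x t - asymptotic_profile \<theta> K \<phi> f x t)
       \<le> ennreal (\<kappa> t * (enn2real (A t) + enn2real (B {0<..<t} t) + enn2real (?D (t/2) t)))"
      unfolding wnorm_def \<kappa>_def A_def B_def
      by (rule bound[OF \<phi>0 f0 e gm c t m[unfolded m_def] efin[OF t] L1 Lq])
         (rule solution_minus_profile_le[OF \<theta> K t c \<phi>m \<phi>0 \<phi>\<phi>0 f0 ff0 e m[unfolded m_def] efin[OF t] L1 sol])
    also have "\<dots> = ennreal (\<kappa> t) * (ennreal (enn2real (A t)) + ennreal (enn2real (B {0<..<t} t)) + ennreal (enn2real (?D (t/2) t)))"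
      using \<kappa>0 by (simp add: ennreal_mult ennreal_plus)
    also have "\<dots> \<le> ennreal (\<kappa> t) * (A t + B {0<..<t} t + ?D (t/2) t)"
      by (intro mult_left_mono add_mono ennreal_enn2real_le) auto
    finally show ?thesis .
  qed
  have Omm[measurable]: "(\<lambda>w. damped_weight \<theta> K d t (fst w) (snd w)) \<in> borel_measurable (borel :: (real \<times> (real^'n)) measure)"
    "(\<lambda>y. damped_weight \<theta> K d t s y) \<in> borel_measurable (borel :: (real^'n) measure)" for s t
    unfolding damped_weight_def by measurable
  define Z where "Z I = (\<integral>\<^sup>+w. ennreal (weight_scale \<theta> (fst w) (snd w) powr K * (indicator I (fst w) * \<bar>f0 w\<bar>)) \<partial>lborel)" for I :: "real set"
  have ZD: "Z I \<le> ennreal c * ?D a b" if I: "I \<subseteq> {a<..<b}" and a: "0 \<le> a" and [measurable]: "I \<in> sets borel" for I a b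
  proof -
    have "Z I = (\<integral>\<^sup>+s. \<integral>\<^sup>+y. ennreal (weight_scale \<theta> s y powr K * (indicator I s * \<bar>f0 (s, y)\<bar>)) \<partial>lborel \<partial>lborel)"
    proof -
      have [measurable]: "(\<lambda>w. indicator I (fst w) :: real) \<in> borel_measurable (borel :: (real \<times> (real^'n)) measure)"
        by (rule measurable_compose[OF fst_borel_measurable]) measurable
      have "(\<lambda>w. ennreal (weight_scale \<theta> (fst w) (snd w) powr K * (indicator I (fst w) * \<bar>f0 w\<bar>))) \<in> borel_measurable borel" by measurable
      from nn_integral_lborel_pair[OF this] show ?thesis unfolding Z_def by simp
    qed
    also have "\<dots> \<le> (\<integral>\<^sup>+s. ennreal c * (indicator {a<..<b} s * e s) \<partial>lborel)"
    proof (rule nn_integral_mono_AE, use L1 in eventually_elim)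
      case (elim s)
      then show ?case using I a by (cases "s \<in> I") (auto simp: indicator_def)
    qed
    also have "\<dots> = ennreal c * ?D a b" by (rule nn_integral_cmult) measurable
    finally show ?thesis .
  qed
  have BZ: "B I t \<le> Z I" for I t
    unfolding B_def Z_def
  proof (intro nn_integral_mono ennreal_leI)
    fix w :: "real \<times> (real^'n)"
    have "damped_weight \<theta> K d t (fst w) (snd w) * (indicator I (fst w) * \<bar>f0 w\<bar>) \<le> weight_scale \<theta> (fst w) (snd w) powr K * (indicator I (fst w) * \<bar>f0 w\<bar>)"
      using d by (intro mult_right_mono damped_weight_le) auto
    then show "indicator I (fst w) * damped_weight \<theta> K d t (fst w) (snd w) * \<bar>f0 w\<bar> \<le> weight_scale \<theta> (fst w) (snd w) powr K * (indicator I (fst w) * \<bar>f0 w\<bar>)"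
      by (simp add: mult_ac)
  qed
  have Am: "A t \<le> m" for t
    unfolding A_def m_def using d by (intro nn_integral_mono ennreal_leI mult_right_mono damped_weight_le) auto
  have A0: "(A \<longlongrightarrow> 0) at_top"
    unfolding A_def by (rule nn_integral_damped_weight_tendsto_0[OF \<theta> d]) (use m in \<open>simp_all add: m_def\<close>)
  have B0: "(B {0<..T} \<longlongrightarrow> 0) at_top" if T: "0 < T" for T
  proof -
    have Zf: "Z {0<..T} < \<infinity>"
    proof -
      have "Z {0<..T} \<le> ennreal c * ?D 0 (T + 1)" by (rule ZD) auto
      also have "\<dots> < \<infinity>" using efin[of "T + 1"] T by (simp add: ennreal_mult_less_top)
      finally show ?thesis .
    qed
    have "((\<lambda>t. \<integral>\<^sup>+w. ennreal (damped_weight \<theta> K d t (fst w) (snd w) * (indicator {0<..T} (fst w) * \<bar>f0 w\<bar>)) \<partial>lborel) \<longlongrightarrow> 0) at_top"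
      by (rule nn_integral_damped_weight_tendsto_0[OF \<theta> d]) (use Zf in \<open>simp_all add: Z_def\<close>)
    then show ?thesis by (simp add: B_def[abs_def] mult_ac)
  qed
  have c1: "1 \<le> ennreal (1 + c)" using c by (simp add: ennreal_ge_1)
  have c1': "ennreal c + 1 = ennreal (1 + c)" using c by (simp add: ennreal_plus add.commute)
  show thesis
  \<comment> \<open>One factor 1 + c comes from the weighted bound. The other adds up the
    coefficients with which the source integral occurs, c from its damped part and 1 from the window
    (t/2, t), and, being at least 1, is put in front of the remaining terms too.\<close>
  proof (rule that[of "C * (1 + c) * (1 + c)" m "\<lambda>T t. A t + B {0<..T} t"])
    show "0 \<le> C * (1 + c) * (1 + c)" using C c by simp
    show "m < \<infinity>" by (rule m)
    show "((\<lambda>t. A t + B {0<..T} t) \<longlongrightarrow> 0) at_top" if "0 < T" for T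
      using tendsto_add[OF A0 B0[OF that]] by simp
    have eq: "ennreal (C * (1 + c) * (1 + c) * ((t + 1) powr (1 / \<theta>)) powr (l - K) * t powr (- ?a)) = ennreal (\<kappa> t) * ennreal (1 + c)" for t
      using c C by (subst ennreal_mult[symmetric]) (auto simp: \<kappa>_def mult_ac)
    show "wnorm q l (\<lambda>x. u x t - asymptotic_profile \<theta> K \<phi> f x t)
       \<le> ennreal (C * (1 + c) * (1 + c) * ((t + 1) powr (1 / \<theta>)) powr (l - K) * t powr (- ?a)) *
         (A t + B {0<..T} t + (\<integral>\<^sup>+ s. source_size \<theta> K q f s \<partial>lebesgue_on {T<..<t}))" if T: "0 < T" "2 * T \<le> t" for T t
    proof -
      have "B {0<..<t} t \<le> (\<integral>\<^sup>+w. ennreal (indicator {0<..T} (fst w) * damped_weight \<theta> K d t (fst w) (snd w) * \<bar>f0 w\<bar>)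
          + ennreal (indicator {T<..<t} (fst w) * damped_weight \<theta> K d t (fst w) (snd w) * \<bar>f0 w\<bar>) \<partial>lborel)"
        unfolding B_def by (intro nn_integral_mono) (auto simp: indicator_def)
      also have "\<dots> = B {0<..T} t + B {T<..<t} t" unfolding B_def by (rule nn_integral_add) measurable
      finally have "B {0<..<t} t \<le> B {0<..T} t + ennreal c * ?D T t"
        using BZ[of "{T<..<t}" t] ZD[of "{T<..<t}" T t] T by (auto intro: order_trans add_left_mono)
      \<comment> \<open>Here 2 T \<le> t enters: the late window (t/2, t) lies inside (T,
        t).\<close>
      moreover have "?D (t/2) t \<le> ?D T t"
        using T by (intro nn_integral_mono mult_right_mono) (auto simp: indicator_def)
      ultimately have "A t + B {0<..<t} t + ?D (t/2) t \<le> A t + (B {0<..T} t + ennreal c * ?D T t) + ?D T t"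
        by (intro add_mono) auto
      also have "\<dots> = (A t + B {0<..T} t) + ennreal (1 + c) * ?D T t"
        unfolding c1'[symmetric] distrib_right by (simp add: add_ac)
      also have "\<dots> \<le> ennreal (1 + c) * (A t + B {0<..T} t) + ennreal (1 + c) * ?D T t"
        using mult_right_mono[OF c1] by (intro add_mono) auto
      finally have "A t + B {0<..<t} t + ?D (t/2) t \<le> ennreal (1 + c) * (A t + B {0<..T} t + ?D T t)"
        by (simp only: distrib_left)
      then have "ennreal (\<kappa> t) * (A t + B {0<..<t} t + ?D (t/2) t) \<le> ennreal (\<kappa> t) * (ennreal (1 + c) * (A t + B {0<..T} t + ?D T t))"
        by (intro mult_left_mono) auto
      moreover have "wnorm q l (\<lambda>x. u x t - asymptotic_profile \<theta> K \<phi> f x t) \<le> ennreal (\<kappa> t) * (A t + B {0<..<t} t + ?D (t/2) t)"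
        using T by (intro main) auto
      moreover have "(\<integral>\<^sup>+ s. source_size \<theta> K q f s \<partial>lebesgue_on {T<..<t}) = ?D T t" using T by (intro eint) auto
      ultimately show ?thesis unfolding eq by (simp only: mult.assoc)
    qed
    show "wnorm q l (\<lambda>x. u x t - asymptotic_profile \<theta> K \<phi> f x t)
       \<le> ennreal (C * (1 + c) * (1 + c) * ((t + 1) powr (1 / \<theta>)) powr (l - K) * t powr (- ?a)) *
         (m + (\<integral>\<^sup>+ s. source_size \<theta> K q f s \<partial>lebesgue_on {0<..<\<tau>}))" if t: "0 < t" "t < \<tau>" for t \<tau>
    proof -
      have B: "B {0<..<t} t \<le> ennreal c * ?D 0 \<tau>"
        using t by (intro order_trans[OF BZ ZD]) auto
      have D: "?D (t/2) t \<le> ?D 0 \<tau>"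
        using t by (intro nn_integral_mono mult_right_mono) (auto simp: indicator_def)
      have "A t + B {0<..<t} t + ?D (t/2) t \<le> m + ennreal c * ?D 0 \<tau> + ?D 0 \<tau>"
        by (intro add_mono Am B D)
      also have "\<dots> = m + ennreal (1 + c) * ?D 0 \<tau>"
        unfolding c1'[symmetric] distrib_right by (simp add: add_ac)
      also have "\<dots> \<le> ennreal (1 + c) * m + ennreal (1 + c) * ?D 0 \<tau>"
        using mult_right_mono[OF c1, of m] by (intro add_mono) auto
      finally have "A t + B {0<..<t} t + ?D (t/2) t \<le> ennreal (1 + c) * (m + ?D 0 \<tau>)"
        by (simp only: distrib_left)
      then have "ennreal (\<kappa> t) * (A t + B {0<..<t} t + ?D (t/2) t) \<le> ennreal (\<kappa> t) * (ennreal (1 + c) * (m + ?D 0 \<tau>))"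
        by (intro mult_left_mono) auto
      moreover have "(\<integral>\<^sup>+ s. source_size \<theta> K q f s \<partial>lebesgue_on {0<..<\<tau>}) = ?D 0 \<tau>" by (intro eint) auto
      ultimately show ?thesis using main[OF t(1)] unfolding eq by (simp only: mult.assoc)
    qed
  qed
qed

text \<open>The tails are dominated by the integrand on the whole half-line and vanish pointwise.
  They start at integers because dominated convergence is applied along a sequence.\<close>

lemma tail_integral_tendsto_0:
  fixes E :: "real \<Rightarrow> ennreal"
  assumes meas: "\<And>\<tau>. 0 < \<tau> \<Longrightarrow> E \<in> borel_measurable (lebesgue_on {0<..<\<tau>})"
    and fin: "(\<integral>\<^sup>+s. E s \<partial>lebesgue_on {0<..}) < \<infinity>"
  shows "(\<lambda>n. \<integral>\<^sup>+s. E s \<partial>lebesgue_on {real n<..}) \<longlonglongrightarrow> 0"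
proof -
  let ?F = "\<lambda>n s. E s * indicator {real n<..} s"
  have 0: "?F 0 \<in> borel_measurable lebesgue" using borel_measurable_lebesgue_on_Ioi[OF meas] by simp
  have [measurable]: "?F n \<in> borel_measurable lebesgue" for n
  proof -
    have "?F n = (\<lambda>s. ?F 0 s * indicator {real n<..} s)" by (auto simp: indicator_def fun_eq_iff)
    moreover have "indicator {real n<..} \<in> borel_measurable (lebesgue :: real measure)" by (rule borel_measurable_indicator) simp
    ultimately show ?thesis using borel_measurable_times_ennreal[OF 0] by metis
  qed
  have eq: "(\<integral>\<^sup>+s. E s \<partial>lebesgue_on {real n<..}) = integral\<^sup>N lebesgue (?F n)" for n
    by (rule nn_integral_restrict_space) simp
  have "(\<lambda>n. integral\<^sup>N lebesgue (?F n)) \<longlonglongrightarrow> (\<integral>\<^sup>+s. 0 \<partial>(lebesgue :: real measure))"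
  proof (rule nn_integral_dominated_convergence[where w = "?F 0"])
    show "AE s in lebesgue. (\<lambda>n. ?F n s) \<longlonglongrightarrow> 0"
    proof (rule AE_I2, rule tendsto_eventually)
      fix s :: real
      obtain N where "s < real N" using reals_Archimedean2 by blast
      then show "\<forall>\<^sub>F n in sequentially. ?F n s = 0"
        by (intro eventually_sequentiallyI[of N]) auto
    qed
    show "AE s in lebesgue. ?F n s \<le> ?F 0 s" for n
      by (rule AE_I2) (auto simp: indicator_def)
    show "integral\<^sup>N lebesgue (?F 0) < \<infinity>" using fin eq[of 0] by simp
  qed (use 0 in auto)
  then show ?thesis by (simp add: eq)
qed

theorem theorem1p1:
  fixes \<theta> l K :: real and q :: ennreal
    and \<phi> :: "real^'n \<Rightarrow> real" and f u w :: "real^'n \<Rightarrow> real \<Rightarrow> real"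
  assumes "0 < \<theta>" "\<theta> < 2" "0 \<le> l" "l \<le> K" "1 \<le> q"
    and "\<phi> \<in> weighted_L 1 K"
    and "(\<lambda>(x, t). f x t) \<in> borel_measurable (lebesgue_on (UNIV \<times> {0<..}))"
    and "\<forall>\<tau>>0. source_size \<theta> K q f \<in> borel_measurable (lebesgue_on {0<..<\<tau>}) \<and>
                 (\<integral>\<^sup>+ t. source_size \<theta> K q f t \<partial>lebesgue_on {0<..<\<tau>}) < \<infinity>"
    and "frac_heat_solution \<theta> \<phi> f u"
    and "w = asymptotic_profile \<theta> K \<phi> f"
  shows
    "(\<forall>\<tau>>0. (SUP t\<in>{0<..<\<tau>}. ennreal (t powr decay_exponent CARD('n) \<theta> q) *
               wnorm q l (\<lambda>x. u x t - w x t)) < \<infinity>) \<and>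
     (\<exists>C>0. \<forall>\<epsilon>>0. \<forall>T>0. \<forall>\<^sub>F t in at_top.
        ennreal (t powr (decay_exponent CARD('n) \<theta> q - l / \<theta>)) * wnorm q l (\<lambda>x. u x t - w x t)
          \<le> ennreal (\<epsilon> * t powr (- K / \<theta>)) +
             ennreal (C * t powr (- K / \<theta>)) *
               (\<integral>\<^sup>+ s. source_size \<theta> K q f s \<partial>lebesgue_on {T<..<t})) \<and>
     ((\<integral>\<^sup>+ s. source_size \<theta> K q f s \<partial>lebesgue_on {0<..}) < \<infinity> \<longrightarrow>
        ((\<lambda>t. ennreal (t powr (decay_exponent CARD('n) \<theta> q + (K - l) / \<theta>)) *
               wnorm q l (\<lambda>x. u x t - w x t)) \<longlongrightarrow> 0) at_top)"
proof -
  note \<theta> = assms(1) and l = assms(3,4) and q = assms(5) and E = assms(8) and w = assms(10)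
  let ?a = "decay_exponent CARD('n) \<theta> q"
  let ?W = "\<lambda>t. wnorm q l (\<lambda>x. u x t - w x t)"
  let ?I = "\<lambda>a b. \<integral>\<^sup>+ s. source_size \<theta> K q f s \<partial>lebesgue_on {a<..<b}"
  obtain C \<psi> m where C: "0 \<le> C" and m: "m < \<infinity>" and \<psi>: "\<And>T. 0 < T \<Longrightarrow> (\<psi> T \<longlongrightarrow> (0::ennreal)) at_top"
    and far: "\<And>T t. 0 < T \<Longrightarrow> 2 * T \<le> t \<Longrightarrow> ?W t
       \<le> ennreal (C * ((t + 1) powr (1 / \<theta>)) powr (l - K) * t powr (- ?a)) * (\<psi> T t + ?I T t)"
    and near: "\<And>\<tau> t. 0 < t \<Longrightarrow> t < \<tau> \<Longrightarrow> ?W t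
       \<le> ennreal (C * ((t + 1) powr (1 / \<theta>)) powr (l - K) * t powr (- ?a)) * (m + ?I 0 \<tau>)"
    unfolding w by (rule wnorm_solution_minus_profile_le[OF \<theta> l q assms(6-9)]) blast
  have I_fin: "?I 0 \<tau> < \<infinity>" if "0 < \<tau>" for \<tau> using E that by simp
  have bounded: "(SUP t\<in>{0<..<\<tau>}. ennreal (t powr ?a) * ?W t) < \<infinity>" if \<tau>: "0 < \<tau>" for \<tau>
  proof -
    have "ennreal (t powr ?a) * ?W t \<le> ennreal C * (m + ?I 0 \<tau>)" if t: "t \<in> {0<..<\<tau>}" for t
    proof -
      let ?k = "((t + 1) powr (1 / \<theta>)) powr (l - K)"
      \<comment> \<open>Near t = 0 the base (t + 1)^(1/\<theta>) is at least 1 and the exponent l -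
        K is not positive, so the shift by 1 in time keeps this factor bounded.\<close>
      have "?k \<le> 1"
        using t \<theta> l powr_mono[of "l - K" 0 "(t + 1) powr (1 / \<theta>)"] by (simp add: ge_one_powr_ge_zero)
      then have "C * ?k \<le> C" using C by (intro mult_left_le) auto
      moreover have "t powr ?a * (C * ?k * t powr (- ?a)) = C * ?k * (t powr ?a * t powr (- ?a))" by (simp only: mult_ac)
      moreover have "t powr ?a * t powr (- ?a) = 1" using t by (simp flip: powr_add)
      ultimately have k: "t powr ?a * (C * ?k * t powr (- ?a)) \<le> C" by (simp only: mult_1_right)
      have "ennreal (t powr ?a) * ?W t \<le> ennreal (t powr ?a) * (ennreal (C * ?k * t powr (- ?a)) * (m + ?I 0 \<tau>))"
        using near t by (intro mult_left_mono) auto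
      also have "\<dots> = ennreal (t powr ?a * (C * ?k * t powr (- ?a))) * (m + ?I 0 \<tau>)"
        using C by (simp add: ennreal_mult mult.assoc)
      also have "\<dots> \<le> ennreal C * (m + ?I 0 \<tau>)" using k by (intro mult_right_mono ennreal_leI) auto
      finally show ?thesis .
    qed
    then have "(SUP t\<in>{0<..<\<tau>}. ennreal (t powr ?a) * ?W t) \<le> ennreal C * (m + ?I 0 \<tau>)" by (intro SUP_least)
    also have "\<dots> < \<infinity>" using m I_fin[OF \<tau>] by (simp add: ennreal_mult_less_top)
    finally show ?thesis .
  qed
  \<comment> \<open>Adding 1 makes the constant positive even when C = 0, as the assertion demands
    and as the threshold \<epsilon>/D for \<psi> requires.\<close>
  define D where "D = C + 1"
  have D: "0 < D" using C by (simp add: D_def)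
  have decay: "\<forall>\<^sub>F t in at_top. ennreal (t powr (?a - l / \<theta>)) * ?W t
      \<le> ennreal (\<epsilon> * t powr (- K / \<theta>)) + ennreal (D * t powr (- K / \<theta>)) * ?I T t"
    if \<epsilon>: "0 < \<epsilon>" and T: "0 < T" for \<epsilon> T
  proof -
    have "\<forall>\<^sub>F t in at_top. \<psi> T t < ennreal (\<epsilon> / D)"
      using \<psi>[OF T] \<epsilon> D by (intro order_tendstoD(2)) auto
    then show ?thesis using eventually_ge_at_top[of "2 * T"]
    proof eventually_elim
      case (elim t)
      then have t: "0 < t" using T by simp
      let ?k = "((t + 1) powr (1 / \<theta>)) powr (l - K)"
      have "?k \<le> (t powr (1 / \<theta>)) powr (l - K)"
        using t \<theta> l by (intro powr_mono2' powr_mono2) auto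
      also have "\<dots> = t powr ((l - K) / \<theta>)" by (simp add: powr_powr)
      finally have "t powr (?a - l / \<theta>) * (C * ?k * t powr (- ?a)) \<le> t powr (?a - l / \<theta>) * (D * t powr ((l - K) / \<theta>) * t powr (- ?a))"
        using C by (intro mult_left_mono mult_right_mono mult_mono) (auto simp: D_def)
      also have "\<dots> = D * (t powr (?a - l / \<theta>) * t powr ((l - K) / \<theta>) * t powr (- ?a))" by (simp add: mult_ac)
      also have "t powr (?a - l / \<theta>) * t powr ((l - K) / \<theta>) * t powr (- ?a) = t powr (- K / \<theta>)"
        by (simp add: diff_divide_distrib flip: powr_add)
      finally have k: "t powr (?a - l / \<theta>) * (C * ?k * t powr (- ?a)) \<le> D * t powr (- K / \<theta>)" .
      have "ennreal (t powr (?a - l / \<theta>)) * ?W t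
          \<le> ennreal (t powr (?a - l / \<theta>)) * (ennreal (C * ?k * t powr (- ?a)) * (\<psi> T t + ?I T t))"
        using far[OF T] elim by (intro mult_left_mono) auto
      also have "\<dots> = ennreal (t powr (?a - l / \<theta>) * (C * ?k * t powr (- ?a))) * (\<psi> T t + ?I T t)"
        using C by (simp add: ennreal_mult mult.assoc)
      also have "\<dots> \<le> ennreal (D * t powr (- K / \<theta>)) * (ennreal (\<epsilon> / D) + ?I T t)"
        using elim by (intro mult_mono[OF ennreal_leI[OF k]] add_mono) auto
      also have "\<dots> = ennreal (\<epsilon> * t powr (- K / \<theta>)) + ennreal (D * t powr (- K / \<theta>)) * ?I T t"
        unfolding distrib_left using D \<epsilon> by (subst ennreal_mult[symmetric]) (auto simp: mult.commute)
      finally show ?case .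
    qed
  qed
  have limit: "((\<lambda>t. ennreal (t powr (?a + (K - l) / \<theta>)) * ?W t) \<longlongrightarrow> 0) at_top"
    if fin: "(\<integral>\<^sup>+ s. source_size \<theta> K q f s \<partial>lebesgue_on {0<..}) < \<infinity>"
  proof (rule order_tendstoI)
    fix z :: ennreal assume "0 < z"
    \<comment> \<open>Since z may be infinite, a real number r below z is chosen. One half of r is
      spent on \<epsilon>; the other half comes from a tail of the source integral below r/(2 D),
      which cancels the constant D.\<close>
    then obtain y where "0 < y" "y < z" using dense by blast
    then obtain r where r: "0 < r" "ennreal r < z" by (cases y) auto
    have tail: "((\<lambda>n. \<integral>\<^sup>+ s. source_size \<theta> K q f s \<partial>lebesgue_on {real n<..}) \<longlongrightarrow> 0) sequentially"
      by (rule tail_integral_tendsto_0[OF _ fin]) (use E in blast)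
    then have "\<forall>\<^sub>F n in sequentially. (\<integral>\<^sup>+ s. source_size \<theta> K q f s \<partial>lebesgue_on {real n<..}) < ennreal (r / (2 * D))"
      using r D by (intro order_tendstoD(2)) auto
    then have "\<forall>\<^sub>F n in sequentially. (\<integral>\<^sup>+ s. source_size \<theta> K q f s \<partial>lebesgue_on {real n<..}) < ennreal (r / (2 * D)) \<and> 0 < n"
      using eventually_gt_at_top by (rule eventually_conj)
    then obtain n where n: "(\<integral>\<^sup>+ s. source_size \<theta> K q f s \<partial>lebesgue_on {real n<..}) < ennreal (r / (2 * D))" "0 < n"
      using eventually_happens trivial_limit_sequentially by blast
    have I: "?I (real n) t \<le> ennreal (r / (2 * D))" for t
    proof -
      have "?I (real n) t = (\<integral>\<^sup>+s. source_size \<theta> K q f s * indicator {real n<..<t} s \<partial>lebesgue)"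
        by (rule nn_integral_restrict_space) simp
      also have "\<dots> \<le> (\<integral>\<^sup>+s. source_size \<theta> K q f s * indicator {real n<..} s \<partial>lebesgue)"
        by (intro nn_integral_mono mult_left_mono) (auto simp: indicator_def)
      also have "\<dots> = (\<integral>\<^sup>+ s. source_size \<theta> K q f s \<partial>lebesgue_on {real n<..})"
        by (rule nn_integral_restrict_space[symmetric]) simp
      finally show ?thesis using n by simp
    qed
    have "\<forall>\<^sub>F t in at_top. ennreal (t powr (?a - l / \<theta>)) * ?W t
      \<le> ennreal (r / 2 * t powr (- K / \<theta>)) + ennreal (D * t powr (- K / \<theta>)) * ?I (real n) t"
      using r n by (intro decay) auto
    then show "\<forall>\<^sub>F t in at_top. ennreal (t powr (?a + (K - l) / \<theta>)) * ?W t < z" using eventually_gt_at_top[of 0]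
    proof eventually_elim
      case (elim t)
      have tK: "t powr (K / \<theta>) * t powr (- K / \<theta>) = 1" using elim by (simp flip: powr_add)
      have ex: "K / \<theta> + (?a - l / \<theta>) = ?a + (K - l) / \<theta>" by (simp add: diff_divide_distrib)
      have "ennreal (t powr (?a + (K - l) / \<theta>)) = ennreal (t powr (K / \<theta>)) * ennreal (t powr (?a - l / \<theta>))"
        by (simp only: ex[symmetric] powr_add ennreal_mult powr_ge_zero)
      then have "ennreal (t powr (?a + (K - l) / \<theta>)) * ?W t = ennreal (t powr (K / \<theta>)) * (ennreal (t powr (?a - l / \<theta>)) * ?W t)"
        by (simp only: mult.assoc)
      also have "\<dots> \<le> ennreal (t powr (K / \<theta>)) * (ennreal (r / 2 * t powr (- K / \<theta>)) + ennreal (D * t powr (- K / \<theta>)) * ennreal (r / (2 * D)))"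
        using elim I by (intro mult_left_mono order_trans[OF elim(1)] add_left_mono) auto
      also have "\<dots> = ennreal (t powr (K / \<theta>) * (r / 2 * t powr (- K / \<theta>) + D * t powr (- K / \<theta>) * (r / (2 * D))))"
        using r D by (simp flip: ennreal_mult ennreal_plus)
      also have "t powr (K / \<theta>) * (r / 2 * t powr (- K / \<theta>) + D * t powr (- K / \<theta>) * (r / (2 * D))) = (t powr (K / \<theta>) * t powr (- K / \<theta>)) * r"
        using D by (simp add: field_simps)
      finally show ?case using r(2) tK by simp
    qed
  qed simp
  show ?thesis
  proof (intro conjI allI impI exI[of _ D])
    show "(SUP t\<in>{0<..<\<tau>}. ennreal (t powr ?a) * ?W t) < \<infinity>" if "0 < \<tau>" for \<tau> by (rule bounded[OF that])
  qed (rule D decay limit; assumption)+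
qed

end
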